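(* For MAB superprocess with preemption in which all processing times are $1$ (i.e. there are no bridge nodes, $\mathcal{B}=\emptyset$), there is a polynomial-time randomized algorithm whose expected reward is at least $\frac{4}{27}\,\mathrm{OPT}_{\mathrm{PolyLP}}$. Consequently, when $\mathcal{B}=\emptyset$, the projection gap of $(\mathrm{PolyLP})$ is at most $\frac{27}{4}$, i.e. $\mathrm{OPT}_{\mathrm{PolyLP}}\le\frac{27}{4}\cdot(\text{maximum expected reward of any adaptive policy})$.
   Context: Model: $n$ arms $i\in[n]$, finite action set $A$, horizon $B$, $[B]=\{1,\dots,B\}$. Arm $i$ is a Markov decision process with disjoint finite node set $\mathcal{S}_i$ ($\mathcal{S}=\bigcup_i\mathcal{S}_i$) and root $\rho_i$; for each action $a$ there are transition probabilities $p^a_{u,v}\ge0$ with $\sum_vp^a_{u,v}=1$ and reward $r^a_u\ge0$; arms are layered acyclic (depth function with $\mathrm{depth}(\rho_i)=0$ and $p^a_{u,v}>0\Rightarrow\mathrm{depth}(v)=\mathrm{depth}(u)+1$). $\mathrm{Par}(u)=\{(v,b)\in\mathcal{S}\times A:p^b_{v,u}>0\}$. Problem (with preemption): all arms start at their roots; at each step $t=1,\dots,B$ the controller pulls at most one arm, choosing an action $a$; pulling an arm on node $u$ yields $r^a_u$ and moves that arm to $v$ with probability $p^a_{u,v}$, observed before the next decision; other arms stay put and may be resumed later. Goal: maximize expected total reward. $(\mathrm{PolyLP})$ (with $\mathcal{B}=\emptyset$): variables $x^a_{u,t},s_{u,t}$; maximize $\sum_u\sum_ar^a_u\sum_{t=1}^Bx^a_{u,t}$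 subject to $\sum_u\sum_ax^a_{u,t}\le1$ ($t\in[B]$); $\sum_ax^a_{u,t}\le s_{u,t}$; $x^a_{u,t}\ge0$; $s_{\rho_i,1}=1$; $s_{u,1}=0$ for non-root $u$; for $t>1$, $s_{u,t}=s_{u,t-1}-\sum_ax^a_{u,t-1}+\sum_{(v,a)\in\mathrm{Par}(u)}x^a_{v,t-1}p^a_{v,u}$. $\mathrm{OPT}_{\mathrm{PolyLP}}$ is its optimal value. *)

theory Defs
  imports "HOL-Probability.Probability" "HOL-Library.Log_Nat"
begin

section \<open>Superprocess bandits with unit processing times\<close>

record ('s, 'a) mab =
  narms :: nat
  nodes :: "nat \<Rightarrow> 's set"
  root :: "nat \<Rightarrow> 's"
  acts :: "'a set"
  prob :: "'a \<Rightarrow> 's \<Rightarrow> 's \<Rightarrow> real"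
  rew :: "'a \<Rightarrow> 's \<Rightarrow> real"

definition states :: "('s, 'a) mab \<Rightarrow> 's set" where
  "states I = (\<Union>i<narms I. nodes I i)"

definition Par :: "('s, 'a) mab \<Rightarrow> 's \<Rightarrow> ('s \<times> 'a) set" where
  "Par I u = {(v, b). v \<in> states I \<and> b \<in> acts I \<and> prob I b v u > 0}"

text \<open>
  A finite layered arm must have a last layer, so outgoing probabilities cannot sum to 1 at every
  node. A node at depth \<open>d\<close> is reached after exactly \<open>d\<close> pulls of its arm; hence nodes at depth
  \<open>B\<close> or more are never pulled within the horizon, and only the other nodes need to be stochastic.
\<close>

definition valid_mab :: "('s, 'a) mab \<Rightarrow> nat \<Rightarrow> bool" where
  "valid_mab I B \<longleftrightarrow>
     finite (acts I) \<and>
     (\<forall>i<narms I. finite (nodes I i) \<and> root I i \<in> nodes I i) \<and>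
     (\<forall>i<narms I. \<forall>j<narms I. i \<noteq> j \<longrightarrow> nodes I i \<inter> nodes I j = {}) \<and>
     (\<forall>a\<in>acts I. \<forall>u\<in>states I. rew I a u \<ge> 0) \<and>
     (\<forall>a\<in>acts I. \<forall>u\<in>states I. \<forall>v\<in>states I. prob I a u v \<ge> 0) \<and>
     (\<forall>a\<in>acts I. \<forall>i<narms I. \<forall>u\<in>nodes I i. \<forall>v\<in>states I - nodes I i. prob I a u v = 0) \<and>
     (\<exists>depth :: 's \<Rightarrow> nat.
        (\<forall>i<narms I. depth (root I i) = 0) \<and>
        (\<forall>a\<in>acts I. \<forall>u\<in>states I. \<forall>v\<in>states I.
           prob I a u v > 0 \<longrightarrow> depth v = depth u + 1) \<and>
        (\<forall>a\<in>acts I. \<forall>u\<in>states I. depth u < B \<longrightarrow> (\<Sum>v\<in>states I. prob I a u v) = 1))"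


section \<open>The linear program\<close>

definition PolyLP_feasible ::
  "('s, 'a) mab \<Rightarrow> nat \<Rightarrow> ('a \<Rightarrow> 's \<Rightarrow> nat \<Rightarrow> real) \<Rightarrow> ('s \<Rightarrow> nat \<Rightarrow> real) \<Rightarrow> bool" where
  "PolyLP_feasible I B x s \<longleftrightarrow>
     (\<forall>t\<in>{1..B}. (\<Sum>u\<in>states I. \<Sum>a\<in>acts I. x a u t) \<le> 1) \<and>
     (\<forall>t\<in>{1..B}. \<forall>u\<in>states I. (\<Sum>a\<in>acts I. x a u t) \<le> s u t) \<and>
     (\<forall>t\<in>{1..B}. \<forall>u\<in>states I. \<forall>a\<in>acts I. x a u t \<ge> 0) \<and>
     (\<forall>i<narms I. s (root I i) 1 = 1) \<and>
     (\<forall>u\<in>states I - root I ` {..<narms I}. s u 1 = 0) \<and>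
     (\<forall>t\<in>{2..B}. \<forall>u\<in>states I.
        s u t = s u (t - 1) - (\<Sum>a\<in>acts I. x a u (t - 1))
                + (\<Sum>(v, a)\<in>Par I u. x a v (t - 1) * prob I a v u))"

definition PolyLP_objective ::
  "('s, 'a) mab \<Rightarrow> nat \<Rightarrow> ('a \<Rightarrow> 's \<Rightarrow> nat \<Rightarrow> real) \<Rightarrow> real" where
  "PolyLP_objective I B x =
     (\<Sum>u\<in>states I. \<Sum>a\<in>acts I. rew I a u * (\<Sum>t = 1..B. x a u t))"

text \<open>
  For valid instances the set below is nonempty and bounded, so \<open>Sup\<close> is the optimal value; the
  same holds for \<open>OPT_adaptive\<close>.
\<close>

definition OPT_PolyLP :: "('s, 'a) mab \<Rightarrow> nat \<Rightarrow> real" where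
  "OPT_PolyLP I B = Sup {PolyLP_objective I B x | x s. PolyLP_feasible I B x s}"


section \<open>The controlled process and adaptive policies\<close>

record 's env =
  pos :: "nat \<Rightarrow> 's"
  clock :: nat
  earned :: real

definition init_env :: "('s, 'a) mab \<Rightarrow> 's env" where
  "init_env I = \<lparr>pos = root I, clock = 0, earned = 0\<rparr>"

definition next_node :: "('s, 'a) mab \<Rightarrow> 'a \<Rightarrow> 's \<Rightarrow> 's pmf" where
  "next_node I a u = embed_pmf (\<lambda>v. if v \<in> states I then prob I a u v else 0)"

text \<open>
  A decision is \<open>Some (i, a)\<close> (pull arm \<open>i\<close> with action \<open>a\<close>) or \<open>None\<close> (pull no arm). A decision
  naming a nonexistent arm or action counts as \<open>None\<close>; after \<open>B\<close> steps nothing changes any more.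
\<close>

definition env_step ::
  "('s, 'a) mab \<Rightarrow> nat \<Rightarrow> (nat \<times> 'a) option \<Rightarrow> 's env \<Rightarrow> 's env pmf" where
  "env_step I B d e =
     (if clock e < B then
        (case d of
           None \<Rightarrow> return_pmf (e\<lparr>clock := clock e + 1\<rparr>)
         | Some (i, a) \<Rightarrow>
             if i < narms I \<and> a \<in> acts I then
               map_pmf (\<lambda>v. \<lparr>pos = (pos e)(i := v), clock = clock e + 1,
                             earned = earned e + rew I a (pos e i)\<rparr>)
                 (next_node I a (pos e i))
             else return_pmf (e\<lparr>clock := clock e + 1\<rparr>))
      else return_pmf e)"

type_synonym ('s, 'a) history = "((nat \<times> 'a) option \<times> (nat \<Rightarrow> 's)) list"
type_synonym ('s, 'a) policy = "('s, 'a) history \<Rightarrow> (nat \<times> 'a) option pmf"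

primrec play ::
  "('s, 'a) mab \<Rightarrow> nat \<Rightarrow> ('s, 'a) policy \<Rightarrow> nat \<Rightarrow> (('s, 'a) history \<times> 's env) pmf" where
  "play I B \<pi> 0 = return_pmf ([], init_env I)"
| "play I B \<pi> (Suc k) =
     bind_pmf (play I B \<pi> k) (\<lambda>(h, e).
       bind_pmf (\<pi> h) (\<lambda>d.
         map_pmf (\<lambda>e'. (h @ [(d, pos e')], e')) (env_step I B d e)))"

definition policy_reward :: "('s, 'a) mab \<Rightarrow> nat \<Rightarrow> ('s, 'a) policy \<Rightarrow> real" where
  "policy_reward I B \<pi> = measure_pmf.expectation (play I B \<pi> B) (\<lambda>(h, e). earned e)"

definition OPT_adaptive :: "('s, 'a) mab \<Rightarrow> nat \<Rightarrow> real" where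
  "OPT_adaptive I B = (SUP \<pi>. policy_reward I B \<pi>)"


section \<open>Polynomial-time randomized algorithms\<close>

text \<open>
  The machine model is a randomized random-access machine with natural-number cells and the
  logarithmic cost criterion, which is polynomially equivalent to Turing machines. The instance is
  given as a read-only sequence of numbers. The machine acts on the process only through
  \<open>Pull\<close> and \<open>Idle\<close>, and the only thing it learns from a pull is the node reached.
\<close>

datatype binop = Add | Sub | Mul | Div

primrec eval_binop :: "binop \<Rightarrow> nat \<Rightarrow> nat \<Rightarrow> nat" where
  "eval_binop Add m n = m + n"
| "eval_binop Sub m n = m - n"
| "eval_binop Mul m n = m * n"
| "eval_binop Div m n = m div n"

text \<open>
  All arguments of type \<^typ>\<open>nat\<close> are cell addresses, except for the second one of \<open>Const\<close>. With
  \<open>R\<close> denoting the memory and \<open>xs\<close> the input: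
  \<^item> \<open>Const d c\<close>: \<open>R[d] := c\<close>
  \<^item> \<open>Op f d r s\<close>: \<open>R[d] := f (R[r]) (R[s])\<close>
  \<^item> \<open>Load d r\<close>: \<open>R[d] := R[R[r]]\<close>
  \<^item> \<open>Store r s\<close>: \<open>R[R[r]] := R[s]\<close>
  \<^item> \<open>Input d r\<close>: \<open>R[d] := xs[R[r]]\<close>, or 0 beyond the end of the input
  \<^item> \<open>Rand d r\<close>: \<open>R[d] :=\<close> uniformly random number below \<open>R[r]\<close> (0 if \<open>R[r] = 0\<close>)
  \<^item> \<open>Pull d r s\<close>: pull arm \<open>R[r]\<close> with action \<open>R[s]\<close>, and put the node the arm is then on into \<open>R[d]\<close>
  \<^item> \<open>Idle\<close>: let one time step pass without a pull
  \<^item> \<open>If r c c'\<close> and \<open>While r c\<close>: the condition is \<open>R[r] \<noteq> 0\<close>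
\<close>

datatype com =
    Skip
  | Const nat nat
  | Op binop nat nat nat
  | Load nat nat
  | Store nat nat
  | Input nat nat
  | Rand nat nat
  | Pull nat nat nat
  | Idle
  | Seq com com
  | If nat com com
  | While nat com

abbreviation len :: "nat \<Rightarrow> nat" where
  "len m \<equiv> floorlog 2 m"

definition lookup :: "nat list \<Rightarrow> nat \<Rightarrow> nat" where
  "lookup xs i = (if i < length xs then xs ! i else 0)"

definition uniform_below :: "nat \<Rightarrow> nat pmf" where
  "uniform_below m = (if m = 0 then return_pmf 0 else pmf_of_set {..<m})"

record config =
  todo :: "com list"
  mem :: "nat \<Rightarrow> nat"
  env :: "nat env"
  cost :: nat

definition init_config :: "com \<Rightarrow> (nat, nat) mab \<Rightarrow> config" where
  "init_config c I = \<lparr>todo = [c], mem = (\<lambda>_. 0), env = init_env I, cost = 0\<rparr>"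

abbreviation halted :: "config \<Rightarrow> bool" where
  "halted g \<equiv> todo g = []"

fun exec ::
  "nat list \<Rightarrow> (nat, nat) mab \<Rightarrow> nat \<Rightarrow> com \<Rightarrow> com list \<Rightarrow> (nat \<Rightarrow> nat) \<Rightarrow> nat env \<Rightarrow> nat
    \<Rightarrow> config pmf" where
  "exec xs I B Skip K R e w = return_pmf \<lparr>todo = K, mem = R, env = e, cost = w + 1\<rparr>"
| "exec xs I B (Const d c) K R e w =
     return_pmf \<lparr>todo = K, mem = R(d := c), env = e, cost = w + 1 + len c\<rparr>"
| "exec xs I B (Op f d r s) K R e w =
     return_pmf \<lparr>todo = K, mem = R(d := eval_binop f (R r) (R s)), env = e,
                 cost = w + 1 + len (R r) + len (R s)\<rparr>"
| "exec xs I B (Load d r) K R e w =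
     return_pmf \<lparr>todo = K, mem = R(d := R (R r)), env = e,
                 cost = w + 1 + len (R r) + len (R (R r))\<rparr>"
| "exec xs I B (Store r s) K R e w =
     return_pmf \<lparr>todo = K, mem = R(R r := R s), env = e,
                 cost = w + 1 + len (R r) + len (R s)\<rparr>"
| "exec xs I B (Input d r) K R e w =
     return_pmf \<lparr>todo = K, mem = R(d := lookup xs (R r)), env = e,
                 cost = w + 1 + len (R r) + len (lookup xs (R r))\<rparr>"
| "exec xs I B (Rand d r) K R e w =
     map_pmf (\<lambda>m. \<lparr>todo = K, mem = R(d := m), env = e, cost = w + 1 + len (R r)\<rparr>)
       (uniform_below (R r))"
| "exec xs I B (Pull d r s) K R e w =
     map_pmf (\<lambda>e'. \<lparr>todo = K, mem = R(d := if R r < narms I then pos e' (R r) else 0), env = e',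
                    cost = w + 1 + len (R r) + len (R s)\<rparr>)
       (env_step I B (Some (R r, R s)) e)"
| "exec xs I B Idle K R e w =
     map_pmf (\<lambda>e'. \<lparr>todo = K, mem = R, env = e', cost = w + 1\<rparr>) (env_step I B None e)"
| "exec xs I B (Seq c c') K R e w =
     return_pmf \<lparr>todo = c # c' # K, mem = R, env = e, cost = w + 1\<rparr>"
| "exec xs I B (If r c c') K R e w =
     return_pmf \<lparr>todo = (if R r \<noteq> 0 then c else c') # K, mem = R, env = e,
                 cost = w + 1 + len (R r)\<rparr>"
| "exec xs I B (While r c) K R e w =
     return_pmf \<lparr>todo = (if R r \<noteq> 0 then c # While r c # K else K), mem = R, env = e,
                 cost = w + 1 + len (R r)\<rparr>"

definition step :: "nat list \<Rightarrow> (nat, nat) mab \<Rightarrow> nat \<Rightarrow> config \<Rightarrow> config pmf" where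
  "step xs I B g =
     (case todo g of
        [] \<Rightarrow> return_pmf g
      | c # K \<Rightarrow> exec xs I B c K (mem g) (env g) (cost g))"

primrec run :: "com \<Rightarrow> nat list \<Rightarrow> (nat, nat) mab \<Rightarrow> nat \<Rightarrow> nat \<Rightarrow> config pmf" where
  "run c xs I B 0 = return_pmf (init_config c I)"
| "run c xs I B (Suc k) = bind_pmf (run c xs I B k) (step xs I B)"

text \<open>
  Input format for instances with rational data: arms, nodes and actions are numbered from 0,
  \<open>arm u\<close> is the arm that node \<open>u\<close> belongs to, and every reward and transition probability is
  written as a numerator followed by a denominator. Numbers are measured in binary.
\<close>

definition encodes :: "nat list \<Rightarrow> (nat, nat) mab \<Rightarrow> nat \<Rightarrow> bool" where
  "encodes xs I B \<longleftrightarrow>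
     (\<exists>K N arm rn rd pn pd.
        acts I = {..<K} \<and>
        (\<forall>u<N. arm u < narms I) \<and>
        (\<forall>i<narms I. nodes I i = {u. u < N \<and> arm u = i}) \<and>
        (\<forall>a<K. \<forall>u<N. rd a u > 0 \<and> rew I a u = real (rn a u) / real (rd a u)) \<and>
        (\<forall>a<K. \<forall>u<N. \<forall>v<N. pd a u v > 0 \<and> prob I a u v = real (pn a u v) / real (pd a u v)) \<and>
        xs = [B, narms I, K, N]
             @ map (root I) [0..<narms I]
             @ map arm [0..<N]
             @ concat [[rn a u, rd a u]. a \<leftarrow> [0..<K], u \<leftarrow> [0..<N]]
             @ concat [[pn a u v, pd a u v]. a \<leftarrow> [0..<K], u \<leftarrow> [0..<N], v \<leftarrow> [0..<N]])"

definition input_size :: "nat list \<Rightarrow> nat" where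
  "input_size xs = (\<Sum>x\<leftarrow>xs. len x + 1)"

text \<open>
  Every step of a machine that has not halted costs at least 1, so a machine whose total cost is
  at most \<open>T\<close> has halted after \<open>T\<close> steps. The bound holds for all outcomes of the random choices
  of the machine and of the transitions of the arms.
\<close>

definition polynomial_time :: "com \<Rightarrow> bool" where
  "polynomial_time c \<longleftrightarrow>
     (\<exists>k. \<forall>I B xs. valid_mab I B \<longrightarrow> encodes xs I B \<longrightarrow>
        (let T = k * input_size xs ^ k + k in
           \<forall>g\<in>set_pmf (run c xs I B T). halted g \<and> cost g \<le> T))"

definition algorithm_reward :: "com \<Rightarrow> nat list \<Rightarrow> (nat, nat) mab \<Rightarrow> nat \<Rightarrow> real" where
  "algorithm_reward c xs I B =
     lim (\<lambda>k. measure_pmf.expectation (run c xs I B k) (\<lambda>g. earned (env g)))"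

end

theory Submission
  imports Defs
begin

text \<open>
  Lagrangian relaxation of the slot constraints decouples the arms: for prices \<open>l t\<close> of the slots, each
  arm is an acyclic Markov decision process. Projected subgradient steps on the prices give polynomially
  many decision tables whose average is almost optimal for the linear program and overloads each slot by
  at most a factor \<open>1 + 1 / (2 * (B + 1))\<close>. Each arm is then kept with probability 1/3 and follows one
  uniformly drawn table, which fixes a virtual time for each of its plays. The scheduler always plays the
  pending arm with the smallest virtual time, treating a play as urgent once its virtual time is at most
  twice the number of earlier plays of its arm. A play with virtual time \<open>t\<close> is made within the horizon if
  fewer than \<open>(t + 1) / 2\<close> other plays come before it, which by a tail bound for sums of independent
  thinned loads happens with probability at least 4/9, so an arm earns 1/3 * 4/9 = 4/27 of its share.
  All of this is exact arithmetic on integers of polynomial length, so it can be compiled to the machine.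
\<close>

text \<open>The constants come from the case of two other arms that each block a play alone: keeping
  arms with probability p then earns the share p * (1 - p)^2, largest at p = 1/3 with value 4/27.
  The factor is exact although the tables are only almost optimal, because time is discrete: a play
  with virtual time t \<le> B tolerates fewer than (t + 1) / 2 other plays while the tables schedule
  about t, so the load relative to this threshold is at most 2 - \<delta> with \<delta> = 1 / (B +
  1). The slack improves the success bound to 4/9 / (1 - \<delta> / 3), and the subgradient
  parameters are chosen so that the tables lose no more than the factor 1 - \<delta> / 3. The other
  obstacle is that the horizon is written in binary. With at least one arm and one action, a valid
  instance has nodes at every depth up to B, so B is less than the number of nodes and loops over
  slots are polynomial; all other instances are dismissed at once. The compiled language clamps
  stored numbers and loop counts at two precomputed limits. Its time bound is thus independent of
  what a program computes, and correctness includes showing that the limits never take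
  effect.\<close>

abbreviation expect where
 "expect \<equiv> measure_pmf.expectation"

section \<open>Polynomial inequalities for the worst two-point loads\<close>

lemma concave_quadratic_nonneg:
 fixes a b c l u x :: real
 assumes "a \<le> 0" "l \<le> x" "x \<le> u"
  and "a * l\<^sup>2 + b * l + c \<ge> 0" "a * u\<^sup>2 + b * u + c \<ge> 0"
 shows "a * x\<^sup>2 + b * x + c \<ge> 0"
proof (cases "l = u")
 case True then show ?thesis using assms by auto
next
 case False
 then have lu: "u - l > 0" using assms by auto
 have "(u - l) * (a * x\<^sup>2 + b * x + c)
   = (u - x) * (a * l\<^sup>2 + b * l + c) + (x - l) * (a * u\<^sup>2 + b * u + c)
    + (- a) * ((u - x) * ((x - l) * (u - l)))"
  by (simp add: power2_eq_square algebra_simps)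
 also have "\<dots> \<ge> 0"
 proof -
  have "(u - x) * (a * l\<^sup>2 + b * l + c) \<ge> 0" "(x - l) * (a * u\<^sup>2 + b * u + c) \<ge> 0"
   using assms by (simp_all only: mult_nonneg_nonneg diff_ge_0_iff_ge)
  moreover have "(- a) * ((u - x) * ((x - l) * (u - l))) \<ge> 0"
   using assms lu by (intro mult_nonneg_nonneg) linarith+
  ultimately show ?thesis by linarith
 qed
 finally show ?thesis using lu by (simp add: zero_le_mult_iff)
qed

text \<open>Serves the case of \<open>four_point_bound\<close> in which only the pair of small
  values stays below 1. There \<open>e\<close> is \<open>1 - x0 - y0\<close>, \<open>g\<close> and
  \<open>h\<close> are the gaps \<open>\<mu> - x0\<close> and \<open>\<nu> - y0\<close>, and
  \<open>G\<close>, \<open>H\<close> are the largest gaps, reached when a mean is 1/3. Concavity in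
  each gap pushes the claim to the boundary of its domain.\<close>

lemma mixed_poly_bound:
 fixes e g h G H :: real
 assumes "0 \<le> g" "g \<le> G" "0 \<le> h" "h \<le> H" "G \<le> 1/3" "H \<le> 1/3" "G + H = e - 1/3"
  and "g + h \<ge> e - 2/3" "e \<le> 1"
 shows "(e - g) * (e - h) * (3 - 2 * e + 3 * g + 3 * h) \<ge> 4/3 * e\<^sup>2"
proof -
 let ?k = "\<lambda>g h. (e - g) * (e - h) * (3 - 2 * e + 3 * g + 3 * h) - 4/3 * e\<^sup>2"
 \<comment> \<open>For a small sum of gaps the nonnegative term with \<open>g * h\<close> is
   dropped, and the rest is \<open>e\<close> times a concave quadratic in
   \<open>s = g + h\<close>.\<close>
 have small: "?k g h \<ge> 0" if gh: "0 \<le> g" "0 \<le> h" "g + h \<ge> e - 2/3" "g + h \<le> 1/3" "g + h \<le> e - 1/3" for g h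
 proof -
  define s where "s = g + h"
  have e: "e \<ge> 1/3" using gh by auto
  have "-3 * s\<^sup>2 + (5 * e - 3) * s + (e * (3 - 2 * e) - 4/3 * e) \<ge> 0"
  proof (cases "e \<ge> 2/3")
   case True
   show ?thesis
   proof (rule concave_quadratic_nonneg[where l = "e - 2/3" and u = "1/3"])
    have "-3 * (e - 2/3)\<^sup>2 + (5 * e - 3) * (e - 2/3) + (e * (3 - 2 * e) - 4/3 * e) = 2/3 * (1 - e)"
     by (simp add: power2_eq_square field_simps)
    then show "-3 * (e - 2/3)\<^sup>2 + (5 * e - 3) * (e - 2/3) + (e * (3 - 2 * e) - 4/3 * e) \<ge> 0"
     using assms by auto
    have "-3 * (1/3)\<^sup>2 + (5 * e - 3) * (1/3) + (e * (3 - 2 * e) - 4/3 * e) = 2 * ((1 - e) * (e - 2/3))"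
     by (simp add: power2_eq_square field_simps)
    then show "-3 * (1/3)\<^sup>2 + (5 * e - 3) * (1/3) + (e * (3 - 2 * e) - 4/3 * e) \<ge> 0"
     using assms True by auto
   qed (use gh in \<open>auto simp: s_def\<close>)
  next
   case False
   show ?thesis
   proof (rule concave_quadratic_nonneg[where l = "e - 2/3" and u = "e - 1/3"])
    have "-3 * (e - 2/3)\<^sup>2 + (5 * e - 3) * (e - 2/3) + (e * (3 - 2 * e) - 4/3 * e) = 2/3 * (1 - e)"
     by (simp add: power2_eq_square field_simps)
    then show "-3 * (e - 2/3)\<^sup>2 + (5 * e - 3) * (e - 2/3) + (e * (3 - 2 * e) - 4/3 * e) \<ge> 0"
     using assms by auto
    have "-3 * (e - 1/3)\<^sup>2 + (5 * e - 3) * (e - 1/3) + (e * (3 - 2 * e) - 4/3 * e) = 2/3 - e"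
     by (simp add: power2_eq_square field_simps)
    then show "-3 * (e - 1/3)\<^sup>2 + (5 * e - 3) * (e - 1/3) + (e * (3 - 2 * e) - 4/3 * e) \<ge> 0"
     using False by auto
   qed (use gh in \<open>auto simp: s_def\<close>)
  qed
  then have "e * (-3 * s\<^sup>2 + (5 * e - 3) * s + (e * (3 - 2 * e) - 4/3 * e)) \<ge> 0"
   using e by (intro mult_nonneg_nonneg) auto
  moreover have "g * h * (3 - 2 * e + 3 * g + 3 * h) \<ge> 0"
   using gh assms by (intro mult_nonneg_nonneg) auto
  moreover have "?k g h = e * (-3 * s\<^sup>2 + (5 * e - 3) * s + (e * (3 - 2 * e) - 4/3 * e))
    + g * h * (3 - 2 * e + 3 * g + 3 * h)"
   by (simp add: s_def power2_eq_square algebra_simps)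
  ultimately show ?thesis by linarith
 qed
 have "?k g h \<ge> 0"
 proof (cases "g + h \<le> 1/3")
  case True
  then show ?thesis using small[of g h] assms by auto
 next
  case False
  then have e: "e \<ge> 2/3" using assms by linarith
  have quad_h: "?k g h = (-3 * (e - g)) * h\<^sup>2 + ((e - g) * (5 * e - 3 - 3 * g)) * h
    + ((e - g) * e * (3 - 2 * e + 3 * g) - 4/3 * e\<^sup>2)" for g h
   by (simp add: power2_eq_square algebra_simps)
  have quad_g: "?k g h = (-3 * (e - h)) * g\<^sup>2 + ((e - h) * (5 * e - 3 - 3 * h)) * g
    + ((e - h) * e * (3 - 2 * e + 3 * h) - 4/3 * e\<^sup>2)" for g h
   by (simp add: power2_eq_square algebra_simps)
  \<comment> \<open>At this corner \<open>e - (G + H) = 1/3\<close>, so the product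
    \<open>G * H\<close> is the only unknown; it is bounded below by expanding
    \<open>(1/3 - G) * (1/3 - H) \<ge> 0\<close>.\<close>
  have top: "?k G H \<ge> 0"
  proof -
   have "(e - G) * (e - H) * (3 - 2 * e + 3 * G + 3 * H)
     = (e * (e - (G + H)) + G * H) * (3 - 2 * e + 3 * (G + H))"
    by (simp add: algebra_simps)
   also have "\<dots> = (e * (1/3) + G * H) * (2 + e)"
   proof -
    have "e - (G + H) = 1/3" using assms(7) by linarith
    moreover have "3 - 2 * e + 3 * (G + H) = 2 + e"
     unfolding assms(7) by simp
    ultimately show ?thesis by (simp only:)
   qed
   finally have *: "(e - G) * (e - H) * (3 - 2 * e + 3 * G + 3 * H) = (e * (1/3) + G * H) * (2 + e)" .
   have "(1/3 - G) * (1/3 - H) \<ge> 0" using assms by auto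
   then have "G * H \<ge> 1/3 * (G + H) - 1/9" by (simp add: algebra_simps)
   then have "G * H \<ge> 1/3 * e - 2/9" unfolding assms(7) by (simp add: field_simps)
   then have "(e * (1/3) + G * H) * (2 + e) \<ge> (e * (1/3) + (1/3 * e - 2/9)) * (2 + e)"
    using e by (intro mult_right_mono) auto
   moreover have "(e * (1/3) + (1/3 * e - 2/9)) * (2 + e) - 4/3 * e\<^sup>2 = 2/3 * ((1 - e) * (e - 2/3))"
    by (simp add: power2_eq_square field_simps)
   moreover have "(1 - e) * (e - 2/3) \<ge> 0" using assms e by auto
   ultimately show ?thesis using * by linarith
  qed
  \<comment> \<open>First \<open>g\<close> moves with \<open>h\<close> fixed at \<open>H\<close>,
    then \<open>h\<close> moves with \<open>g\<close> fixed. The lower end of each segment lies on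
    the line \<open>g + h = 1/3\<close>, where \<open>small\<close> applies.\<close>
  have gH: "?k g H \<ge> 0" if "1/3 - H \<le> g" "g \<le> G" for g
   unfolding quad_g
  proof (rule concave_quadratic_nonneg[where l = "1/3 - H" and u = G])
   have "?k (1/3 - H) H \<ge> 0" using assms e that by (intro small) auto
   then show "(-3 * (e - H)) * (1/3 - H)\<^sup>2 + ((e - H) * (5 * e - 3 - 3 * H)) * (1/3 - H)
    + ((e - H) * e * (3 - 2 * e + 3 * H) - 4/3 * e\<^sup>2) \<ge> 0" unfolding quad_g .
   show "(-3 * (e - H)) * G\<^sup>2 + ((e - H) * (5 * e - 3 - 3 * H)) * G
    + ((e - H) * e * (3 - 2 * e + 3 * H) - 4/3 * e\<^sup>2) \<ge> 0" using top unfolding quad_g .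
  qed (use that assms e in auto)
  show ?thesis unfolding quad_h
  proof (rule concave_quadratic_nonneg[where l = "1/3 - g" and u = H])
   have "?k g (1/3 - g) \<ge> 0" using assms e by (intro small) auto
   then show "(-3 * (e - g)) * (1/3 - g)\<^sup>2 + ((e - g) * (5 * e - 3 - 3 * g)) * (1/3 - g)
    + ((e - g) * e * (3 - 2 * e + 3 * g) - 4/3 * e\<^sup>2) \<ge> 0" unfolding quad_h .
   have "?k g H \<ge> 0" using False assms by (intro gH) auto
   then show "(-3 * (e - g)) * H\<^sup>2 + ((e - g) * (5 * e - 3 - 3 * g)) * H
    + ((e - g) * e * (3 - 2 * e + 3 * g) - 4/3 * e\<^sup>2) \<ge> 0" unfolding quad_h .
  qed (use False assms e in auto)
 qed
 then show ?thesis by simp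
qed

lemma single_high_bound:
 fixes \<mu> \<nu> :: real
 assumes "0 \<le> \<mu>" "\<mu> \<le> 1/3" "0 \<le> \<nu>" "\<nu> \<le> 1/3" "\<mu> + \<nu> \<ge> 1/3"
 shows "3 * (\<mu> + \<nu>) * \<nu> \<le> (2 * (\<mu> + \<nu>) - 1/3) * (1 - \<mu>)"
proof -
 have "(-3) * \<nu>\<^sup>2 + (2 - 5 * \<mu>) * \<nu> + ((2 * \<mu> - 1/3) * (1 - \<mu>)) \<ge> 0"
 proof (rule concave_quadratic_nonneg[where l = "1/3 - \<mu>" and u = "1/3"])
  have "(-3) * (1/3 - \<mu>)\<^sup>2 + (2 - 5 * \<mu>) * (1/3 - \<mu>) + ((2 * \<mu> - 1/3) * (1 - \<mu>)) = 2/3 * \<mu>"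
   by (simp add: power2_eq_square field_simps)
  then show "(-3) * (1/3 - \<mu>)\<^sup>2 + (2 - 5 * \<mu>) * (1/3 - \<mu>) + ((2 * \<mu> - 1/3) * (1 - \<mu>)) \<ge> 0"
   using assms by auto
  have "(-3) * (1/3)\<^sup>2 + (2 - 5 * \<mu>) * (1/3) + ((2 * \<mu> - 1/3) * (1 - \<mu>)) = 2 * (\<mu> * (1/3 - \<mu>))"
   by (simp add: power2_eq_square field_simps)
  then show "(-3) * (1/3)\<^sup>2 + (2 - 5 * \<mu>) * (1/3) + ((2 * \<mu> - 1/3) * (1 - \<mu>)) \<ge> 0"
   using assms by auto
 qed (use assms in auto)
 then show ?thesis by (simp add: power2_eq_square algebra_simps)
qed

text \<open>Upper bound for the tail probability given that the groups \<open>U\<close> and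
  \<open>W\<close> of \<open>thin_sum_tail\<close> sum to \<open>N\<close>, after averaging over the
  straddling load. If \<open>s\<close> is the mean of \<open>U + W\<close>, that load has mean at
  most \<open>2 - 3 * s\<close>. For \<open>N < 1\<close> it must be kept, with probability 1/3, and
  reach \<open>1 - N\<close>, with probability at most its mean plus \<open>N\<close>.\<close>

definition penalty :: "real \<Rightarrow> real \<Rightarrow> real" where
 "penalty s N = (if N \<ge> 1 then 1 else (2 - 3 * s + N) / 3)"

text \<open>Covers the configurations in which the upper value \<open>y1\<close> lifts the sum to 1
  whatever the first load is. The jump can then be averaged over the first load, and only an
  inequality about the second load remains.\<close>

lemma single_high_case:
 fixes \<mu> \<nu> :: real
 assumes "0 \<le> \<mu>" "\<mu> \<le> 1/3" "0 \<le> \<nu>" "\<nu> \<le> 1/3" "\<mu> + \<nu> \<ge> 1/3"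
  and "0 \<le> x0" "x0 \<le> \<mu>" "0 \<le> y0" "y0 \<le> \<nu>" "\<nu> \<le> y1" "x0 + y1 \<ge> 1"
 shows "(\<nu> - y0) * (1 + 3 * (\<mu> + \<nu>) - \<mu> - y1) \<le> (2 * (\<mu> + \<nu>) - 1/3) * (y1 - y0)"
proof -
 let ?s = "\<mu> + \<nu>"
 have "(\<nu> - y0) * (1 + 3 * ?s - \<mu> - y1) \<le> (\<nu> - y0) * (3 * ?s + x0 - \<mu>)"
  using assms by (intro mult_left_mono) auto
 also have "\<dots> \<le> (2 * ?s - 1/3) * (1 - x0 - y0)"
 proof -
  have "(\<nu> - y0) * (1 - x0) \<le> \<nu> * (1 - x0 - y0)"
  proof -
   have "y0 * \<nu> \<le> y0 * (1 - x0)" using assms by (intro mult_left_mono) auto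
   then show ?thesis by (simp add: algebra_simps)
  qed
  then have "(\<nu> - y0) * (1 - x0) * (3 * ?s + x0 - \<mu>) \<le> \<nu> * (1 - x0 - y0) * (3 * ?s + x0 - \<mu>)"
   using assms by (intro mult_right_mono) auto
  also have "\<dots> = (1 - x0 - y0) * (\<nu> * (3 * ?s + x0 - \<mu>))" by simp
  also have "\<dots> \<le> (1 - x0 - y0) * ((2 * ?s - 1/3) * (1 - x0))"
  proof (rule mult_left_mono)
   have "\<nu> * (3 * ?s) \<le> (2 * ?s - 1/3) * (1 - \<mu>)"
    using single_high_bound[of \<mu> \<nu>] assms by (simp add: algebra_simps)
   moreover have "0 \<le> (\<mu> - x0) * (2 * ?s - 1/3 + \<nu>)" using assms by (intro mult_nonneg_nonneg) auto
   ultimately show "\<nu> * (3 * ?s + x0 - \<mu>) \<le> (2 * ?s - 1/3) * (1 - x0)"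
    by (simp add: field_simps)
  qed (use assms in auto)
  finally have "(1 - x0) * ((\<nu> - y0) * (3 * ?s + x0 - \<mu>)) \<le> (1 - x0) * ((2 * ?s - 1/3) * (1 - x0 - y0))"
   by (simp add: mult_ac)
  then show ?thesis using assms by (subst (asm) mult_le_cancel_left_pos) auto
 qed
 also have "\<dots> \<le> (2 * ?s - 1/3) * (y1 - y0)"
  using assms by (intro mult_left_mono) auto
 finally show ?thesis .
qed

text \<open>This is the expectation of \<open>penalty\<close> for independent loads on
  \<open>x0\<close>, \<open>x1\<close> and on \<open>y0\<close>, \<open>y1\<close> with means
  \<open>\<mu>\<close> and \<open>\<nu>\<close>, cleared of the denominators \<open>x1 - x0\<close>
  and \<open>y1 - y0\<close>. The cases differ in which of the four sums reach 1;
  \<open>x0 + y0\<close> never does.\<close>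

lemma four_point_bound:
 fixes \<mu> \<nu> :: real
 assumes \<mu>: "0 \<le> \<mu>" "\<mu> \<le> 1/3" and \<nu>: "0 \<le> \<nu>" "\<nu> \<le> 1/3" and s: "\<mu> + \<nu> \<ge> 1/3"
  and x: "0 \<le> x0" "x0 \<le> \<mu>" "\<mu> \<le> x1" and y: "0 \<le> y0" "y0 \<le> \<nu>" "\<nu> \<le> y1"
 defines "f \<equiv> penalty (\<mu> + \<nu>)"
 shows "(y1 - \<nu>) * ((x1 - \<mu>) * f (x0 + y0) + (\<mu> - x0) * f (x1 + y0))
   + (\<nu> - y0) * ((x1 - \<mu>) * f (x0 + y1) + (\<mu> - x0) * f (x1 + y1)) \<le> 5/9 * (x1 - x0) * (y1 - y0)"
proof -
 let ?s = "\<mu> + \<nu>"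
 define A B a b where AB: "A = x1 - \<mu>" "B = \<mu> - x0" "a = y1 - \<nu>" "b = \<nu> - y0"
 have nn: "A \<ge> 0" "B \<ge> 0" "a \<ge> 0" "b \<ge> 0" using x y AB by auto
 \<comment> \<open>Three times the excess of \<open>f\<close> over its affine branch. That branch
   averages to \<open>(2 - 2 * ?s) / 3\<close>, so the target 5/9 leaves
   \<open>(2 * ?s - 1/3) / 3\<close> for the excess.\<close>
 define J where "J N = (if N \<ge> 1 then 1 + 3 * ?s - N else 0)" for N
 have f: "f N = (2 - 3 * ?s + N) / 3 + J N / 3" for N
  by (simp add: f_def penalty_def J_def field_simps)
 define S where "S = A * a * J (x0 + y0) + B * a * J (x1 + y0) + A * b * J (x0 + y1) + B * b * J (x1 + y1)"
 have tot: "a * (A * f (x0 + y0) + B * f (x1 + y0)) + b * (A * f (x0 + y1) + B * f (x1 + y1))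
  = (A + B) * (a + b) * (2 - 2 * ?s) / 3 + S / 3"
  unfolding f S_def AB by (simp add: field_simps)
 have "S \<le> (2 * ?s - 1/3) * ((A + B) * (a + b))"
 proof -
  have J00: "J (x0 + y0) = 0" using assms by (auto simp: J_def)
  have pos: "0 \<le> (2 * ?s - 1/3) * ((A + B) * (a + b))"
   using nn s by (intro mult_nonneg_nonneg) auto
  consider (none) "x1 + y1 < 1" | (both) "x1 + y1 \<ge> 1" "x1 + y0 < 1" "x0 + y1 < 1"
   | (left) "x1 + y0 \<ge> 1" "x0 + y1 < 1" | (right) "x1 + y0 < 1" "x0 + y1 \<ge> 1"
   | (any) "x1 + y0 \<ge> 1" "x0 + y1 \<ge> 1" by linarith
  then show ?thesis
  proof cases
   case none
   then have "S = 0" using x y by (auto simp: S_def J_def)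
   then show ?thesis using pos by simp
  next
   case both
   then have "S = B * b * (1 + 3 * ?s - (x1 + y1))" using J00 by (auto simp: S_def J_def)
   also have "\<dots> \<le> B * b * (3 * ?s)" using both nn by (intro mult_left_mono) auto
   also have "\<dots> \<le> (2 * ?s - 1/3) * ((A + B) * (a + b))"
   proof -
    \<comment> \<open>Under \<open>x1 + y1 \<ge> 1\<close>, \<open>x1 \<ge> \<mu>\<close> and
      \<open>y1 \<ge> \<nu>\<close> the product is smallest at an end of the segment
      \<open>x1 + y1 = 1\<close>.\<close>
    have prodge: "x1 * y1 \<ge> \<mu> * (1 - \<mu>) \<or> x1 * y1 \<ge> \<nu> * (1 - \<nu>)"
    proof (cases "y1 \<ge> 1 - \<mu>")
     case True
     then have "x1 * y1 \<ge> \<mu> * (1 - \<mu>)" using x \<mu> by (intro mult_mono) auto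
     then show ?thesis by simp
    next
     case False
     have "x1 * y1 \<ge> (1 - y1) * y1" using both False x y \<nu> by (intro mult_right_mono) auto
     moreover have "(-1) * y1\<^sup>2 + 1 * y1 + (- min (\<mu> * (1 - \<mu>)) (\<nu> * (1 - \<nu>))) \<ge> 0"
      by (rule concave_quadratic_nonneg[where l = \<nu> and u = "1 - \<mu>"])
       (use False y in \<open>auto simp: power2_eq_square algebra_simps min_def\<close>)
     ultimately have "x1 * y1 \<ge> min (\<mu> * (1 - \<mu>)) (\<nu> * (1 - \<nu>))"
      by (simp add: power2_eq_square algebra_simps)
     then show ?thesis by (auto simp: min_def split: if_splits)
    qed
    have key: "3 * ?s * (\<mu> * \<nu>) \<le> (2 * ?s - 1/3) * (x1 * y1)"
    proof -
     have 1: "3 * ?s * (\<mu> * \<nu>) \<le> (2 * ?s - 1/3) * (\<mu> * (1 - \<mu>))"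
      using mult_left_mono[OF single_high_bound[OF \<mu> \<nu> s] \<mu>(1)] by (simp add: mult_ac)
     have 2: "3 * ?s * (\<mu> * \<nu>) \<le> (2 * ?s - 1/3) * (\<nu> * (1 - \<nu>))"
      using mult_left_mono[OF single_high_bound[OF \<nu> \<mu>] \<nu>(1)] s by (simp add: mult_ac add.commute)
     from prodge show ?thesis
     proof
      assume "x1 * y1 \<ge> \<mu> * (1 - \<mu>)"
      then have "(2 * ?s - 1/3) * (x1 * y1) \<ge> (2 * ?s - 1/3) * (\<mu> * (1 - \<mu>))"
       using s by (intro mult_left_mono) auto
      then show ?thesis using 1 by linarith
     next
      assume "x1 * y1 \<ge> \<nu> * (1 - \<nu>)"
      then have "(2 * ?s - 1/3) * (x1 * y1) \<ge> (2 * ?s - 1/3) * (\<nu> * (1 - \<nu>))"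
       using s by (intro mult_left_mono) auto
      then show ?thesis using 2 by linarith
     qed
    qed
    \<comment> \<open>Markov's inequality for each load: the weight of the upper point is at most
      the mean divided by that point.\<close>
    have B1: "B * x1 \<le> \<mu> * (A + B)" "b * y1 \<le> \<nu> * (a + b)"
     using mult_left_mono[OF x(3) x(1)] mult_left_mono[OF y(3) y(1)] by (auto simp: AB algebra_simps)
    have x1y1: "x1 > 0" "y1 > 0" using both x y \<mu> \<nu> by auto
    have "(B * x1) * (b * y1) \<le> (\<mu> * (A + B)) * (\<nu> * (a + b))"
     by (rule mult_mono[OF B1]) (use nn x1y1 \<mu> \<nu> in auto)
    then have "3 * ?s * ((B * x1) * (b * y1)) \<le> 3 * ?s * ((\<mu> * (A + B)) * (\<nu> * (a + b)))"
     using s by (intro mult_left_mono) auto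
    also have "\<dots> = (3 * ?s * (\<mu> * \<nu>)) * ((A + B) * (a + b))" by (simp add: mult_ac)
    also have "\<dots> \<le> ((2 * ?s - 1/3) * (x1 * y1)) * ((A + B) * (a + b))"
     using key nn by (intro mult_right_mono) auto
    finally have "(x1 * y1) * (B * b * (3 * ?s)) \<le> (x1 * y1) * ((2 * ?s - 1/3) * ((A + B) * (a + b)))"
     by (simp add: mult_ac)
    then show ?thesis using x1y1 by (subst (asm) mult_le_cancel_left_pos) auto
   qed
   finally show ?thesis .
  next
   case left
   have "S = B * ((a + b) * (1 + 3 * ?s - \<nu> - x1))"
    using left J00 y by (auto simp: S_def J_def AB algebra_simps)
   also have "\<dots> = (a + b) * (B * (1 + 3 * ?s - \<nu> - x1))" by simp
   also have "\<dots> \<le> (a + b) * ((2 * ?s - 1/3) * (A + B))"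
   proof (rule mult_left_mono)
    have "B * (1 + 3 * (\<nu> + \<mu>) - \<nu> - x1) \<le> (2 * (\<nu> + \<mu>) - 1/3) * (x1 - x0)"
     unfolding AB using assms left by (intro single_high_case) auto
    then show "B * (1 + 3 * ?s - \<nu> - x1) \<le> (2 * ?s - 1/3) * (A + B)"
     by (simp add: AB add.commute)
   qed (use nn in auto)
   finally show ?thesis by (simp add: mult_ac)
  next
   case right
   have "S = b * ((A + B) * (1 + 3 * ?s - \<mu> - y1))"
    using right J00 x by (auto simp: S_def J_def AB algebra_simps)
   also have "\<dots> = (A + B) * (b * (1 + 3 * ?s - \<mu> - y1))" by simp
   also have "\<dots> \<le> (A + B) * ((2 * ?s - 1/3) * (a + b))"
   proof (rule mult_left_mono)
    have "b * (1 + 3 * ?s - \<mu> - y1) \<le> (2 * ?s - 1/3) * (y1 - y0)"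
     unfolding AB using assms right by (intro single_high_case) auto
    then show "b * (1 + 3 * ?s - \<mu> - y1) \<le> (2 * ?s - 1/3) * (a + b)"
     by (simp add: AB)
   qed (use nn in auto)
   finally show ?thesis by (simp add: mult_ac)
  next
   case any
   let ?l = "x0 + y0"
   have "S = (1 + 3 * ?s) * ((A + B) * (a + b) - A * a) - (?s * ((A + B) * (a + b)) - A * a * ?l)"
    using any J00 x y by (auto simp: S_def J_def AB algebra_simps)
   also have "\<dots> = (1 + 2 * ?s) * ((A + B) * (a + b)) - A * a * (1 + 3 * ?s - ?l)"
    by (simp add: algebra_simps)
   finally have S: "S = (1 + 2 * ?s) * ((A + B) * (a + b)) - A * a * (1 + 3 * ?s - ?l)" .
   define e where "e = 1 - ?l"
   have e: "e > 0" using x y \<mu> \<nu> by (auto simp: e_def)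
   have poly: "(e - (\<mu> - x0)) * (e - (\<nu> - y0)) * (1 + 3 * ?s - ?l) \<ge> 4/3 * e\<^sup>2"
   proof -
    have "(e - (\<mu> - x0)) * (e - (\<nu> - y0)) * (3 - 2 * e + 3 * (\<mu> - x0) + 3 * (\<nu> - y0)) \<ge> 4/3 * e\<^sup>2"
     by (rule mixed_poly_bound[where G = "1/3 - x0" and H = "1/3 - y0"])
      (use x y \<mu> \<nu> s in \<open>auto simp: e_def\<close>)
    then show ?thesis by (simp add: e_def algebra_simps)
   qed
   \<comment> \<open>The weight of the lower point is smallest at \<open>x1 = 1 - y0\<close>, the
     least value that reaches 1 together with \<open>y0\<close>.\<close>
   have A1: "A * e \<ge> (e - (\<mu> - x0)) * (A + B)"
   proof -
    have "(x1 - (1 - y0)) * (\<mu> - x0) \<ge> 0" using any x by (intro mult_nonneg_nonneg) auto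
    then show ?thesis by (simp add: AB e_def algebra_simps)
   qed
   have a1: "a * e \<ge> (e - (\<nu> - y0)) * (a + b)"
   proof -
    have "(y1 - (1 - x0)) * (\<nu> - y0) \<ge> 0" using any y by (intro mult_nonneg_nonneg) auto
    then show ?thesis by (simp add: AB e_def algebra_simps)
   qed
   have pos2: "e - (\<mu> - x0) \<ge> 0" "e - (\<nu> - y0) \<ge> 0" "1 + 3 * ?s - ?l \<ge> 0"
    using x y \<mu> \<nu> by (auto simp: e_def)
   have "(A * e) * (a * e) \<ge> ((e - (\<mu> - x0)) * (A + B)) * ((e - (\<nu> - y0)) * (a + b))"
    by (rule mult_mono[OF A1 a1]) (use pos2 nn e in auto)
   then have "(A * e) * (a * e) * (1 + 3 * ?s - ?l)
     \<ge> ((e - (\<mu> - x0)) * (A + B)) * ((e - (\<nu> - y0)) * (a + b)) * (1 + 3 * ?s - ?l)"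
    using pos2 by (intro mult_right_mono) auto
   also have "((e - (\<mu> - x0)) * (A + B)) * ((e - (\<nu> - y0)) * (a + b)) * (1 + 3 * ?s - ?l)
     = ((e - (\<mu> - x0)) * (e - (\<nu> - y0)) * (1 + 3 * ?s - ?l)) * ((A + B) * (a + b))"
    by (simp only: mult_ac)
   finally have up: "\<dots> \<le> (A * e) * (a * e) * (1 + 3 * ?s - ?l)" .
   have "(4/3 * e\<^sup>2) * ((A + B) * (a + b))
     \<le> ((e - (\<mu> - x0)) * (e - (\<nu> - y0)) * (1 + 3 * ?s - ?l)) * ((A + B) * (a + b))"
    using poly nn by (intro mult_right_mono) auto
   also note up
   also have "(A * e) * (a * e) * (1 + 3 * ?s - ?l) = e\<^sup>2 * (A * a * (1 + 3 * ?s - ?l))"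
    by (simp add: power2_eq_square)
   finally have "e\<^sup>2 * (4/3 * ((A + B) * (a + b))) \<le> e\<^sup>2 * (A * a * (1 + 3 * ?s - ?l))"
    by (simp only: mult_ac)
   then have "4/3 * ((A + B) * (a + b)) \<le> A * a * (1 + 3 * ?s - ?l)"
    using e by (subst (asm) mult_le_cancel_left_pos) auto
   moreover have "(1 + 2 * ?s) * Y = (2 * ?s - 1/3) * Y + 4/3 * Y" for Y
    by (simp add: field_simps)
   ultimately show ?thesis unfolding S by smt
  qed
 qed
 then have "a * (A * f (x0 + y0) + B * f (x1 + y0)) + b * (A * f (x0 + y1) + B * f (x1 + y1))
  \<le> (A + B) * (a + b) * (2 - 2 * ?s) / 3 + (2 * ?s - 1/3) * ((A + B) * (a + b)) / 3"
  unfolding tot by simp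
 also have "\<dots> = 5/9 * (A + B) * (a + b)" by (simp add: field_simps)
 finally show ?thesis by (simp add: AB)
qed

section \<open>Expectations over laws with finite support\<close>

lemma integrable_finite_pmf [simp]:
 fixes f :: "'a \<Rightarrow> real"
 assumes "finite (set_pmf p)"
 shows "integrable (measure_pmf p) f"
 using assms by (rule integrable_measure_pmf_finite)

lemma expectation_mono_finite:
 fixes f g :: "'a \<Rightarrow> real"
 assumes "finite (set_pmf p)" "\<And>x. x \<in> set_pmf p \<Longrightarrow> f x \<le> g x"
 shows "expect p f \<le> expect p g"
 using assms by (intro integral_mono_AE) (auto simp: AE_measure_pmf_iff)

lemma expectation_nonneg_pmf:
 fixes f :: "'a \<Rightarrow> real"
 assumes "\<And>x. x \<in> set_pmf p \<Longrightarrow> f x \<ge> 0"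
 shows "expect p f \<ge> 0"
 using assms by (intro integral_nonneg_AE) (auto simp: AE_measure_pmf_iff)

lemma expectation_cong_pmf:
 fixes f g :: "'a \<Rightarrow> real"
 assumes "\<And>x. x \<in> set_pmf p \<Longrightarrow> f x = g x"
 shows "expect p f = expect p g"
 using assms by (intro integral_cong_AE) (auto simp: AE_measure_pmf_iff)

lemma expectation_bind_finite:
 fixes h :: "'b \<Rightarrow> real"
 assumes p: "finite (set_pmf p)" and f: "\<And>x. x \<in> set_pmf p \<Longrightarrow> finite (set_pmf (f x))"
 shows "expect (bind_pmf p f) h
   = expect p (\<lambda>x. expect (f x) h)"
proof -
 let ?S = "set_pmf (bind_pmf p f)"
 have S: "finite ?S" using p f by auto
 have "expect (bind_pmf p f) h = (\<Sum>y\<in>?S. h y * pmf (bind_pmf p f) y)"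
  using S by (intro integral_measure_pmf_real) auto
 also have "\<dots> = (\<Sum>y\<in>?S. h y * (\<Sum>x\<in>set_pmf p. pmf (f x) y * pmf p x))"
  using p by (intro sum.cong refl arg_cong2[where f = "(*)"])
   (simp_all add: pmf_bind integral_measure_pmf_real[where A = "set_pmf p"])
 also have "\<dots> = (\<Sum>x\<in>set_pmf p. (\<Sum>y\<in>?S. h y * pmf (f x) y) * pmf p x)"
  unfolding sum_distrib_left sum_distrib_right by (subst sum.swap) (simp add: mult_ac)
 also have "\<dots> = (\<Sum>x\<in>set_pmf p. expect (f x) h * pmf p x)"
  using S by (intro sum.cong refl arg_cong2[where f = "(*)"] integral_measure_pmf_real[symmetric]) auto
 also have "\<dots> = expect p (\<lambda>x. expect (f x) h)"
  using p by (intro integral_measure_pmf_real[symmetric]) auto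
 finally show ?thesis .
qed

lemma expectation_swap_finite:
 fixes h :: "'a \<Rightarrow> 'b \<Rightarrow> real"
 assumes "finite (set_pmf p)" "finite (set_pmf q)"
 shows "expect p (\<lambda>x. expect q (h x))
   = expect q (\<lambda>y. expect p (\<lambda>x. h x y))"
proof -
 have "expect p (\<lambda>x. expect q (h x))
   = (\<Sum>x\<in>set_pmf p. (\<Sum>y\<in>set_pmf q. h x y * pmf q y) * pmf p x)"
  using assms by (subst integral_measure_pmf_real[where A = "set_pmf p"])
   (auto intro!: sum.cong simp: integral_measure_pmf_real[where A = "set_pmf q"])
 also have "\<dots> = (\<Sum>y\<in>set_pmf q. (\<Sum>x\<in>set_pmf p. h x y * pmf p x) * pmf q y)"
  unfolding sum_distrib_right by (subst sum.swap) (simp add: mult_ac)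
 also have "\<dots> = expect q (\<lambda>y. expect p (\<lambda>x. h x y))"
  using assms by (subst integral_measure_pmf_real[where A = "set_pmf q"])
   (auto intro!: sum.cong simp: integral_measure_pmf_real[where A = "set_pmf p"])
 finally show ?thesis .
qed

text \<open>The envelope of \<open>f\<close> at the mean is attained on two points, so a bound for all two-point laws
 gives a supporting line.\<close>

lemma expectation_le_two_point:
 fixes f :: "real \<Rightarrow> real"
 assumes fin: "finite (set_pmf D)" and nn: "\<And>x. x \<in> set_pmf D \<Longrightarrow> 0 \<le> x"
  and mean: "expect D (\<lambda>x. x) = \<mu>"
  and two: "\<And>x0 x1. 0 \<le> x0 \<Longrightarrow> x0 \<le> \<mu> \<Longrightarrow> \<mu> \<le> x1 \<Longrightarrow>
   (x1 - \<mu>) * f x0 + (\<mu> - x0) * f x1 \<le> C * (x1 - x0)"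
 shows "expect D f \<le> C"
proof -
 have "\<mu> \<ge> 0" unfolding mean[symmetric] using nn by (rule expectation_nonneg_pmf)
 then have at_mean: "f \<mu> \<le> C" using two[of \<mu> "\<mu> + 1"] by simp
 let ?S0 = "{x \<in> set_pmf D. x < \<mu>}" and ?S1 = "{x \<in> set_pmf D. x > \<mu>}"
 define lo where "lo = (\<lambda>x. (C - f x) / (\<mu> - x))"
 define hi where "hi = (\<lambda>x. (f x - C) / (x - \<mu>))"
 have cross: "hi x1 \<le> lo x0" if "x0 \<in> ?S0" "x1 \<in> ?S1" for x0 x1
 proof -
  have pos: "\<mu> - x0 > 0" "x1 - \<mu> > 0" using that by auto
  have "(x1 - \<mu>) * f x0 + (\<mu> - x0) * f x1 \<le> C * (x1 - x0)" using two[of x0 x1] that nn by auto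
  then have "(f x1 - C) * (\<mu> - x0) \<le> (C - f x0) * (x1 - \<mu>)" by (simp add: algebra_simps)
  then show ?thesis unfolding hi_def lo_def using pos by (simp add: divide_simps mult.commute)
 qed
 \<comment> \<open>By \<open>cross\<close> every slope to the right of the mean is at most every
   slope to the left, so some number separates them; the case split is for supports on one side of
   the mean.\<close>
 obtain c where c: "\<forall>x1\<in>?S1. hi x1 \<le> c" "\<forall>x0\<in>?S0. c \<le> lo x0"
 proof (cases "?S1 = {}")
  case True
  show ?thesis
  proof (cases "?S0 = {}")
   case True
   then show ?thesis using that[of 0] \<open>?S1 = {}\<close> by blast
  next
   case False
   have "\<forall>x0\<in>?S0. Min (lo ` ?S0) \<le> lo x0" using fin by (auto intro!: Min_le)
   then show ?thesis using that[of "Min (lo ` ?S0)"] True by blast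
  qed
 next
  case False
  have "\<forall>x1\<in>?S1. hi x1 \<le> Max (hi ` ?S1)" using fin by (auto intro!: Max_ge)
  moreover have "Max (hi ` ?S1) \<in> hi ` ?S1" using fin False by (intro Max_in) auto
  ultimately have "\<exists>c. (\<forall>x1\<in>?S1. hi x1 \<le> c) \<and> (\<forall>x0\<in>?S0. c \<le> lo x0)"
   using cross by (metis (no_types, lifting) imageE)
  then show ?thesis using that by blast
 qed
 have line: "f x \<le> C + c * (x - \<mu>)" if x: "x \<in> set_pmf D" for x
 proof -
  consider "x = \<mu>" | "x < \<mu>" | "x > \<mu>" by linarith
  then show ?thesis
  proof cases
   case 1 then show ?thesis using at_mean by simp
  next
   case 2
   then have "c \<le> (C - f x) / (\<mu> - x)" using c(2) x unfolding lo_def by auto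
   then have "c * (\<mu> - x) \<le> C - f x" using 2 by (simp add: pos_le_divide_eq)
   then show ?thesis by (simp add: algebra_simps)
  next
   case 3
   then have "(f x - C) / (x - \<mu>) \<le> c" using c(1) x unfolding hi_def by auto
   then have "f x - C \<le> c * (x - \<mu>)" using 3 by (simp add: pos_divide_le_eq)
   then show ?thesis by (simp add: algebra_simps)
  qed
 qed
 have "expect D f \<le> expect D (\<lambda>x. C + c * (x - \<mu>))"
  using fin line by (rule expectation_mono_finite)
 also have "\<dots> = C" using fin mean by simp
 finally show ?thesis .
qed

text \<open>The two-point reduction is applied to each load in turn, the inner one for a fixed pair
  of values of the outer load. What remains is \<open>four_point_bound\<close>.\<close>

lemma expectation_penalty_sum:
 assumes U: "finite (set_pmf U)" "\<And>x. x \<in> set_pmf U \<Longrightarrow> 0 \<le> x" "expect U (\<lambda>x. x) = \<mu>"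
  and W: "finite (set_pmf W)" "\<And>x. x \<in> set_pmf W \<Longrightarrow> 0 \<le> x" "expect W (\<lambda>x. x) = \<nu>"
  and m: "\<mu> \<le> 1/3" "\<nu> \<le> 1/3" "\<mu> + \<nu> \<ge> 1/3"
 shows "expect U (\<lambda>x. expect W (\<lambda>y. penalty (\<mu> + \<nu>) (x + y))) \<le> 5/9"
proof (rule expectation_le_two_point[OF U])
 fix x0 x1 :: real
 assume x: "0 \<le> x0" "x0 \<le> \<mu>" "\<mu> \<le> x1"
 have mn: "\<mu> \<ge> 0" "\<nu> \<ge> 0" using U W by (auto intro: expectation_nonneg_pmf)
 let ?f = "penalty (\<mu> + \<nu>)"
 have "expect W (\<lambda>y. (x1 - \<mu>) * ?f (x0 + y) + (\<mu> - x0) * ?f (x1 + y)) \<le> 5/9 * (x1 - x0)"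
  using four_point_bound[OF mn(1) m(1) mn(2) m(2,3) x]
  by (intro expectation_le_two_point[OF W]) auto
 then show "(x1 - \<mu>) * expect W (\<lambda>y. ?f (x0 + y))
   + (\<mu> - x0) * expect W (\<lambda>y. ?f (x1 + y)) \<le> 5/9 * (x1 - x0)"
  using W(1) by simp
qed

section \<open>Tail of a sum of independent thinned loads\<close>

definition thin :: "real pmf \<Rightarrow> real pmf" where
 "thin m = bind_pmf (bernoulli_pmf (1/3)) (\<lambda>b. if b then m else return_pmf 0)"

primrec thin_sum :: "real pmf list \<Rightarrow> real pmf" where
 "thin_sum [] = return_pmf 0"
| "thin_sum (m # ms) = bind_pmf (thin m) (\<lambda>x. map_pmf ((+) x) (thin_sum ms))"

definition load_law :: "real pmf \<Rightarrow> bool" where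
 "load_law m \<longleftrightarrow> finite (set_pmf m) \<and> (\<forall>x\<in>set_pmf m. 0 \<le> x)"

abbreviation mean :: "real pmf \<Rightarrow> real" where
 "mean m \<equiv> expect m (\<lambda>x. x)"

lemma load_law_thin: "load_law m \<Longrightarrow> load_law (thin m)"
 by (auto simp: load_law_def thin_def split: if_splits)

lemma load_law_thin_sum: "(\<And>m. m \<in> set ms \<Longrightarrow> load_law m) \<Longrightarrow> load_law (thin_sum ms)"
proof (induction ms)
 case (Cons m ms)
 then have "load_law (thin m)" "load_law (thin_sum ms)" by (auto intro: load_law_thin)
 then show ?case by (auto simp: load_law_def)
qed (simp add: load_law_def)

lemma expectation_thin:
 fixes h :: "real \<Rightarrow> real"
 assumes "finite (set_pmf m)"
 shows "expect (thin m) h = 2/3 * h 0 + 1/3 * expect m h"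
 unfolding thin_def using assms by (subst expectation_bind_finite) auto

lemma thin_sum_append:
 "thin_sum (xs @ ys) = bind_pmf (thin_sum xs) (\<lambda>x. map_pmf ((+) x) (thin_sum ys))"
proof (induction xs)
 case Nil
 have "map_pmf ((+) 0) (thin_sum ys) = map_pmf (\<lambda>x. x) (thin_sum ys)"
  by (intro map_pmf_cong) auto
 then show ?case by (simp add: bind_return_pmf)
next
 case (Cons a xs)
 have "(\<lambda>z. x + (y + z)) = (+) (x + y)" for x y :: real by (auto simp: add.assoc)
 then show ?case using Cons
  by (simp add: map_bind_pmf bind_assoc_pmf bind_map_pmf map_pmf_comp)
qed

lemma mean_thin_sum:
 "(\<And>m. m \<in> set ms \<Longrightarrow> load_law m) \<Longrightarrow> mean (thin_sum ms) = (\<Sum>m\<leftarrow>ms. mean m) / 3"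
proof (induction ms)
 case (Cons m ms)
 have f: "finite (set_pmf m)" "finite (set_pmf (thin m))" "finite (set_pmf (thin_sum ms))"
 proof -
  have "load_law m" "load_law (thin m)" "load_law (thin_sum ms)"
   using Cons.prems by (auto intro!: load_law_thin load_law_thin_sum)
  then show "finite (set_pmf m)" "finite (set_pmf (thin m))" "finite (set_pmf (thin_sum ms))"
   by (simp_all add: load_law_def)
 qed
 have "mean (thin_sum (m # ms))
   = expect (thin m) (\<lambda>x. expect (thin_sum ms) (\<lambda>y. x + y))"
  using f by (simp add: expectation_bind_finite)
 also have "\<dots> = expect (thin m) (\<lambda>x. x + mean (thin_sum ms))"
  using f by (intro expectation_cong_pmf) simp
 also have "\<dots> = mean m / 3 + mean (thin_sum ms)"
  using f by (simp add: expectation_thin)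
 also have "mean (thin_sum ms) = (\<Sum>m\<leftarrow>ms. mean m) / 3"
  using Cons by simp
 finally show ?case by (simp add: add_divide_distrib)
qed simp

lemma split_straddling:
 fixes f :: "'a \<Rightarrow> real"
 assumes "1 < (\<Sum>m\<leftarrow>ms. f m)"
 shows "\<exists>us z ws. ms = us @ z # ws \<and> (\<Sum>m\<leftarrow>us. f m) \<le> 1 \<and> (\<Sum>m\<leftarrow>us. f m) + f z > 1"
 using assms
proof (induction ms rule: rev_induct)
 case (snoc m ms)
 show ?case
 proof (cases "1 < (\<Sum>m\<leftarrow>ms. f m)")
  case True
  then obtain us z ws where "ms = us @ z # ws" "(\<Sum>m\<leftarrow>us. f m) \<le> 1" "(\<Sum>m\<leftarrow>us. f m) + f z > 1"
   using snoc.IH by blast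
  then show ?thesis by (intro exI[of _ us] exI[of _ z] exI[of _ "ws @ [m]"]) auto
 next
  case False
  then show ?thesis using snoc.prems by (intro exI[of _ ms] exI[of _ m] exI[of _ "[]"]) auto
 qed
qed simp

lemma indicator_le_mean:
 assumes "load_law m" "t > 0"
 shows "expect m (\<lambda>x. if x \<ge> t then 1 else 0) \<le> mean m / t"
proof -
 have "expect m (\<lambda>x. if x \<ge> t then 1 else 0) \<le> expect m (\<lambda>x. x / t)"
  using assms by (intro expectation_mono_finite) (auto simp: load_law_def field_simps)
 then show ?thesis by simp
qed

text \<open>A sharpening of Markov's inequality (which would give only 2/3) for independent loads,
 tight for two deterministic loads of size 1. The laws are grouped into \<open>U\<close>, one straddling
 law \<open>Z\<close>, and \<open>W\<close>, so that \<open>U\<close> and \<open>W\<close> both have mean at most 1/3.\<close>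

theorem thin_sum_tail:
 assumes law: "\<And>m. m \<in> set ms \<Longrightarrow> load_law m" and le1: "\<And>m. m \<in> set ms \<Longrightarrow> mean m \<le> 1"
  and total: "(\<Sum>m\<leftarrow>ms. mean m) \<le> 2"
 shows "expect (thin_sum ms) (\<lambda>x. if x \<ge> 1 then 1 else 0 :: real) \<le> 5/9"
proof (cases "1 < (\<Sum>m\<leftarrow>ms. mean m)")
 \<comment> \<open>A total mean of at most 1 drops to 1/3 by thinning, and Markov's inequality
   suffices.\<close>
 case False
 have "expect (thin_sum ms) (\<lambda>x. if x \<ge> 1 then 1 else 0) \<le> mean (thin_sum ms) / 1"
  by (rule indicator_le_mean) (use law in \<open>auto intro: load_law_thin_sum\<close>)
 also have "\<dots> \<le> 5/9" using False mean_thin_sum[of ms] law by auto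
 finally show ?thesis .
next
 case True
 then obtain us z ws where ms: "ms = us @ z # ws"
  and us1: "(\<Sum>m\<leftarrow>us. mean m) \<le> 1" and usz: "(\<Sum>m\<leftarrow>us. mean m) + mean z > 1"
  using split_straddling by blast
 let ?U = "thin_sum us" and ?W = "thin_sum ws"
 let ?I = "\<lambda>x::real. if x \<ge> 1 then 1 else (0::real)"
 let ?E = expect
 have lU: "load_law ?U" and lW: "load_law ?W" and lz: "load_law z"
  using law ms by (auto intro: load_law_thin_sum)
 then have fin: "finite (set_pmf ?U)" "finite (set_pmf ?W)" "finite (set_pmf z)" "finite (set_pmf (thin z))"
  and nn: "\<And>x. x \<in> set_pmf ?U \<Longrightarrow> 0 \<le> x" "\<And>x. x \<in> set_pmf ?W \<Longrightarrow> 0 \<le> x" "\<And>x. x \<in> set_pmf z \<Longrightarrow> 0 \<le> x"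
  using load_law_thin by (auto simp: load_law_def)
 define \<mu> \<nu> where "\<mu> = mean ?U" and "\<nu> = mean ?W"
 have \<mu>: "\<mu> = (\<Sum>m\<leftarrow>us. mean m) / 3" and \<nu>: "\<nu> = (\<Sum>m\<leftarrow>ws. mean m) / 3"
  unfolding \<mu>_def \<nu>_def using law ms by (auto simp: mean_thin_sum)
 have z1: "mean z \<le> 1" "mean z \<ge> 0" using le1 ms nn by (auto intro: expectation_nonneg_pmf)
 have sum2: "3 * \<mu> + mean z + 3 * \<nu> \<le> 2" using total unfolding ms \<mu> \<nu> by simp
 have \<mu>le: "\<mu> \<le> 1/3" and \<nu>le: "\<nu> \<le> 1/3" using us1 usz sum2 \<mu> by linarith+
 define g where "g N = 2/3 * ?I N + 1/3 * ?E z (\<lambda>x. ?I (x + N))" for N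
 have "?E (thin_sum ms) ?I = ?E ?U (\<lambda>x. ?E (thin z) (\<lambda>t. ?E ?W (\<lambda>y. ?I (x + (t + y)))))"
  unfolding ms thin_sum_append using fin by (simp add: expectation_bind_finite)
 also have "\<dots> = ?E ?U (\<lambda>x. ?E ?W (\<lambda>y. g (x + y)))"
 proof (rule expectation_cong_pmf)
  fix x
  have "?E (thin z) (\<lambda>t. ?E ?W (\<lambda>y. ?I (x + (t + y)))) = ?E ?W (\<lambda>y. ?E (thin z) (\<lambda>t. ?I (x + (t + y))))"
   using fin by (intro expectation_swap_finite)
  also have "\<dots> = ?E ?W (\<lambda>y. g (x + y))"
   unfolding g_def using fin by (intro expectation_cong_pmf) (simp add: expectation_thin add_ac)
  finally show "?E (thin z) (\<lambda>t. ?E ?W (\<lambda>y. ?I (x + (t + y)))) = ?E ?W (\<lambda>y. g (x + y))" .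
 qed
 finally have tail: "?E (thin_sum ms) ?I = ?E ?U (\<lambda>x. ?E ?W (\<lambda>y. g (x + y)))" .
 have Zle1: "?E z (\<lambda>x. ?I (x + N)) \<le> 1" for N
  using fin expectation_mono_finite[of z "\<lambda>x. ?I (x + N)" "\<lambda>_. 1"] by simp
 show ?thesis
 proof (cases "\<mu> + \<nu> \<ge> 1/3")
  case True
  have "g N \<le> penalty (\<mu> + \<nu>) N" if "N \<ge> 0" for N
  proof (cases "N \<ge> 1")
   case True
   then show ?thesis using Zle1[of N] by (simp add: g_def penalty_def)
  next
   case False
   \<comment> \<open>The smaller of 1 and the Markov bound \<open>mean z / (1 - N)\<close> never
     exceeds \<open>mean z + N\<close>; all three agree at \<open>N = 1 - mean z\<close>.\<close>
   have "?E z (\<lambda>x. ?I (x + N)) \<le> mean z + N"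
   proof (cases "N \<le> 1 - mean z")
    case True
    have "?E z (\<lambda>x. ?I (x + N)) = ?E z (\<lambda>x. if x \<ge> 1 - N then 1 else 0)"
     by (intro expectation_cong_pmf) auto
    also have "\<dots> \<le> mean z / (1 - N)" using False lz by (intro indicator_le_mean) auto
    also have "\<dots> \<le> mean z + N"
    proof -
     have "0 \<le> N * (1 - mean z - N)" using that True by auto
     then show ?thesis using False by (simp add: field_simps)
    qed
    finally show ?thesis .
   next
    case False
    then show ?thesis using Zle1[of N] by linarith
   qed
   then show ?thesis using False sum2 by (simp add: g_def penalty_def)
  qed
  then have "?E ?U (\<lambda>x. ?E ?W (\<lambda>y. g (x + y))) \<le> ?E ?U (\<lambda>x. ?E ?W (\<lambda>y. penalty (\<mu> + \<nu>) (x + y)))"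
   using fin nn by (intro expectation_mono_finite) auto
  also have "\<dots> \<le> 5/9"
   using fin nn \<mu>le \<nu>le True \<mu>_def \<nu>_def by (intro expectation_penalty_sum) auto
  finally show ?thesis using tail by simp
 next
  case False
  \<comment> \<open>With little mass in the two groups a crude bound is enough: a kept straddling
    load contributes at most 1/3 and \<open>N\<close> at most 2/3 times its mean, together at most
    1/3 + 2/9.\<close>
  have "g N \<le> 1/3 + 2/3 * N" if "N \<ge> 0" for N
   using Zle1[of N] that by (auto simp: g_def)
  then have "?E ?U (\<lambda>x. ?E ?W (\<lambda>y. g (x + y))) \<le> ?E ?U (\<lambda>x. ?E ?W (\<lambda>y. 1/3 + 2/3 * (x + y)))"
   using fin nn by (intro expectation_mono_finite) (simp_all only: add_nonneg_nonneg)
  also have "\<dots> = 1/3 + 2/3 * (\<mu> + \<nu>)"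
   unfolding \<mu>_def \<nu>_def using fin by (simp add: field_simps)
  also have "\<dots> \<le> 5/9" using False by (simp add: field_simps)
  finally show ?thesis using tail by simp
 qed
qed

text \<open>A dummy load of mean \<open>\<delta>\<close> turns slack in the total mean into slack in the bound.\<close>

corollary thin_sum_success:
 assumes law: "\<And>m. m \<in> set ms \<Longrightarrow> load_law m" and le1: "\<And>m. m \<in> set ms \<Longrightarrow> mean m \<le> 1"
  and total: "(\<Sum>m\<leftarrow>ms. mean m) \<le> 2 - \<delta>" and \<delta>: "0 \<le> \<delta>" "\<delta> \<le> 1"
 shows "expect (thin_sum ms) (\<lambda>x. if x < 1 then 1 else 0 :: real) \<ge> 4/9 / (1 - \<delta> / 3)"
proof -
 let ?E = expect
 let ?I = "\<lambda>x::real. if x \<ge> 1 then 1 else (0::real)"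
 define d where "d = map_pmf (\<lambda>b. if b then 1 else (0::real)) (bernoulli_pmf \<delta>)"
 have d: "load_law d" "mean d = \<delta>" "finite (set_pmf d)"
  using \<delta> by (auto simp: d_def load_law_def)
 have fin: "finite (set_pmf (thin_sum ms))" and nn: "\<And>x. x \<in> set_pmf (thin_sum ms) \<Longrightarrow> 0 \<le> x"
  using load_law_thin_sum[of ms] law by (auto simp: load_law_def)
 define q where "q = ?E (thin_sum ms) ?I"
 have one: "?E (thin_sum ms) (\<lambda>y. ?I (1 + y)) = 1"
  using nn expectation_cong_pmf[of "thin_sum ms" "\<lambda>y. ?I (1 + y)" "\<lambda>_. 1"] by simp
 have "?E (thin_sum (d # ms)) ?I = ?E (thin d) (\<lambda>x. ?E (thin_sum ms) (\<lambda>y. ?I (x + y)))"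
  using fin d load_law_thin[of d] by (simp add: expectation_bind_finite load_law_def)
 also have "\<dots> = 2/3 * q + 1/3 * ?E d (\<lambda>x. ?E (thin_sum ms) (\<lambda>y. ?I (x + y)))"
  using d by (simp add: expectation_thin q_def)
 also have "?E d (\<lambda>x. ?E (thin_sum ms) (\<lambda>y. ?I (x + y))) = \<delta> * 1 + (1 - \<delta>) * q"
  using \<delta> one by (simp add: d_def q_def)
 finally have "?E (thin_sum (d # ms)) ?I = 2/3 * q + 1/3 * (\<delta> * 1 + (1 - \<delta>) * q)" .
 moreover have "?E (thin_sum (d # ms)) ?I \<le> 5/9"
  using law le1 total d \<delta> by (intro thin_sum_tail) auto
 \<comment> \<open>A kept dummy of size 1 reaches 1 alone, so with the dummy the tail probability is
   \<open>q + \<delta> / 3 * (1 - q)\<close>.\<close>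
 ultimately have "4/9 \<le> (1 - q) * (1 - \<delta> / 3)" by (simp add: field_simps)
 then have "4/9 / (1 - \<delta> / 3) \<le> 1 - q" using \<delta> by (subst pos_divide_le_eq) auto
 also have "1 - q = ?E (thin_sum ms) (\<lambda>x. 1 - ?I x)" using fin by (simp add: q_def)
 also have "\<dots> = ?E (thin_sum ms) (\<lambda>x. if x < 1 then 1 else 0)" by (intro expectation_cong_pmf) auto
 finally show ?thesis .
qed

section \<open>Arms as layered decision processes, and weak duality\<close>

text \<open>Names the facts of \<open>valid_mab\<close> for a fixed depth function. Probabilities
  are known to sum to 1 only at depths below \<open>B\<close>, which is why depth bounds accompany
  many later statements.\<close>

locale bandit =
 fixes I :: "('s, 'a) mab" and B :: nat and dep :: "'s \<Rightarrow> nat"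
 assumes fin_acts: "finite (acts I)"
  and fin_nodes: "\<And>i. i < narms I \<Longrightarrow> finite (nodes I i)"
  and root_in: "\<And>i. i < narms I \<Longrightarrow> root I i \<in> nodes I i"
  and disjoint: "\<And>i j. i < narms I \<Longrightarrow> j < narms I \<Longrightarrow> i \<noteq> j \<Longrightarrow> nodes I i \<inter> nodes I j = {}"
  and cross: "\<And>a i u v. a \<in> acts I \<Longrightarrow> i < narms I \<Longrightarrow> u \<in> nodes I i \<Longrightarrow> v \<in> states I \<Longrightarrow> v \<notin> nodes I i \<Longrightarrow> prob I a u v = 0"
  and rew_nn: "\<And>a u. a \<in> acts I \<Longrightarrow> u \<in> states I \<Longrightarrow> rew I a u \<ge> 0"
  and prob_nn: "\<And>a u v. a \<in> acts I \<Longrightarrow> u \<in> states I \<Longrightarrow> v \<in> states I \<Longrightarrow> prob I a u v \<ge> 0"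
  and dep_root: "\<And>i. i < narms I \<Longrightarrow> dep (root I i) = 0"
  and dep_succ: "\<And>a u v. a \<in> acts I \<Longrightarrow> u \<in> states I \<Longrightarrow> v \<in> states I \<Longrightarrow> prob I a u v > 0 \<Longrightarrow> dep v = dep u + 1"
  and prob_sum: "\<And>a u. a \<in> acts I \<Longrightarrow> u \<in> states I \<Longrightarrow> dep u < B \<Longrightarrow> (\<Sum>v\<in>states I. prob I a u v) = 1"
begin

lemma fin_states: "finite (states I)"
 using fin_nodes by (auto simp: states_def)

lemma root_states: "i < narms I \<Longrightarrow> root I i \<in> states I"
 using root_in by (auto simp: states_def)

lemma inj_root: "inj_on (root I) {..<narms I}"
 using root_in disjoint by (force simp: inj_on_def)

text \<open>With \<open>k\<close> steps to go, the current time is \<open>B + 1 - k\<close>. The functions below are value functions of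
 one arm: \<open>pay\<close> for a fixed decision table \<open>d\<close> (indexed by time and node) and payoffs \<open>g\<close>, and \<open>val\<close>
 for optimal decisions when a pull at time \<open>t\<close> costs \<open>l t\<close>.\<close>

primrec pay :: "(nat \<Rightarrow> 's \<Rightarrow> 'a option) \<Rightarrow> (nat \<Rightarrow> 'a \<Rightarrow> 's \<Rightarrow> real) \<Rightarrow> nat \<Rightarrow> 's \<Rightarrow> real" where
 "pay d g 0 u = 0"
| "pay d g (Suc k) u = (case d (B - k) u of None \<Rightarrow> pay d g k u
  | Some a \<Rightarrow> g (B - k) a u + (\<Sum>v\<in>states I. prob I a u v * pay d g k v))"

primrec val :: "(nat \<Rightarrow> real) \<Rightarrow> nat \<Rightarrow> 's \<Rightarrow> real" where
 "val l 0 u = 0"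
| "val l (Suc k) u = Max (insert (val l k u)
  ((\<lambda>a. rew I a u - l (B - k) + (\<Sum>v\<in>states I. prob I a u v * val l k v)) ` acts I))"

definition table :: "(nat \<Rightarrow> 's \<Rightarrow> 'a option) \<Rightarrow> bool" where
 "table d \<longleftrightarrow> (\<forall>t u a. t \<in> {1..B} \<longrightarrow> u \<in> states I \<longrightarrow> d t u = Some a \<longrightarrow> a \<in> acts I)"

text \<open>Bellman optimality, kept as a relation so that the tables computed by the machine
  qualify however ties are broken.\<close>

definition best_response :: "(nat \<Rightarrow> real) \<Rightarrow> (nat \<Rightarrow> 's \<Rightarrow> 'a option) \<Rightarrow> bool" where
 "best_response l d \<longleftrightarrow> table d \<and> (\<forall>k<B. \<forall>u\<in>states I. val l (Suc k) u = (case d (B - k) u of None \<Rightarrow> val l k u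
  | Some a \<Rightarrow> rew I a u - l (B - k) + (\<Sum>v\<in>states I. prob I a u v * val l k v)))"

lemma val_ge_stay: "val l (Suc k) u \<ge> val l k u"
 using fin_acts by simp

lemma val_ge_act: "a \<in> acts I \<Longrightarrow>
  val l (Suc k) u \<ge> rew I a u - l (B - k) + (\<Sum>v\<in>states I. prob I a u v * val l k v)"
 using fin_acts by simp

lemma val_nonneg: "val l k u \<ge> 0"
proof (induction k)
 case (Suc k) then show ?case using val_ge_stay[of l k u] by linarith
qed simp

lemma table_D: "table d \<Longrightarrow> k < B \<Longrightarrow> u \<in> states I \<Longrightarrow> d (B - k) u = Some a \<Longrightarrow> a \<in> acts I"
 unfolding table_def by (auto dest: spec[of _ "B - k"])

lemma pay_nonneg:
 assumes "table d" "\<And>t a u. a \<in> acts I \<Longrightarrow> u \<in> states I \<Longrightarrow> g t a u \<ge> 0"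
 shows "k \<le> B \<Longrightarrow> u \<in> states I \<Longrightarrow> pay d g k u \<ge> 0"
proof (induction k arbitrary: u)
 case (Suc k)
 show ?case
 proof (cases "d (B - k) u")
  case (Some a)
  then have "a \<in> acts I" using table_D[OF assms(1), of k u a] Suc.prems by simp
  then show ?thesis using Some Suc assms prob_nn by (auto intro!: add_nonneg_nonneg sum_nonneg mult_nonneg_nonneg)
 qed (use Suc in auto)
qed simp

lemma pay_diff:
 "pay d (\<lambda>t a u. g t a u - h t a u) k u = pay d g k u - pay d h k u"
 by (induction k arbitrary: u) (auto split: option.split simp: right_diff_distrib sum_subtractf)

lemma pay_scale: "pay d (\<lambda>t a u. c * g t a u) k u = c * pay d g k u"
 by (induction k arbitrary: u) (auto split: option.split simp: ring_distribs sum_distrib_left mult_ac)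

lemma pay_sum: "pay d (\<lambda>t a u. \<Sum>i\<in>J. g i t a u) k u = (\<Sum>i\<in>J. pay d (g i) k u)"
proof (induction k arbitrary: u)
 case (Suc k)
 show ?case
 proof (cases "d (B - k) u")
  case (Some a)
  have "(\<Sum>v\<in>states I. prob I a u v * (\<Sum>i\<in>J. pay d (g i) k v))
   = (\<Sum>i\<in>J. \<Sum>v\<in>states I. prob I a u v * pay d (g i) k v)"
   unfolding sum_distrib_left by (rule sum.swap)
  then show ?thesis using Some Suc by (simp add: sum.distrib)
 qed (use Suc in auto)
qed simp

lemma pay_cong:
 assumes "\<And>t a u. t \<in> {1..B} \<Longrightarrow> g t a u = h t a u"
 shows "k \<le> B \<Longrightarrow> pay d g k u = pay d h k u"
proof (induction k arbitrary: u)
 case (Suc k)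
 then show ?case using assms[of "B - k"] by (auto split: option.split)
qed simp

lemma pay_le_val:
 assumes "table d"
 shows "k \<le> B \<Longrightarrow> u \<in> states I \<Longrightarrow> pay d (\<lambda>t a u. rew I a u - l t) k u \<le> val l k u"
proof (induction k arbitrary: u)
 case (Suc k)
 show ?case
 proof (cases "d (B - k) u")
  case None
  then show ?thesis using Suc val_ge_stay[of l k u] by (simp only: pay.simps option.case) (smt (verit) Suc_leD)
 next
  case (Some a)
  then have a: "a \<in> acts I" using table_D[OF assms, of k u a] Suc.prems by simp
  have "(\<Sum>v\<in>states I. prob I a u v * pay d (\<lambda>t a u. rew I a u - l t) k v)
    \<le> (\<Sum>v\<in>states I. prob I a u v * val l k v)"
   using Suc a prob_nn by (intro sum_mono mult_left_mono) auto
  then show ?thesis using Some val_ge_act[OF a, of u l k] by (simp del: val.simps)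
 qed
qed simp

lemma best_response_pay:
 assumes "best_response l d"
 shows "k \<le> B \<Longrightarrow> u \<in> states I \<Longrightarrow> pay d (\<lambda>t a u. rew I a u - l t) k u = val l k u"
proof (induction k arbitrary: u)
 case (Suc k)
 have "val l (Suc k) u = (case d (B - k) u of None \<Rightarrow> val l k u
  | Some a \<Rightarrow> rew I a u - l (B - k) + (\<Sum>v\<in>states I. prob I a u v * val l k v))"
  using assms Suc.prems unfolding best_response_def by (auto simp del: val.simps)
 then show ?case using Suc by (auto split: option.split simp del: val.simps)
qed simp

lemma best_response_exists: "\<exists>d. best_response l d"
proof -
 have ex: "\<exists>x. case x of None \<Rightarrow> val l (Suc k) u = val l k u | Some a \<Rightarrow> a \<in> acts I \<and>
   val l (Suc k) u = rew I a u - l (B - k) + (\<Sum>v\<in>states I. prob I a u v * val l k v)" for k u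
 proof -
  let ?M = "insert (val l k u) ((\<lambda>a. rew I a u - l (B - k) + (\<Sum>v\<in>states I. prob I a u v * val l k v)) ` acts I)"
  have "val l (Suc k) u \<in> ?M" unfolding val.simps using fin_acts by (intro Max_in) auto
  then consider "val l (Suc k) u = val l k u" | a where "a \<in> acts I"
   "val l (Suc k) u = rew I a u - l (B - k) + (\<Sum>v\<in>states I. prob I a u v * val l k v)" by blast
  then show ?thesis
  proof cases
   case 1 then show ?thesis by (intro exI[of _ None]) simp
  next
   case (2 a) then show ?thesis by (intro exI[of _ "Some a"]) (simp del: val.simps)
  qed
 qed
 define d where "d t u = (SOME x. case x of None \<Rightarrow> val l (Suc (B - t)) u = val l (B - t) u | Some a \<Rightarrow> a \<in> acts I \<and>
   val l (Suc (B - t)) u = rew I a u - l (B - (B - t)) + (\<Sum>v\<in>states I. prob I a u v * val l (B - t) v))" for t u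
 have d: "case d t u of None \<Rightarrow> val l (Suc (B - t)) u = val l (B - t) u | Some a \<Rightarrow> a \<in> acts I \<and>
   val l (Suc (B - t)) u = rew I a u - l (B - (B - t)) + (\<Sum>v\<in>states I. prob I a u v * val l (B - t) v)" for t u
  unfolding d_def by (rule someI_ex[OF ex])
 have "table d" unfolding table_def using d by (metis (no_types, lifting) option.simps(5))
 moreover have "val l (Suc k) u = (case d (B - k) u of None \<Rightarrow> val l k u
  | Some a \<Rightarrow> rew I a u - l (B - k) + (\<Sum>v\<in>states I. prob I a u v * val l k v))" if "k < B" for k u
  using d[of "B - k" u] that by (auto split: option.splits simp del: val.simps)
 ultimately show ?thesis unfolding best_response_def by blast
qed

lemma prob_sum_le:
 assumes "a \<in> acts I" "u \<in> states I" "dep u < B"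
  and "\<And>v. v \<in> states I \<Longrightarrow> dep v = dep u + 1 \<Longrightarrow> f v \<le> c"
 shows "(\<Sum>v\<in>states I. prob I a u v * f v) \<le> c"
proof -
 have "(\<Sum>v\<in>states I. prob I a u v * f v) \<le> (\<Sum>v\<in>states I. prob I a u v * c)"
 proof (rule sum_mono)
  fix v assume v: "v \<in> states I"
  show "prob I a u v * f v \<le> prob I a u v * c"
  proof (cases "prob I a u v > 0")
   case True
   then show ?thesis using assms v dep_succ by (intro mult_left_mono) auto
  next
   case False
   then have "prob I a u v = 0" using prob_nn[OF assms(1,2) v] by linarith
   then show ?thesis by simp
  qed
 qed
 also have "\<dots> = c" using prob_sum[OF assms(1-3)] by (simp flip: sum_distrib_right)
 finally show ?thesis .
qed

text \<open>An arm is pulled at most once in slot \<open>\<tau>\<close>. The bound 0 for slots that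
  are over is what the induction needs when the current slot is \<open>\<tau>\<close>
  itself.\<close>

lemma pay_slot_le_1:
 assumes "table d"
 shows "k \<le> B \<Longrightarrow> u \<in> states I \<Longrightarrow> dep u + k \<le> B \<Longrightarrow> pay d (\<lambda>t a u. if t = \<tau> then 1 else 0) k u \<le> (if \<tau> > B - k then 1 else 0)"
proof (induction k arbitrary: u)
 case (Suc k)
 show ?case
 proof (cases "d (B - k) u")
  case None
  then show ?thesis using Suc.IH[of u] Suc.prems by (auto split: if_splits)
 next
  case (Some a)
  then have a: "a \<in> acts I" using table_D[OF assms, of k u a] Suc.prems by simp
  have "(\<Sum>v\<in>states I. prob I a u v * pay d (\<lambda>t a u. if t = \<tau> then 1 else 0) k v) \<le> (if \<tau> > B - k then 1 else 0)"
   using Suc.IH Suc.prems a by (intro prob_sum_le) auto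
  then show ?thesis using Some Suc.prems by (auto split: if_splits)
 qed
qed simp

text \<open>Following an optimal policy for zero prices pays the price of each remaining slot at
  most once.\<close>

lemma val_ge_free:
 assumes "\<And>t. l t \<ge> 0"
 shows "k \<le> B \<Longrightarrow> u \<in> states I \<Longrightarrow> dep u + k \<le> B \<Longrightarrow> val (\<lambda>_. 0) k u - (\<Sum>j<k. l (B - j)) \<le> val l k u"
proof (induction k arbitrary: u)
 case (Suc k)
 let ?c = "\<Sum>j<k. l (B - j)"
 have "val (\<lambda>_. 0) (Suc k) u \<in> insert (val (\<lambda>_. 0) k u)
  ((\<lambda>a. rew I a u - 0 + (\<Sum>v\<in>states I. prob I a u v * val (\<lambda>_. 0) k v)) ` acts I)"
  unfolding val.simps using fin_acts by (intro Max_in) auto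
 then consider "val (\<lambda>_. 0) (Suc k) u = val (\<lambda>_. 0) k u"
  | a where "a \<in> acts I" "val (\<lambda>_. 0) (Suc k) u = rew I a u + (\<Sum>v\<in>states I. prob I a u v * val (\<lambda>_. 0) k v)"
  by auto
 then show ?case
 proof cases
  case 1
  have "val (\<lambda>_. 0) k u - ?c \<le> val l k u" using Suc by auto
  then show ?thesis using 1 val_ge_stay[of l k u] assms[of "B - k"] by (simp del: val.simps)
 next
  case (2 a)
  have "(\<Sum>v\<in>states I. prob I a u v * (val (\<lambda>_. 0) k v - val l k v)) \<le> ?c"
  proof (rule prob_sum_le)
   fix v assume "v \<in> states I" "dep v = dep u + 1"
   then show "val (\<lambda>_. 0) k v - val l k v \<le> ?c" using Suc.IH[of v] Suc.prems by auto
  qed (use 2 Suc.prems in auto)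
  then show ?thesis using 2 val_ge_act[OF 2(1), of u l k]
   by (simp del: val.simps add: right_diff_distrib sum_subtractf)
 qed
qed simp

text \<open>Transposes the transition matrix: inflow tested against \<open>f\<close> equals outflow
  tested against the expectation of \<open>f\<close> one step later.\<close>

lemma flow_swap:
 "(\<Sum>u\<in>states I. (\<Sum>(v, a)\<in>Par I u. x a v * prob I a v u) * f u)
 = (\<Sum>v\<in>states I. \<Sum>a\<in>acts I. x a v * (\<Sum>u\<in>states I. prob I a v u * (f u :: real)))"
proof -
 have par: "(\<Sum>(v, a)\<in>Par I u. x a v * prob I a v u)
   = (\<Sum>v\<in>states I. \<Sum>a\<in>acts I. x a v * prob I a v u)" if u: "u \<in> states I" for u
 proof -
  have "(\<Sum>(v, a)\<in>Par I u. x a v * prob I a v u)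
    = (\<Sum>(v, a)\<in>states I \<times> acts I. x a v * prob I a v u)"
  proof (rule sum.mono_neutral_left)
   show "finite (states I \<times> acts I)" using fin_states fin_acts by auto
   show "Par I u \<subseteq> states I \<times> acts I" by (auto simp: Par_def)
   show "\<forall>i\<in>states I \<times> acts I - Par I u. (case i of (v, a) \<Rightarrow> x a v * prob I a v u) = 0"
   proof
    fix z assume z: "z \<in> states I \<times> acts I - Par I u"
    obtain v a where va: "z = (v, a)" by (cases z)
    have "v \<in> states I" "a \<in> acts I" "\<not> prob I a v u > 0" using z by (auto simp: va Par_def)
    then have "prob I a v u = 0" using prob_nn[of a v u] u by linarith
    then show "(case z of (v, a) \<Rightarrow> x a v * prob I a v u) = 0" by (simp add: va)
   qed
  qed
  then show ?thesis by (simp add: sum.cartesian_product)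
 qed
 have "(\<Sum>u\<in>states I. (\<Sum>(v, a)\<in>Par I u. x a v * prob I a v u) * f u)
   = (\<Sum>u\<in>states I. \<Sum>v\<in>states I. \<Sum>a\<in>acts I. x a v * prob I a v u * f u)"
  by (intro sum.cong refl) (simp add: par sum_distrib_right)
 also have "\<dots> = (\<Sum>v\<in>states I. \<Sum>u\<in>states I. \<Sum>a\<in>acts I. x a v * prob I a v u * f u)"
  by (rule sum.swap)
 also have "\<dots> = (\<Sum>v\<in>states I. \<Sum>a\<in>acts I. \<Sum>u\<in>states I. x a v * prob I a v u * f u)"
  by (intro sum.cong refl sum.swap)
 also have "\<dots> = (\<Sum>v\<in>states I. \<Sum>a\<in>acts I. x a v * (\<Sum>u\<in>states I. prob I a v u * f u))"
  by (simp add: sum_distrib_left mult.assoc)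
 finally show ?thesis .
qed

text \<open>The value function is a potential: the rewards minus prices collected in the last
  \<open>k\<close> slots are at most the LP mass present before them, each unit weighted by
  \<open>val l k\<close>. The sum over \<open>k\<close> telescopes.\<close>

lemma weak_duality:
 assumes feas: "PolyLP_feasible I B x s" and l: "\<And>t. l t \<ge> 0"
 shows "PolyLP_objective I B x \<le> (\<Sum>t=1..B. l t) + (\<Sum>i<narms I. val l B (root I i))"
proof -
 let ?S = "states I" and ?A = "acts I"
 define gain where "gain t = (\<Sum>u\<in>?S. \<Sum>a\<in>?A. x a u t * (rew I a u - l t))" for t
 have telescope: "(\<Sum>j<k. gain (B - j)) \<le> (\<Sum>u\<in>?S. s u (B + 1 - k) * val l k u)" if "k \<le> B" for k
  using that
 proof (induction k)
  case (Suc k)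
  let ?t = "B - k"
  have t: "?t \<in> {1..B}" using Suc by auto
  have xnn: "x a u ?t \<ge> 0" if "u \<in> ?S" "a \<in> ?A" for a u
   using feas t that unfolding PolyLP_feasible_def by blast
  have xs: "(\<Sum>a\<in>?A. x a u ?t) \<le> s u ?t" if "u \<in> ?S" for u
   using feas t that unfolding PolyLP_feasible_def by blast
  have nxt: "(\<Sum>u\<in>?S. s u (B + 1 - k) * val l k u)
   = (\<Sum>u\<in>?S. (s u ?t - (\<Sum>a\<in>?A. x a u ?t)) * val l k u)
    + (\<Sum>u\<in>?S. \<Sum>a\<in>?A. x a u ?t * (\<Sum>v\<in>?S. prob I a u v * val l k v))"
  \<comment> \<open>For \<open>k = 0\<close> the value function vanishes, so the mass at time
    \<open>B + 1\<close>, about which the LP says nothing, does not matter.\<close>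
  proof (cases k)
   case (Suc k')
   have *: "s u (B + 1 - k) = s u ?t - (\<Sum>a\<in>?A. x a u ?t) + (\<Sum>(v, a)\<in>Par I u. x a v ?t * prob I a v u)"
    if "u \<in> ?S" for u
   proof -
    have t': "B + 1 - k \<in> {2..B}" "B + 1 - k - 1 = ?t" using Suc \<open>Suc k \<le> B\<close> by auto
    have "\<forall>t\<in>{2..B}. \<forall>u\<in>?S. s u t = s u (t - 1) - (\<Sum>a\<in>?A. x a u (t - 1))
      + (\<Sum>(v, a)\<in>Par I u. x a v (t - 1) * prob I a v u)"
     using feas unfolding PolyLP_feasible_def by blast
    from bspec[OF bspec[OF this t'(1)] that] show ?thesis unfolding t'(2) .
   qed
   have "(\<Sum>u\<in>?S. s u (B + 1 - k) * val l k u)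
    = (\<Sum>u\<in>?S. (s u ?t - (\<Sum>a\<in>?A. x a u ?t)) * val l k u + (\<Sum>(v, a)\<in>Par I u. x a v ?t * prob I a v u) * val l k u)"
    by (intro sum.cong refl) (simp only: * distrib_right)
   then show ?thesis by (simp add: sum.distrib flow_swap)
  qed simp
  have "(\<Sum>j<Suc k. gain (B - j)) \<le> (\<Sum>u\<in>?S. s u (B + 1 - k) * val l k u) + gain ?t"
   using Suc by simp
  also have "\<dots> = (\<Sum>u\<in>?S. (s u ?t - (\<Sum>a\<in>?A. x a u ?t)) * val l k u
    + (\<Sum>a\<in>?A. x a u ?t * (rew I a u - l ?t + (\<Sum>v\<in>?S. prob I a u v * val l k v))))"
   unfolding nxt gain_def by (simp add: sum.distrib distrib_left)
  also have "\<dots> \<le> (\<Sum>u\<in>?S. s u ?t * val l (Suc k) u)"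
  proof (rule sum_mono)
   fix u assume u: "u \<in> ?S"
   have "(s u ?t - (\<Sum>a\<in>?A. x a u ?t)) * val l k u \<le> (s u ?t - (\<Sum>a\<in>?A. x a u ?t)) * val l (Suc k) u"
    using xs[OF u] val_ge_stay by (intro mult_left_mono) auto
   moreover have "(\<Sum>a\<in>?A. x a u ?t * (rew I a u - l ?t + (\<Sum>v\<in>?S. prob I a u v * val l k v)))
    \<le> (\<Sum>a\<in>?A. x a u ?t * val l (Suc k) u)"
    using xnn[OF u] val_ge_act by (intro sum_mono mult_left_mono) auto
   moreover have "(\<Sum>a\<in>?A. x a u ?t * val l (Suc k) u) = (\<Sum>a\<in>?A. x a u ?t) * val l (Suc k) u"
    by (simp add: sum_distrib_right)
   ultimately show "(s u ?t - (\<Sum>a\<in>?A. x a u ?t)) * val l k u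
    + (\<Sum>a\<in>?A. x a u ?t * (rew I a u - l ?t + (\<Sum>v\<in>?S. prob I a u v * val l k v))) \<le> s u ?t * val l (Suc k) u"
    by (simp add: left_diff_distrib del: val.simps)
  qed
  finally show ?case by (simp del: val.simps)
 qed simp
 have rev: "(\<Sum>j<B. h (B - j)) = (\<Sum>t=1..B. h t)" for h :: "nat \<Rightarrow> real"
  by (rule sum.reindex_bij_witness[of _ "\<lambda>t. B - t" "\<lambda>j. B - j"]) auto
 have "(\<Sum>t=1..B. gain t) \<le> (\<Sum>u\<in>?S. s u 1 * val l B u)"
  using telescope[of B] rev[of gain] by simp
 also have "\<dots> = (\<Sum>u\<in>root I ` {..<narms I}. s u 1 * val l B u)"
 proof (rule sum.mono_neutral_right)
  show "\<forall>u\<in>?S - root I ` {..<narms I}. s u 1 * val l B u = 0"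
   using feas unfolding PolyLP_feasible_def by auto
 qed (use fin_states root_states in auto)
 also have "\<dots> = (\<Sum>i<narms I. val l B (root I i))"
  using feas inj_root unfolding PolyLP_feasible_def by (simp add: sum.reindex)
 finally have g: "(\<Sum>t=1..B. gain t) \<le> (\<Sum>i<narms I. val l B (root I i))" .
 have "PolyLP_objective I B x = (\<Sum>t=1..B. \<Sum>u\<in>?S. \<Sum>a\<in>?A. rew I a u * x a u t)"
  unfolding PolyLP_objective_def sum_distrib_left
  by (subst (2) sum.swap, subst sum.swap) simp
 also have "\<dots> = (\<Sum>t=1..B. gain t + l t * (\<Sum>u\<in>?S. \<Sum>a\<in>?A. x a u t))"
  unfolding gain_def sum_distrib_left
  by (simp add: right_diff_distrib mult_ac flip: sum.distrib)
 also have "\<dots> \<le> (\<Sum>t=1..B. gain t + l t * 1)"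
  using feas l unfolding PolyLP_feasible_def by (intro sum_mono add_left_mono mult_left_mono) auto
 finally show ?thesis using g by (simp add: sum.distrib)
qed

section \<open>The subgradient method on the slot prices\<close>

text \<open>By weak duality at zero prices this bounds the LP value, and it is at most
  \<open>narms I\<close> times any dual value. It sets the scale of the prices.\<close>

definition free_value :: real where
 "free_value = (\<Sum>i<narms I. val (\<lambda>_. 0) B (root I i))"

definition slot_load :: "(nat \<Rightarrow> 's \<Rightarrow> 'a option) \<Rightarrow> nat \<Rightarrow> real" where
 "slot_load d \<tau> = (\<Sum>i<narms I. pay d (\<lambda>t a u. if t = \<tau> then 1 else 0) B (root I i))"

definition table_reward :: "(nat \<Rightarrow> 's \<Rightarrow> 'a option) \<Rightarrow> real" where
 "table_reward d = (\<Sum>i<narms I. pay d (\<lambda>t a u. rew I a u) B (root I i))"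

text \<open>Projected subgradient steps for the Lagrangian dual; \<open>\<eta> * q r t\<close> is the price of slot \<open>t\<close> in round \<open>r\<close>.\<close>

definition dual_run :: "real \<Rightarrow> nat \<Rightarrow> (nat \<Rightarrow> nat \<Rightarrow> real) \<Rightarrow> (nat \<Rightarrow> nat \<Rightarrow> 's \<Rightarrow> 'a option) \<Rightarrow> bool" where
 "dual_run \<eta> T q d \<longleftrightarrow> (\<forall>t\<in>{1..B}. q 0 t = 0) \<and>
  (\<forall>r<T. best_response (\<lambda>t. \<eta> * q r t) (d r) \<and>
    (\<forall>t\<in>{1..B}. q (Suc r) t = max 0 (q r t + slot_load (d r) t - 1)))"

lemma slot_load_nonneg: "table d \<Longrightarrow> slot_load d \<tau> \<ge> 0"
 unfolding slot_load_def using root_states by (intro sum_nonneg pay_nonneg) auto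

lemma slot_load_le: "table d \<Longrightarrow> slot_load d \<tau> \<le> narms I"
proof -
 assume d: "table d"
 have "slot_load d \<tau> \<le> (\<Sum>i<narms I. 1)"
  unfolding slot_load_def
 proof (rule sum_mono)
  fix i assume "i \<in> {..<narms I}"
  then show "pay d (\<lambda>t a u. if t = \<tau> then 1 else 0) B (root I i) \<le> (1::real)"
   using pay_slot_le_1[OF d, of B "root I i" \<tau>] root_states dep_root by (auto split: if_splits)
 qed
 then show ?thesis by simp
qed

lemma lagrangian_split:
 "(\<Sum>i<narms I. pay d (\<lambda>t a u. rew I a u - l t) B (root I i))
 = table_reward d - (\<Sum>t=1..B. l t * slot_load d t)"
proof -
 have 1: "pay d (\<lambda>t a u. rew I a u - l t) B w = pay d (\<lambda>t a u. rew I a u) B w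
  - (\<Sum>\<tau>=1..B. l \<tau> * pay d (\<lambda>t a u. if t = \<tau> then 1 else 0) B w)" for w
 proof -
  have "pay d (\<lambda>t a u. l t) B w = pay d (\<lambda>t a u. \<Sum>\<tau>=1..B. l \<tau> * (if t = \<tau> then 1 else 0)) B w"
   by (rule pay_cong) (auto simp: if_distrib cong: if_cong)
  then show ?thesis by (simp add: pay_diff pay_sum pay_scale)
 qed
 have "(\<Sum>i<narms I. \<Sum>\<tau>=1..B. l \<tau> * pay d (\<lambda>t a u. if t = \<tau> then 1 else 0) B (root I i))
  = (\<Sum>t=1..B. l t * slot_load d t)"
  unfolding slot_load_def sum_distrib_left by (rule sum.swap)
 then show ?thesis unfolding table_reward_def 1 by (simp add: sum_subtractf)
qed

text \<open>The usual regret argument, with the squared norm of the queue \<open>q\<close> as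
  potential: a round raises it by at most twice the inner product of queue and overload plus
  \<open>B * (narms I)^2\<close>, as each load differs from 1 by at most \<open>narms I\<close>. The
  norm stays nonnegative, which bounds the inner products from below.\<close>

lemma dual_run_reward:
 fixes \<eta> D :: real
 assumes run: "dual_run \<eta> T q d" and \<eta>: "\<eta> \<ge> 0" and n: "narms I \<ge> 1"
  and D: "\<And>l. (\<And>t. l t \<ge> 0) \<Longrightarrow> D \<le> (\<Sum>t=1..B. l t) + (\<Sum>i<narms I. val l B (root I i))"
 shows "(\<Sum>r<T. table_reward (d r)) \<ge> T * D - \<eta> * (T * B * (narms I)\<^sup>2) / 2"
proof -
 let ?n = "real (narms I)"
 let ?L = "\<lambda>r t. slot_load (d r) t"
 have tab: "table (d r)" if "r < T" for r using run that by (auto simp: dual_run_def best_response_def)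
 have qnn: "r \<le> T \<Longrightarrow> t \<in> {1..B} \<Longrightarrow> q r t \<ge> 0" for r t
  using run unfolding dual_run_def by (cases r) auto
 have rew: "table_reward (d r) \<ge> D + \<eta> * (\<Sum>t=1..B. q r t * (?L r t - 1))" if r: "r < T" for r
 proof -
  \<comment> \<open>Outside the slots \<open>q\<close> is unconstrained and may be negative, while
    \<open>D\<close> is a bound only for prices that are nonnegative everywhere.\<close>
  define l where "l t = (if t \<in> {1..B} then \<eta> * q r t else 0)" for t
  have lnn: "l t \<ge> 0" for t using qnn[of r t] r \<eta> by (auto simp: l_def)
  have same: "val (\<lambda>t. \<eta> * q r t) k u = val l k u" if "k \<le> B" for k u
   using that by (induction k arbitrary: u) (auto simp: l_def)
  have "table_reward (d r) - (\<Sum>t=1..B. \<eta> * q r t * ?L r t) = (\<Sum>i<narms I. val l B (root I i))"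
   using lagrangian_split[of "d r" "\<lambda>t. \<eta> * q r t"] best_response_pay[of "\<lambda>t. \<eta> * q r t" "d r" B]
    run r root_states same by (simp add: dual_run_def)
  moreover have "D \<le> (\<Sum>t=1..B. l t) + (\<Sum>i<narms I. val l B (root I i))" using D lnn by blast
  moreover have "(\<Sum>t=1..B. l t) = (\<Sum>t=1..B. \<eta> * q r t)" by (simp add: l_def)
  ultimately show ?thesis
   by (simp add: right_diff_distrib sum_subtractf sum_distrib_left mult_ac)
 qed
 have drift: "(\<Sum>t=1..B. (q R t)\<^sup>2) \<le> 2 * (\<Sum>r<R. \<Sum>t=1..B. q r t * (?L r t - 1)) + R * B * ?n\<^sup>2" if "R \<le> T" for R
  using that
 proof (induction R)
  case 0
  then show ?case using run by (simp add: dual_run_def)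
 next
  case (Suc R)
  have "(q (Suc R) t)\<^sup>2 \<le> (q R t)\<^sup>2 + 2 * (q R t * (?L R t - 1)) + ?n\<^sup>2" if t: "t \<in> {1..B}" for t
  proof -
   have L: "?L R t \<ge> 0" "?L R t \<le> ?n" using slot_load_nonneg slot_load_le tab Suc by auto
   have "(q (Suc R) t)\<^sup>2 \<le> (q R t + (?L R t - 1))\<^sup>2"
    using run Suc.prems t by (auto simp: dual_run_def max_def)
   also have "\<dots> = (q R t)\<^sup>2 + 2 * (q R t * (?L R t - 1)) + (?L R t - 1)\<^sup>2"
    by (simp add: power2_sum mult_ac)
   also have "(?L R t - 1)\<^sup>2 \<le> ?n\<^sup>2"
   proof -
    have "\<bar>?L R t - 1\<bar> \<le> ?n" using L n by linarith
    then show ?thesis using abs_le_square_iff[of "?L R t - 1" ?n] by simp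
   qed
   finally show ?thesis by simp
  qed
  then have "(\<Sum>t=1..B. (q (Suc R) t)\<^sup>2) \<le> (\<Sum>t=1..B. (q R t)\<^sup>2 + 2 * (q R t * (?L R t - 1)) + ?n\<^sup>2)"
   by (rule sum_mono)
  also have "\<dots> = (\<Sum>t=1..B. (q R t)\<^sup>2) + 2 * (\<Sum>t=1..B. q R t * (?L R t - 1)) + B * ?n\<^sup>2"
   by (simp add: sum.distrib sum_distrib_left)
  finally show ?case using Suc by (simp add: algebra_simps)
 qed
 have "0 \<le> (\<Sum>t=1..B. (q T t)\<^sup>2)" by (simp add: sum_nonneg)
 then have low: "(\<Sum>r<T. \<Sum>t=1..B. q r t * (?L r t - 1)) \<ge> - (T * B * ?n\<^sup>2) / 2"
  using drift[of T] by simp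
 have "(\<Sum>r<T. table_reward (d r)) \<ge> (\<Sum>r<T. D + \<eta> * (\<Sum>t=1..B. q r t * (?L r t - 1)))"
  using rew by (intro sum_mono) auto
 also have "(\<Sum>r<T. D + \<eta> * (\<Sum>t=1..B. q r t * (?L r t - 1)))
   = T * D + \<eta> * (\<Sum>r<T. \<Sum>t=1..B. q r t * (?L r t - 1))"
  by (simp add: sum.distrib sum_distrib_left)
 finally have "(\<Sum>r<T. table_reward (d r)) \<ge> T * D + \<eta> * (\<Sum>r<T. \<Sum>t=1..B. q r t * (?L r t - 1))" .
 moreover have "\<eta> * (\<Sum>r<T. \<Sum>t=1..B. q r t * (?L r t - 1)) \<ge> \<eta> * (- (T * B * ?n\<^sup>2) / 2)"
  using low \<eta> by (rule mult_left_mono)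
 ultimately show ?thesis by simp
qed

text \<open>A slot whose price exceeds the total value of all arms gets load at most 1, which bounds all prices.\<close>

lemma dual_run_load:
 fixes \<eta> \<kappa> :: real
 assumes run: "dual_run \<eta> T q d" and \<kappa>: "\<eta> * \<kappa> = free_value" "\<kappa> \<ge> 0" and pos: "free_value > 0"
  and t: "t \<in> {1..B}"
 shows "(\<Sum>r<T. slot_load (d r) t) \<le> T + \<kappa> + narms I"
proof -
 let ?L = "\<lambda>r t. slot_load (d r) t"
 have \<eta>: "\<eta> > 0" using \<kappa> pos by (metis mult_nonneg_nonpos2 not_less linorder_le_less_linear mult.commute)
 have tab: "table (d r)" if "r < T" for r using run that by (auto simp: dual_run_def best_response_def)
 have qnn: "r \<le> T \<Longrightarrow> t \<in> {1..B} \<Longrightarrow> q r t \<ge> 0" for r t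
  using run unfolding dual_run_def by (cases r) auto
 have sat: "?L r t \<le> 1" if r: "r < T" and "q r t \<ge> \<kappa>" for r
 proof -
  have "0 \<le> (\<Sum>i<narms I. val (\<lambda>t. \<eta> * q r t) B (root I i))" by (intro sum_nonneg val_nonneg)
  also have "\<dots> = table_reward (d r) - (\<Sum>t=1..B. \<eta> * q r t * ?L r t)"
   using lagrangian_split[of "d r" "\<lambda>t. \<eta> * q r t"] best_response_pay[of "\<lambda>t. \<eta> * q r t" "d r" B]
    run r root_states by (simp add: dual_run_def)
  finally have "(\<Sum>t=1..B. \<eta> * q r t * ?L r t) \<le> table_reward (d r)" by simp
  also have "table_reward (d r) \<le> free_value"
   unfolding table_reward_def free_value_def
   using pay_le_val[OF tab[OF r], of B _ "\<lambda>_. 0"] root_states by (intro sum_mono) auto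
  finally have le: "(\<Sum>t=1..B. \<eta> * q r t * ?L r t) \<le> free_value" .
  have "\<eta> * q r t * ?L r t \<le> (\<Sum>t=1..B. \<eta> * q r t * ?L r t)"
   using t qnn r \<eta> slot_load_nonneg[OF tab[OF r]] by (intro member_le_sum) auto
  moreover have "free_value * ?L r t \<le> \<eta> * q r t * ?L r t"
   unfolding \<kappa>(1)[symmetric] using that \<eta> slot_load_nonneg[OF tab[OF r]] by (intro mult_right_mono mult_left_mono) auto
  ultimately have "free_value * ?L r t \<le> free_value * 1" using le by linarith
  then show ?thesis using pos by (subst (asm) mult_le_cancel_left_pos) auto
 qed
 \<comment> \<open>A queue grows only while it is below \<open>\<kappa>\<close>, and then by less
   than \<open>narms I\<close> in a round or not at all.\<close>
 have qb: "R \<le> T \<Longrightarrow> q R t \<le> \<kappa> + narms I" for R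
 proof (induction R)
  case 0 then show ?case using run t \<kappa> by (simp add: dual_run_def)
 next
  case (Suc R)
  have "q (Suc R) t = max 0 (q R t + ?L R t - 1)" using run t Suc.prems by (auto simp: dual_run_def)
  moreover have "q R t + ?L R t - 1 \<le> \<kappa> + narms I"
  proof (cases "q R t \<ge> \<kappa>")
   case True then show ?thesis using sat[of R] Suc by auto
  next
   case False then show ?thesis using slot_load_le[OF tab[of R], of t] Suc by auto
  qed
  ultimately show ?case using \<kappa> by auto
 qed
 have "R \<le> T \<Longrightarrow> (\<Sum>r<R. ?L r t) \<le> R + q R t" for R
 proof (induction R)
  case 0 then show ?case using qnn[of 0 t] t by simp
 next
  case (Suc R)
  have "q (Suc R) t \<ge> q R t + ?L R t - 1" using run t Suc.prems by (auto simp: dual_run_def)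
  then show ?case using Suc by simp
 qed
 from this[of T] qb[of T] show ?thesis by simp
qed

text \<open>With step size \<open>free_value / step_scale\<close> and \<open>n\<close> arms, the
  regret per round is \<open>free_value / (4 * n * (B + 1))\<close>, at most the fraction
  \<open>1 / (4 * (B + 1))\<close> of any number that is at least
  \<open>free_value / n\<close>.\<close>

definition step_scale :: nat where
 "step_scale = 2 * narms I ^ 3 * B * (B + 1)"

text \<open>The total overload of a slot is at most \<open>step_scale + narms I\<close> over all
  rounds; this many rounds spread it to \<open>1 / (2 * (B + 1))\<close> per round.\<close>

definition num_rounds :: nat where
 "num_rounds = 2 * (B + 1) * (step_scale + narms I)"

theorem dual_run_near_optimal:
 assumes run: "dual_run (free_value / step_scale) num_rounds q d"
  and pos: "free_value > 0" and n: "narms I \<ge> 1" and B: "B \<ge> 1"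
  and feas: "PolyLP_feasible I B x s"
 shows "(\<Sum>r<num_rounds. table_reward (d r)) \<ge> num_rounds * ((1 - 1 / (3 * (B + 1))) * PolyLP_objective I B x)"
  and "t \<in> {1..B} \<Longrightarrow> (\<Sum>r<num_rounds. slot_load (d r) t) \<le> num_rounds * (1 + 1 / (2 * (B + 1)))"
proof -
 let ?n = "real (narms I)" and ?T = "real num_rounds" and ?k = "real step_scale"
 have kpos: "?k > 0" using n B unfolding of_nat_0_less_iff by (simp add: step_scale_def)
 have Tpos: "?T > 0" using n unfolding of_nat_0_less_iff by (simp add: num_rounds_def)
 \<comment> \<open>\<open>x\<close> may be any feasible point, even of value 0, so the additive
   regret is measured against \<open>free_value / ?n\<close> too, which is also a lower bound for
   every dual value.\<close>
 define D where "D = max (PolyLP_objective I B x) (free_value / ?n)"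
 have Dpos: "D > 0" unfolding D_def using pos n by (simp add: less_max_iff_disj)
 have dual: "D \<le> (\<Sum>t=1..B. l t) + (\<Sum>i<narms I. val l B (root I i))" if l: "\<And>t. l t \<ge> 0" for l
 proof -
  have rev: "(\<Sum>j<B. l (B - j)) = (\<Sum>t=1..B. l t)"
   by (rule sum.reindex_bij_witness[of _ "\<lambda>t. B - t" "\<lambda>j. B - j"]) auto
  let ?v = "\<lambda>l i. val l B (root I i)"
  have each: "?v (\<lambda>_. 0) i \<le> (\<Sum>t=1..B. l t) + (\<Sum>i<narms I. ?v l i)" if i: "i < narms I" for i
  proof -
   have "?v (\<lambda>_. 0) i - (\<Sum>j<B. l (B - j)) \<le> ?v l i"
    using l i root_states dep_root by (intro val_ge_free) auto
   moreover have "?v l i \<le> (\<Sum>i<narms I. ?v l i)"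
    using i val_nonneg by (intro member_le_sum) auto
   ultimately show ?thesis unfolding rev by linarith
  qed
  have "free_value \<le> (\<Sum>i<narms I. (\<Sum>t=1..B. l t) + (\<Sum>i<narms I. ?v l i))"
   unfolding free_value_def using each by (intro sum_mono) auto
  also have "\<dots> = ?n * ((\<Sum>t=1..B. l t) + (\<Sum>i<narms I. ?v l i))" by simp
  finally have "free_value / ?n \<le> (\<Sum>t=1..B. l t) + (\<Sum>i<narms I. ?v l i)"
   using n by (simp add: divide_le_eq mult.commute)
  then show ?thesis unfolding D_def using weak_duality[OF feas, of l] l by simp
 qed
 have "(\<Sum>r<num_rounds. table_reward (d r))
   \<ge> ?T * D - free_value / ?k * (?T * B * ?n\<^sup>2) / 2"
  using dual_run_reward[OF run _ n dual] pos kpos by simp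
 moreover have "free_value / ?k * (?T * B * ?n\<^sup>2) / 2 \<le> ?T * (D / (3 * (B + 1)))"
 proof -
  have "?n * (free_value / ?n) \<le> ?n * D" unfolding D_def by (intro mult_left_mono) auto
  then have "free_value \<le> ?n * D" using n by simp
  then have "free_value / ?k * (?T * B * ?n\<^sup>2) / 2 \<le> (?n * D) / ?k * (?T * B * ?n\<^sup>2) / 2"
   using kpos by (intro divide_right_mono mult_right_mono) auto
  also have "\<dots> = ?T * (D / (4 * (B + 1)))"
  proof -
   have "(m * D) / (2 * m ^ 3 * b * c) * (?T * b * m\<^sup>2) / 2 = ?T * (D / (4 * c))"
    if "m > 0" "b > 0" "c > 0" for m b c :: real
    using that by (simp add: field_simps power2_eq_square power3_eq_cube)
   from this[of ?n "real B" "real (B + 1)"] show ?thesis using n B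
    by (simp only: step_scale_def of_nat_mult of_nat_power of_nat_numeral of_nat_0_less_iff)
  qed
  also have "\<dots> \<le> ?T * (D / (3 * (B + 1)))"
   using Dpos Tpos by (intro mult_left_mono divide_left_mono) auto
  finally show ?thesis .
 qed
 ultimately have "(\<Sum>r<num_rounds. table_reward (d r)) \<ge> ?T * ((1 - 1 / (3 * (B + 1))) * D)"
  by (simp add: algebra_simps)
 moreover have "?T * ((1 - 1 / (3 * (B + 1))) * D) \<ge> ?T * ((1 - 1 / (3 * (B + 1))) * PolyLP_objective I B x)"
  unfolding D_def using Tpos by (intro mult_left_mono) (auto simp: field_simps)
 ultimately show "(\<Sum>r<num_rounds. table_reward (d r)) \<ge> ?T * ((1 - 1 / (3 * (B + 1))) * PolyLP_objective I B x)"
  by linarith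
 show "(\<Sum>r<num_rounds. slot_load (d r) t) \<le> ?T * (1 + 1 / (2 * (B + 1)))" if t: "t \<in> {1..B}"
 proof -
  have "(\<Sum>r<num_rounds. slot_load (d r) t) \<le> ?T + ?k + ?n"
   using dual_run_load[OF run _ _ pos t, of ?k] kpos by auto
  also have "?k + ?n = ?T / (2 * (B + 1))"
   unfolding num_rounds_def by (simp add: field_simps)
  then have "?T + ?k + ?n = ?T * (1 + 1 / (2 * (B + 1)))" by (simp add: algebra_simps)
  finally show ?thesis .
 qed
qed

lemma dual_run_exists: "\<exists>q d. dual_run \<eta> T q d"
proof -
 define dsel where "dsel l = (SOME d. best_response l d)" for l
 have dsel: "best_response l (dsel l)" for l
  unfolding dsel_def by (rule someI_ex[OF best_response_exists])
 define q where "q = rec_nat (\<lambda>t::nat. 0) (\<lambda>_ p t. max 0 (p t + slot_load (dsel (\<lambda>t. \<eta> * p t)) t - 1))"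
 have "dual_run \<eta> T q (\<lambda>r. dsel (\<lambda>t. \<eta> * q r t))"
  unfolding dual_run_def using dsel by (simp add: q_def)
 then show ?thesis by blast
qed

end

section \<open>Product laws\<close>

lemma finite_set_Pi_pmf:
 assumes "finite A" "\<And>x. x \<in> A \<Longrightarrow> finite (set_pmf (p x))"
 shows "finite (set_pmf (Pi_pmf A d p))"
 using assms by (subst set_Pi_pmf) (auto intro!: finite_PiE_dflt)

lemma expectation_Pi_pmf_split:
 fixes h :: "('i \<Rightarrow> 'x) \<Rightarrow> real"
 assumes A: "finite A" "i \<in> A" and fin: "\<And>x. x \<in> A \<Longrightarrow> finite (set_pmf (p x))"
 shows "expect (Pi_pmf A d p) h
  = expect (p i) (\<lambda>y. expect (Pi_pmf (A - {i}) d p) (\<lambda>f. h (f(i := y))))"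
proof -
 have "Pi_pmf A d p = Pi_pmf (insert i (A - {i})) d p" using A by (simp add: insert_absorb)
 also have "\<dots> = bind_pmf (p i) (\<lambda>y. map_pmf (\<lambda>f. f(i := y)) (Pi_pmf (A - {i}) d p))"
  using A by (subst Pi_pmf_insert') (auto simp: map_pmf_def)
 finally show ?thesis
  using A fin finite_set_Pi_pmf[of "A - {i}" p d] by (simp add: expectation_bind_finite)
qed

lemma set_Pi_pmf_D:
 assumes "finite A" "f \<in> set_pmf (Pi_pmf A d p)" "x \<in> A"
 shows "f x \<in> set_pmf (p x)"
 using assms set_Pi_pmf[of A d p] by (auto simp: PiE_dflt_def)

section \<open>The scheduler\<close>

text \<open>\<open>B + 1\<close> marks an arm without further plays and 0 an urgent one;
  \<open>t\<close> is the virtual time of the next play and \<open>c\<close> the number of plays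
  made by the arm.\<close>

definition prio :: "nat \<Rightarrow> nat \<Rightarrow> nat \<Rightarrow> nat" where
 "prio B t c = (if t > B then B + 1 else if t \<le> 2 * c then 0 else t)"

definition pick :: "nat \<Rightarrow> nat \<Rightarrow> (nat \<Rightarrow> nat) \<Rightarrow> nat option" where
 "pick n B ks = (if \<forall>i<n. ks i > B then None else Some (LEAST i. i < n \<and> (\<forall>j<n. ks i \<le> ks j)))"

lemma pick_Some:
 assumes "pick n B ks = Some i"
 shows "i < n" "ks i \<le> B" "\<And>j. j < n \<Longrightarrow> ks i \<le> ks j"
proof -
 have ne: "\<exists>i<n. ks i \<le> B" and i: "i = (LEAST i. i < n \<and> (\<forall>j<n. ks i \<le> ks j))"
  using assms by (auto simp: pick_def not_less split: if_splits)
 then obtain i0 where i0: "i0 < n" "ks i0 \<le> B" by blast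
 have "\<exists>i. i < n \<and> (\<forall>j<n. ks i \<le> ks j)"
  using i0 ex_has_least_nat[of "\<lambda>i. i < n" i0 ks] by auto
 from LeastI_ex[OF this] have *: "i < n \<and> (\<forall>j<n. ks i \<le> ks j)" unfolding i .
 then show "i < n" "\<And>j. j < n \<Longrightarrow> ks i \<le> ks j" by auto
 then show "ks i \<le> B" using i0 order_trans by blast
qed

lemma pick_None: "pick n B ks = None \<longleftrightarrow> (\<forall>i<n. ks i > B)"
 by (simp add: pick_def)

lemma pick_cong: "(\<And>i. i < n \<Longrightarrow> ks i = ks' i) \<Longrightarrow> pick n B ks = pick n B ks'"
 by (simp add: pick_def cong: conj_cong)

definition next_time :: "nat \<Rightarrow> (nat \<times> real) list \<Rightarrow> nat" where
 "next_time B l = (case l of [] \<Rightarrow> B + 1 | p # _ \<Rightarrow> fst p)"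

text \<open>\<open>m\<close> is fuel and \<open>c\<close> the real time, since each iteration makes
  a play. The run continues after the horizon without reward, so it may be given fuel for all plays
  of all lists.\<close>

primrec sched :: "nat \<Rightarrow> nat \<Rightarrow> nat \<Rightarrow> nat \<Rightarrow> (nat \<Rightarrow> nat \<times> (nat \<times> real) list) \<Rightarrow> real" where
 "sched n B 0 c S = 0"
| "sched n B (Suc m) c S = (case pick n B (\<lambda>i. prio B (next_time B (snd (S i))) (fst (S i))) of
  None \<Rightarrow> 0
 | Some i \<Rightarrow> (if c < B then snd (hd (snd (S i))) else 0)
   + sched n B m (c + 1) (S(i := (Suc (fst (S i)), tl (snd (S i))))))"

text \<open>Time of the head of the component that play number \<open>k\<close> belongs to.\<close>

primrec head_time :: "(nat \<times> real) list \<Rightarrow> nat \<Rightarrow> nat" where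
 "head_time l 0 = fst (l ! 0)"
| "head_time l (Suc k) = (if fst (l ! Suc k) \<le> 2 * Suc k then head_time l k else fst (l ! Suc k))"

definition plays_until :: "nat \<Rightarrow> (nat \<times> real) list \<Rightarrow> nat" where
 "plays_until t l = length (filter (\<lambda>p. fst p \<le> t) l)"

definition play_list :: "nat \<Rightarrow> (nat \<times> real) list \<Rightarrow> bool" where
 "play_list B l \<longleftrightarrow> sorted_wrt (<) (map fst l) \<and> (\<forall>p\<in>set l. 1 \<le> fst p \<and> fst p \<le> B \<and> 0 \<le> snd p)"

lemma plays_until_nth:
 assumes "sorted_wrt (<) (map fst l)" "plays_until t l < length l"
 shows "fst (l ! plays_until t l) > t"
 using assms
proof (induction l)
 case (Cons p l)
 show ?case
 proof (cases "fst p \<le> t")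
  case True
  then show ?thesis using Cons by (auto simp: plays_until_def)
 next
  case False
  then have "filter (\<lambda>p. fst p \<le> t) l = []" using Cons.prems by (auto simp: filter_empty_conv)
  then show ?thesis using False by (simp add: plays_until_def)
 qed
qed simp

lemma play_list_nth:
 assumes "play_list B l" "k < length l"
 shows "1 \<le> fst (l ! k)" "fst (l ! k) \<le> B" "0 \<le> snd (l ! k)"
 using assms by (auto simp: play_list_def)

lemma play_list_less:
 assumes "play_list B l" "k < k'" "k' < length l"
 shows "fst (l ! k) < fst (l ! k')"
 using assms by (auto simp: play_list_def sorted_wrt_iff_nth_less)

lemma head_time_mem:
 assumes "play_list B l" "k < length l"
 shows "1 \<le> head_time l k \<and> head_time l k \<le> B"
 using assms(2) play_list_nth[OF assms(1)] by (induction k) auto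

definition on_time :: "nat \<Rightarrow> (nat \<Rightarrow> (nat \<times> real) list) \<Rightarrow> nat \<Rightarrow> nat \<Rightarrow> bool" where
 "on_time n L i t \<longleftrightarrow> 2 * (\<Sum>j\<in>{..<n} - {i}. plays_until t (L j)) < t + 1"

text \<open>A component with head at time \<open>t\<close> starts on time if fewer than \<open>(t + 1) / 2\<close> plays of other arms
 are due by \<open>t\<close>: then no other arm is in the middle of a component reaching beyond \<open>t\<close>, because
 such an arm alone would account for that many plays. A component that starts on time stays on time.\<close>

lemma sched_lower:
 assumes L: "\<And>i. i < n \<Longrightarrow> play_list B (L i)"
  and c: "\<And>i. i < n \<Longrightarrow> c i \<le> length (L i)"
  and m: "(\<Sum>i<n. length (L i) - c i) \<le> m"
  and heads: "\<And>j j' k. j < n \<Longrightarrow> j' < n \<Longrightarrow> k < c j \<Longrightarrow> 2 * k < fst (L j ! k) \<Longrightarrow> c j' < length (L j')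
   \<Longrightarrow> fst (L j ! k) \<le> fst (L j' ! c j')"
  and one: "\<And>i j. i < n \<Longrightarrow> j < n \<Longrightarrow> c i < length (L i) \<Longrightarrow> c j < length (L j) \<Longrightarrow>
   fst (L i ! c i) \<le> 2 * c i \<Longrightarrow> fst (L j ! c j) \<le> 2 * c j \<Longrightarrow> i = j"
  and prompt: "\<And>i. i < n \<Longrightarrow> c i < length (L i) \<Longrightarrow> fst (L i ! c i) \<le> 2 * c i \<Longrightarrow>
   on_time n L i (head_time (L i) (c i)) \<Longrightarrow> (\<Sum>i<n. c i) < fst (L i ! c i)"
 shows "(\<Sum>i<n. \<Sum>k=c i..<length (L i). if on_time n L i (head_time (L i) k) then snd (L i ! k) else 0)
  \<le> sched n B m (\<Sum>i<n. c i) (\<lambda>i. (c i, drop (c i) (L i)))"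
 \<comment> \<open>The last three are invariants of the run: no component head that was played has a
   later virtual time than a pending play; at most one arm is urgent; and an urgent play of a
   component that began on time is reached before its virtual time.\<close>
 using c m heads one prompt
proof (induction m arbitrary: c)
 case 0
 then have "c i = length (L i)" if "i < n" for i using that by (auto simp: antisym)
 then show ?case by simp
next
 case (Suc m)
 let ?ks = "\<lambda>i. prio B (next_time B (drop (c i) (L i))) (c i)"
 have nt: "next_time B (drop (c i) (L i)) = (if c i < length (L i) then fst (L i ! c i) else B + 1)" if "i < n" for i
  using that Suc.prems(1)[of i] by (auto simp: next_time_def Cons_nth_drop_Suc[symmetric])
 have ks_pend: "?ks i = (if fst (L i ! c i) \<le> 2 * c i then 0 else fst (L i ! c i))"
  if "i < n" "c i < length (L i)" for i
  using that nt[of i] play_list_nth[OF L[OF that(1)] that(2)] by (simp add: prio_def)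
 have ks_done: "?ks i = B + 1" if "i < n" "\<not> c i < length (L i)" for i
  using that nt[of i] by (simp add: prio_def)
 show ?case
 proof (cases "pick n B ?ks")
  case None
  have "\<not> c i < length (L i)" if i: "i < n" for i
  proof
   assume p: "c i < length (L i)"
   have "?ks i \<le> B" using ks_pend[OF i p] play_list_nth[OF L[OF i] p] by simp
   moreover have "?ks i > B" using None i unfolding pick_None by blast
   ultimately show False by simp
  qed
  then have "(\<Sum>i<n. \<Sum>k=c i..<length (L i). if on_time n L i (head_time (L i) k) then snd (L i ! k) else 0)
    = (\<Sum>i<n. 0)"
   by (intro sum.cong refl) (simp add: not_less)
  then show ?thesis using None by (simp only: sched.simps fst_conv snd_conv option.case sum.neutral_const)
 next
  case (Some i)
  note p = pick_Some[OF Some]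
  have i: "i < n" by (rule p)
  have pend: "c i < length (L i)"
  proof (rule ccontr)
   assume "\<not> c i < length (L i)"
   then have "?ks i = B + 1" by (rule ks_done[OF i])
   then show False using p(2) by simp
  qed
  let ?\<tau> = "fst (L i ! c i)"
  let ?g = "on_time n L i (head_time (L i) (c i))"
  have timely: "(\<Sum>i<n. c i) < ?\<tau>" if good: ?g
  proof (cases "?\<tau> \<le> 2 * c i")
   case True
   then show ?thesis using Suc.prems(5)[OF i pend] good by blast
  next
   case False
   then have ht: "head_time (L i) (c i) = ?\<tau>" by (cases "c i") auto
   have kt: "?ks i = ?\<tau>" using False ks_pend[OF i pend] by simp
   \<comment> \<open>Otherwise arm \<open>j\<close> has already made its first play with virtual
     time beyond \<open>?\<tau>\<close>. As the other plays due are few, the number of that play is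
     too small for it to have been urgent, so it was a head, and \<open>heads\<close> forbids
     this.\<close>
   have others: "c j \<le> plays_until ?\<tau> (L j)" if j: "j \<in> {..<n} - {i}" for j
   proof (rule ccontr)
    let ?k = "plays_until ?\<tau> (L j)"
    assume "\<not> c j \<le> ?k"
    then have k: "?k < c j" by simp
    have jn: "j < n" using j by simp
    then have "?k < length (L j)" using k Suc.prems(1)[of j] by simp
    then have late: "fst (L j ! ?k) > ?\<tau>"
     using L[OF jn] by (intro plays_until_nth) (auto simp: play_list_def)
    have "?k \<le> (\<Sum>j\<in>{..<n} - {i}. plays_until ?\<tau> (L j))"
     using j by (intro member_le_sum) auto
    then have "2 * ?k < ?\<tau> + 1" using good unfolding ht on_time_def by linarith
    then have "fst (L j ! ?k) \<le> ?\<tau>"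
     using Suc.prems(3)[OF jn i k _ pend] late by simp
    then show False using late by simp
   qed
   have "(\<Sum>i<n. c i) = c i + (\<Sum>j\<in>{..<n} - {i}. c j)"
    using i by (subst sum.remove[of _ i]) auto
   also have "(\<Sum>j\<in>{..<n} - {i}. c j) \<le> (\<Sum>j\<in>{..<n} - {i}. plays_until ?\<tau> (L j))"
    using others by (intro sum_mono)
   finally have "(\<Sum>i<n. c i) \<le> c i + (\<Sum>j\<in>{..<n} - {i}. plays_until ?\<tau> (L j))" by simp
   moreover have "2 * (\<Sum>j\<in>{..<n} - {i}. plays_until ?\<tau> (L j)) < ?\<tau> + 1"
    using good unfolding ht on_time_def .
   \<comment> \<open>The play is not urgent, so \<open>2 * c i < ?\<tau>\<close>, and twice the
     number of other plays is at most \<open>?\<tau>\<close>; by integrality fewer than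
     \<open>?\<tau>\<close> plays were made in all. This is the reason for the threshold
     \<open>(t + 1) / 2\<close>.\<close>
   ultimately show ?thesis using False by linarith
  qed
  define c' where "c' = c(i := Suc (c i))"
  have c'i: "c' i = Suc (c i)" and c'j: "j \<noteq> i \<Longrightarrow> c' j = c j" for j by (auto simp: c'_def)
  have sum_c': "(\<Sum>i<n. c' i) = (\<Sum>i<n. c i) + 1"
   using i unfolding c'_def by (subst (1 2) sum.remove[of _ i]) auto
  have nxt: "?\<tau> < fst (L i ! c' i)" if "c' i < length (L i)"
   using that c'i play_list_less[OF L[OF i], of "c i" "c' i"] by simp
  let ?R = "\<lambda>c. \<Sum>i<n. \<Sum>k=c i..<length (L i). if on_time n L i (head_time (L i) k) then snd (L i ! k) else 0"
  have IH: "?R c' \<le> sched n B m (\<Sum>i<n. c' i) (\<lambda>i. (c' i, drop (c' i) (L i)))"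
  proof (rule Suc.IH)
   show "c' j \<le> length (L j)" if "j < n" for j
    using that pend Suc.prems(1)[of j] by (auto simp: c'_def)
   show "(\<Sum>j<n. length (L j) - c' j) \<le> m"
   proof -
    have "(\<Sum>j<n. length (L j) - c j) = Suc (\<Sum>j<n. length (L j) - c' j)"
     using i pend unfolding c'_def by (subst (1 2) sum.remove[of _ i]) auto
    then show ?thesis using Suc.prems(2) by simp
   qed
  next
   fix j j' k
   assume a: "j < n" "j' < n" "k < c' j" "2 * k < fst (L j ! k)" "c' j' < length (L j')"
   have pj': "c j' < length (L j')" using a by (cases "j' = i") (auto simp: c'_def)
   have le': "fst (L j' ! c j') \<le> fst (L j' ! c' j')"
    using a nxt by (cases "j' = i") (auto simp: c'_def)
   show "fst (L j ! k) \<le> fst (L j' ! c' j')"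
   proof (cases "k < c j")
    case True
    then show ?thesis using Suc.prems(3)[OF a(1,2) True a(4) pj'] le' by simp
   next
    case False
    then have ji: "j = i" "k = c i" using a(3) by (auto simp: c'_def split: if_splits)
    then have "?ks i = ?\<tau>" using a(4) ks_pend[OF i pend] by simp
    moreover have "?ks i \<le> ?ks j'" using p(3)[OF a(2)] .
    moreover have "?ks j' \<le> fst (L j' ! c j')" using ks_pend[OF a(2) pj'] by simp
    ultimately show ?thesis using ji le' by simp
   qed
  next
   fix j j'
   assume a: "j < n" "j' < n" "c' j < length (L j)" "c' j' < length (L j')"
    "fst (L j ! c' j) \<le> 2 * c' j" "fst (L j' ! c' j') \<le> 2 * c' j'"
   \<comment> \<open>Another urgent arm would have been urgent before this play. Arm
     \<open>i\<close> was picked with the least key, hence it was urgent as well, contradicting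
     \<open>one\<close>.\<close>
   have only: "j = i" if "j < n" "c' j < length (L j)" "fst (L j ! c' j) \<le> 2 * c' j" for j
   proof (rule ccontr)
    assume ne: "j \<noteq> i"
    then have "?ks j = 0" using that ks_pend[of j] by (simp add: c'j)
    then have "?ks i = 0" using p(3)[OF that(1)] by simp
    then have "?\<tau> \<le> 2 * c i" using ks_pend[OF i pend] play_list_nth[OF L[OF i] pend] by (auto split: if_splits)
    then show False using Suc.prems(4)[OF i that(1) pend] that ne by (simp add: c'j)
   qed
   show "j = j'" using only a by blast
  next
   fix j
   assume a: "j < n" "c' j < length (L j)" "fst (L j ! c' j) \<le> 2 * c' j" "on_time n L j (head_time (L j) (c' j))"
   have ji: "j = i"
   proof (rule ccontr)
    assume ne: "j \<noteq> i"
    then have "?ks j = 0" using a ks_pend[of j] by (simp add: c'j)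
    then have "?ks i = 0" using p(3)[OF a(1)] by simp
    then have "?\<tau> \<le> 2 * c i" using ks_pend[OF i pend] play_list_nth[OF L[OF i] pend] by (auto split: if_splits)
    then show False using Suc.prems(4)[OF i a(1) pend] a ne by (simp add: c'j)
   qed
   then have "head_time (L i) (c' i) = head_time (L i) (c i)" using a by (simp add: c'i)
   then have "(\<Sum>i<n. c i) < ?\<tau>" using timely a ji by simp
   then show "(\<Sum>i<n. c' i) < fst (L j ! c' j)" using nxt a ji unfolding sum_c' by simp
  qed
  have "?R c = ?R c' + (if ?g then snd (L i ! c i) else 0)"
  proof -
   have "(\<Sum>k=c i..<length (L i). if on_time n L i (head_time (L i) k) then snd (L i ! k) else 0)
    = (if ?g then snd (L i ! c i) else 0)
     + (\<Sum>k=Suc (c i)..<length (L i). if on_time n L i (head_time (L i) k) then snd (L i ! k) else 0)"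
    using pend by (rule sum.atLeast_Suc_lessThan)
   then show ?thesis
    using i unfolding c'_def by (subst (1 2) sum.remove[of _ i]) auto
  qed
  also have "\<dots> \<le> sched n B m (\<Sum>i<n. c' i) (\<lambda>i. (c' i, drop (c' i) (L i)))
    + (if (\<Sum>i<n. c i) < B then snd (L i ! c i) else 0)"
   using IH timely play_list_nth[OF L[OF i] pend] by (intro add_mono) auto
  also have "\<dots> = sched n B (Suc m) (\<Sum>i<n. c i) (\<lambda>i. (c i, drop (c i) (L i)))"
  proof -
   have S: "(\<lambda>j. (c j, drop (c j) (L j)))(i := (Suc (c i), tl (drop (c i) (L i)))) = (\<lambda>j. (c' j, drop (c' j) (L j)))"
    by (auto simp: c'_def fun_eq_iff drop_Suc tl_drop)
   have "hd (drop (c i) (L i)) = L i ! c i" using pend by (rule hd_drop_conv_nth)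
   then show ?thesis using Some S sum_c' by simp
  qed
  finally show ?thesis .
 qed
qed

lemma sched_lower_0:
 assumes L: "\<And>i. i < n \<Longrightarrow> play_list B (L i)" and m: "(\<Sum>i<n. length (L i)) \<le> m"
 shows "(\<Sum>i<n. \<Sum>k<length (L i). if on_time n L i (head_time (L i) k) then snd (L i ! k) else 0)
  \<le> sched n B m 0 (\<lambda>i. (0, L i))"
proof -
 have nz: "fst (L i ! 0) \<noteq> 0" if "i < n" "L i \<noteq> []" for i
  using play_list_nth(1)[OF L[OF that(1)], of 0] that(2) by auto
 have "(\<Sum>i<n. \<Sum>k=0..<length (L i). if on_time n L i (head_time (L i) k) then snd (L i ! k) else 0)
  \<le> sched n B m (\<Sum>i<n. 0) (\<lambda>i. (0, drop 0 (L i)))"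
  by (rule sched_lower) (use L m nz in auto)
 then show ?thesis by (simp add: atLeast0LessThan)
qed

text \<open>Each arm's play list is drawn independently, and whether the plays of arm \<open>i\<close> are on time
 depends on the other arms only.\<close>

lemma expected_sched_lower:
 fixes D :: "nat \<Rightarrow> (nat \<times> real) list pmf"
 assumes fin: "\<And>i. i < n \<Longrightarrow> finite (set_pmf (D i))"
  and L: "\<And>i l. i < n \<Longrightarrow> l \<in> set_pmf (D i) \<Longrightarrow> play_list B l \<and> length l \<le> B"
  and s: "\<And>i t. i < n \<Longrightarrow> t \<in> {1..B} \<Longrightarrow>
   s \<le> expect (Pi_pmf ({..<n} - {i}) [] D) (\<lambda>f. if on_time n f i t then 1 else 0)"
 shows "s * (\<Sum>i<n. expect (D i) (\<lambda>l. \<Sum>p\<leftarrow>l. snd p))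
  \<le> expect (Pi_pmf {..<n} [] D) (\<lambda>\<omega>. sched n B (n * B) 0 (\<lambda>i. (0, \<omega> i)))"
proof -
 let ?E = expect
 let ?P = "Pi_pmf {..<n} [] D"
 have finP: "finite (set_pmf (Pi_pmf A [] D))" if "A \<subseteq> {..<n}" for A
  using that fin finite_subset[OF that] by (intro finite_set_Pi_pmf) auto
 have "s * (\<Sum>i<n. ?E (D i) (\<lambda>l. \<Sum>p\<leftarrow>l. snd p)) = (\<Sum>i<n. ?E (D i) (\<lambda>l. \<Sum>k<length l. s * snd (l ! k)))"
  by (simp add: sum_distrib_left sum_list_sum_nth atLeast0LessThan flip: sum_distrib_left)
 also have "\<dots> \<le> (\<Sum>i<n. ?E ?P (\<lambda>\<omega>. \<Sum>k<length (\<omega> i). if on_time n \<omega> i (head_time (\<omega> i) k) then snd (\<omega> i ! k) else 0))"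
 proof (rule sum_mono)
  fix i assume "i \<in> {..<n}"
  then have i: "i < n" by simp
  let ?Q = "Pi_pmf ({..<n} - {i}) [] D"
  have indep: "on_time n (f(i := l)) i t = on_time n f i t" for f l t
   unfolding on_time_def by (intro arg_cong2[where f = "(<)"] arg_cong2[where f = "(*)"] refl sum.cong) auto
  have "?E (D i) (\<lambda>l. \<Sum>k<length l. s * snd (l ! k))
    \<le> ?E (D i) (\<lambda>l. \<Sum>k<length l. ?E ?Q (\<lambda>f. if on_time n f i (head_time l k) then 1 else 0) * snd (l ! k))"
  proof (rule expectation_mono_finite[OF fin[OF i]])
   fix l assume l: "l \<in> set_pmf (D i)"
   note pl = L[OF i l, THEN conjunct1]
   show "(\<Sum>k<length l. s * snd (l ! k))
    \<le> (\<Sum>k<length l. ?E ?Q (\<lambda>f. if on_time n f i (head_time l k) then 1 else 0) * snd (l ! k))"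
    using play_list_nth(3)[OF pl] head_time_mem[OF pl] s[OF i]
    by (intro sum_mono mult_right_mono) auto
  qed
  also have "\<dots> = ?E (D i) (\<lambda>l. ?E ?Q (\<lambda>f. \<Sum>k<length l. if on_time n f i (head_time l k) then snd (l ! k) else 0))"
   using finP[of "{..<n} - {i}"]
   by (intro expectation_cong_pmf) (simp add: Bochner_Integration.integral_sum if_distrib[of "\<lambda>x. x * _"] flip: integral_mult_left_zero cong: if_cong)
  also have "\<dots> = ?E ?P (\<lambda>\<omega>. \<Sum>k<length (\<omega> i). if on_time n \<omega> i (head_time (\<omega> i) k) then snd (\<omega> i ! k) else 0)"
  proof -
   have "?E ?P h = ?E (D i) (\<lambda>y. ?E ?Q (\<lambda>f. h (f(i := y))))" for h :: "_ \<Rightarrow> real"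
    using i fin by (intro expectation_Pi_pmf_split) auto
   then show ?thesis by (simp add: indep cong: if_cong)
  qed
  finally show "?E (D i) (\<lambda>l. \<Sum>k<length l. s * snd (l ! k))
   \<le> ?E ?P (\<lambda>\<omega>. \<Sum>k<length (\<omega> i). if on_time n \<omega> i (head_time (\<omega> i) k) then snd (\<omega> i ! k) else 0)" .
 qed
 also have "\<dots> = ?E ?P (\<lambda>\<omega>. \<Sum>i<n. \<Sum>k<length (\<omega> i). if on_time n \<omega> i (head_time (\<omega> i) k) then snd (\<omega> i ! k) else 0)"
  using finP[of "{..<n}"] by (simp add: Bochner_Integration.integral_sum)
 also have "\<dots> \<le> ?E ?P (\<lambda>\<omega>. sched n B (n * B) 0 (\<lambda>i. (0, \<omega> i)))"
 proof (rule expectation_mono_finite[OF finP[OF subset_refl]])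
  fix \<omega> assume w: "\<omega> \<in> set_pmf ?P"
  have wi: "\<omega> i \<in> set_pmf (D i)" if "i < n" for i using set_Pi_pmf_D[OF _ w, of i] that by auto
  have "(\<Sum>i<n. length (\<omega> i)) \<le> (\<Sum>i<n. B)" using L wi by (intro sum_mono) auto
  then show "(\<Sum>i<n. \<Sum>k<length (\<omega> i). if on_time n \<omega> i (head_time (\<omega> i) k) then snd (\<omega> i ! k) else 0)
   \<le> sched n B (n * B) 0 (\<lambda>i. (0, \<omega> i))"
   using L wi by (intro sched_lower_0) auto
 qed
 finally show ?thesis .
qed

section \<open>The probability that a play is on time\<close>

lemma uniform_3: "map_pmf (\<lambda>x. x = 0) (uniform_below 3) = bernoulli_pmf (1/3)"
proof (rule pmf_eqI)
 fix b
 have U: "uniform_below 3 = pmf_of_set {..<3}" by (simp add: uniform_below_def)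
 have S: "{..<3} \<inter> (\<lambda>x. x = 0) -` {b} = (if b then {0} else {1, 2::nat})"
  by (cases b) (simp_all add: set_eq_iff numeral_3_eq_3 less_Suc_eq, auto)
 have "pmf (map_pmf (\<lambda>x. x = 0) (uniform_below 3)) b
   = card ({..<3::nat} \<inter> (\<lambda>x. x = 0) -` {b}) / card {..<3::nat}"
  unfolding U by (simp add: pmf_map measure_pmf_of_set lessThan_empty_iff)
 also have "\<dots> = pmf (bernoulli_pmf (1/3)) b" unfolding S by simp
 finally show "pmf (map_pmf (\<lambda>x. x = 0) (uniform_below 3)) b = pmf (bernoulli_pmf (1/3)) b" .
qed

definition included :: "(nat \<times> real) list pmf \<Rightarrow> (nat \<times> real) list pmf" where
 "included A = bind_pmf (uniform_below 3) (\<lambda>x. if x = 0 then A else return_pmf [])"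

lemma included_bernoulli: "included A = bind_pmf (bernoulli_pmf (1/3)) (\<lambda>b. if b then A else return_pmf [])"
 unfolding included_def uniform_3[symmetric] by (simp add: bind_map_pmf)

lemma map_included: "f [] = 0 \<Longrightarrow> map_pmf f (included A) = thin (map_pmf f A)"
 unfolding included_bernoulli thin_def map_bind_pmf by (intro bind_pmf_cong) auto

lemma sum_Pi_pmf_thin:
 assumes "distinct js" "f [] = 0"
 shows "map_pmf (\<lambda>\<omega>. \<Sum>j\<in>set js. f (\<omega> j)) (Pi_pmf (set js) [] (\<lambda>j. included (A j)))
   = thin_sum (map (\<lambda>j. map_pmf f (A j)) js)"
 using assms(1)
proof (induction js)
 case (Cons j js)
 then have j: "j \<notin> set js" by simp
 have "map_pmf (\<lambda>\<omega>. \<Sum>j\<in>set (j # js). f (\<omega> j)) (Pi_pmf (set (j # js)) [] (\<lambda>j. included (A j)))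
   = bind_pmf (included (A j)) (\<lambda>y. map_pmf (\<lambda>\<omega>. f y + (\<Sum>i\<in>set js. f (fun_upd \<omega> j y i)))
     (Pi_pmf (set js) [] (\<lambda>j. included (A j))))"
  using j by (simp add: Pi_pmf_insert' map_bind_pmf map_pmf_def bind_assoc_pmf bind_return_pmf)
 also have "\<dots> = bind_pmf (included (A j)) (\<lambda>y. map_pmf (\<lambda>\<omega>. f y + (\<Sum>i\<in>set js. f (\<omega> i)))
     (Pi_pmf (set js) [] (\<lambda>j. included (A j))))"
  using j by (intro bind_pmf_cong map_pmf_cong refl arg_cong2[where f = "(+)"] sum.cong) auto
 also have "\<dots> = bind_pmf (map_pmf f (included (A j))) (\<lambda>x. map_pmf ((+) x) (map_pmf (\<lambda>\<omega>. \<Sum>i\<in>set js. f (\<omega> i))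
     (Pi_pmf (set js) [] (\<lambda>j. included (A j)))))"
  by (simp add: bind_map_pmf map_pmf_comp)
 finally show ?case using Cons by (simp add: map_included assms(2))
qed simp

lemma on_time_probability:
 assumes fin: "\<And>j. j < n \<Longrightarrow> finite (set_pmf (A j))"
  and \<delta>: "0 \<le> \<delta>" "\<delta> \<le> 1" and i: "i < n"
  and load: "(\<Sum>j<n. expect (A j) (\<lambda>l. real (plays_until t l))) * 2 \<le> (2 - \<delta>) * (t + 1)"
 shows "4/9 / (1 - \<delta> / 3)
  \<le> expect (Pi_pmf ({..<n} - {i}) [] (\<lambda>j. included (A j))) (\<lambda>f. if on_time n f i t then 1 else 0 :: real)"
proof -
 let ?E = expect
 \<comment> \<open>Truncation at 1 gives each load the mean at most 1 that the tail bound requires,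
   and it does not affect the event: a truncated load alone already makes the sum reach 1.\<close>
 define f where "f l = min 1 (2 * real (plays_until t l) / (t + 1))" for l :: "(nat \<times> real) list"
 have f0: "f [] = 0" by (simp add: f_def plays_until_def)
 have fnn: "f l \<ge> 0" "f l \<le> 1" for l by (auto simp: f_def)
 obtain js where js: "set js = {..<n} - {i}" "distinct js"
  using finite_distinct_list[of "{..<n} - {i}"] by auto
 let ?P = "Pi_pmf ({..<n} - {i}) [] (\<lambda>j. included (A j))"
 let ?ms = "map (\<lambda>j. map_pmf f (A j)) js"
 have law: "load_law m" if "m \<in> set ?ms" for m
  using that fin js fnn by (auto simp: load_law_def)
 have mean1: "mean m \<le> 1" if m: "m \<in> set ?ms" for m
 proof -
  have "mean m \<le> ?E m (\<lambda>_. 1)"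
   using law[OF m] m fnn by (intro expectation_mono_finite) (auto simp: load_law_def)
  then show ?thesis by simp
 qed
 have "(\<Sum>m\<leftarrow>?ms. mean m) = (\<Sum>j\<in>{..<n} - {i}. ?E (A j) f)"
  using js by (simp add: sum_list_distinct_conv_sum_set o_def)
 also have "\<dots> \<le> (\<Sum>j<n. ?E (A j) f)"
  using fnn by (intro sum_mono2) (auto intro: expectation_nonneg_pmf)
 also have "\<dots> \<le> (\<Sum>j<n. ?E (A j) (\<lambda>l. 2 * real (plays_until t l) / (t + 1)))"
  using fin by (intro sum_mono expectation_mono_finite) (auto simp: f_def)
 also have "\<dots> = (\<Sum>j<n. ?E (A j) (\<lambda>l. real (plays_until t l))) * 2 / (t + 1)"
  by (simp add: sum_divide_distrib[symmetric] sum_distrib_left[symmetric])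
 also have "\<dots> \<le> 2 - \<delta>" using load by (simp add: pos_divide_le_eq add.commute)
 finally have total: "(\<Sum>m\<leftarrow>?ms. mean m) \<le> 2 - \<delta>" .
 have "4/9 / (1 - \<delta> / 3) \<le> ?E (thin_sum ?ms) (\<lambda>x. if x < 1 then 1 else 0)"
  by (rule thin_sum_success[OF law mean1 total \<delta>])
 also have "thin_sum ?ms = map_pmf (\<lambda>\<omega>. \<Sum>j\<in>{..<n} - {i}. f (\<omega> j)) ?P"
  using sum_Pi_pmf_thin[OF js(2), of f A] f0 js(1) by simp
 also have "?E \<dots> (\<lambda>x. if x < 1 then 1 else 0)
   = ?E ?P (\<lambda>\<omega>. if (\<Sum>j\<in>{..<n} - {i}. f (\<omega> j)) < 1 then 1 else 0 :: real)"
  by simp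
 also have "\<dots> \<le> ?E ?P (\<lambda>\<omega>. if on_time n \<omega> i t then 1 else 0)"
 proof (rule expectation_mono_finite)
  show "finite (set_pmf ?P)" using fin by (intro finite_set_Pi_pmf) (auto simp: included_bernoulli split: if_splits)
  fix \<omega>
  have "on_time n \<omega> i t" if less: "(\<Sum>j\<in>{..<n} - {i}. f (\<omega> j)) < 1"
  proof -
   have "f (\<omega> j) = 2 * real (plays_until t (\<omega> j)) / (t + 1)" if j: "j \<in> {..<n} - {i}" for j
   proof -
    have "f (\<omega> j) \<le> (\<Sum>j\<in>{..<n} - {i}. f (\<omega> j))" using j fnn by (intro member_le_sum) auto
    then show ?thesis using less by (auto simp: f_def min_def split: if_splits)
   qed
   then have "(\<Sum>j\<in>{..<n} - {i}. 2 * real (plays_until t (\<omega> j)) / (t + 1)) < 1" using less by simp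
   then have "2 * (\<Sum>j\<in>{..<n} - {i}. real (plays_until t (\<omega> j))) / (t + 1) < 1"
    by (simp add: sum_divide_distrib[symmetric] sum_distrib_left[symmetric])
   then have "2 * (\<Sum>j\<in>{..<n} - {i}. real (plays_until t (\<omega> j))) < real t + 1" by (simp add: field_simps)
   then have "real (2 * (\<Sum>j\<in>{..<n} - {i}. plays_until t (\<omega> j))) < real (t + 1)" by simp
   then show ?thesis unfolding on_time_def of_nat_less_iff .
  qed
  then show "(if (\<Sum>j\<in>{..<n} - {i}. f (\<omega> j)) < 1 then 1 else 0) \<le> (if on_time n \<omega> i t then 1 else (0::real))"
   by auto
 qed
 finally show ?thesis .
qed

section \<open>Random play lists and deferred decisions\<close>

context bandit
begin

text \<open>\<open>next_node\<close> is a meaningful law only where the probabilities sum to 1;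
  elsewhere a dummy law makes the definition total.\<close>

definition kernel :: "'a \<Rightarrow> 's \<Rightarrow> 's pmf" where
 "kernel a u = (if a \<in> acts I \<and> u \<in> states I \<and> dep u < B then next_node I a u else return_pmf u)"

lemma pmf_next_node:
 assumes "a \<in> acts I" "u \<in> states I" "dep u < B"
 shows "pmf (next_node I a u) v = (if v \<in> states I then prob I a u v else 0)"
 unfolding next_node_def
proof (rule pmf_embed_pmf)
 show "0 \<le> (if v \<in> states I then prob I a u v else 0)" for v using prob_nn assms by auto
 have "(\<integral>\<^sup>+ v. ennreal (if v \<in> states I then prob I a u v else 0) \<partial>count_space UNIV)
   = (\<Sum>v\<in>states I. ennreal (if v \<in> states I then prob I a u v else 0))"
  using fin_states by (intro nn_integral_count_space') auto
 also have "\<dots> = ennreal (\<Sum>v\<in>states I. prob I a u v)"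
  using prob_nn assms by (subst sum_ennreal[symmetric]) auto
 finally show "(\<integral>\<^sup>+ v. ennreal (if v \<in> states I then prob I a u v else 0) \<partial>count_space UNIV) = 1"
  using prob_sum assms by simp
qed

lemma set_next_node:
 assumes "a \<in> acts I" "u \<in> states I" "dep u < B" "v \<in> set_pmf (next_node I a u)"
 shows "v \<in> states I" "prob I a u v > 0" "dep v = dep u + 1"
proof -
 have "pmf (next_node I a u) v > 0" using assms(4) by (simp add: pmf_positive)
 then show *: "v \<in> states I" "prob I a u v > 0"
  using pmf_next_node[OF assms(1-3), of v] by (auto split: if_splits)
 then show "dep v = dep u + 1" using dep_succ assms by blast
qed

lemma set_kernel: "u \<in> states I \<Longrightarrow> v \<in> set_pmf (kernel a u) \<Longrightarrow> v \<in> states I"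
 using set_next_node(1)[of a u v] by (simp add: kernel_def split: if_splits)

lemma finite_kernel: "u \<in> states I \<Longrightarrow> finite (set_pmf (kernel a u))"
 by (rule finite_subset[OF _ fin_states]) (auto dest: set_kernel)

lemma expectation_kernel:
 assumes "a \<in> acts I" "u \<in> states I" "dep u < B"
 shows "expect (kernel a u) f = (\<Sum>v\<in>states I. prob I a u v * f v)"
proof -
 have "expect (kernel a u) f = (\<Sum>v\<in>states I. f v * pmf (kernel a u) v)"
  using set_kernel[of u _ a] assms fin_states by (intro integral_measure_pmf_real) auto
 then show ?thesis using assms by (simp add: kernel_def pmf_next_node mult.commute)
qed

text \<open>The virtual run of a single arm, in which each play takes place in the slot that the
  table prescribes.\<close>

primrec plays :: "(nat \<Rightarrow> 's \<Rightarrow> 'a option) \<Rightarrow> nat \<Rightarrow> 's \<Rightarrow> (nat \<times> real) list pmf" where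
 "plays d 0 u = return_pmf []"
| "plays d (Suc k) u = (case d (B - k) u of None \<Rightarrow> plays d k u
  | Some a \<Rightarrow> bind_pmf (kernel a u) (\<lambda>v. map_pmf (Cons (B - k, rew I a u)) (plays d k v)))"

lemma finite_plays: "u \<in> states I \<Longrightarrow> finite (set_pmf (plays d k u))"
proof (induction k arbitrary: u)
 case (Suc k)
 show ?case
 proof (cases "d (B - k) u")
  case (Some a)
  then show ?thesis using Suc finite_kernel set_kernel by auto
 qed (use Suc in auto)
qed simp

lemma play_list_plays:
 assumes "table d"
 shows "k \<le> B \<Longrightarrow> u \<in> states I \<Longrightarrow> l \<in> set_pmf (plays d k u) \<Longrightarrow>
  play_list B l \<and> length l \<le> k \<and> (\<forall>p\<in>set l. B - k < fst p)"
proof (induction k arbitrary: u l)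
 case (Suc k)
 show ?case
 proof (cases "d (B - k) u")
  case None
  then have "l \<in> set_pmf (plays d k u)" using Suc.prems by simp
  then show ?thesis using Suc.IH[of u l] Suc.prems by force
 next
  case (Some a)
  then have a: "a \<in> acts I" using table_D[OF assms, of k u a] Suc.prems by simp
  obtain v l' where v: "v \<in> set_pmf (kernel a u)" "l' \<in> set_pmf (plays d k v)" "l = (B - k, rew I a u) # l'"
   using Suc.prems Some by auto
  have "play_list B l' \<and> length l' \<le> k \<and> (\<forall>p\<in>set l'. B - k < fst p)"
   using Suc.IH[of v l'] v set_kernel Suc.prems by auto
  then show ?thesis using v Suc.prems rew_nn[OF a] unfolding play_list_def by auto
 qed
qed (simp add: play_list_def)

lemma expectation_plays:
 fixes h :: "nat \<Rightarrow> real \<Rightarrow> real"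
 assumes "table d"
 shows "k \<le> B \<Longrightarrow> u \<in> states I \<Longrightarrow> dep u + k \<le> B \<Longrightarrow>
  expect (plays d k u) (\<lambda>l. \<Sum>p\<leftarrow>l. h (fst p) (snd p)) = pay d (\<lambda>t a u. h t (rew I a u)) k u"
proof (induction k arbitrary: u)
 case (Suc k)
 show ?case
 proof (cases "d (B - k) u")
  case None
  then show ?thesis using Suc by simp
 next
  case (Some a)
  then have a: "a \<in> acts I" using table_D[OF assms, of k u a] Suc.prems by simp
  have dep: "dep u < B" using Suc.prems by simp
  let ?E = expect
  have "?E (plays d (Suc k) u) (\<lambda>l. \<Sum>p\<leftarrow>l. h (fst p) (snd p))
    = ?E (kernel a u) (\<lambda>v. ?E (plays d k v) (\<lambda>l. h (B - k) (rew I a u) + (\<Sum>p\<leftarrow>l. h (fst p) (snd p))))"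
   using Some Suc.prems finite_kernel finite_plays set_kernel by (simp add: expectation_bind_finite)
  also have "\<dots> = ?E (kernel a u) (\<lambda>v. h (B - k) (rew I a u) + pay d (\<lambda>t a u. h t (rew I a u)) k v)"
  proof (rule expectation_cong_pmf)
   fix v assume v: "v \<in> set_pmf (kernel a u)"
   then have v': "v \<in> states I" "dep v = dep u + 1"
    using set_next_node[OF a Suc.prems(2) dep] a Suc.prems dep by (auto simp: kernel_def)
   have "?E (plays d k v) (\<lambda>l. h (B - k) (rew I a u) + (\<Sum>p\<leftarrow>l. h (fst p) (snd p)))
     = h (B - k) (rew I a u) + ?E (plays d k v) (\<lambda>l. \<Sum>p\<leftarrow>l. h (fst p) (snd p))"
    using finite_plays[OF v'(1)] by simp
   then show "?E (plays d k v) (\<lambda>l. h (B - k) (rew I a u) + (\<Sum>p\<leftarrow>l. h (fst p) (snd p)))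
     = h (B - k) (rew I a u) + pay d (\<lambda>t a u. h t (rew I a u)) k v"
    using Suc.IH[of v] Suc.prems v' by simp
  qed
  also have "\<dots> = h (B - k) (rew I a u) + ?E (kernel a u) (pay d (\<lambda>t a u. h t (rew I a u)) k)"
   using finite_kernel[OF Suc.prems(2)] by simp
  finally show ?thesis using Some expectation_kernel[OF a Suc.prems(2) dep] by simp
 qed
qed simp

text \<open>While the table idles the node does not change, so the idle slots up to the next pull
  can be skipped. \<open>B + 1\<close> stands for never.\<close>

definition adv :: "(nat \<Rightarrow> 's \<Rightarrow> 'a option) \<Rightarrow> nat \<Rightarrow> 's \<Rightarrow> nat" where
 "adv d t u = (if \<exists>t'. t \<le> t' \<and> t' \<le> B \<and> d t' u \<noteq> None then LEAST t'. t \<le> t' \<and> t' \<le> B \<and> d t' u \<noteq> None else B + 1)"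

lemma adv_cases:
 obtains (none) "adv d t u = B + 1" "\<And>t'. t \<le> t' \<Longrightarrow> t' \<le> B \<Longrightarrow> d t' u = None"
 | (some) "t \<le> adv d t u" "adv d t u \<le> B" "d (adv d t u) u \<noteq> None"
proof (cases "\<exists>t'. t \<le> t' \<and> t' \<le> B \<and> d t' u \<noteq> None")
 case ex: True
 then have "adv d t u = (LEAST t'. t \<le> t' \<and> t' \<le> B \<and> d t' u \<noteq> None)" by (simp only: adv_def if_True)
 with LeastI_ex[OF ex] show ?thesis using some by simp
next
 case False
 then have "adv d t u = B + 1" by (simp only: adv_def if_False)
 moreover have "d t' u = None" if "t \<le> t'" "t' \<le> B" for t' using False that by blast
 ultimately show ?thesis by (rule none)
qed

lemma adv_now: "t \<le> B \<Longrightarrow> d t u \<noteq> None \<Longrightarrow> adv d t u = t"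
 unfolding adv_def by (auto intro!: Least_equality)

lemma adv_later: "d t u = None \<Longrightarrow> adv d t u = adv d (Suc t) u"
proof -
 assume "d t u = None"
 then have "(t \<le> t' \<and> t' \<le> B \<and> d t' u \<noteq> None) \<longleftrightarrow> (Suc t \<le> t' \<and> t' \<le> B \<and> d t' u \<noteq> None)" for t'
  by (metis Suc_leD le_antisym not_less_eq_eq)
 then show ?thesis unfolding adv_def by (simp only:)
qed

lemma adv_end: "t > B \<Longrightarrow> adv d t u = B + 1"
 by (auto simp: adv_def)

lemma plays_adv: "k \<le> B \<Longrightarrow> plays d k u = plays d (B + 1 - adv d (B + 1 - k) u) u"
proof (induction k)
 case 0
 then show ?case by (simp add: adv_end)
next
 case (Suc k)
 then have t: "B + 1 - Suc k = B - k" "B + 1 - k = Suc (B - k)" "B + 1 - (B - k) = Suc k" by auto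
 show ?case
 proof (cases "d (B - k) u")
  case None
  then show ?thesis using Suc adv_later[of d "B - k" u] unfolding t(1) by (simp add: t(2) Suc_diff_le)
 next
  case (Some a)
  then have "adv d (B - k) u = B - k" by (intro adv_now) auto
  then show ?thesis unfolding t(1) by (simp only: t(3))
 qed
qed

text \<open>A state assigns to every arm its node, the virtual time of its next play, and the number of plays made.\<close>

definition state_pick :: "(nat \<Rightarrow> 's \<times> nat \<times> nat) \<Rightarrow> nat option" where
 "state_pick \<sigma> = pick (narms I) B (\<lambda>i. prio B (fst (snd (\<sigma> i))) (snd (snd (\<sigma> i))))"

definition move :: "(nat \<Rightarrow> nat \<Rightarrow> 's \<Rightarrow> 'a option) \<Rightarrow> (nat \<Rightarrow> 's \<times> nat \<times> nat) \<Rightarrow> nat \<Rightarrow> 's \<Rightarrow> (nat \<Rightarrow> 's \<times> nat \<times> nat)" where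
 "move d \<sigma> i v = \<sigma>(i := (v, adv (d i) (fst (snd (\<sigma> i)) + 1) v, snd (snd (\<sigma> i)) + 1))"

definition choice :: "(nat \<Rightarrow> nat \<Rightarrow> 's \<Rightarrow> 'a option) \<Rightarrow> (nat \<Rightarrow> 's \<times> nat \<times> nat) \<Rightarrow> nat \<Rightarrow> 'a" where
 "choice d \<sigma> i = the (d i (fst (snd (\<sigma> i))) (fst (\<sigma> i)))"

text \<open>The scheduler in the form that an adaptive policy can follow: a transition is drawn only
  when the play is made, whereas \<open>sched\<close> receives complete play lists.\<close>

primrec lazy :: "(nat \<Rightarrow> nat \<Rightarrow> 's \<Rightarrow> 'a option) \<Rightarrow> nat \<Rightarrow> nat \<Rightarrow> (nat \<Rightarrow> 's \<times> nat \<times> nat) \<Rightarrow> real" where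
 "lazy d 0 c \<sigma> = 0"
| "lazy d (Suc m) c \<sigma> = (case state_pick \<sigma> of None \<Rightarrow> 0
  | Some i \<Rightarrow> (if c < B then rew I (choice d \<sigma> i) (fst (\<sigma> i)) else 0)
    + expect (kernel (choice d \<sigma> i) (fst (\<sigma> i))) (\<lambda>v. lazy d m (c + 1) (move d \<sigma> i v)))"

text \<open>\<open>dep u < t\<close> is kept because each virtual play uses up a slot and descends
  one layer. It places every node about to be pulled at a depth below \<open>B\<close>, where
  transitions are proper laws.\<close>

definition state_ok :: "(nat \<Rightarrow> nat \<Rightarrow> 's \<Rightarrow> 'a option) \<Rightarrow> (nat \<Rightarrow> 's \<times> nat \<times> nat) \<Rightarrow> bool" where
 "state_ok d \<sigma> \<longleftrightarrow> (\<forall>i<narms I. case \<sigma> i of (u, t, c) \<Rightarrow>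
  u \<in> nodes I i \<and> 1 \<le> t \<and> (t \<le> B \<longrightarrow> dep u < t \<and> d i t u \<noteq> None))"

lemma nodes_states: "i < narms I \<Longrightarrow> u \<in> nodes I i \<Longrightarrow> u \<in> states I"
 by (auto simp: states_def)

lemma kernel_node:
 assumes "i < narms I" "u \<in> nodes I i" "v \<in> set_pmf (kernel a u)"
 shows "v \<in> nodes I i"
proof (rule ccontr)
 assume not: "v \<notin> nodes I i"
 have u: "u \<in> states I" using assms nodes_states by blast
 have ok: "a \<in> acts I" "dep u < B" using assms not by (auto simp: kernel_def split: if_splits)
 then have v: "v \<in> set_pmf (next_node I a u)" using assms u by (simp add: kernel_def)
 then have "prob I a u v > 0" "v \<in> states I" using set_next_node[OF ok(1) u ok(2)] by auto
 then show False using cross[OF ok(1) assms(1,2), of v] not by simp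
qed

lemma state_ok_move:
 assumes \<sigma>: "state_ok d \<sigma>" and i: "i < narms I" and t: "fst (snd (\<sigma> i)) \<le> B" and tab: "table (d i)"
  and v: "v \<in> set_pmf (kernel (choice d \<sigma> i) (fst (\<sigma> i)))"
 shows "state_ok d (move d \<sigma> i v)"
proof -
 obtain u t c where s: "\<sigma> i = (u, t, c)" by (cases "\<sigma> i")
 then have ok: "u \<in> nodes I i" "1 \<le> t" "t \<le> B" "dep u < t" "d i t u \<noteq> None"
  using \<sigma> i t unfolding state_ok_def by auto
 have u: "u \<in> states I" using ok i nodes_states by blast
 obtain a where a: "d i t u = Some a" using ok by auto
 have "t \<in> {1..B}" using ok by simp
 then have aA: "a \<in> acts I" using tab a u unfolding table_def by blast
 have ch: "choice d \<sigma> i = a" using s a by (simp add: choice_def)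
 have vn: "v \<in> nodes I i" using kernel_node[OF i ok(1)] v s ch by simp
 have "dep v = dep u + 1" using v set_next_node[OF aA u] ok aA u s ch by (simp add: kernel_def)
 then have "1 \<le> adv (d i) (t + 1) v \<and> (adv (d i) (t + 1) v \<le> B \<longrightarrow>
   dep v < adv (d i) (t + 1) v \<and> d i (adv (d i) (t + 1) v) v \<noteq> None)"
  using ok by (cases rule: adv_cases[of "d i" "t + 1" v]) auto
 then show ?thesis using \<sigma> vn s unfolding state_ok_def move_def by auto
qed

text \<open>Deferred decisions: the priorities depend only on the next virtual times, which the
  state already determines. Hence the picked arm is the same for all undrawn lists, and only its
  first transition has to be revealed.\<close>

lemma lazy_sched:
 assumes tab: "\<And>i. i < narms I \<Longrightarrow> table (d i)"
 shows "state_ok d \<sigma> \<Longrightarrow> lazy d m c \<sigma>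
  = expect (Pi_pmf {..<narms I} [] (\<lambda>i. plays (d i) (B + 1 - fst (snd (\<sigma> i))) (fst (\<sigma> i))))
    (\<lambda>\<omega>. sched (narms I) B m c (\<lambda>i. (snd (snd (\<sigma> i)), \<omega> i)))"
proof (induction m arbitrary: c \<sigma>)
 case (Suc m)
 let ?n = "narms I" and ?E = expect
 let ?law = "\<lambda>\<sigma> i. plays (d i) (B + 1 - fst (snd (\<sigma> i))) (fst (\<sigma> i))"
 let ?P = "Pi_pmf {..<?n} [] (?law \<sigma>)"
 have st: "fst (\<sigma> i) \<in> states I" if "i < ?n" for i
  using Suc.prems that nodes_states unfolding state_ok_def by (cases "\<sigma> i") fastforce
 have fin: "finite (set_pmf (?law \<sigma> i))" if "i < ?n" for i using finite_plays[OF st[OF that]] .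
 have unfold: "?law \<sigma> i = (if fst (snd (\<sigma> i)) \<le> B then
   bind_pmf (kernel (choice d \<sigma> i) (fst (\<sigma> i))) (\<lambda>v. map_pmf (Cons (fst (snd (\<sigma> i)), rew I (choice d \<sigma> i) (fst (\<sigma> i))))
    (plays (d i) (B - fst (snd (\<sigma> i))) v)) else return_pmf [])" if i: "i < ?n" for i
 proof -
  obtain u t c where s: "\<sigma> i = (u, t, c)" by (cases "\<sigma> i")
  show ?thesis
  proof (cases "t \<le> B")
   case True
   then have "d i t u \<noteq> None" "B - (B - t) = t" using Suc.prems i s unfolding state_ok_def by auto
   then show ?thesis using s True by (auto simp: choice_def Suc_diff_le)
  qed (use s in auto)
 qed
 have nt: "prio B (next_time B (\<omega> i)) c' = prio B (fst (snd (\<sigma> i))) c'"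
  if "\<omega> \<in> set_pmf ?P" "i < ?n" for \<omega> i c'
 proof -
  have "\<omega> i \<in> set_pmf (?law \<sigma> i)" using set_Pi_pmf_D[OF _ that(1)] that(2) by auto
  then show ?thesis unfolding unfold[OF that(2)] by (auto simp: next_time_def prio_def split: if_splits)
 qed
 have same: "pick ?n B (\<lambda>i. prio B (next_time B (snd (snd (snd (\<sigma> i)), \<omega> i))) (fst (snd (snd (\<sigma> i)), \<omega> i))) = state_pick \<sigma>"
  if "\<omega> \<in> set_pmf ?P" for \<omega>
  unfolding state_pick_def using nt[OF that] by (intro pick_cong) auto
 show ?case
 proof (cases "state_pick \<sigma>")
  case None
  have "?E ?P (\<lambda>\<omega>. sched ?n B (Suc m) c (\<lambda>i. (snd (snd (\<sigma> i)), \<omega> i))) = ?E ?P (\<lambda>_. 0)"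
   using same None by (intro expectation_cong_pmf) simp
  then show ?thesis using None by simp
 next
  case (Some i)
  have i: "i < ?n" using Some unfolding state_pick_def by (rule pick_Some)
  have "prio B (fst (snd (\<sigma> i))) (snd (snd (\<sigma> i))) \<le> B" using Some unfolding state_pick_def by (rule pick_Some)
  then have tB: "fst (snd (\<sigma> i)) \<le> B" by (auto simp: prio_def split: if_splits)
  let ?Q = "Pi_pmf ({..<?n} - {i}) [] (?law \<sigma>)"
  let ?k = "kernel (choice d \<sigma> i) (fst (\<sigma> i))" and ?t = "fst (snd (\<sigma> i))" and ?c = "snd (snd (\<sigma> i))"
  let ?r = "rew I (choice d \<sigma> i) (fst (\<sigma> i))"
  let ?S = "\<lambda>\<omega> i. (snd (snd (\<sigma> i)), \<omega> i)"
  let ?rw = "if c < B then ?r else 0"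
  have finQ: "finite (set_pmf ?Q)" using fin by (intro finite_set_Pi_pmf) auto
  have fink: "finite (set_pmf ?k)" by (rule finite_kernel[OF st[OF i]])
  have finl: "finite (set_pmf (plays (d i) k v))" if "v \<in> set_pmf ?k" for v k
   using finite_plays[OF set_kernel[OF st[OF i] that]] .
  have step: "sched ?n B (Suc m) c (?S (f(i := (?t, ?r) # l)))
    = ?rw + sched ?n B m (c + 1) ((?S f)(i := (Suc ?c, l)))"
   if "(?t, ?r) # l \<in> set_pmf (?law \<sigma> i)" "f \<in> set_pmf ?Q" for f l
  proof -
   have "f(i := (?t, ?r) # l) \<in> set_pmf ?P"
   proof -
    have fp: "x \<in> {..<?n} - {i} \<Longrightarrow> f x \<in> set_pmf (?law \<sigma> x)" and f0: "x \<notin> {..<?n} - {i} \<Longrightarrow> f x = []" for x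
     using that(2) set_Pi_pmf[of "{..<?n} - {i}" "[]" "?law \<sigma>"] by (auto simp: PiE_dflt_def)
    show ?thesis using that(1) fp f0 i by (subst set_Pi_pmf) (auto simp: PiE_dflt_def)
   qed
   note same[OF this]
   moreover have "(?S (f(i := (?t, ?r) # l)))(i := (Suc ?c, l)) = (?S f)(i := (Suc ?c, l))" by (auto simp: fun_eq_iff)
   ultimately show ?thesis using Some by simp
  qed
  have "?E ?P (\<lambda>\<omega>. sched ?n B (Suc m) c (?S \<omega>))
   = ?E (?law \<sigma> i) (\<lambda>l. ?E ?Q (\<lambda>f. sched ?n B (Suc m) c (?S (f(i := l)))))"
   using i fin by (intro expectation_Pi_pmf_split) auto
  also have "\<dots> = ?E ?k (\<lambda>v. ?E (plays (d i) (B - ?t) v) (\<lambda>l. ?E ?Q (\<lambda>f. sched ?n B (Suc m) c (?S (f(i := (?t, ?r) # l))))))"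
   unfolding unfold[OF i] using tB fink finl by (simp add: expectation_bind_finite del: sched.simps)
  also have "\<dots> = ?E ?k (\<lambda>v. ?rw + lazy d m (c + 1) (move d \<sigma> i v))"
  proof (rule expectation_cong_pmf)
   fix v assume v: "v \<in> set_pmf ?k"
   have mem: "(?t, ?r) # l \<in> set_pmf (?law \<sigma> i)" if "l \<in> set_pmf (plays (d i) (B - ?t) v)" for l
    using that v tB unfolding unfold[OF i] by auto
   let ?\<sigma>' = "move d \<sigma> i v"
   have "?E (plays (d i) (B - ?t) v) (\<lambda>l. ?E ?Q (\<lambda>f. sched ?n B (Suc m) c (?S (f(i := (?t, ?r) # l)))))
    = ?E (plays (d i) (B - ?t) v) (\<lambda>l. ?E ?Q (\<lambda>f. ?rw + sched ?n B m (c + 1) ((?S f)(i := (Suc ?c, l)))))"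
    using step[OF mem] by (intro expectation_cong_pmf) auto
   also have "\<dots> = ?rw + ?E (plays (d i) (B - ?t) v) (\<lambda>l. ?E ?Q (\<lambda>f. sched ?n B m (c + 1) ((?S f)(i := (Suc ?c, l)))))"
    using finQ finl[OF v] by (simp del: sched.simps)
   also have "?E (plays (d i) (B - ?t) v) (\<lambda>l. ?E ?Q (\<lambda>f. sched ?n B m (c + 1) ((?S f)(i := (Suc ?c, l)))))
    = ?E (Pi_pmf {..<?n} [] (?law ?\<sigma>')) (\<lambda>\<omega>. sched ?n B m (c + 1) (\<lambda>i. (snd (snd (?\<sigma>' i)), \<omega> i)))"
   proof -
    have tt: "B + 1 - (B - ?t) = ?t + 1" using tB by simp
    have li: "?law ?\<sigma>' i = plays (d i) (B - ?t) v"
     using plays_adv[of "B - ?t" "d i" v] unfolding tt by (simp add: move_def)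
    have Q: "Pi_pmf ({..<?n} - {i}) [] (?law ?\<sigma>') = ?Q"
     by (intro Pi_pmf_cong) (auto simp: move_def)
    have finP': "finite (set_pmf (?law ?\<sigma>' j))" if "j < ?n" for j
     using fin[OF that] finl[OF v] li by (cases "j = i") (auto simp: move_def)
    have "?E (Pi_pmf {..<?n} [] (?law ?\<sigma>')) (\<lambda>\<omega>. sched ?n B m (c + 1) (\<lambda>i. (snd (snd (?\<sigma>' i)), \<omega> i)))
     = ?E (?law ?\<sigma>' i) (\<lambda>l. ?E (Pi_pmf ({..<?n} - {i}) [] (?law ?\<sigma>'))
       (\<lambda>f. sched ?n B m (c + 1) (\<lambda>j. (snd (snd (?\<sigma>' j)), (f(i := l)) j))))"
     using i finP' by (intro expectation_Pi_pmf_split) auto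
    moreover have "sched ?n B m (c + 1) (\<lambda>j. (snd (snd (?\<sigma>' j)), (f(i := l)) j))
      = sched ?n B m (c + 1) ((?S f)(i := (Suc ?c, l)))" for f l
     by (rule arg_cong[where f = "sched ?n B m (c + 1)"]) (auto simp: fun_eq_iff move_def)
    ultimately show ?thesis unfolding li Q by (simp only:)
   qed
   also have "\<dots> = lazy d m (c + 1) ?\<sigma>'"
    using Suc.IH[OF state_ok_move[OF Suc.prems i tB tab[OF i] v]] by simp
   finally show "?E (plays (d i) (B - ?t) v) (\<lambda>l. ?E ?Q (\<lambda>f. sched ?n B (Suc m) c (?S (f(i := (?t, ?r) # l)))))
    = ?rw + lazy d m (c + 1) ?\<sigma>'" .
  qed
  also have "\<dots> = lazy d (Suc m) c \<sigma>" using Some fink by simp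
  finally show ?thesis by simp
 qed
qed simp

lemma lazy_late: "c \<ge> B \<Longrightarrow> lazy d m c \<sigma> = 0"
proof (induction m arbitrary: c \<sigma>)
 case (Suc m)
 then have "lazy d m (c + 1) \<sigma>' = 0" for \<sigma>' by simp
 then show ?case using Suc.prems by (simp split: option.split)
qed simp

section \<open>The rounding theorem\<close>

text \<open>For each arm a die with three faces, on which 0 keeps the arm, and the index of a table;
  both can be drawn by the random instruction of the machine.\<close>

definition seeds :: "nat \<Rightarrow> (nat \<Rightarrow> nat \<times> nat) pmf" where
 "seeds T = Pi_pmf {..<narms I} (0, 0) (\<lambda>_. pair_pmf (uniform_below 3) (uniform_below T))"

definition start :: "(nat \<Rightarrow> nat \<Rightarrow> 's \<Rightarrow> 'a option) \<Rightarrow> (nat \<Rightarrow> nat \<times> nat) \<Rightarrow> nat \<Rightarrow> 's \<times> nat \<times> nat" where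
 "start d w i = (root I i, if fst (w i) = 0 then adv (d (snd (w i))) 1 (root I i) else B + 1, 0)"

abbreviation seeded :: "(nat \<Rightarrow> nat \<Rightarrow> 's \<Rightarrow> 'a option) \<Rightarrow> (nat \<Rightarrow> nat \<times> nat) \<Rightarrow> nat \<Rightarrow> nat \<Rightarrow> 's \<Rightarrow> 'a option" where
 "seeded d w i \<equiv> d (snd (w i))"

lemma state_ok_start: "state_ok (seeded d w) (start d w)"
proof -
 have "1 \<le> adv (d r) 1 u \<and> (adv (d r) 1 u \<le> B \<longrightarrow> 0 < adv (d r) 1 u \<and> d r (adv (d r) 1 u) u \<noteq> None)" for r u
 proof (cases rule: adv_cases[of "d r" 1 u])
  case none then show ?thesis by simp
 next
  case some then show ?thesis by linarith
 qed
 then show ?thesis unfolding state_ok_def start_def using root_in dep_root by simp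
qed

lemma uniform_below_set: "T > 0 \<Longrightarrow> set_pmf (uniform_below T) = {..<T}"
 by (auto simp: uniform_below_def set_pmf_of_set lessThan_empty_iff)

lemma expectation_uniform_below:
 "T > 0 \<Longrightarrow> expect (uniform_below T) f = (\<Sum>r<T. f r) / (T :: nat)"
 by (simp add: uniform_below_def integral_pmf_of_set lessThan_empty_iff)

text \<open>Drawing a table uniformly makes the expected number of plays due by \<open>t\<close>,
  before thinning, at most \<open>t * (1 + \<delta> / 2)\<close>. So
  \<open>on_time_probability\<close> gives one success bound for all play times, and keeping an arm
  costs the factor 1/3.\<close>

theorem rounding:
 assumes tab: "\<And>r. r < T \<Longrightarrow> table (d r)" and T: "T > 0"
  and load: "\<And>t. t \<in> {1..B} \<Longrightarrow> (\<Sum>r<T. slot_load (d r) t) \<le> T * (1 + 1 / (2 * (B + 1)))"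
 shows "expect (seeds T) (\<lambda>w. lazy (seeded d w) (narms I * B) 0 (start d w))
  \<ge> 4/27 / (1 - 1 / (3 * (B + 1))) * ((\<Sum>r<T. table_reward (d r)) / T)"
proof -
 let ?n = "narms I" and ?E = expect
 define A where "A i = bind_pmf (uniform_below T) (\<lambda>r. plays (d r) B (root I i))" for i
 let ?U = "uniform_below T"
 have finU: "finite (set_pmf ?U)" "set_pmf ?U = {..<T}" using uniform_below_set[OF T] by auto
 have fin3: "finite (set_pmf (uniform_below 3))" using uniform_below_set[of 3] by simp
 have finp: "finite (set_pmf (plays (d r) k (root I i)))" if "i < ?n" for r k i
  using finite_plays[OF root_states[OF that]] .
 have finA: "finite (set_pmf (A i))" if "i < ?n" for i
  unfolding A_def using finU finp[OF that] by auto
 have EA: "?E (A i) (\<lambda>l. \<Sum>p\<leftarrow>l. h (fst p) (snd p)) = (\<Sum>r<T. pay (d r) (\<lambda>t a u. h t (rew I a u)) B (root I i)) / T"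
  if i: "i < ?n" for i h
 proof -
  have "?E (A i) (\<lambda>l. \<Sum>p\<leftarrow>l. h (fst p) (snd p)) = ?E ?U (\<lambda>r. ?E (plays (d r) B (root I i)) (\<lambda>l. \<Sum>p\<leftarrow>l. h (fst p) (snd p)))"
   unfolding A_def using finU finp[OF i] by (intro expectation_bind_finite) auto
  also have "\<dots> = ?E ?U (\<lambda>r. pay (d r) (\<lambda>t a u. h t (rew I a u)) B (root I i))"
   using finU tab i root_states dep_root by (intro expectation_cong_pmf expectation_plays) auto
  finally show ?thesis using expectation_uniform_below[OF T] by simp
 qed
 have finI: "finite (set_pmf (included (A i)))" if "i < ?n" for i
  using finA[OF that] fin3 by (auto simp: included_def split: if_splits)
 \<comment> \<open>For fixed seeds the play lists are independent. Averaging over the independent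
   seeds turns the law of each list into the thinned mixture over all tables.\<close>
 have mixture: "?E (seeds T) (\<lambda>w. lazy (seeded d w) (?n * B) 0 (start d w))
  = ?E (Pi_pmf {..<?n} [] (\<lambda>i. included (A i))) (\<lambda>\<omega>. sched ?n B (?n * B) 0 (\<lambda>i. (0, \<omega> i)))"
 proof -
  let ?g = "\<lambda>(w :: nat \<times> nat) i. if fst w = 0 then plays (d (snd w)) B (root I i) else return_pmf []"
  have g: "plays (d (snd (w i))) (B + 1 - fst (snd (start d w i))) (fst (start d w i)) = ?g (w i) i" for w i
   using plays_adv[of B "d (snd (w i))" "root I i"] by (simp add: start_def)
  have inc: "included (A i) = bind_pmf (pair_pmf (uniform_below 3) ?U) (\<lambda>w. ?g w i)" for i
   unfolding included_def A_def pair_pmf_def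
   by (simp add: bind_assoc_pmf bind_return_pmf if_distrib[of "bind_pmf _"] cong: if_cong)
    (intro bind_pmf_cong refl, auto)
  have seeded_tab: "table (seeded d w i)" if "w \<in> set_pmf (seeds T)" "i < ?n" for w i
  proof -
   have "w i \<in> set_pmf (pair_pmf (uniform_below 3) ?U)"
    using that unfolding seeds_def by (intro set_Pi_pmf_D[of "{..<?n}"]) auto
   then show ?thesis using finU tab by auto
  qed
  have "Pi_pmf {..<?n} [] (\<lambda>i. included (A i)) = bind_pmf (seeds T) (\<lambda>w. Pi_pmf {..<?n} [] (\<lambda>i. ?g (w i) i))"
   unfolding inc seeds_def by (rule Pi_pmf_bind) simp
  then have "?E (Pi_pmf {..<?n} [] (\<lambda>i. included (A i))) (\<lambda>\<omega>. sched ?n B (?n * B) 0 (\<lambda>i. (0, \<omega> i)))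
   = ?E (seeds T) (\<lambda>w. ?E (Pi_pmf {..<?n} [] (\<lambda>i. ?g (w i) i)) (\<lambda>\<omega>. sched ?n B (?n * B) 0 (\<lambda>i. (0, \<omega> i))))"
   using finp fin3 finU
   by (simp only: seeds_def) (intro expectation_bind_finite finite_set_Pi_pmf, auto)
  also have "\<dots> = ?E (seeds T) (\<lambda>w. lazy (seeded d w) (?n * B) 0 (start d w))"
  proof (rule expectation_cong_pmf)
   fix w assume "w \<in> set_pmf (seeds T)"
   then have "lazy (seeded d w) (?n * B) 0 (start d w)
    = ?E (Pi_pmf {..<?n} [] (\<lambda>i. plays (d (snd (w i))) (B + 1 - fst (snd (start d w i))) (fst (start d w i))))
    (\<lambda>\<omega>. sched ?n B (?n * B) 0 (\<lambda>i. (snd (snd (start d w i)), \<omega> i)))"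
    using seeded_tab by (intro lazy_sched state_ok_start)
   then show "?E (Pi_pmf {..<?n} [] (\<lambda>i. ?g (w i) i)) (\<lambda>\<omega>. sched ?n B (?n * B) 0 (\<lambda>i. (0, \<omega> i)))
    = lazy (seeded d w) (?n * B) 0 (start d w)"
    unfolding g by (simp add: start_def)
  qed
  finally show ?thesis by simp
 qed
 define \<delta> where "\<delta> = 1 / real (B + 1)"
 have \<delta>: "0 \<le> \<delta>" "\<delta> \<le> 1" by (auto simp: \<delta>_def)
 define s where "s = 4/9 / (1 - \<delta> / 3)"
 have "s * (\<Sum>i<?n. ?E (included (A i)) (\<lambda>l. \<Sum>p\<leftarrow>l. snd p))
  \<le> ?E (Pi_pmf {..<?n} [] (\<lambda>i. included (A i))) (\<lambda>\<omega>. sched ?n B (?n * B) 0 (\<lambda>i. (0, \<omega> i)))"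
 proof (rule expected_sched_lower)
  fix i l assume i: "i < ?n" and l: "l \<in> set_pmf (included (A i))"
  then have "l = [] \<or> (\<exists>r<T. l \<in> set_pmf (plays (d r) B (root I i)))"
   using finU by (auto simp: included_def A_def split: if_splits)
  then show "play_list B l \<and> length l \<le> B"
   using play_list_plays[OF tab, of _ B "root I i" l] root_states[OF i] by (auto simp: play_list_def)
 next
  fix i t assume i: "i < ?n" and t: "t \<in> {1..B}"
  have until: "real (plays_until t l) = (\<Sum>p\<leftarrow>l. if fst p \<le> t then 1 else 0)" for l
   by (induction l) (auto simp: plays_until_def)
  have "?E (A j) (\<lambda>l. real (plays_until t l)) = (\<Sum>r<T. \<Sum>\<tau>=1..t. pay (d r) (\<lambda>t a u. if t = \<tau> then 1 else 0) B (root I j)) / T"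
   if j: "j < ?n" for j
  proof -
   have "pay (d r) (\<lambda>t' a u. if t' \<le> t then 1 else 0) B u = (\<Sum>\<tau>=1..t. pay (d r) (\<lambda>t a u. if t = \<tau> then 1 else 0) B u)" for r u
    unfolding pay_sum[symmetric] by (rule pay_cong) (auto simp: sum.delta)
   then show ?thesis using EA[OF j, of "\<lambda>t' _. if t' \<le> t then 1 else 0"] by (simp add: until)
  qed
  then have "(\<Sum>j<?n. ?E (A j) (\<lambda>l. real (plays_until t l)))
    = (\<Sum>j<?n. \<Sum>r<T. \<Sum>\<tau>=1..t. pay (d r) (\<lambda>t a u. if t = \<tau> then 1 else 0) B (root I j)) / T"
   by (simp add: sum_divide_distrib)
  also have "(\<Sum>j<?n. \<Sum>r<T. \<Sum>\<tau>=1..t. pay (d r) (\<lambda>t a u. if t = \<tau> then 1 else 0) B (root I j))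
   = (\<Sum>\<tau>=1..t. \<Sum>r<T. slot_load (d r) \<tau>)"
  proof -
   have "(\<Sum>j<?n. \<Sum>r<T. \<Sum>\<tau>=1..t. f j r \<tau>) = (\<Sum>\<tau>=1..t. \<Sum>r<T. \<Sum>j<?n. f j r \<tau>)" for f :: "nat \<Rightarrow> nat \<Rightarrow> nat \<Rightarrow> real"
   proof -
    have "(\<Sum>j<?n. \<Sum>r<T. \<Sum>\<tau>=1..t. f j r \<tau>) = (\<Sum>j<?n. \<Sum>\<tau>=1..t. \<Sum>r<T. f j r \<tau>)"
     by (intro sum.cong refl sum.swap)
    also have "\<dots> = (\<Sum>\<tau>=1..t. \<Sum>j<?n. \<Sum>r<T. f j r \<tau>)" by (rule sum.swap)
    also have "\<dots> = (\<Sum>\<tau>=1..t. \<Sum>r<T. \<Sum>j<?n. f j r \<tau>)" by (intro sum.cong refl sum.swap)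
    finally show ?thesis .
   qed
   then show ?thesis unfolding slot_load_def .
  qed
  also have "\<dots> \<le> (\<Sum>\<tau>=1..t. T * (1 + 1 / (2 * (B + 1))))" using load t by (intro sum_mono) auto
  also have "\<dots> = T * (t * (1 + \<delta> / 2))" by (simp add: \<delta>_def)
  finally have "(\<Sum>j<?n. ?E (A j) (\<lambda>l. real (plays_until t l))) \<le> t * (1 + \<delta> / 2)"
   using T by (simp add: divide_right_mono pos_divide_le_eq mult.commute)
  \<comment> \<open>The claim amounts to \<open>\<delta> * (2 * t + 1) \<le> 2\<close>, which holds
    because \<open>t \<le> B\<close>; here the discreteness of time pays for the overload and leaves
    the slack \<open>\<delta>\<close>.\<close>
  moreover have "t * (1 + \<delta> / 2) * 2 \<le> (2 - \<delta>) * (real t + 1)"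
  proof -
   have "\<delta> * (1 + real t) \<le> 1" using t by (simp add: \<delta>_def field_simps)
   moreover have "\<delta> * real t \<le> 1" using t by (simp add: \<delta>_def field_simps)
   ultimately show ?thesis by (simp add: algebra_simps)
  qed
  ultimately have "(\<Sum>j<?n. ?E (A j) (\<lambda>l. real (plays_until t l))) * 2 \<le> (2 - \<delta>) * (real t + 1)"
   by linarith
  from on_time_probability[OF finA \<delta> i this]
  show "s \<le> ?E (Pi_pmf ({..<?n} - {i}) [] (\<lambda>i. included (A i))) (\<lambda>f. if on_time ?n f i t then 1 else 0)"
   unfolding s_def by simp
 qed (use finI in auto)
 also have "(\<Sum>i<?n. ?E (included (A i)) (\<lambda>l. \<Sum>p\<leftarrow>l. snd p)) = (\<Sum>r<T. table_reward (d r)) / T / 3"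
 proof -
  have "?E (included (A i)) (\<lambda>l. \<Sum>p\<leftarrow>l. snd p) = (\<Sum>r<T. pay (d r) (\<lambda>t a u. rew I a u) B (root I i)) / T / 3"
   if i: "i < ?n" for i
  proof -
   have "?E (included (A i)) (\<lambda>l. \<Sum>p\<leftarrow>l. snd p) = 1/3 * ?E (A i) (\<lambda>l. \<Sum>p\<leftarrow>l. snd p)"
    unfolding included_bernoulli using finA[OF i] by (subst expectation_bind_finite) auto
   then show ?thesis using EA[OF i, of "\<lambda>_ r. r"] by simp
  qed
  then have "(\<Sum>i<?n. ?E (included (A i)) (\<lambda>l. \<Sum>p\<leftarrow>l. snd p))
   = (\<Sum>i<?n. \<Sum>r<T. pay (d r) (\<lambda>t a u. rew I a u) B (root I i)) / T / 3"
   by (simp add: sum_divide_distrib)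
  also have "(\<Sum>i<?n. \<Sum>r<T. pay (d r) (\<lambda>t a u. rew I a u) B (root I i)) = (\<Sum>r<T. table_reward (d r))"
   unfolding table_reward_def by (rule sum.swap)
  finally show ?thesis .
 qed
 finally have fin: "s * ((\<Sum>r<T. table_reward (d r)) / T / 3)
  \<le> ?E (Pi_pmf {..<?n} [] (\<lambda>i. included (A i))) (\<lambda>\<omega>. sched ?n B (?n * B) 0 (\<lambda>i. (0, \<omega> i)))" .
 have s: "4/27 / (1 - \<delta> / 3) * Y = s * (Y / 3)" for Y by (simp add: s_def)
 have \<delta>3: "1 / (3 * (B + 1)) = \<delta> / 3" by (simp add: \<delta>_def)
 show ?thesis unfolding mixture \<delta>3 s by (rule fin)
qed

text \<open>The tables lose at most the factor \<open>f\<close>, and the slack in the on-time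
  probability wins back \<open>1 / f\<close>, so the constant against the LP is exact.\<close>

theorem rounded_dual_run:
 assumes run: "dual_run (free_value / step_scale) num_rounds q d"
  and pos: "free_value > 0" and n: "narms I \<ge> 1" and B: "B \<ge> 1"
  and feas: "PolyLP_feasible I B x s"
 shows "expect (seeds num_rounds) (\<lambda>w. lazy (seeded d w) (narms I * B) 0 (start d w))
  \<ge> 4/27 * PolyLP_objective I B x"
proof -
 let ?T = "num_rounds"
 define f where "f = 1 - 1 / (3 * real (B + 1))"
 have fpos: "f > 0" by (simp add: f_def field_simps)
 have T: "?T > 0" using n by (simp add: num_rounds_def)
 have "?T * (f * PolyLP_objective I B x) \<le> (\<Sum>r<?T. table_reward (d r))"
  using dual_run_near_optimal(1)[OF run pos n B feas] by (simp add: f_def)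
 then have "f * PolyLP_objective I B x \<le> (\<Sum>r<?T. table_reward (d r)) / ?T"
  using T by (simp add: pos_le_divide_eq mult.commute)
 then have "4/27 / f * (f * PolyLP_objective I B x) \<le> 4/27 / f * ((\<Sum>r<?T. table_reward (d r)) / ?T)"
  using fpos by (intro mult_left_mono) auto
 also have "\<dots> \<le> expect (seeds ?T) (\<lambda>w. lazy (seeded d w) (narms I * B) 0 (start d w))"
  using rounding[of ?T d, OF _ T dual_run_near_optimal(2)[OF run pos n B feas]] run
  by (simp add: f_def dual_run_def best_response_def)
 finally show ?thesis using fpos by simp
qed

section \<open>Adaptive policies\<close>

text \<open>A policy sees only the history, so it recovers the scheduler state from its own
  decisions and the nodes reached.\<close>

definition replay :: "(nat \<Rightarrow> nat \<Rightarrow> 's \<Rightarrow> 'a option) \<Rightarrow> (nat \<Rightarrow> 's \<times> nat \<times> nat) \<Rightarrow> ('s, 'a) history \<Rightarrow> nat \<Rightarrow> 's \<times> nat \<times> nat" where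
 "replay d \<sigma> h = fold (\<lambda>(x, p) \<sigma>. case x of None \<Rightarrow> \<sigma> | Some (i, a) \<Rightarrow> move d \<sigma> i (p i)) h \<sigma>"

definition replay_policy :: "(nat \<Rightarrow> nat \<Rightarrow> 's \<Rightarrow> 'a option) \<Rightarrow> (nat \<Rightarrow> 's \<times> nat \<times> nat) \<Rightarrow> ('s, 'a) policy" where
 "replay_policy d \<sigma> h = return_pmf (map_option (\<lambda>i. (i, choice d (replay d \<sigma> h) i)) (state_pick (replay d \<sigma> h)))"

lemma state_pick_D:
 assumes "state_ok d \<sigma>" "state_pick \<sigma> = Some i" "\<And>i. i < narms I \<Longrightarrow> table (d i)"
 shows "i < narms I" "fst (snd (\<sigma> i)) \<le> B" "fst (\<sigma> i) \<in> nodes I i" "choice d \<sigma> i \<in> acts I" "dep (fst (\<sigma> i)) < B"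
proof -
 show i: "i < narms I" using assms(2) unfolding state_pick_def by (rule pick_Some)
 have "prio B (fst (snd (\<sigma> i))) (snd (snd (\<sigma> i))) \<le> B" using assms(2) unfolding state_pick_def by (rule pick_Some)
 then show tB: "fst (snd (\<sigma> i)) \<le> B" by (auto simp: prio_def split: if_splits)
 obtain u t c where s: "\<sigma> i = (u, t, c)" by (cases "\<sigma> i")
 then have ok: "u \<in> nodes I i" "1 \<le> t" "t \<le> B" "dep u < t" "d i t u \<noteq> None"
  using assms(1) i tB unfolding state_ok_def by auto
 then show "fst (\<sigma> i) \<in> nodes I i" "dep (fst (\<sigma> i)) < B" using s by auto
 obtain a where a: "d i t u = Some a" using ok by auto
 have "t \<in> {1..B}" "u \<in> states I" using ok i nodes_states by auto
 then have "a \<in> acts I" using assms(3)[OF i] a unfolding table_def by blast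
 then show "choice d \<sigma> i \<in> acts I" using s a by (simp add: choice_def)
qed

text \<open>The reward earned so far plus the lazy value of the remaining run has constant
  expectation over the steps.\<close>

lemma play_replay:
 assumes \<sigma>: "state_ok d \<sigma>" and start: "\<And>i. i < narms I \<Longrightarrow> fst (\<sigma> i) = root I i"
  and tab: "\<And>i. i < narms I \<Longrightarrow> table (d i)"
 defines "\<pi> \<equiv> replay_policy d \<sigma>"
 shows "k \<le> B \<Longrightarrow> k \<le> m \<Longrightarrow> finite (set_pmf (play I B \<pi> k)) \<and>
  (\<forall>(h, e)\<in>set_pmf (play I B \<pi> k). clock e = k \<and> state_ok d (replay d \<sigma> h) \<and>
   (\<forall>i<narms I. pos e i = fst (replay d \<sigma> h i))) \<and>
  expect (play I B \<pi> k) (\<lambda>(h, e). earned e + lazy d (m - k) k (replay d \<sigma> h)) = lazy d m 0 \<sigma>"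
proof (induction k)
 case 0
 then show ?case using \<sigma> start by (simp add: init_env_def replay_def)
next
 case (Suc k)
 let ?E = expect and ?P = "play I B \<pi> k"
 have fin: "finite (set_pmf ?P)"
  and inv: "\<And>h e. (h, e) \<in> set_pmf ?P \<Longrightarrow> clock e = k \<and> state_ok d (replay d \<sigma> h) \<and>
   (\<forall>i<narms I. pos e i = fst (replay d \<sigma> h i))"
  and val: "?E ?P (\<lambda>(h, e). earned e + lazy d (m - k) k (replay d \<sigma> h)) = lazy d m 0 \<sigma>"
  using Suc by auto
 obtain m' where m': "m - k = Suc m'" "m - Suc k = m'" using Suc.prems by (metis Suc_diff_Suc Suc_le_eq)
 define nx where "nx h e = map_pmf (\<lambda>e'. (h @ [(map_option (\<lambda>i. (i, choice d (replay d \<sigma> h) i)) (state_pick (replay d \<sigma> h)), pos e')], e'))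
  (env_step I B (map_option (\<lambda>i. (i, choice d (replay d \<sigma> h) i)) (state_pick (replay d \<sigma> h))) e)" for h e
 have play: "play I B \<pi> (Suc k) = bind_pmf ?P (\<lambda>(h, e). nx h e)"
  unfolding \<pi>_def replay_policy_def by (simp add: bind_return_pmf nx_def)
 have step: "finite (set_pmf (nx h e)) \<and> (\<forall>(h', e')\<in>set_pmf (nx h e). clock e' = Suc k \<and> state_ok d (replay d \<sigma> h') \<and>
   (\<forall>i<narms I. pos e' i = fst (replay d \<sigma> h' i))) \<and>
  ?E (nx h e) (\<lambda>(h, e). earned e + lazy d m' (Suc k) (replay d \<sigma> h)) = earned e + lazy d (Suc m') k (replay d \<sigma> h)"
  if he: "(h, e) \<in> set_pmf ?P" for h e
 proof -
  let ?\<sigma> = "replay d \<sigma> h"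
  have ok: "clock e = k" "state_ok d ?\<sigma>" "\<And>i. i < narms I \<Longrightarrow> pos e i = fst (?\<sigma> i)" using inv[OF he] by auto
  have kB: "k < B" using Suc.prems by simp
  show ?thesis
  proof (cases "state_pick ?\<sigma>")
   case None
   then have "lazy d m' c ?\<sigma> = 0" for c by (cases m') simp_all
   then show ?thesis using None ok kB by (simp add: nx_def env_step_def replay_def)
  next
   case (Some i)
   note D = state_pick_D[OF ok(2) Some tab]
   let ?a = "choice d ?\<sigma> i" and ?u = "fst (?\<sigma> i)"
   have ker: "next_node I ?a ?u = kernel ?a ?u"
    using D nodes_states[OF D(1) D(3)] by (simp add: kernel_def)
   have nxt: "nx h e = map_pmf (\<lambda>v. (h @ [(Some (i, ?a), (pos e)(i := v))],
     \<lparr>pos = (pos e)(i := v), clock = Suc k, earned = earned e + rew I ?a ?u\<rparr>)) (kernel ?a ?u)"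
    using Some ok kB D by (simp add: nx_def env_step_def map_pmf_comp ker)
   have rep: "replay d \<sigma> (h @ [(Some (i, ?a), (pos e)(i := v))]) = move d ?\<sigma> i v" for v
    by (simp add: replay_def)
   have fk: "finite (set_pmf (kernel ?a ?u))" using finite_kernel nodes_states D by blast
   have "state_ok d (move d ?\<sigma> i v)" if "v \<in> set_pmf (kernel ?a ?u)" for v
    by (rule state_ok_move[OF ok(2) D(1,2) tab[OF D(1)] that])
   moreover have "((pos e)(i := v)) j = fst (move d ?\<sigma> i v j)" if "j < narms I" for v j
    using ok(3)[OF that] by (simp add: move_def)
   moreover have "?E (nx h e) (\<lambda>(h, e). earned e + lazy d m' (Suc k) (replay d \<sigma> h))
    = ?E (kernel ?a ?u) (\<lambda>v. earned e + rew I ?a ?u + lazy d m' (Suc k) (move d ?\<sigma> i v))"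
    unfolding nxt by (simp add: rep)
   moreover have "\<dots> = earned e + lazy d (Suc m') k ?\<sigma>"
    using fk Some kB by simp
   ultimately show ?thesis unfolding nxt using fk by (simp add: rep)
  qed
 qed
 have fin': "finite (set_pmf (play I B \<pi> (Suc k)))" unfolding play using fin step by auto
 have inv': "\<forall>(h, e)\<in>set_pmf (play I B \<pi> (Suc k)). clock e = Suc k \<and> state_ok d (replay d \<sigma> h) \<and>
   (\<forall>i<narms I. pos e i = fst (replay d \<sigma> h i))"
  unfolding play using step by fastforce
 have "?E (play I B \<pi> (Suc k)) (\<lambda>(h, e). earned e + lazy d m' (Suc k) (replay d \<sigma> h))
  = ?E ?P (\<lambda>p. ?E (case p of (h, e) \<Rightarrow> nx h e) (\<lambda>(h, e). earned e + lazy d m' (Suc k) (replay d \<sigma> h)))"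
  unfolding play using fin step by (intro expectation_bind_finite) auto
 also have "\<dots> = ?E ?P (\<lambda>(h, e). earned e + lazy d (m - k) k (replay d \<sigma> h))"
  using step m' by (intro expectation_cong_pmf) auto
 finally show ?case using fin' inv' val m' by simp
qed

lemma policy_reward_replay:
 assumes "state_ok d \<sigma>" "\<And>i. i < narms I \<Longrightarrow> fst (\<sigma> i) = root I i" "\<And>i. i < narms I \<Longrightarrow> table (d i)" "m \<ge> B"
 shows "policy_reward I B (replay_policy d \<sigma>) = lazy d m 0 \<sigma>"
proof -
 have "expect (play I B (replay_policy d \<sigma>) B) (\<lambda>(h, e). earned e + lazy d (m - B) B (replay d \<sigma> h)) = lazy d m 0 \<sigma>"
  using play_replay[OF assms(1-3), of B m] assms(4) by auto
 then show ?thesis by (simp add: lazy_late policy_reward_def)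
qed

text \<open>A pull takes one time step and descends one layer, so depth never exceeds the clock.
  Every pull that takes effect therefore starts at a depth below \<open>B\<close>, where the
  transition law is proper.\<close>

definition env_ok :: "'s env \<Rightarrow> bool" where
 "env_ok e \<longleftrightarrow> (\<forall>i<narms I. pos e i \<in> nodes I i \<and> dep (pos e i) \<le> clock e)"

lemma env_ok_init: "env_ok (init_env I)"
 using root_in dep_root by (simp add: env_ok_def init_env_def)

lemma env_ok_step:
 assumes e: "env_ok e" and e': "e' \<in> set_pmf (env_step I B x e)"
 shows "env_ok e' \<and> clock e' \<le> clock e + 1 \<and> earned e' \<ge> earned e \<and>
  (earned e' = earned e \<or> clock e' = clock e + 1 \<and> earned e' \<le> earned e + (\<Sum>a\<in>acts I. \<Sum>u\<in>states I. rew I a u))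
  \<and> clock e \<le> clock e' \<and> (clock e \<le> B \<longrightarrow> clock e' \<le> B)"
proof (cases "clock e < B \<and> (\<exists>i a. x = Some (i, a) \<and> i < narms I \<and> a \<in> acts I)")
 case False
 then have "e' = e \<or> clock e < B \<and> e' = e\<lparr>clock := clock e + 1\<rparr>"
  using e' by (auto simp: env_step_def split: option.splits if_splits)
 then show ?thesis using e by (auto simp: env_ok_def le_SucI)
next
 case True
 then obtain i a where x: "x = Some (i, a)" "i < narms I" "a \<in> acts I" and c: "clock e < B" by blast
 let ?u = "pos e i"
 have u: "?u \<in> nodes I i" "?u \<in> states I" "dep ?u < B" "dep ?u \<le> clock e"
  using e x c nodes_states[OF x(2)] by (auto simp: env_ok_def)
 obtain v where v: "v \<in> set_pmf (next_node I a ?u)"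
  and e'v: "e' = \<lparr>pos = (pos e)(i := v), clock = clock e + 1, earned = earned e + rew I a ?u\<rparr>"
  using e' x c by (auto simp: env_step_def)
 have "kernel a ?u = next_node I a ?u" using u x by (simp add: kernel_def)
 then have vn: "v \<in> nodes I i" using kernel_node[OF x(2) u(1), of v a] v by simp
 have "dep v = dep ?u + 1" using set_next_node[OF x(3) u(2,3) v] by simp
 then have "env_ok e'" using e vn u unfolding env_ok_def e'v by (auto simp: le_SucI)
 moreover have "rew I a ?u \<le> (\<Sum>a\<in>acts I. \<Sum>u\<in>states I. rew I a u)"
 proof -
  have "rew I a ?u \<le> (\<Sum>u\<in>states I. rew I a u)" using u x rew_nn fin_states by (intro member_le_sum) auto
  also have "\<dots> \<le> (\<Sum>a\<in>acts I. \<Sum>u\<in>states I. rew I a u)"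
   using x rew_nn fin_acts by (intro member_le_sum) (auto intro: sum_nonneg)
  finally show ?thesis .
 qed
 ultimately show ?thesis using c rew_nn[OF x(3) u(2)] by (simp add: e'v)
qed

lemma play_bounds:
 "(h, e) \<in> set_pmf (play I B \<pi> k) \<Longrightarrow> env_ok e \<and> clock e \<le> B \<and> 0 \<le> earned e \<and>
  earned e \<le> clock e * (\<Sum>a\<in>acts I. \<Sum>u\<in>states I. rew I a u)"
proof (induction k arbitrary: h e)
 case 0
 then show ?case using env_ok_init by (simp add: init_env_def)
next
 case (Suc k)
 let ?R = "\<Sum>a\<in>acts I. \<Sum>u\<in>states I. rew I a u"
 have R: "?R \<ge> 0" using rew_nn by (intro sum_nonneg) auto
 obtain h0 e0 x where p: "(h0, e0) \<in> set_pmf (play I B \<pi> k)" and e: "e \<in> set_pmf (env_step I B x e0)"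
  using Suc.prems by auto
 note s = env_ok_step[OF Suc.IH[OF p, THEN conjunct1] e] and IH = Suc.IH[OF p]
 have "earned e \<le> clock e * ?R"
 proof (cases "earned e = earned e0")
  case True
  have "clock e0 * ?R \<le> clock e * ?R" using s R by (intro mult_right_mono) auto
  then show ?thesis using True IH by linarith
 next
  case False
  then have "clock e = clock e0 + 1" "earned e \<le> earned e0 + ?R" using s by auto
  then show ?thesis using IH by (simp add: algebra_simps)
 qed
 then show ?case using s IH by auto
qed

text \<open>The uniform upper bound makes the supremum in \<open>OPT_adaptive\<close> bound each
  single policy.\<close>

lemma policy_reward_bounds: "0 \<le> policy_reward I B \<pi>" "policy_reward I B \<pi> \<le> B * (\<Sum>a\<in>acts I. \<Sum>u\<in>states I. rew I a u)"
proof -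
 let ?R = "\<Sum>a\<in>acts I. \<Sum>u\<in>states I. rew I a u"
 have R: "?R \<ge> 0" using rew_nn by (intro sum_nonneg) auto
 have b: "0 \<le> earned (snd p) \<and> earned (snd p) \<le> B * ?R" if "p \<in> set_pmf (play I B \<pi> B)" for p
 proof -
  have "(fst p, snd p) \<in> set_pmf (play I B \<pi> B)" using that by simp
  from play_bounds[OF this] have "0 \<le> earned (snd p)" "earned (snd p) \<le> clock (snd p) * ?R" "clock (snd p) \<le> B" by auto
  moreover have "clock (snd p) * ?R \<le> B * ?R" using R calculation by (intro mult_right_mono) auto
  ultimately show ?thesis by linarith
 qed
 have reward: "policy_reward I B \<pi> = expect (play I B \<pi> B) (\<lambda>p. earned (snd p))"
  unfolding policy_reward_def by (intro expectation_cong_pmf) auto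
 show "0 \<le> policy_reward I B \<pi>" unfolding reward using b by (intro expectation_nonneg_pmf) auto
 have int: "integrable (play I B \<pi> B) (\<lambda>p. earned (snd p))"
  using b by (intro measure_pmf.integrable_const_bound[where B = "B * ?R"]) (auto simp: AE_measure_pmf_iff)
 show "policy_reward I B \<pi> \<le> B * ?R" unfolding reward
  using int b by (intro measure_pmf.integral_le_const) (auto simp: AE_measure_pmf_iff)
qed

lemma policy_reward_le_OPT: "policy_reward I B \<pi> \<le> OPT_adaptive I B"
 unfolding OPT_adaptive_def
 by (rule cSUP_upper) (auto intro!: bdd_aboveI2 policy_reward_bounds(2))

text \<open>Settles the instances for which the step size of the subgradient method would be 0 or
  have denominator 0.\<close>

lemma objective_trivial:
 assumes "PolyLP_feasible I B x s" "\<not> (free_value > 0 \<and> narms I \<ge> 1 \<and> B \<ge> 1)"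
 shows "PolyLP_objective I B x \<le> 0"
proof -
 have "PolyLP_objective I B x \<le> free_value"
  using weak_duality[OF assms(1), of "\<lambda>_. 0"] by (simp add: free_value_def)
 moreover have "free_value \<le> 0"
 proof (cases "narms I \<ge> 1 \<and> B \<ge> 1")
  case False
  then have "narms I = 0 \<or> B = 0" by linarith
  moreover have "k = 0 \<Longrightarrow> val l k u = 0" for k l u by simp
  ultimately have "(\<Sum>i<narms I. val (\<lambda>_. 0) B (root I i)) = 0" by fastforce
  then show ?thesis unfolding free_value_def by simp
 qed (use assms(2) in linarith)
 ultimately show ?thesis by linarith
qed

text \<open>Fixing the seeds turns the randomized schedule into a deterministic adaptive policy, so
  the average over the seeds is at most the best policy reward.\<close>

lemma objective_le_adaptive:
 assumes feas: "PolyLP_feasible I B x s"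
 shows "PolyLP_objective I B x \<le> 27/4 * OPT_adaptive I B"
proof (cases "free_value > 0 \<and> narms I \<ge> 1 \<and> B \<ge> 1")
 case True
 then have pos: "free_value > 0" "narms I \<ge> 1" "B \<ge> 1" by auto
 obtain q d where run: "dual_run (free_value / step_scale) num_rounds q d" using dual_run_exists by blast
 let ?f = "\<lambda>w. lazy (seeded d w) (narms I * B) 0 (start d w)"
 have T: "num_rounds > 0" using pos by (simp add: num_rounds_def)
 have fin: "finite (set_pmf (seeds num_rounds))"
  unfolding seeds_def using uniform_below_set[OF T] uniform_below_set[of 3] by (intro finite_set_Pi_pmf) auto
 have le: "?f w \<le> OPT_adaptive I B" if w: "w \<in> set_pmf (seeds num_rounds)" for w
 proof -
  have tab: "table (seeded d w i)" if i: "i < narms I" for i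
  proof -
   have "w i \<in> set_pmf (pair_pmf (uniform_below 3) (uniform_below num_rounds))"
    using w i unfolding seeds_def by (intro set_Pi_pmf_D[of "{..<narms I}"]) auto
   then show ?thesis using uniform_below_set[OF T] run by (auto simp: dual_run_def best_response_def)
  qed
  have "B \<le> narms I * B" using pos by simp
  then have "?f w = policy_reward I B (replay_policy (seeded d w) (start d w))"
   using tab by (intro policy_reward_replay[symmetric] state_ok_start) (auto simp: start_def)
  then show ?thesis using policy_reward_le_OPT by simp
 qed
 have "4/27 * PolyLP_objective I B x \<le> expect (seeds num_rounds) ?f"
  by (rule rounded_dual_run[OF run pos feas])
 also have "\<dots> \<le> expect (seeds num_rounds) (\<lambda>_. OPT_adaptive I B)"
  using fin le by (rule expectation_mono_finite)
 finally show ?thesis by simp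
next
 case False
 have "0 \<le> OPT_adaptive I B" using policy_reward_bounds(1) policy_reward_le_OPT order_trans by blast
 then show ?thesis using objective_trivial[OF feas False] by linarith
qed

lemma OPT_PolyLP_le:
 assumes "\<And>x s. PolyLP_feasible I B x s \<Longrightarrow> PolyLP_objective I B x \<le> c"
 shows "OPT_PolyLP I B \<le> c"
 unfolding OPT_PolyLP_def
proof (rule cSup_least)
 have "PolyLP_feasible I B (\<lambda>_ _ _. 0) (\<lambda>u _. if u \<in> root I ` {..<narms I} then 1 else 0)"
  unfolding PolyLP_feasible_def by auto
 then show "{PolyLP_objective I B x |x s. PolyLP_feasible I B x s} \<noteq> {}" by blast
qed (use assms in auto)

end

lemma bandit_of_valid:
 assumes "valid_mab I B"
 obtains dep where "bandit I B dep"
proof -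
 obtain dep :: "'a \<Rightarrow> nat" where dep: "\<forall>i<narms I. dep (root I i) = 0"
  "\<forall>a\<in>acts I. \<forall>u\<in>states I. \<forall>v\<in>states I. prob I a u v > 0 \<longrightarrow> dep v = dep u + 1"
  "\<forall>a\<in>acts I. \<forall>u\<in>states I. dep u < B \<longrightarrow> (\<Sum>v\<in>states I. prob I a u v) = 1"
  using assms unfolding valid_mab_def by metis
 have "bandit I B dep"
  by unfold_locales (use assms dep in \<open>auto simp: valid_mab_def\<close>)
 then show ?thesis by (rule that)
qed

section \<open>A compiler for bounded loop programs\<close>

text \<open>A power of a base that is at least 2 absorbs constants, sums and products alike, which
  keeps the closure rules short.\<close>

definition poly_bounded :: "('x \<Rightarrow> nat) \<Rightarrow> ('x \<Rightarrow> nat) \<Rightarrow> bool" where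
 "poly_bounded s f \<longleftrightarrow> (\<exists>C. \<forall>x. f x \<le> (s x + 2) ^ C)"

lemma poly_bounded_le: "(\<And>x. f x \<le> s x) \<Longrightarrow> poly_bounded s f"
 unfolding poly_bounded_def by (rule exI[of _ 1]) (simp add: le_SucI)

lemma poly_bounded_const: "poly_bounded s (\<lambda>x. c)"
 unfolding poly_bounded_def
proof (intro exI allI)
 fix x
 have "c \<le> 2 ^ c" using less_exp[of c] by (rule less_imp_le)
 also have "\<dots> \<le> (s x + 2) ^ c" by (rule power_mono) simp_all
 finally show "c \<le> (s x + 2) ^ c" .
qed

lemma poly_bounded_mult: "poly_bounded s f \<Longrightarrow> poly_bounded s g \<Longrightarrow> poly_bounded s (\<lambda>x. f x * g x)"
 unfolding poly_bounded_def by (metis mult_le_mono power_add)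

lemma poly_bounded_add:
 assumes "poly_bounded s f" "poly_bounded s g"
 shows "poly_bounded s (\<lambda>x. f x + g x)"
proof -
 obtain C D where C: "\<And>x. f x \<le> (s x + 2) ^ C" and D: "\<And>x. g x \<le> (s x + 2) ^ D"
  using assms unfolding poly_bounded_def by blast
 have "f x + g x \<le> (s x + 2) ^ (C + D + 1)" for x
 proof -
  have "f x \<le> (s x + 2) ^ (C + D)" "g x \<le> (s x + 2) ^ (C + D)"
   using C[of x] D[of x] power_increasing[of C "C + D" "s x + 2"] power_increasing[of D "C + D" "s x + 2"] by linarith+
  then have "f x + g x \<le> 2 * (s x + 2) ^ (C + D)" by linarith
  also have "\<dots> \<le> (s x + 2) * (s x + 2) ^ (C + D)" by (rule mult_le_mono1) simp
  finally show ?thesis by simp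
 qed
 then show ?thesis unfolding poly_bounded_def by blast
qed

lemma poly_bounded_power: "poly_bounded s f \<Longrightarrow> poly_bounded s (\<lambda>x. f x ^ k)"
 by (induction k) (simp_all add: poly_bounded_const poly_bounded_mult)

section \<open>Execution of machine commands with a cost bound\<close>

locale machine =
 fixes xs :: "nat list" and I :: "(nat, nat) mab" and B :: nat
begin

text \<open>Generalizes \<open>run\<close> to arbitrary initial configurations, so that a run can be
  cut into pieces.\<close>

definition steps :: "nat \<Rightarrow> config \<Rightarrow> config pmf" where
 "steps k g = ((\<lambda>D. bind_pmf D (step xs I B)) ^^ k) (return_pmf g)"

lemma steps_0: "steps 0 g = return_pmf g"
 by (simp add: steps_def)

lemma steps_Suc: "steps (Suc k) g = bind_pmf (steps k g) (step xs I B)"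
 by (simp add: steps_def)

lemma steps_Suc': "steps (Suc k) g = bind_pmf (step xs I B g) (steps k)"
proof (induction k)
 case 0
 have "bind_pmf (step xs I B g) return_pmf = step xs I B g" by (rule bind_return_pmf')
 then show ?case by (simp add: steps_Suc steps_0 bind_return_pmf cong: bind_pmf_cong)
next
 case (Suc k)
 have "steps (Suc (Suc k)) g = bind_pmf (bind_pmf (step xs I B g) (steps k)) (step xs I B)"
  using Suc by (simp add: steps_Suc)
 also have "\<dots> = bind_pmf (step xs I B g) (\<lambda>h. bind_pmf (steps k h) (step xs I B))"
  by (rule bind_assoc_pmf)
 also have "\<dots> = bind_pmf (step xs I B g) (steps (Suc k))"
  by (rule bind_pmf_cong) (simp_all add: steps_Suc)
 finally show ?case .
qed

lemma run_steps: "run c xs I B k = steps k (init_config c I)"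
 by (induction k) (simp_all add: steps_0 steps_Suc)

text \<open>\<open>ends W g E\<close>: from \<open>g\<close>, the machine halts at total cost at most \<open>W\<close>, with environment distributed
 as \<open>E\<close>.\<close>

definition ends :: "nat \<Rightarrow> config \<Rightarrow> nat env pmf \<Rightarrow> bool" where
 "ends W g E \<longleftrightarrow> (\<forall>k. W \<le> k + cost g \<longrightarrow>
  map_pmf env (steps k g) = E \<and> (\<forall>h\<in>set_pmf (steps k g). halted h \<and> cost h \<le> W))"

lemma ends_halted:
 assumes "w \<le> W"
 shows "ends W \<lparr>todo = [], mem = R, env = e, cost = w\<rparr> (return_pmf e)"
proof -
 have "steps k \<lparr>todo = [], mem = R, env = e, cost = w\<rparr> = return_pmf \<lparr>todo = [], mem = R, env = e, cost = w\<rparr>" for k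
  by (induction k) (simp_all add: steps_0 steps_Suc bind_return_pmf step_def)
 then show ?thesis using assms by (simp add: ends_def)
qed

text \<open>Each step costs at least 1, so the sum of the remaining step count and the cost does not
  drop when a step is taken off.\<close>

lemma ends_step:
 assumes "\<And>h. h \<in> set_pmf (step xs I B g) \<Longrightarrow> cost g < cost h \<and> ends W h (E h)"
 shows "ends W g (bind_pmf (step xs I B g) E)"
 unfolding ends_def
proof (intro allI impI)
 fix k assume k: "W \<le> k + cost g"
 obtain h where h: "h \<in> set_pmf (step xs I B g)" using set_pmf_not_empty by fast
 show "map_pmf env (steps k g) = bind_pmf (step xs I B g) E \<and> (\<forall>h\<in>set_pmf (steps k g). halted h \<and> cost h \<le> W)"
 proof (cases k)
  case 0
  then have "W \<le> 0 + cost h" using k assms[OF h] by simp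
  then have "\<forall>h'\<in>set_pmf (steps 0 h). cost h' \<le> W" using assms[OF h] unfolding ends_def by blast
  then have "cost h \<le> W" by (simp add: steps_0)
  then show ?thesis using 0 k assms[OF h] by simp
 next
  case (Suc k')
  have "map_pmf env (steps k' h) = E h \<and> (\<forall>h'\<in>set_pmf (steps k' h). halted h' \<and> cost h' \<le> W)"
   if "h \<in> set_pmf (step xs I B g)" for h
  proof -
   have "W \<le> k' + cost h" using assms[OF that] k Suc by simp
   then show ?thesis using assms[OF that] unfolding ends_def by blast
  qed
  then show ?thesis unfolding Suc steps_Suc' map_bind_pmf by (auto intro!: bind_pmf_cong)
 qed
qed

text \<open>Correctness in continuation form, so that commands compose without any description of
  intermediate configurations. The final cost is only bounded, not fixed, because it may vary with
  the random outcome.\<close>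

definition sound :: "com \<Rightarrow> (nat \<Rightarrow> nat) \<Rightarrow> nat env \<Rightarrow> ((nat \<Rightarrow> nat) \<times> nat env) pmf \<Rightarrow> nat \<Rightarrow> bool" where
 "sound c R e D w \<longleftrightarrow> (\<forall>K W w0 E.
  (\<forall>p\<in>set_pmf D. \<forall>w1\<le>w0 + w. ends W \<lparr>todo = K, mem = fst p, env = snd p, cost = w1\<rparr> (E p)) \<longrightarrow>
  ends W \<lparr>todo = c # K, mem = R, env = e, cost = w0\<rparr> (bind_pmf D E))"

lemma soundD:
 assumes "sound c R e D w"
  and "\<And>p w1. p \<in> set_pmf D \<Longrightarrow> w1 \<le> w0 + w \<Longrightarrow> ends W \<lparr>todo = K, mem = fst p, env = snd p, cost = w1\<rparr> (E p)"
 shows "ends W \<lparr>todo = c # K, mem = R, env = e, cost = w0\<rparr> (bind_pmf D E)"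
 using assms unfolding sound_def by blast

lemma sound_mono: "sound c R e D w \<Longrightarrow> w \<le> w' \<Longrightarrow> sound c R e D w'"
 unfolding sound_def by (meson add_left_mono order_trans)

lemma sound_prim:
 assumes "\<And>K w0. exec xs I B c K R e w0 = map_pmf (\<lambda>p. \<lparr>todo = K, mem = fst p, env = snd p, cost = w0 + w\<rparr>) D"
  and "w > 0"
 shows "sound c R e D w"
 unfolding sound_def
proof (intro allI impI)
 fix K W w0 E
 assume a: "\<forall>p\<in>set_pmf D. \<forall>w1\<le>w0 + w. ends W \<lparr>todo = K, mem = fst p, env = snd p, cost = w1\<rparr> (E p)"
 let ?g = "\<lparr>todo = c # K, mem = R, env = e, cost = w0\<rparr>"
 have st: "step xs I B ?g = map_pmf (\<lambda>p. \<lparr>todo = K, mem = fst p, env = snd p, cost = w0 + w\<rparr>) D"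
  by (simp add: step_def assms(1))
 have "ends W ?g (bind_pmf (step xs I B ?g) (\<lambda>h. E (mem h, env h)))"
  by (rule ends_step) (use a assms(2) in \<open>auto simp: st\<close>)
 then show "ends W ?g (bind_pmf D E)" by (simp add: st bind_map_pmf)
qed

lemma sound_Seq:
 assumes "sound c R e D w" "\<And>p. p \<in> set_pmf D \<Longrightarrow> sound c' (fst p) (snd p) (D' p) w'"
 shows "sound (Seq c c') R e (bind_pmf D D') (w + w' + 1)"
 unfolding sound_def
proof (intro allI impI)
 fix K W w0 E
 assume a: "\<forall>p\<in>set_pmf (bind_pmf D D'). \<forall>w1\<le>w0 + (w + w' + 1). ends W \<lparr>todo = K, mem = fst p, env = snd p, cost = w1\<rparr> (E p)"
 let ?g = "\<lparr>todo = Seq c c' # K, mem = R, env = e, cost = w0\<rparr>"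
 have st: "step xs I B ?g = return_pmf \<lparr>todo = c # c' # K, mem = R, env = e, cost = w0 + 1\<rparr>"
  by (simp add: step_def)
 have "ends W \<lparr>todo = c # c' # K, mem = R, env = e, cost = w0 + 1\<rparr> (bind_pmf D (\<lambda>p. bind_pmf (D' p) E))"
 proof (rule soundD[OF assms(1)])
  fix p w1 assume p: "p \<in> set_pmf D" and w1: "w1 \<le> w0 + 1 + w"
  show "ends W \<lparr>todo = c' # K, mem = fst p, env = snd p, cost = w1\<rparr> (bind_pmf (D' p) E)"
   by (rule soundD[OF assms(2)[OF p]]) (use a p w1 in auto)
 qed
 then have "ends W ?g (bind_pmf (step xs I B ?g) (\<lambda>_. bind_pmf D (\<lambda>p. bind_pmf (D' p) E)))"
  by (intro ends_step) (auto simp: st)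
 then show "ends W ?g (bind_pmf (bind_pmf D D') E)" by (simp add: st bind_assoc_pmf bind_return_pmf)
qed

lemma sound_If:
 assumes "sound (if R r \<noteq> 0 then c else c') R e D w"
 shows "sound (If r c c') R e D (w + 1 + len (R r))"
 unfolding sound_def
proof (intro allI impI)
 fix K W w0 E
 assume a: "\<forall>p\<in>set_pmf D. \<forall>w1\<le>w0 + (w + 1 + len (R r)). ends W \<lparr>todo = K, mem = fst p, env = snd p, cost = w1\<rparr> (E p)"
 let ?g = "\<lparr>todo = If r c c' # K, mem = R, env = e, cost = w0\<rparr>"
 let ?h = "\<lparr>todo = (if R r \<noteq> 0 then c else c') # K, mem = R, env = e, cost = w0 + 1 + len (R r)\<rparr>"
 have st: "step xs I B ?g = return_pmf ?h" by (simp add: step_def)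
 have "ends W ?h (bind_pmf D E)"
  by (rule soundD[OF assms]) (use a in auto)
 then have "ends W ?g (bind_pmf (step xs I B ?g) (\<lambda>_. bind_pmf D E))"
  by (intro ends_step) (auto simp: st)
 then show "ends W ?g (bind_pmf D E)" by (simp add: st bind_return_pmf)
qed

lemma sound_While_False:
 assumes "R r = 0"
 shows "sound (While r c) R e (return_pmf (R, e)) 1"
 by (rule sound_prim) (use assms in \<open>auto simp: floorlog_def\<close>)

lemma sound_While_True:
 assumes "R r \<noteq> 0" "sound c R e D w" "\<And>p. p \<in> set_pmf D \<Longrightarrow> sound (While r c) (fst p) (snd p) (D' p) w'"
 shows "sound (While r c) R e (bind_pmf D D') (w + w' + 1 + len (R r))"
 unfolding sound_def
proof (intro allI impI)
 fix K W w0 E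
 assume a: "\<forall>p\<in>set_pmf (bind_pmf D D'). \<forall>w1\<le>w0 + (w + w' + 1 + len (R r)). ends W \<lparr>todo = K, mem = fst p, env = snd p, cost = w1\<rparr> (E p)"
 let ?g = "\<lparr>todo = While r c # K, mem = R, env = e, cost = w0\<rparr>"
 let ?h = "\<lparr>todo = c # While r c # K, mem = R, env = e, cost = w0 + 1 + len (R r)\<rparr>"
 have st: "step xs I B ?g = return_pmf ?h" using assms(1) by (simp add: step_def)
 have "ends W ?h (bind_pmf D (\<lambda>p. bind_pmf (D' p) E))"
 proof (rule soundD[OF assms(2)])
  fix p w1 assume p: "p \<in> set_pmf D" and w1: "w1 \<le> w0 + 1 + len (R r) + w"
  show "ends W \<lparr>todo = While r c # K, mem = fst p, env = snd p, cost = w1\<rparr> (bind_pmf (D' p) E)"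
   by (rule soundD[OF assms(3)[OF p]]) (use a p w1 in auto)
 qed
 then have "ends W ?g (bind_pmf (step xs I B ?g) (\<lambda>_. bind_pmf D (\<lambda>p. bind_pmf (D' p) E)))"
  by (intro ends_step) (auto simp: st)
 then show "ends W ?g (bind_pmf (bind_pmf D D') E)" by (simp add: st bind_assoc_pmf bind_return_pmf)
qed

text \<open>For commands without randomness that leave the environment alone, a single final memory
  replaces the law.\<close>

definition dsound :: "com \<Rightarrow> (nat \<Rightarrow> nat) \<Rightarrow> (nat \<Rightarrow> nat) \<Rightarrow> nat \<Rightarrow> bool" where
 "dsound c R R' w \<longleftrightarrow> (\<forall>e. sound c R e (return_pmf (R', e)) w)"

lemma dsound_Seq: "dsound c R R' w \<Longrightarrow> dsound c' R' R'' w' \<Longrightarrow> dsound (Seq c c') R R'' (w + w' + 1)"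
 unfolding dsound_def
proof
 fix e assume a: "\<forall>e. sound c R e (return_pmf (R', e)) w" "\<forall>e. sound c' R' e (return_pmf (R'', e)) w'"
 have "sound (Seq c c') R e (bind_pmf (return_pmf (R', e)) (\<lambda>p. return_pmf (R'', snd p))) (w + w' + 1)"
  by (rule sound_Seq) (use a in auto)
 then show "sound (Seq c c') R e (return_pmf (R'', e)) (w + w' + 1)" by (simp add: bind_return_pmf)
qed

lemma dsound_mono: "dsound c R R' w \<Longrightarrow> w \<le> w' \<Longrightarrow> dsound c R R' w'"
 unfolding dsound_def using sound_mono by blast

lemma dsound_Const: "dsound (Const d c) R (R(d := c)) (1 + len c)"
 unfolding dsound_def by (intro allI sound_prim) auto

lemma dsound_Op: "dsound (Op f d r s) R (R(d := eval_binop f (R r) (R s))) (1 + len (R r) + len (R s))"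
 unfolding dsound_def by (intro allI sound_prim) auto

lemma dsound_Load: "dsound (Load d r) R (R(d := R (R r))) (1 + len (R r) + len (R (R r)))"
 unfolding dsound_def by (intro allI sound_prim) auto

lemma dsound_Store: "dsound (Store r s) R (R(R r := R s)) (1 + len (R r) + len (R s))"
 unfolding dsound_def by (intro allI sound_prim) auto

lemma dsound_Input: "dsound (Input d r) R (R(d := lookup xs (R r))) (1 + len (R r) + len (lookup xs (R r)))"
 unfolding dsound_def by (intro allI sound_prim) auto

lemma sound_dsound_Seq:
 assumes "dsound c R R' w" "sound c' R' e D w'"
 shows "sound (Seq c c') R e D (w + w' + 1)"
proof -
 have "sound (Seq c c') R e (bind_pmf (return_pmf (R', e)) (\<lambda>_. D)) (w + w' + 1)"
  by (rule sound_Seq) (use assms in \<open>auto simp: dsound_def\<close>)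
 then show ?thesis by (simp add: bind_return_pmf)
qed

lemma sound_Seq_dsound:
 assumes "sound c R e D w" "\<And>p. p \<in> set_pmf D \<Longrightarrow> dsound c' (fst p) (f (fst p)) w'"
 shows "sound (Seq c c') R e (map_pmf (\<lambda>p. (f (fst p), snd p)) D) (w + w' + 1)"
proof -
 have "sound (Seq c c') R e (bind_pmf D (\<lambda>p. return_pmf (f (fst p), snd p))) (w + w' + 1)"
  by (rule sound_Seq) (use assms in \<open>auto simp: dsound_def\<close>)
 then show ?thesis by (simp add: map_pmf_def)
qed

section \<open>Compilation of expressions\<close>

text \<open>Memory is split into arrays: cell \<open>i\<close> of array \<open>k < 64\<close> has address \<open>64 * i + k\<close>. Array 0 holds
 temporaries, cell 0 of arrays 1 and 2 the bounds for stored values and for loop counts.\<close>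

datatype expr = Num nat | Arr nat expr | Inp expr | Bin binop expr expr

abbreviation view :: "(nat \<Rightarrow> nat) \<Rightarrow> nat \<Rightarrow> nat \<Rightarrow> nat" where
 "view R k i \<equiv> R (64 * i + k)"

primrec ev :: "(nat \<Rightarrow> nat \<Rightarrow> nat) \<Rightarrow> expr \<Rightarrow> nat" where
 "ev S (Num c) = c"
| "ev S (Arr k e) = S k (ev S e)"
| "ev S (Inp e) = lookup xs (ev S e)"
| "ev S (Bin f a b) = eval_binop f (ev S a) (ev S b)"

primrec wf_expr :: "expr \<Rightarrow> bool" where
 "wf_expr (Num c) = True"
| "wf_expr (Arr k e) = (0 < k \<and> k < 64 \<and> wf_expr e)"
| "wf_expr (Inp e) = wf_expr e"
| "wf_expr (Bin f a b) = (wf_expr a \<and> wf_expr b)"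

text \<open>Growth of bit lengths: over memory and input numbers of at most \<open>L\<close> bits,
  the value of an expression has at most \<open>esize e * L\<close> bits.\<close>

primrec esize :: "expr \<Rightarrow> nat" where
 "esize (Num c) = len c + 1"
| "esize (Arr k e) = esize e + 1"
| "esize (Inp e) = esize e + 1"
| "esize (Bin f a b) = esize a + esize b"

definition comp_addr :: "nat \<Rightarrow> nat \<Rightarrow> com" where
 "comp_addr s k = Seq (Const (64 * (s + 1)) 64) (Seq (Op Mul (64 * s) (64 * s) (64 * (s + 1)))
  (Seq (Const (64 * (s + 1)) k) (Op Add (64 * s) (64 * s) (64 * (s + 1)))))"

text \<open>Temporaries form a stack: the result is left in cell \<open>64 * s\<close>, and only
  temporaries from \<open>s\<close> on are overwritten.\<close>

primrec comp :: "nat \<Rightarrow> expr \<Rightarrow> com" where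
 "comp s (Num c) = Const (64 * s) c"
| "comp s (Arr k e) = Seq (comp s e) (Seq (comp_addr s k) (Load (64 * s) (64 * s)))"
| "comp s (Inp e) = Seq (comp s e) (Input (64 * s) (64 * s))"
| "comp s (Bin f a b) = Seq (comp s a) (Seq (comp (s + 1) b) (Op f (64 * s) (64 * s) (64 * (s + 1))))"

primrec ecost :: "expr \<Rightarrow> nat" where
 "ecost (Num c) = 1 + len c"
| "ecost (Arr k e) = ecost e + 4 * esize e + 70"
| "ecost (Inp e) = ecost e + esize e + 4"
| "ecost (Bin f a b) = ecost a + ecost b + esize a + esize b + 3"

definition agree :: "nat \<Rightarrow> (nat \<Rightarrow> nat) \<Rightarrow> (nat \<Rightarrow> nat) \<Rightarrow> bool" where
 "agree s R R' \<longleftrightarrow> (\<forall>a. a mod 64 \<noteq> 0 \<or> a < 64 * s \<longrightarrow> R' a = R a)"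

definition bounded :: "nat \<Rightarrow> (nat \<Rightarrow> nat) \<Rightarrow> bool" where
 "bounded L R \<longleftrightarrow> L > 0 \<and> (\<forall>a. a mod 64 \<noteq> 0 \<longrightarrow> R a < 2 ^ L) \<and> (\<forall>x\<in>set xs. x < 2 ^ L)"

lemma len_le: "x < 2 ^ n \<Longrightarrow> len x \<le> n"
 by (rule floorlog_leI) auto

lemma less_len: "x < 2 ^ len x"
 by (rule floorlog_leD) auto

lemma len_mono: "x \<le> y \<Longrightarrow> len x \<le> len y"
 by (rule floorlog_mono)

lemma agree_trans: "agree s R R' \<Longrightarrow> agree s R' R'' \<Longrightarrow> agree s R R''"
 by (simp add: agree_def)

lemma agree_Suc: "agree (s + 1) R R' \<Longrightarrow> agree s R R'"
 by (simp add: agree_def)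

lemma agree_temp: "agree s R (R(64 * t := v))" if "s \<le> t"
 using that by (auto simp: agree_def)

lemma agree_bounded: "agree s R R' \<Longrightarrow> bounded L R \<Longrightarrow> bounded L R'"
 by (auto simp: agree_def bounded_def)

lemma ev_agree: "wf_expr e \<Longrightarrow> agree s R R' \<Longrightarrow> ev (view R') e = ev (view R) e"
 by (induction e) (auto simp: agree_def)

lemma lookup_less: "bounded L R \<Longrightarrow> lookup xs i < 2 ^ L"
 by (auto simp: bounded_def lookup_def)

lemma ev_less:
 assumes R: "bounded L R"
 shows "wf_expr e \<Longrightarrow> ev (view R) e < 2 ^ (esize e * L)"
proof (induction e)
 case (Num c)
 have "c < 2 ^ len c" by (rule less_len)
 also have "\<dots> \<le> 2 ^ (esize (Num c) * L)"
 proof (rule power_increasing)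
  have "1 \<le> L" using R by (simp add: bounded_def)
  then have "(len c + 1) * 1 \<le> (len c + 1) * L" by (rule mult_le_mono2)
  then show "len c \<le> esize (Num c) * L" by simp
 qed simp
 finally show ?case by simp
next
 case (Arr k e)
 then have "view R k (ev (view R) e) < 2 ^ L" using R by (auto simp: bounded_def)
 also have "\<dots> \<le> 2 ^ (esize (Arr k e) * L)" by (intro power_increasing) auto
 finally show ?case by simp
next
 case (Inp e)
 have "lookup xs (ev (view R) e) < 2 ^ L" using lookup_less[OF R] .
 also have "\<dots> \<le> 2 ^ (esize (Inp e) * L)" by (intro power_increasing) auto
 finally show ?case by simp
next
 case (Bin f a b)
 let ?x = "ev (view R) a" and ?y = "ev (view R) b"
 have x: "?x < 2 ^ (esize a * L)" and y: "?y < 2 ^ (esize b * L)" using Bin by auto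
 have pos: "1 \<le> esize e" for e by (induction e) auto
 have L: "1 \<le> L" using R by (simp add: bounded_def)
 have "1 \<le> esize a * L" "1 \<le> esize b * L" using pos[of a] pos[of b] L by (auto simp: Suc_le_eq)
 then have two: "2 \<le> (2::nat) ^ (esize a * L)" "2 \<le> (2::nat) ^ (esize b * L)"
  using power_increasing[of 1 _ "2::nat"] by fastforce+
 have prod: "(2::nat) ^ (esize a * L) * 2 ^ (esize b * L) = 2 ^ (esize (Bin f a b) * L)"
  by (simp add: power_add[symmetric] algebra_simps)
 have "eval_binop f ?x ?y < 2 ^ (esize a * L) * 2 ^ (esize b * L)"
 proof (cases f)
  case Add
  \<comment> \<open>Numbers that are at least 2 have a sum of at most their product, so one rule for
    exponents covers all four operators.\<close>
  have "u + v \<le> u * v" if "2 \<le> u" "2 \<le> v" for u v :: nat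
  proof -
   have "(u - 1) * (v - 1) \<ge> 1" using that by (simp add: Suc_le_eq)
   then show ?thesis using that by (cases u; cases v) (auto simp: algebra_simps)
  qed
  from this[OF two] show ?thesis using x y Add by simp
 next
  case Sub
  have "?x < 2 ^ (esize a * L) * 1" using x by simp
  also have "\<dots> \<le> 2 ^ (esize a * L) * 2 ^ (esize b * L)" by (intro mult_le_mono2) simp
  finally show ?thesis using Sub by (simp add: less_imp_diff_less)
 next
  case Mul
  then show ?thesis using x y by (simp add: mult_strict_mono)
 next
  case Div
  have "?x < 2 ^ (esize a * L) * 1" using x by simp
  also have "\<dots> \<le> 2 ^ (esize a * L) * 2 ^ (esize b * L)" by (intro mult_le_mono2) simp
  finally have "?x < 2 ^ (esize a * L) * 2 ^ (esize b * L)" .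
  then have "?x div ?y < 2 ^ (esize a * L) * 2 ^ (esize b * L)" by (rule le_less_trans[OF div_le_dividend])
  then show ?thesis using Div by simp
 qed
 then show ?case unfolding prod by simp
qed

lemma len_ev: "bounded L R \<Longrightarrow> wf_expr e \<Longrightarrow> len (ev (view R) e) \<le> esize e * L"
 by (rule len_le) (rule ev_less)

lemma len_add_le: "len (x + y) \<le> len x + len y + 1"
proof (rule len_le)
 have "x < 2 ^ len x" "y < 2 ^ len y" by (rule less_len)+
 moreover have "2 ^ len x \<le> (2::nat) ^ (len x + len y)" "2 ^ len y \<le> (2::nat) ^ (len x + len y)"
  by (intro power_increasing; simp)+
 ultimately have "x + y < 2 ^ (len x + len y) + 2 ^ (len x + len y)" by linarith
 then show "x + y < 2 ^ (len x + len y + 1)" by simp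
qed

lemma len_mult_le: "len (x * y) \<le> len x + len y"
proof (rule len_le)
 have "x * y < 2 ^ len x * 2 ^ len y" using less_len[of x] less_len[of y] by (intro mult_strict_mono) auto
 then show "x * y < 2 ^ (len x + len y)" by (simp add: power_add)
qed

lemma len_64: "len 64 \<le> 7" and len_small: "k < 64 \<Longrightarrow> len k \<le> 6"
 by (auto intro!: len_le)

lemma dsound_addr:
 assumes k: "k < 64" and x: "R (64 * s) = x"
 shows "\<exists>R'. dsound (comp_addr s k) R R' (2 * len x + 45) \<and> R' (64 * s) = 64 * x + k \<and> agree s R R'"
proof -
 let ?t = "64 * s" and ?u = "64 * (s + 1)"
 define R1 where "R1 = R(?u := 64)"
 define R2 where "R2 = R1(?t := R1 ?t * R1 ?u)"
 define R3 where "R3 = R2(?u := k)"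
 define R4 where "R4 = R3(?t := R3 ?t + R3 ?u)"
 have c1: "dsound (Const ?u 64) R R1 (1 + len 64)" unfolding R1_def by (rule dsound_Const)
 have c2: "dsound (Op Mul ?t ?t ?u) R1 R2 (1 + len (R1 ?t) + len (R1 ?u))"
  using dsound_Op[of Mul ?t ?t ?u R1] by (simp add: R2_def)
 have c3: "dsound (Const ?u k) R2 R3 (1 + len k)" unfolding R3_def by (rule dsound_Const)
 have c4: "dsound (Op Add ?t ?t ?u) R3 R4 (1 + len (R3 ?t) + len (R3 ?u))"
  using dsound_Op[of Add ?t ?t ?u R3] by (simp add: R4_def)
 have v: "R1 ?t = x" "R1 ?u = 64" "R3 ?t = 64 * x" "R3 ?u = k" "R4 ?t = 64 * x + k"
  using x by (auto simp: R1_def R2_def R3_def R4_def)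
 have d: "dsound (comp_addr s k) R R4
   ((1 + len 64) + ((1 + len (R1 ?t) + len (R1 ?u)) + ((1 + len k) + (1 + len (R3 ?t) + len (R3 ?u)) + 1) + 1) + 1)"
  unfolding comp_addr_def by (rule dsound_Seq[OF c1 dsound_Seq[OF c2 dsound_Seq[OF c3 c4]]])
 have "len (64 * x) \<le> 7 + len x" using len_mult_le[of 64 x] len_64 by linarith
 then have "dsound (comp_addr s k) R R4 (2 * len x + 45)"
  using len_64 len_small[OF k] by (intro dsound_mono[OF d]) (unfold v, linarith)
 moreover have "agree s R R4" by (auto simp: agree_def R1_def R2_def R3_def R4_def)
 ultimately show ?thesis using v by blast
qed

lemma dsound_comp:
 "wf_expr e \<Longrightarrow> bounded L R \<Longrightarrow> \<exists>R'. dsound (comp s e) R R' (ecost e * L) \<and> R' (64 * s) = ev (view R) e \<and> agree s R R'"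
proof (induction e arbitrary: s R)
 case (Num c)
 have "(1 + len c) * 1 \<le> (1 + len c) * L" using Num by (intro mult_le_mono2) (simp add: bounded_def)
 then have "1 + len c \<le> (1 + len c) * L" by simp
 then have "dsound (Const (64 * s) c) R (R(64 * s := c)) (ecost (Num c) * L)"
  using dsound_mono[OF dsound_Const[of "64 * s" c R]] by simp
 moreover have "agree s R (R(64 * s := c))" by (rule agree_temp) simp
 moreover have "(R(64 * s := c)) (64 * s) = ev (view R) (Num c)" by simp
 ultimately show ?case unfolding comp.simps by blast
next
 case (Arr k e)
 have L: "1 \<le> L" and k: "0 < k" "k < 64" and wf: "wf_expr e" using Arr by (auto simp: bounded_def)
 let ?x = "ev (view R) e"
 obtain R1 where R1: "dsound (comp s e) R R1 (ecost e * L)" "R1 (64 * s) = ?x" "agree s R R1"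
  using Arr by auto
 obtain R2 where R2: "dsound (comp_addr s k) R1 R2 (2 * len ?x + 45)" "R2 (64 * s) = 64 * ?x + k" "agree s R1 R2"
  using dsound_addr[of k R1 s] k R1 by blast
 define R3 where "R3 = R2(64 * s := R2 (R2 (64 * s)))"
 have c3: "dsound (Load (64 * s) (64 * s)) R2 R3 (1 + len (R2 (64 * s)) + len (R2 (R2 (64 * s))))"
  unfolding R3_def by (rule dsound_Load)
 have val: "R2 (64 * ?x + k) = view R k ?x"
  using agree_trans[OF R1(3) R2(3)] k by (simp add: agree_def)
 have "dsound (comp s (Arr k e)) R R3 (ecost e * L + ((2 * len ?x + 45) + (1 + len (R2 (64 * s)) + len (R2 (R2 (64 * s)))) + 1) + 1)"
  unfolding comp.simps by (rule dsound_Seq[OF R1(1) dsound_Seq[OF R2(1) c3]])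
 moreover have "ecost e * L + ((2 * len ?x + 45) + (1 + len (R2 (64 * s)) + len (R2 (R2 (64 * s)))) + 1) + 1 \<le> ecost (Arr k e) * L"
 proof -
  have "len ?x \<le> esize e * L" using len_ev[OF Arr.prems(2) wf] .
  moreover have "len (64 * ?x + k) \<le> 7 + len ?x + 6 + 1"
   using len_add_le[of "64 * ?x" k] len_mult_le[of 64 ?x] len_64 len_small[OF k(2)] by linarith
  moreover have "len (view R k ?x) \<le> L" using Arr.prems k by (intro len_le) (simp add: bounded_def)
  moreover have "62 \<le> 62 * L" using L by simp
  ultimately show ?thesis unfolding R2(2) val by (simp add: algebra_simps)
 qed
 ultimately have "dsound (comp s (Arr k e)) R R3 (ecost (Arr k e) * L)" by (rule dsound_mono)
 moreover have "agree s R R3" using agree_trans[OF R1(3) R2(3)] by (auto simp: R3_def agree_def)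
 moreover have "R3 (64 * s) = ev (view R) (Arr k e)" using R2(2) val by (simp add: R3_def)
 ultimately show ?case by blast
next
 case (Inp e)
 have L: "1 \<le> L" and wf: "wf_expr e" using Inp by (auto simp: bounded_def)
 let ?x = "ev (view R) e"
 obtain R1 where R1: "dsound (comp s e) R R1 (ecost e * L)" "R1 (64 * s) = ?x" "agree s R R1"
  using Inp by auto
 define R2 where "R2 = R1(64 * s := lookup xs (R1 (64 * s)))"
 have c2: "dsound (Input (64 * s) (64 * s)) R1 R2 (1 + len (R1 (64 * s)) + len (lookup xs (R1 (64 * s))))"
  unfolding R2_def by (rule dsound_Input)
 have "dsound (comp s (Inp e)) R R2 (ecost e * L + (1 + len (R1 (64 * s)) + len (lookup xs (R1 (64 * s)))) + 1)"
  unfolding comp.simps by (rule dsound_Seq[OF R1(1) c2])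
 moreover have "ecost e * L + (1 + len (R1 (64 * s)) + len (lookup xs (R1 (64 * s)))) + 1 \<le> ecost (Inp e) * L"
 proof -
  have "len ?x \<le> esize e * L" using len_ev[OF Inp.prems(2) wf] .
  moreover have "len (lookup xs ?x) \<le> L" using lookup_less[OF Inp.prems(2)] by (rule len_le)
  ultimately show ?thesis using L unfolding R1(2) by (simp add: algebra_simps)
 qed
 ultimately have "dsound (comp s (Inp e)) R R2 (ecost (Inp e) * L)" by (rule dsound_mono)
 moreover have "agree s R R2" using R1(3) by (auto simp: R2_def agree_def)
 moreover have "R2 (64 * s) = ev (view R) (Inp e)" using R1(2) by (simp add: R2_def)
 ultimately show ?case by blast
next
 case (Bin f a b)
 have L: "1 \<le> L" and wf: "wf_expr a" "wf_expr b" using Bin by (auto simp: bounded_def)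
 let ?x = "ev (view R) a" and ?y = "ev (view R) b"
 obtain R1 where R1: "dsound (comp s a) R R1 (ecost a * L)" "R1 (64 * s) = ?x" "agree s R R1"
  using Bin.IH(1)[OF wf(1) Bin.prems(2), of s] by auto
 have B1: "bounded L R1" using agree_bounded R1 Bin.prems by blast
 obtain R2 where R2: "dsound (comp (s + 1) b) R1 R2 (ecost b * L)" "R2 (64 * (s + 1)) = ev (view R1) b" "agree (s + 1) R1 R2"
  using Bin.IH(2)[OF wf(2) B1, of "s + 1"] by auto
 have y: "R2 (64 * (s + 1)) = ?y" using R2(2) ev_agree[OF wf(2) R1(3)] by simp
 have x: "R2 (64 * s) = ?x" using R2(3) R1(2) by (simp add: agree_def)
 define R3 where "R3 = R2(64 * s := eval_binop f (R2 (64 * s)) (R2 (64 * (s + 1))))"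
 have c3: "dsound (Op f (64 * s) (64 * s) (64 * (s + 1))) R2 R3 (1 + len (R2 (64 * s)) + len (R2 (64 * (s + 1))))"
  unfolding R3_def by (rule dsound_Op)
 have "dsound (comp s (Bin f a b)) R R3 (ecost a * L + (ecost b * L + (1 + len (R2 (64 * s)) + len (R2 (64 * (s + 1)))) + 1) + 1)"
  unfolding comp.simps by (rule dsound_Seq[OF R1(1) dsound_Seq[OF R2(1) c3]])
 moreover have "ecost a * L + (ecost b * L + (1 + len (R2 (64 * s)) + len (R2 (64 * (s + 1)))) + 1) + 1 \<le> ecost (Bin f a b) * L"
  using len_ev[OF Bin.prems(2) wf(1)] len_ev[OF Bin.prems(2) wf(2)] L unfolding x y by (simp add: algebra_simps)
 ultimately have "dsound (comp s (Bin f a b)) R R3 (ecost (Bin f a b) * L)" by (rule dsound_mono)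
 moreover have "agree s R R3" using R1(3) R2(3) by (auto simp: R3_def agree_def)
 moreover have "R3 (64 * s) = ev (view R) (Bin f a b)" unfolding R3_def fun_upd_same x y by simp
 ultimately show ?case by blast
qed

section \<open>A language of bounded loops, its semantics and its compiler\<close>

datatype stm = Nop | Asg nat expr expr | Rnd nat expr expr | Pul nat expr expr expr
 | Then stm stm | Cnd expr stm stm | For nat expr stm

definition put :: "(nat \<Rightarrow> nat \<Rightarrow> nat) \<Rightarrow> nat \<Rightarrow> nat \<Rightarrow> nat \<Rightarrow> nat \<Rightarrow> nat \<Rightarrow> nat" where
 "put S k i v = S(k := (S k)(i := v))"

type_synonym ('e) sstate = "(nat \<Rightarrow> nat \<Rightarrow> nat) \<times> 'e"

primrec iter :: "nat \<Rightarrow> ('p \<Rightarrow> 'p pmf) \<Rightarrow> 'p \<Rightarrow> 'p pmf" where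
 "iter 0 f p = return_pmf p"
| "iter (Suc m) f p = bind_pmf (f p) (iter m f)"

text \<open>Stores saturate at the limit in cell 0 of array 1. Memory contents are thus short by
  construction, and the time bound does not depend on what a program computes.\<close>

definition asg :: "nat \<Rightarrow> expr \<Rightarrow> expr \<Rightarrow> (nat \<Rightarrow> nat \<Rightarrow> nat) \<Rightarrow> nat \<Rightarrow> nat \<Rightarrow> nat" where
 "asg k a b S = put S k (ev S a) (min (ev S b) (S 1 0))"

abbreviation incr :: "nat \<Rightarrow> (nat \<Rightarrow> nat \<Rightarrow> nat) \<Rightarrow> nat \<Rightarrow> nat \<Rightarrow> nat" where
 "incr k \<equiv> asg k (Num 0) (Bin Add (Arr k (Num 0)) (Num 1))"

text \<open>A loop evaluates its count once and caps it by cell 0 of array 2. The loop variable is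
  an ordinary cell, while compiled code counts down in a temporary, so assignments to the variable
  cannot prolong the loop.\<close>

primrec sem :: "stm \<Rightarrow> (nat \<Rightarrow> nat \<Rightarrow> nat) \<times> nat env \<Rightarrow> ((nat \<Rightarrow> nat \<Rightarrow> nat) \<times> nat env) pmf" where
 "sem Nop p = return_pmf p"
| "sem (Asg k a b) p = return_pmf (asg k a b (fst p), snd p)"
| "sem (Rnd k a b) p = map_pmf (\<lambda>m. (put (fst p) k (ev (fst p) a) m, snd p))
  (uniform_below (min (ev (fst p) b) (fst p 1 0)))"
| "sem (Pul k a i x) p = map_pmf (\<lambda>e. (put (fst p) k (ev (fst p) a)
   (min (if ev (fst p) i < narms I then pos e (ev (fst p) i) else 0) (fst p 1 0)), e))
  (env_step I B (Some (ev (fst p) i, ev (fst p) x)) (snd p))"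
| "sem (Then s s') p = bind_pmf (sem s p) (sem s')"
| "sem (Cnd e s s') p = (if ev (fst p) e \<noteq> 0 then sem s p else sem s' p)"
| "sem (For k n s) p = iter (min (ev (fst p) n) (fst p 2 0))
  (\<lambda>p. map_pmf (\<lambda>p. (incr k (fst p), snd p)) (sem s p)) (asg k (Num 0) (Num 0) (fst p), snd p)"

primrec wf_stm :: "stm \<Rightarrow> bool" where
 "wf_stm Nop = True"
| "wf_stm (Asg k a b) = (2 < k \<and> k < 64 \<and> wf_expr a \<and> wf_expr b)"
| "wf_stm (Rnd k a b) = (2 < k \<and> k < 64 \<and> wf_expr a \<and> wf_expr b)"
| "wf_stm (Pul k a i x) = (2 < k \<and> k < 64 \<and> wf_expr a \<and> wf_expr i \<and> wf_expr x)"
| "wf_stm (Then s s') = (wf_stm s \<and> wf_stm s')"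
| "wf_stm (Cnd e s s') = (wf_expr e \<and> wf_stm s \<and> wf_stm s')"
| "wf_stm (For k n s) = (2 < k \<and> k < 64 \<and> wf_expr n \<and> wf_stm s)"

text \<open>With truncated subtraction, \<open>x - (x - y)\<close> is the minimum of
  \<open>x\<close> and \<open>y\<close>.\<close>

definition clamp :: "nat \<Rightarrow> nat \<Rightarrow> com" where
 "clamp s r = Seq (Op Sub (64 * (s + 1)) (64 * s) r) (Op Sub (64 * s) (64 * s) (64 * (s + 1)))"

definition comp_loc :: "nat \<Rightarrow> nat \<Rightarrow> expr \<Rightarrow> com" where
 "comp_loc s k a = Seq (comp s a) (comp_addr s k)"

definition comp_asg :: "nat \<Rightarrow> nat \<Rightarrow> expr \<Rightarrow> expr \<Rightarrow> com" where
 "comp_asg s k a b = Seq (comp_loc s k a) (Seq (comp (s + 1) b) (Seq (clamp (s + 1) 1)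
  (Store (64 * s) (64 * (s + 1)))))"

primrec comps :: "nat \<Rightarrow> stm \<Rightarrow> com" where
 "comps s Nop = Skip"
| "comps s (Asg k a b) = comp_asg s k a b"
| "comps s (Rnd k a b) = Seq (comp_loc s k a) (Seq (comp (s + 1) b) (Seq (clamp (s + 1) 1)
  (Seq (Rand (64 * (s + 1)) (64 * (s + 1))) (Store (64 * s) (64 * (s + 1))))))"
| "comps s (Pul k a i x) = Seq (comp_loc s k a) (Seq (comp (s + 1) i) (Seq (comp (s + 2) x)
  (Seq (Pull (64 * (s + 1)) (64 * (s + 1)) (64 * (s + 2))) (Seq (clamp (s + 1) 1) (Store (64 * s) (64 * (s + 1)))))))"
| "comps s (Then c c') = Seq (comps s c) (comps s c')"
| "comps s (Cnd e c c') = Seq (comp s e) (If (64 * s) (comps s c) (comps s c'))"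
| "comps s (For k n c) = Seq (comp s n) (Seq (clamp s 2) (Seq (comp_asg (s + 1) k (Num 0) (Num 0))
  (While (64 * s) (Seq (comps (s + 1) c) (Seq (comp_asg (s + 1) k (Num 0) (Bin Add (Arr k (Num 0)) (Num 1)))
   (Seq (Const (64 * (s + 1)) 1) (Op Sub (64 * s) (64 * s) (64 * (s + 1)))))))))"

definition acost :: "expr \<Rightarrow> expr \<Rightarrow> nat" where
 "acost a b = ecost a + ecost b + 10 * esize a + 10 * esize b + 100"

primrec scost :: "stm \<Rightarrow> nat \<Rightarrow> nat \<Rightarrow> nat" where
 "scost Nop L m = 1"
| "scost (Asg k a b) L m = acost a b * L"
| "scost (Rnd k a b) L m = (acost a b + 10) * L"
| "scost (Pul k a i x) L m = (acost a i + ecost x + esize x + 10) * L"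
| "scost (Then s s') L m = scost s L m + scost s' L m + 1"
| "scost (Cnd e s s') L m = scost s L m + scost s' L m + (ecost e + esize e + 3) * L"
| "scost (For k n s) L m = (acost n n + acost (Num 0) (Num 0) + 100) * L
  + m * (scost s L m + (acost (Num 0) (Bin Add (Arr k (Num 0)) (Num 1)) + esize n + 100) * L)"

lemma scost_poly: "poly_bounded (\<lambda>p. fst p + snd p) (\<lambda>p. scost st (fst p) (snd p))"
 by (induction st) (unfold scost.simps, (intro poly_bounded_add poly_bounded_mult poly_bounded_const; (assumption | rule poly_bounded_le; simp))+)

text \<open>Array 0 is hidden, so that the temporaries of compiled code do not show in the abstract
  state.\<close>

definition abs :: "(nat \<Rightarrow> nat) \<Rightarrow> nat \<Rightarrow> nat \<Rightarrow> nat" where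
 "abs R k i = (if 0 < k \<and> k < 64 then view R k i else 0)"

lemma ev_abs: "wf_expr e \<Longrightarrow> ev (abs R) e = ev (view R) e"
 by (induction e) (auto simp: abs_def)

lemma abs_agree: "agree s R R' \<Longrightarrow> abs R' = abs R"
 by (auto simp: abs_def agree_def fun_eq_iff)

lemma abs_put:
 assumes "0 < k" "k < 64"
 shows "abs (R(64 * i + k := v)) = put (abs R) k i v"
proof (intro ext)
 fix k' i'
 have "64 * i' + k' = 64 * i + k \<longleftrightarrow> k' = k \<and> i' = i" if "k' < 64"
 proof -
  have "(64 * i' + k') div 64 = i'" "(64 * i + k) div 64 = i" using that assms by simp_all
  then have "i' = i" if "64 * i' + k' = 64 * i + k" using that by metis
  then show ?thesis by auto
 qed
 then show "abs (R(64 * i + k := v)) k' i' = put (abs R) k i v k' i'"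
  using assms unfolding abs_def put_def fun_upd_apply by (cases "k' = k") simp_all
qed

lemma dsound_clamp:
 assumes r: "r = 1 \<or> r = 2" and R: "bounded L R"
 shows "\<exists>R'. dsound (clamp s r) R R' (4 * len (R (64 * s)) + L + 4) \<and> R' (64 * s) = min (R (64 * s)) (R r) \<and> agree s R R'"
proof -
 let ?t = "64 * s" and ?u = "64 * (s + 1)"
 define R1 where "R1 = R(?u := R ?t - R r)"
 define R2 where "R2 = R1(?t := R1 ?t - R1 ?u)"
 have c1: "dsound (Op Sub ?u ?t r) R R1 (1 + len (R ?t) + len (R r))"
  using dsound_Op[of Sub ?u ?t r R] by (simp add: R1_def)
 have c2: "dsound (Op Sub ?t ?t ?u) R1 R2 (1 + len (R1 ?t) + len (R1 ?u))"
  using dsound_Op[of Sub ?t ?t ?u R1] by (simp add: R2_def)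
 have v: "R1 ?t = R ?t" "R1 ?u = R ?t - R r" by (auto simp: R1_def)
 have "len (R r) \<le> L" using R r by (intro len_le) (auto simp: bounded_def)
 moreover have "len (R ?t - R r) \<le> len (R ?t)" by (rule len_mono) simp
 ultimately have "(1 + len (R ?t) + len (R r)) + (1 + len (R1 ?t) + len (R1 ?u)) + 1 \<le> 4 * len (R ?t) + L + 4"
  unfolding v by linarith
 then have "dsound (clamp s r) R R2 (4 * len (R ?t) + L + 4)"
  unfolding clamp_def using dsound_mono[OF dsound_Seq[OF c1 c2]] by blast
 moreover have "R2 ?t = min (R ?t) (R r)" unfolding R2_def fun_upd_same v by simp
 moreover have "agree s R R2" by (auto simp: R1_def R2_def agree_def)
 ultimately show ?thesis by blast
qed

definition keeps :: "nat \<Rightarrow> (nat \<Rightarrow> nat) \<Rightarrow> (nat \<Rightarrow> nat) \<Rightarrow> bool" where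
 "keeps s R R' \<longleftrightarrow> (\<forall>j<s. R' (64 * j) = R (64 * j)) \<and> (\<forall>i. R' (64 * i + 1) = R (64 * i + 1) \<and> R' (64 * i + 2) = R (64 * i + 2))"

lemma keeps_refl: "keeps s R R" by (simp add: keeps_def)

lemma keeps_trans: "keeps s R R' \<Longrightarrow> keeps s R' R'' \<Longrightarrow> keeps s R R''"
 by (simp add: keeps_def)

lemma keeps_Suc: "keeps (s + 1) R R' \<Longrightarrow> keeps s R R'"
 by (simp add: keeps_def)

lemma keeps_agree: "agree s R R' \<Longrightarrow> keeps s R R'"
proof -
 have "(64 * i + 1) mod 64 = (1::nat)" "(64 * i + 2) mod 64 = (2::nat)" for i by presburger+
 then show "agree s R R' \<Longrightarrow> keeps s R R'" by (simp add: agree_def keeps_def)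
qed

lemma keeps_put:
 assumes "2 < k" "k < 64"
 shows "keeps s R (R(64 * i + k := v))"
proof -
 have "64 * j + c \<noteq> 64 * i + k" if "c \<le> 2" for j c
 proof -
  have "(64 * j + c) mod 64 = c" "(64 * i + k) mod 64 = k" using that assms by simp_all
  then show ?thesis using that assms by (metis not_le)
 qed
 from this[of 0] this[of 1] this[of 2]
 show ?thesis by (simp add: keeps_def)
qed

lemma bounded_put:
 assumes "bounded L R" "v \<le> R 1"
 shows "bounded L (R(a := v))"
proof -
 have "R 1 < 2 ^ L" using assms(1) by (auto simp: bounded_def)
 then have "v < 2 ^ L" using assms(2) by simp
 then show ?thesis using assms(1) by (auto simp: bounded_def)
qed

lemma keeps_limits: "keeps s R R' \<Longrightarrow> R' 1 = R 1 \<and> R' 2 = R 2"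
 unfolding keeps_def
 by (elim conjE) (drule spec[of "\<lambda>i. R' (64 * i + 1) = R (64 * i + 1) \<and> R' (64 * i + 2) = R (64 * i + 2)" 0], simp only: mult_zero_right add_0)

lemma dsound_loc:
 assumes a: "wf_expr a" and k: "2 < k" "k < 64" and R: "bounded L R"
 shows "\<exists>R'. dsound (comp_loc s k a) R R' ((ecost a + 2 * esize a + 46) * L)
  \<and> R' (64 * s) = 64 * ev (view R) a + k \<and> agree s R R'"
proof -
 let ?x = "ev (view R) a"
 obtain R1 where R1: "dsound (comp s a) R R1 (ecost a * L)" "R1 (64 * s) = ?x" "agree s R R1"
  using dsound_comp[OF a R] by blast
 obtain R2 where R2: "dsound (comp_addr s k) R1 R2 (2 * len ?x + 45)" "R2 (64 * s) = 64 * ?x + k" "agree s R1 R2"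
  using dsound_addr[of k R1 s, OF k(2) R1(2)] by blast
 have "46 * 1 \<le> 46 * L" using R by (intro mult_le_mono2) (simp add: bounded_def)
 then have "ecost a * L + (2 * len ?x + 45) + 1 \<le> (ecost a + 2 * esize a + 46) * L"
  using len_ev[OF R a] by (simp add: algebra_simps)
 then have "dsound (comp_loc s k a) R R2 ((ecost a + 2 * esize a + 46) * L)"
  unfolding comp_loc_def using dsound_mono[OF dsound_Seq[OF R1(1) R2(1)]] by blast
 then show ?thesis using R2(2) agree_trans[OF R1(3) R2(3)] by blast
qed

lemma min_cap: "bounded L R \<Longrightarrow> len (min x (R 1)) \<le> L"
proof (rule len_le)
 assume "bounded L R"
 then have "R 1 < 2 ^ L" by (auto simp: bounded_def)
 then show "min x (R 1) < 2 ^ L" by simp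
qed

text \<open>The common beginning of compiled stores: the target address ends up in temporary
  \<open>s\<close> and the clamped operand in temporary \<open>s + 1\<close>.\<close>

lemma dsound_operands:
 assumes a: "wf_expr a" "wf_expr b" and k: "2 < k" "k < 64" and R: "bounded L R"
 obtains R1 R2 R3 where "dsound (comp_loc s k a) R R1 ((ecost a + 2 * esize a + 46) * L)"
  "dsound (comp (s + 1) b) R1 R2 (ecost b * L)" "dsound (clamp (s + 1) 1) R2 R3 ((4 * esize b + 5) * L)"
  "R3 (64 * s) = 64 * ev (abs R) a + k" "R3 (64 * (s + 1)) = min (ev (abs R) b) (R 1)" "agree s R R3"
  "len (R3 (64 * s)) \<le> (esize a + 14) * L" "len (R3 (64 * (s + 1))) \<le> L"
proof -
 let ?x = "ev (view R) a"
 have L: "1 \<le> L" using R by (simp add: bounded_def)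
 obtain R1 where R1: "dsound (comp_loc s k a) R R1 ((ecost a + 2 * esize a + 46) * L)" "R1 (64 * s) = 64 * ?x + k" "agree s R R1"
  using dsound_loc[OF a(1) k R] by blast
 have B1: "bounded L R1" using agree_bounded R1(3) R by blast
 obtain R2 where R2: "dsound (comp (s + 1) b) R1 R2 (ecost b * L)" "R2 (64 * (s + 1)) = ev (view R1) b" "agree (s + 1) R1 R2"
  using dsound_comp[OF a(2) B1] by blast
 have B2: "bounded L R2" using agree_bounded R2(3) B1 by blast
 have vb: "R2 (64 * (s + 1)) = ev (view R) b" using R2(2) ev_agree[OF a(2) R1(3)] by simp
 obtain R3 where R3: "dsound (clamp (s + 1) 1) R2 R3 (4 * len (R2 (64 * (s + 1))) + L + 4)"
  "R3 (64 * (s + 1)) = min (R2 (64 * (s + 1))) (R2 1)" "agree (s + 1) R2 R3"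
  using dsound_clamp[of 1 L R2 "s + 1"] B2 by blast
 have all: "agree s R R3" using agree_trans[OF R1(3) agree_trans[OF agree_Suc[OF R2(3)] agree_Suc[OF R3(3)]]] .
 have cap: "R2 1 = R 1" using agree_trans[OF R1(3) agree_Suc[OF R2(3)]] by (simp add: agree_def)
 have "4 * len (ev (view R) b) + L + 4 \<le> (4 * esize b + 5) * L"
  using len_ev[OF R a(2)] L by (simp add: algebra_simps)
 then have c3: "dsound (clamp (s + 1) 1) R2 R3 ((4 * esize b + 5) * L)"
  using dsound_mono[OF R3(1)] unfolding vb by blast
 have loc: "R3 (64 * s) = 64 * ?x + k" using R1(2) R2(3) R3(3) by (simp add: agree_def)
 have "len (64 * ?x + k) \<le> (7 + len ?x) + 6 + 1"
  using len_add_le[of "64 * ?x" k] len_mult_le[of 64 ?x] len_64 len_small[OF k(2)] by linarith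
 then have lloc: "len (R3 (64 * s)) \<le> (esize a + 14) * L"
  using len_ev[OF R a(1)] L unfolding loc by (simp add: algebra_simps)
 show ?thesis
 proof (rule that[OF R1(1) R2(1) c3 _ _ all lloc])
  show "R3 (64 * s) = 64 * ev (abs R) a + k" using loc ev_abs[OF a(1)] by simp
  show v: "R3 (64 * (s + 1)) = min (ev (abs R) b) (R 1)" unfolding R3(2) vb cap ev_abs[OF a(2)] ..
  show "len (R3 (64 * (s + 1))) \<le> L" unfolding v by (rule min_cap[OF R])
 qed
qed

lemma finish_assignment:
 assumes k: "2 < k" "k < 64" and R: "bounded L R" and ag: "agree s R R3" and loc: "R3 (64 * s) = 64 * i + k"
  and v: "v \<le> R 1"
 shows "abs (R3(64 * i + k := v)) = put (abs R) k i v" "keeps s R (R3(64 * i + k := v))" "bounded L (R3(64 * i + k := v))"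
proof -
 show "abs (R3(64 * i + k := v)) = put (abs R) k i v" using abs_put[of k] k abs_agree[OF ag] by simp
 show "keeps s R (R3(64 * i + k := v))" using keeps_trans[OF keeps_agree[OF ag] keeps_put[OF k]] .
 have "R3 1 = R 1" using ag by (simp add: agree_def)
 then show "bounded L (R3(64 * i + k := v))" using bounded_put[OF agree_bounded[OF ag R]] v by simp
qed

lemma dsound_asg:
 assumes a: "wf_expr a" "wf_expr b" and k: "2 < k" "k < 64" and R: "bounded L R"
 shows "\<exists>R'. dsound (comp_asg s k a b) R R' (acost a b * L) \<and> abs R' = asg k a b (abs R) \<and> keeps s R R' \<and> bounded L R'"
proof -
 obtain R1 R2 R3 where o: "dsound (comp_loc s k a) R R1 ((ecost a + 2 * esize a + 46) * L)"
  "dsound (comp (s + 1) b) R1 R2 (ecost b * L)" "dsound (clamp (s + 1) 1) R2 R3 ((4 * esize b + 5) * L)"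
  "R3 (64 * s) = 64 * ev (abs R) a + k" "R3 (64 * (s + 1)) = min (ev (abs R) b) (R 1)" "agree s R R3"
  "len (R3 (64 * s)) \<le> (esize a + 14) * L" "len (R3 (64 * (s + 1))) \<le> L"
  by (rule dsound_operands[OF a k R])
 let ?R4 = "R3(64 * ev (abs R) a + k := min (ev (abs R) b) (R 1))"
 have L: "1 \<le> L" using R by (simp add: bounded_def)
 have c4: "dsound (Store (64 * s) (64 * (s + 1))) R3 ?R4 (1 + len (R3 (64 * s)) + len (R3 (64 * (s + 1))))"
  using dsound_Store[of "64 * s" "64 * (s + 1)" R3] by (simp only: o(4,5))
 have "dsound (comp_asg s k a b) R ?R4 (acost a b * L)"
  unfolding comp_asg_def
  by (rule dsound_mono[OF dsound_Seq[OF o(1) dsound_Seq[OF o(2) dsound_Seq[OF o(3) c4]]]])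
   (use o(7,8) L in \<open>simp add: acost_def algebra_simps\<close>)
 moreover have "abs ?R4 = asg k a b (abs R)"
  using finish_assignment(1)[OF k R o(6,4)] by (simp add: asg_def abs_def)
 ultimately show ?thesis using finish_assignment(2,3)[OF k R o(6,4)] by (meson min.cobounded2)
qed

lemma abs_limits: "abs R 1 0 = R 1" "abs R 2 0 = R 2"
 unfolding abs_def by (simp_all only: mult_zero_right add_0) simp_all

text \<open>Compiler correctness in law: a distribution \<open>D\<close> of concrete memories is
  mapped by \<open>abs\<close> onto the semantics. The invariant \<open>Ok\<close> of the
  environment is what bounds the length of the node numbers that a pull returns.\<close>

theorem sound_comps:
 assumes Ok_step: "\<And>e x e'. Ok e \<Longrightarrow> e' \<in> set_pmf (env_step I B x e) \<Longrightarrow> Ok e'"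
  and Ok_pos: "\<And>e i. Ok e \<Longrightarrow> i < narms I \<Longrightarrow> pos e i < 2 ^ L"
 shows "wf_stm st \<Longrightarrow> bounded L R \<Longrightarrow> R 2 \<le> m \<Longrightarrow> Ok e \<Longrightarrow>
  \<exists>D. sound (comps s st) R e D (scost st L m) \<and> map_pmf (\<lambda>p. (abs (fst p), snd p)) D = sem st (abs R, e) \<and>
   (\<forall>p\<in>set_pmf D. keeps s R (fst p) \<and> bounded L (fst p) \<and> Ok (snd p))"
proof (induction st arbitrary: s R e)
 case Nop
 have "sound Skip R e (return_pmf (R, e)) 1" by (rule sound_prim) auto
 then show ?case using Nop by (intro exI[of _ "return_pmf (R, e)"]) (simp add: keeps_refl)
next
 case (Asg k a b)
 obtain R' where R': "dsound (comp_asg s k a b) R R' (acost a b * L)" "abs R' = asg k a b (abs R)" "keeps s R R'" "bounded L R'"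
  using dsound_asg[of a b k L R s] Asg by auto
 then show ?case using Asg by (intro exI[of _ "return_pmf (R', e)"]) (auto simp: dsound_def)
next
 case (Rnd k a b)
 then have a: "wf_expr a" "wf_expr b" and k: "2 < k" "k < 64" and R: "bounded L R" by auto
 obtain R1 R2 R3 where o: "dsound (comp_loc s k a) R R1 ((ecost a + 2 * esize a + 46) * L)"
  "dsound (comp (s + 1) b) R1 R2 (ecost b * L)" "dsound (clamp (s + 1) 1) R2 R3 ((4 * esize b + 5) * L)"
  "R3 (64 * s) = 64 * ev (abs R) a + k" "R3 (64 * (s + 1)) = min (ev (abs R) b) (R 1)" "agree s R R3"
  "len (R3 (64 * s)) \<le> (esize a + 14) * L" "len (R3 (64 * (s + 1))) \<le> L"
  by (rule dsound_operands[OF a k R, where s = s])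
 let ?t = "64 * (s + 1)" and ?i = "ev (abs R) a" and ?n = "min (ev (abs R) b) (R 1)"
 let ?D = "map_pmf (\<lambda>v. (R3(?t := v), e)) (uniform_below ?n)"
 have L: "1 \<le> L" using R by (simp add: bounded_def)
 have rnd: "sound (Rand ?t ?t) R3 e ?D (1 + len (R3 ?t))"
  by (rule sound_prim) (unfold exec.simps o(5) map_pmf_comp, simp_all)
 define f where "f R' = R'(64 * ?i + k := R' ?t)" for R' :: "nat \<Rightarrow> nat"
 have below: "v \<le> ?n" if "v \<in> set_pmf (uniform_below ?n)" for v
  using that by (auto simp: uniform_below_def set_pmf_of_set lessThan_empty_iff split: if_splits)
 have ag: "agree s R (R3(?t := v))" for v
  using agree_trans[OF o(6) agree_temp[of s "s + 1"]] by simp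
 have loc: "(R3(?t := v)) (64 * s) = 64 * ?i + k" for v using o(4) by simp
 have fv: "f (R3(?t := v)) = (R3(?t := v))(64 * ?i + k := v)" for v
  by (simp only: f_def fun_upd_same)
 have fin: "abs (f (R3(?t := v))) = put (abs R) k ?i v \<and> keeps s R (f (R3(?t := v))) \<and> bounded L (f (R3(?t := v)))"
  if "v \<le> ?n" for v
 proof -
  have "v \<le> R 1" using that by simp
  from finish_assignment[OF k R ag loc this] show ?thesis unfolding fv by blast
 qed
 have st: "dsound (Store (64 * s) ?t) (fst p) (f (fst p)) ((esize a + 16) * L)" if p: "p \<in> set_pmf ?D" for p
 proof -
  obtain v where v: "p = (R3(?t := v), e)" "v \<in> set_pmf (uniform_below ?n)"
   using p unfolding set_map_pmf by (rule imageE)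
  note v = v(1) below[OF v(2)]
  have "len v \<le> len ?n" using v by (intro len_mono)
  then have "1 + len ((fst p) (64 * s)) + len ((fst p) ?t) \<le> (esize a + 16) * L"
   using o(7,8) L unfolding o(5) v(1) by (simp add: algebra_simps)
  moreover have "f (fst p) = (fst p)((fst p) (64 * s) := (fst p) ?t)" using loc by (simp add: v f_def)
  ultimately show ?thesis using dsound_mono[OF dsound_Store[of "64 * s" ?t "fst p"]] by simp
 qed
 let ?D' = "map_pmf (\<lambda>p. (f (fst p), snd p)) ?D"
 have "sound (comps s (Rnd k a b)) R e ?D' (scost (Rnd k a b) L m)"
  unfolding comps.simps
  by (rule sound_mono[OF sound_dsound_Seq[OF o(1) sound_dsound_Seq[OF o(2) sound_dsound_Seq[OF o(3)
   sound_Seq_dsound[OF rnd st]]]]]) (use o(8) L in \<open>unfold scost.simps acost_def, simp_all add: algebra_simps\<close>)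
 moreover have "map_pmf (\<lambda>p. (abs (fst p), snd p)) ?D' = sem (Rnd k a b) (abs R, e)"
  unfolding map_pmf_comp sem.simps fst_conv snd_conv abs_limits
  by (rule map_pmf_cong[OF refl]) (use fin[OF below] in \<open>simp only: fst_conv\<close>)
 moreover have "keeps s R (fst p) \<and> bounded L (fst p) \<and> Ok (snd p)" if p: "p \<in> set_pmf ?D'" for p
 proof -
  obtain q where q: "p = (f (fst q), snd q)" "q \<in> set_pmf ?D"
   using p unfolding set_map_pmf[of "\<lambda>p. (f (fst p), snd p)"] by (rule imageE)
  obtain v where v: "q = (R3(?t := v), e)" "v \<in> set_pmf (uniform_below ?n)"
   using q(2) unfolding set_map_pmf by (rule imageE)
  show ?thesis using fin[OF below[OF v(2)]] Rnd.prems(4) unfolding q(1) v(1) fst_conv snd_conv by blast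
 qed
 ultimately show ?case by blast
next
 case (Pul k a i x)
 then have a: "wf_expr a" "wf_expr i" "wf_expr x" and k: "2 < k" "k < 64" and R: "bounded L R" by auto
 have L: "1 \<le> L" using R by (simp add: bounded_def)
 let ?t = "64 * (s + 1)" and ?u = "64 * (s + 2)" and ?j = "ev (abs R) a"
 obtain R1 where R1: "dsound (comp_loc s k a) R R1 ((ecost a + 2 * esize a + 46) * L)" "R1 (64 * s) = 64 * ev (view R) a + k" "agree s R R1"
  using dsound_loc[OF a(1) k R] by blast
 have B1: "bounded L R1" using agree_bounded R1(3) R by blast
 obtain R2 where R2: "dsound (comp (s + 1) i) R1 R2 (ecost i * L)" "R2 ?t = ev (view R1) i" "agree (s + 1) R1 R2"
  using dsound_comp[OF a(2) B1] by blast
 have B2: "bounded L R2" using agree_bounded R2(3) B1 by blast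
 have A2: "agree s R R2" using agree_trans[OF R1(3) agree_Suc[OF R2(3)]] .
 obtain R3 where R3: "dsound (comp (s + 2) x) R2 R3 (ecost x * L)" "R3 ?u = ev (view R2) x" "agree (s + 2) R2 R3"
  using dsound_comp[OF a(3) B2] by blast
 have A3: "agree s R R3" using A2 R3(3) by (auto simp: agree_def)
 have vi: "R3 ?t = ev (abs R) i" using R2(2) R3(3) ev_agree[OF a(2) R1(3)] ev_abs[OF a(2)] by (simp add: agree_def)
 have vx: "R3 ?u = ev (abs R) x" using R3(2) ev_agree[OF a(3) A2] ev_abs[OF a(3)] by simp
 have vloc: "R3 (64 * s) = 64 * ?j + k" using R1(2) R2(3) R3(3) ev_abs[OF a(1)] by (simp add: agree_def)
 let ?E = "env_step I B (Some (R3 ?t, R3 ?u)) e"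
 define g where "g e' = (if R3 ?t < narms I then pos e' (R3 ?t) else 0)" for e' :: "nat env"
 let ?D = "map_pmf (\<lambda>e'. (R3(?t := g e'), e')) ?E"
 have pull: "sound (Pull ?t ?t ?u) R3 e ?D (1 + len (R3 ?t) + len (R3 ?u))"
  unfolding g_def by (rule sound_prim) (simp_all add: map_pmf_comp add.assoc cong: if_cong)
 define f where "f R' = R'(?t := min (R' ?t) (R 1), 64 * ?j + k := min (R' ?t) (R 1))" for R' :: "nat \<Rightarrow> nat"
 have glen: "len (g e') \<le> L" if "e' \<in> set_pmf ?E" for e'
  using Ok_pos Ok_step[OF Pul.prems(4) that] L by (auto simp: g_def floorlog_def[of 2 0] intro!: len_le)
 have tail: "\<exists>R'. dsound (Seq (clamp (s + 1) 1) (Store (64 * s) ?t)) (fst p) R' ((esize a + 30) * L)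
   \<and> abs R' = put (abs R) k ?j (min (g (snd p)) (R 1)) \<and> keeps s R R' \<and> bounded L R'" (is "\<exists>R'. ?Q p R'")
  if p: "p \<in> set_pmf ?D" for p
 proof -
  obtain e' where e': "e' \<in> set_pmf ?E" "p = (R3(?t := g e'), e')" using p by auto
  let ?P = "R3(?t := g e')"
  have AP: "agree s R ?P" using agree_trans[OF A3 agree_temp[of s "s + 1"]] by simp
  obtain R4 where R4: "dsound (clamp (s + 1) 1) ?P R4 (4 * len (?P ?t) + L + 4)" "R4 ?t = min (?P ?t) (?P 1)" "agree (s + 1) ?P R4"
   using dsound_clamp[of 1 L ?P "s + 1"] agree_bounded[OF AP R] by blast
  have A4: "agree s R R4" using agree_trans[OF AP agree_Suc[OF R4(3)]] .
  have cap: "?P 1 = R 1" using AP unfolding agree_def by (elim allE[of _ 1]) simp_all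
  have loc4: "R4 (64 * s) = 64 * ?j + k" using R4(3) vloc by (simp add: agree_def)
  let ?v = "min (g e') (R 1)"
  have v4: "R4 ?t = ?v" using R4(2) cap by simp
  have s5: "dsound (Store (64 * s) ?t) R4 (R4(64 * ?j + k := ?v)) (1 + len (64 * ?j + k) + len ?v)"
   using dsound_Store[of "64 * s" ?t R4] by (simp only: loc4 v4)
  have "len (64 * ?j + k) \<le> (7 + len ?j) + 6 + 1"
   using len_add_le[of "64 * ?j" k] len_mult_le[of 64 ?j] len_64 len_small[OF k(2)] by linarith
  moreover have "len ?j \<le> esize a * L" using len_ev[OF R a(1)] ev_abs[OF a(1)] by simp
  moreover have "len ?v \<le> L" by (rule min_cap[OF R])
  ultimately have "dsound (Seq (clamp (s + 1) 1) (Store (64 * s) ?t)) ?P (R4(64 * ?j + k := ?v)) ((esize a + 30) * L)"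
   using glen[OF e'(1)] L by (intro dsound_mono[OF dsound_Seq[OF R4(1) s5]]) (simp add: algebra_simps)
  then show ?thesis using finish_assignment[OF k R A4 loc4, of ?v] e'(2) by auto
 qed
 then obtain h where h: "\<And>p. p \<in> set_pmf ?D \<Longrightarrow> dsound (Seq (clamp (s + 1) 1) (Store (64 * s) ?t)) (fst p) (h p) ((esize a + 30) * L)
   \<and> abs (h p) = put (abs R) k ?j (min (g (snd p)) (R 1)) \<and> keeps s R (h p) \<and> bounded L (h p)"
  using bchoice[of "set_pmf ?D" ?Q] by blast
 let ?D' = "bind_pmf ?D (\<lambda>p. return_pmf (h p, snd p))"
 have "sound (Seq (Pull ?t ?t ?u) (Seq (clamp (s + 1) 1) (Store (64 * s) ?t))) R3 e ?D'
   ((1 + len (R3 ?t) + len (R3 ?u)) + ((esize a + 30) * L) + 1)"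
  by (rule sound_Seq[OF pull]) (use h in \<open>auto simp: dsound_def\<close>)
 from sound_dsound_Seq[OF R1(1) sound_dsound_Seq[OF R2(1) sound_dsound_Seq[OF R3(1) this]]]
 have "sound (comps s (Pul k a i x)) R e ?D' (scost (Pul k a i x) L m)"
  unfolding comps.simps
  by (rule sound_mono) (use len_ev[OF R a(2)] len_ev[OF R a(3)] L in
   \<open>unfold vi vx ev_abs[OF a(2)] ev_abs[OF a(3)] scost.simps acost_def, simp add: algebra_simps\<close>)
 moreover have "map_pmf (\<lambda>p. (abs (fst p), snd p)) ?D' = sem (Pul k a i x) (abs R, e)"
 proof -
  have "map_pmf (\<lambda>p. (abs (fst p), snd p)) ?D' = map_pmf (\<lambda>p. (abs (h p), snd p)) ?D"
   by (simp add: map_pmf_def bind_assoc_pmf bind_return_pmf)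
  also have "\<dots> = map_pmf (\<lambda>p. (put (abs R) k ?j (min (g (snd p)) (R 1)), snd p)) ?D"
   using h by (intro map_pmf_cong) auto
  finally show ?thesis unfolding sem.simps fst_conv snd_conv abs_limits g_def vi vx map_pmf_comp .
 qed
 moreover have "keeps s R (fst p) \<and> bounded L (fst p) \<and> Ok (snd p)" if "p \<in> set_pmf ?D'" for p
  using that h Ok_step[OF Pul.prems(4)] by auto
 ultimately show ?case by blast
next
 case (Then c c')
 obtain D where D: "sound (comps s c) R e D (scost c L m)" "map_pmf (\<lambda>p. (abs (fst p), snd p)) D = sem c (abs R, e)"
  "\<And>p. p \<in> set_pmf D \<Longrightarrow> keeps s R (fst p) \<and> bounded L (fst p) \<and> Ok (snd p)"
  using Then.IH(1)[of R e s] Then.prems by auto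
 have "\<exists>D'. sound (comps s c') (fst p) (snd p) D' (scost c' L m) \<and> map_pmf (\<lambda>p. (abs (fst p), snd p)) D' = sem c' (abs (fst p), snd p)
  \<and> (\<forall>q\<in>set_pmf D'. keeps s (fst p) (fst q) \<and> bounded L (fst q) \<and> Ok (snd q))"
  (is "\<exists>D'. ?Q p D'") if "p \<in> set_pmf D" for p
  using Then.IH(2)[of "fst p" "snd p" s] Then.prems D(3)[OF that] keeps_limits[of s R "fst p"] by auto
 then obtain D' where D': "\<And>p. p \<in> set_pmf D \<Longrightarrow> sound (comps s c') (fst p) (snd p) (D' p) (scost c' L m)
  \<and> map_pmf (\<lambda>p. (abs (fst p), snd p)) (D' p) = sem c' (abs (fst p), snd p)
  \<and> (\<forall>q\<in>set_pmf (D' p). keeps s (fst p) (fst q) \<and> bounded L (fst q) \<and> Ok (snd q))"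
  using bchoice[of "set_pmf D" ?Q] by blast
 have "sound (comps s (Then c c')) R e (bind_pmf D D') (scost (Then c c') L m)"
  unfolding comps.simps scost.simps by (rule sound_Seq[OF D(1)]) (use D' in blast)
 moreover have "map_pmf (\<lambda>p. (abs (fst p), snd p)) (bind_pmf D D') = sem (Then c c') (abs R, e)"
 proof -
  have "map_pmf (\<lambda>p. (abs (fst p), snd p)) (bind_pmf D D') = bind_pmf D (\<lambda>p. sem c' (abs (fst p), snd p))"
   unfolding map_bind_pmf using D' by (intro bind_pmf_cong) auto
  also have "\<dots> = bind_pmf (map_pmf (\<lambda>p. (abs (fst p), snd p)) D) (sem c')" by (simp add: bind_map_pmf)
  finally show ?thesis by (simp add: D(2))
 qed
 moreover have "keeps s R (fst p) \<and> bounded L (fst p) \<and> Ok (snd p)" if "p \<in> set_pmf (bind_pmf D D')" for p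
 proof -
  obtain q where "q \<in> set_pmf D" "p \<in> set_pmf (D' q)" using \<open>p \<in> set_pmf (bind_pmf D D')\<close> by auto
  then show ?thesis using D(3) D' keeps_trans by blast
 qed
 ultimately show ?case by blast
next
 case (Cnd b c c')
 then have b: "wf_expr b" and R: "bounded L R" by auto
 have L: "1 \<le> L" using R by (simp add: bounded_def)
 obtain R1 where R1: "dsound (comp s b) R R1 (ecost b * L)" "R1 (64 * s) = ev (view R) b" "agree s R R1"
  using dsound_comp[OF b R] by blast
 have B1: "bounded L R1" using agree_bounded R1(3) R by blast
 have m1: "R1 2 \<le> m" using R1(3) Cnd.prems by (simp add: agree_def)
 let ?c = "if R1 (64 * s) \<noteq> 0 then c else c'"
 obtain D where D: "sound (comps s ?c) R1 e D (scost ?c L m)" "map_pmf (\<lambda>p. (abs (fst p), snd p)) D = sem ?c (abs R1, e)"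
  "\<forall>p\<in>set_pmf D. keeps s R1 (fst p) \<and> bounded L (fst p) \<and> Ok (snd p)"
  using Cnd.IH(1)[of R1 e s] Cnd.IH(2)[of R1 e s] Cnd.prems B1 m1 by (cases "R1 (64 * s) = 0") auto
 have comm: "comps s ?c = (if R1 (64 * s) \<noteq> 0 then comps s c else comps s c')" by simp
 have "sound (comps s (Cnd b c c')) R e D (ecost b * L + (scost ?c L m + 1 + len (R1 (64 * s))) + 1)"
  unfolding comps.simps by (rule sound_dsound_Seq[OF R1(1) sound_If[OF D(1)[unfolded comm]]])
 then have "sound (comps s (Cnd b c c')) R e D (scost (Cnd b c c') L m)"
 proof (rule sound_mono)
  have "len (ev (view R) b) \<le> esize b * L" by (rule len_ev[OF R b])
  moreover have "scost ?c L m \<le> scost c L m + scost c' L m" by simp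
  ultimately show "ecost b * L + (scost ?c L m + 1 + len (R1 (64 * s))) + 1 \<le> scost (Cnd b c c') L m"
   using L unfolding R1(2) scost.simps add_mult_distrib by linarith
 qed
 moreover have "sem ?c (abs R1, e) = sem (Cnd b c c') (abs R, e)"
  using abs_agree[OF R1(3)] ev_abs[OF b] R1(2) by simp
 moreover have "keeps s R (fst p) \<and> bounded L (fst p) \<and> Ok (snd p)" if "p \<in> set_pmf D" for p
  using D(3) that keeps_trans[OF keeps_agree[OF R1(3)]] by blast
 ultimately show ?case using D(2) by (intro exI[of _ D]) simp
next
 case (For k n c)
 then have n: "wf_expr n" and k: "2 < k" "k < 64" and R: "bounded L R" and c: "wf_stm c" by auto
 have L: "1 \<le> L" using R by (simp add: bounded_def)
 let ?t = "64 * s" and ?u = "64 * (s + 1)"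
 let ?inc = "comp_asg (s + 1) k (Num 0) (Bin Add (Arr k (Num 0)) (Num 1))"
 let ?dec = "Seq (Const ?u 1) (Op Sub ?t ?t ?u)"
 let ?body = "Seq (comps (s + 1) c) (Seq ?inc ?dec)"
 let ?a = "acost (Num 0) (Bin Add (Arr k (Num 0)) (Num 1))"
 let ?f = "\<lambda>p. map_pmf (\<lambda>p. (incr k (fst p), snd p)) (sem c p)"
 let ?w = "scost c L m + (?a + 20) * L"
 have body: "\<exists>D. sound ?body R e D (scost c L m + (?a + 10) * L) \<and> map_pmf (\<lambda>p. (abs (fst p), snd p)) D = ?f (abs R, e) \<and>
   (\<forall>p\<in>set_pmf D. keeps s R (fst p) \<and> bounded L (fst p) \<and> Ok (snd p) \<and> fst p ?t = R ?t - 1)"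
  if R: "bounded L R" and m: "R 2 \<le> m" and e: "Ok e" and j: "len (R ?t) \<le> L" for R e
 proof -
  obtain D where D: "sound (comps (s + 1) c) R e D (scost c L m)" "map_pmf (\<lambda>p. (abs (fst p), snd p)) D = sem c (abs R, e)"
   "\<And>p. p \<in> set_pmf D \<Longrightarrow> keeps (s + 1) R (fst p) \<and> bounded L (fst p) \<and> Ok (snd p)"
   using For.IH[OF c R m e, of "s + 1"] by auto
  have "\<exists>R'. dsound (Seq ?inc ?dec) (fst p) R' (?a * L + 9 * L) \<and> abs R' = incr k (abs (fst p)) \<and> keeps s R R' \<and> bounded L R' \<and> R' ?t = R ?t - 1"
   if p: "p \<in> set_pmf D" for p
  proof -
   obtain R1 where R1: "dsound ?inc (fst p) R1 (?a * L)" "abs R1 = incr k (abs (fst p))" "keeps (s + 1) (fst p) R1" "bounded L R1"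
    using dsound_asg[of "Num 0" "Bin Add (Arr k (Num 0)) (Num 1)" k L "fst p" "s + 1"] D(3)[OF p] k by auto
   have t1: "R1 ?t = R ?t" using R1(3) D(3)[OF p] by (simp add: keeps_def)
   define R2 where "R2 = R1(?u := 1)"
   define R3 where "R3 = R2(?t := R2 ?t - R2 ?u)"
   have c2: "dsound (Const ?u 1) R1 R2 (1 + len 1)" unfolding R2_def by (rule dsound_Const)
   have c3: "dsound (Op Sub ?t ?t ?u) R2 R3 (1 + len (R2 ?t) + len (R2 ?u))"
    using dsound_Op[of Sub ?t ?t ?u R2] by (simp add: R3_def)
   have v: "R2 ?t = R ?t" "R2 ?u = 1" using t1 by (auto simp: R2_def)
   have ag: "agree s R1 R3" by (auto simp: R2_def R3_def agree_def)
   have "len 1 \<le> 1" by (rule len_le) simp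
   then have "dsound (Seq ?inc ?dec) (fst p) R3 (?a * L + 9 * L)"
    using j L by (intro dsound_mono[OF dsound_Seq[OF R1(1) dsound_Seq[OF c2 c3]]]) (unfold v, linarith)
   moreover have "keeps s R R3"
    using keeps_trans[OF keeps_Suc[of s R "fst p"] keeps_trans[OF keeps_Suc[OF R1(3)] keeps_agree[OF ag]]] D(3)[OF p] by simp
   moreover have "R3 ?t = R ?t - 1" unfolding R3_def fun_upd_same v ..
   ultimately show ?thesis using abs_agree[OF ag] R1(2) agree_bounded[OF ag R1(4)] by auto
  qed
  then obtain h where h: "\<And>p. p \<in> set_pmf D \<Longrightarrow> dsound (Seq ?inc ?dec) (fst p) (h p) (?a * L + 9 * L)
   \<and> abs (h p) = incr k (abs (fst p)) \<and> keeps s R (h p) \<and> bounded L (h p) \<and> h p ?t = R ?t - 1" by metis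
  let ?D = "bind_pmf D (\<lambda>p. return_pmf (h p, snd p))"
  have "sound ?body R e ?D (scost c L m + (?a * L + 9 * L) + 1)"
   by (rule sound_Seq[OF D(1)]) (use h in \<open>auto simp: dsound_def\<close>)
  then have "sound ?body R e ?D (scost c L m + (?a + 10) * L)"
   by (rule sound_mono) (use L in \<open>simp add: algebra_simps\<close>)
  moreover have "map_pmf (\<lambda>p. (abs (fst p), snd p)) ?D = ?f (abs R, e)"
  proof -
   have "map_pmf (\<lambda>p. (abs (fst p), snd p)) ?D = map_pmf (\<lambda>p. (abs (h p), snd p)) D"
    by (simp add: map_pmf_def bind_assoc_pmf bind_return_pmf)
   also have "\<dots> = map_pmf (\<lambda>p. (incr k (fst p), snd p)) (map_pmf (\<lambda>p. (abs (fst p), snd p)) D)"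
    unfolding map_pmf_comp using h by (intro map_pmf_cong) auto
   finally show ?thesis by (simp add: D(2))
  qed
  moreover have "keeps s R (fst p) \<and> bounded L (fst p) \<and> Ok (snd p) \<and> fst p ?t = R ?t - 1" if "p \<in> set_pmf ?D" for p
   using that h D(3) by auto
  ultimately show ?thesis by blast
 qed
 \<comment> \<open>The induction is on the value \<open>j\<close> of the hidden counter, which is
   the same for all random outcomes.\<close>
 have loop: "\<exists>D. sound (While ?t ?body) R e D (j * ?w + 1) \<and> map_pmf (\<lambda>p. (abs (fst p), snd p)) D = iter j ?f (abs R, e) \<and>
   (\<forall>p\<in>set_pmf D. keeps s R (fst p) \<and> bounded L (fst p) \<and> Ok (snd p))"
  if "R ?t = j" "len j \<le> L" "bounded L R" "R 2 \<le> m" "Ok e" for j R e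
  using that
 proof (induction j arbitrary: R e)
  case 0
  then show ?case using sound_While_False[of R ?t ?body e]
   by (intro exI[of _ "return_pmf (R, e)"]) (simp add: keeps_refl)
 next
  case (Suc j)
  obtain D where D: "sound ?body R e D (scost c L m + (?a + 10) * L)" "map_pmf (\<lambda>p. (abs (fst p), snd p)) D = ?f (abs R, e)"
   "\<And>p. p \<in> set_pmf D \<Longrightarrow> keeps s R (fst p) \<and> bounded L (fst p) \<and> Ok (snd p) \<and> fst p ?t = R ?t - 1"
   using body[of R e] Suc.prems by auto
  have "len j \<le> L" using Suc.prems(2) len_mono[of j "Suc j"] by simp
  then have "\<exists>D'. sound (While ?t ?body) (fst p) (snd p) D' (j * ?w + 1) \<and> map_pmf (\<lambda>p. (abs (fst p), snd p)) D' = iter j ?f (abs (fst p), snd p)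
   \<and> (\<forall>q\<in>set_pmf D'. keeps s (fst p) (fst q) \<and> bounded L (fst q) \<and> Ok (snd q))"
  (is "\<exists>D'. ?Q p D'") if "p \<in> set_pmf D" for p
   using D(3)[OF that] keeps_limits[of s R "fst p"] Suc.prems by (intro Suc.IH) auto
  then obtain D' where D': "\<And>p. p \<in> set_pmf D \<Longrightarrow> sound (While ?t ?body) (fst p) (snd p) (D' p) (j * ?w + 1)
   \<and> map_pmf (\<lambda>p. (abs (fst p), snd p)) (D' p) = iter j ?f (abs (fst p), snd p)
   \<and> (\<forall>q\<in>set_pmf (D' p). keeps s (fst p) (fst q) \<and> bounded L (fst q) \<and> Ok (snd q))"
  using bchoice[of "set_pmf D" ?Q] by blast
  have "sound (While ?t ?body) R e (bind_pmf D D') ((scost c L m + (?a + 10) * L) + (j * ?w + 1) + 1 + len (R ?t))"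
   by (rule sound_While_True[OF _ D(1)]) (use D' Suc.prems in auto)
  then have "sound (While ?t ?body) R e (bind_pmf D D') (Suc j * ?w + 1)"
   by (rule sound_mono) (use Suc.prems L in \<open>simp add: algebra_simps\<close>)
  moreover have "map_pmf (\<lambda>p. (abs (fst p), snd p)) (bind_pmf D D') = iter (Suc j) ?f (abs R, e)"
  proof -
   have "map_pmf (\<lambda>p. (abs (fst p), snd p)) (bind_pmf D D') = bind_pmf D (\<lambda>p. iter j ?f (abs (fst p), snd p))"
    unfolding map_bind_pmf using D' by (intro bind_pmf_cong) auto
   also have "\<dots> = bind_pmf (map_pmf (\<lambda>p. (abs (fst p), snd p)) D) (iter j ?f)" by (simp add: bind_map_pmf)
   finally show ?thesis by (simp only: D(2) iter.simps)
  qed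
  moreover have "keeps s R (fst p) \<and> bounded L (fst p) \<and> Ok (snd p)" if "p \<in> set_pmf (bind_pmf D D')" for p
  proof -
   obtain q where "q \<in> set_pmf D" "p \<in> set_pmf (D' q)" using \<open>p \<in> set_pmf (bind_pmf D D')\<close> by auto
   then show ?thesis using D(3) D' keeps_trans by blast
  qed
  ultimately show ?case by blast
 qed
 obtain R1 where R1: "dsound (comp s n) R R1 (ecost n * L)" "R1 ?t = ev (view R) n" "agree s R R1"
  using dsound_comp[OF n R] by blast
 have B1: "bounded L R1" using agree_bounded R1(3) R by blast
 obtain R2 where R2: "dsound (clamp s 2) R1 R2 (4 * len (R1 ?t) + L + 4)" "R2 ?t = min (R1 ?t) (R1 2)" "agree s R1 R2"
  using dsound_clamp[of 2 L R1 s] B1 by blast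
 have A2: "agree s R R2" using agree_trans[OF R1(3) R2(3)] .
 have B2: "bounded L R2" using agree_bounded A2 R by blast
 obtain R3 where R3: "dsound (comp_asg (s + 1) k (Num 0) (Num 0)) R2 R3 (acost (Num 0) (Num 0) * L)"
  "abs R3 = asg k (Num 0) (Num 0) (abs R2)" "keeps (s + 1) R2 R3" "bounded L R3"
  using dsound_asg[of "Num 0" "Num 0" k L R2 "s + 1"] B2 k by auto
 let ?j = "min (ev (abs R) n) (R 2)"
 have R12: "R1 2 = R 2" using R1(3) by (simp add: agree_def)
 have j: "R3 ?t = ?j" using R3(3) R2(2) R1(2) R12 ev_abs[OF n] by (simp add: keeps_def)
 have "R 2 < 2 ^ L" using R by (auto simp: bounded_def)
 then have lj: "len ?j \<le> L" by (intro len_le) simp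
 have lim: "R3 2 = R 2" using keeps_limits[OF R3(3)] A2 by (simp add: agree_def)
 obtain D where D: "sound (While ?t ?body) R3 e D (?j * ?w + 1)" "map_pmf (\<lambda>p. (abs (fst p), snd p)) D = iter ?j ?f (abs R3, e)"
   "\<And>p. p \<in> set_pmf D \<Longrightarrow> keeps s R3 (fst p) \<and> bounded L (fst p) \<and> Ok (snd p)"
 proof -
  have "R3 2 \<le> m" using lim For.prems by simp
  from loop[OF j lj R3(4) this For.prems(4)] that show ?thesis by blast
 qed
 have "sound (comps s (For k n c)) R e D (ecost n * L + ((4 * len (R1 ?t) + L + 4) + (acost (Num 0) (Num 0) * L + (?j * ?w + 1) + 1) + 1) + 1)"
  unfolding comps.simps using sound_dsound_Seq[OF R1(1) sound_dsound_Seq[OF R2(1) sound_dsound_Seq[OF R3(1) D(1)]]] .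
 then have "sound (comps s (For k n c)) R e D (scost (For k n c) L m)"
 proof (rule sound_mono)
  have "?j * ?w \<le> m * (scost c L m + (?a + esize n + 100) * L)"
   using For.prems by (intro mult_le_mono add_left_mono) auto
  moreover have "len (R1 ?t) \<le> esize n * L" unfolding R1(2) by (rule len_ev[OF R n])
  ultimately show "ecost n * L + ((4 * len (R1 ?t) + L + 4) + (acost (Num 0) (Num 0) * L + (?j * ?w + 1) + 1) + 1) + 1
   \<le> scost (For k n c) L m" using L unfolding scost.simps acost_def[of n n] by (simp add: algebra_simps)
 qed
 moreover have "iter ?j ?f (abs R3, e) = sem (For k n c) (abs R, e)"
  using R3(2) abs_agree[OF A2] by (simp add: abs_limits)
 moreover have "keeps s R (fst p) \<and> bounded L (fst p) \<and> Ok (snd p)" if "p \<in> set_pmf D" for p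
  using D(3)[OF that] keeps_trans[OF keeps_agree[OF A2] keeps_trans[OF keeps_Suc[OF R3(3)]]] by blast
 ultimately show ?case using D(2) by (intro exI[of _ D]) simp
qed

end

text \<open>Gives the form that \<open>polynomial_time\<close> asks for. The number
  \<open>3 ^ C\<close> can be both factor and exponent, since \<open>S + 2 \<le> 3 * S\<close> for
  positive \<open>S\<close> and \<open>C \<le> 3 ^ C\<close>.\<close>

lemma poly_bounded_normal: "poly_bounded (\<lambda>S. S) f \<Longrightarrow> \<exists>k. \<forall>S. f S \<le> k * S ^ k + k"
proof -
 assume "poly_bounded (\<lambda>S. S) f"
 then obtain C where C: "\<And>S. f S \<le> (S + 2) ^ C" unfolding poly_bounded_def by blast
 have "f S \<le> 3 ^ C * S ^ (3 ^ C) + 3 ^ C" for S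
 proof (cases "S = 0")
  case True
  have "(2::nat) ^ C \<le> 3 ^ C" by (rule power_mono) simp_all
  moreover have "f 0 \<le> 2 ^ C" using C[of 0] unfolding add_0 .
  ultimately show ?thesis using True by (simp add: trans_le_add2)
 next
  case False
  have "f S \<le> (S + 2) ^ C" by (rule C)
  also have "\<dots> \<le> (3 * S) ^ C" using False by (intro power_mono) auto
  also have "\<dots> = 3 ^ C * S ^ C" by (rule power_mult_distrib)
  also have "\<dots> \<le> 3 ^ C * S ^ (3 ^ C)"
  proof (intro mult_le_mono2 power_increasing)
   have "C < 2 ^ C" by (rule less_exp)
   also have "\<dots> \<le> 3 ^ C" by (rule power_mono) simp_all
   finally show "C \<le> 3 ^ C" by simp
  qed (use False in simp)
  finally show ?thesis by simp
 qed
 then show ?thesis by blast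
qed

section \<open>Precomputed limits, and termination of the complete machine program\<close>

context machine
begin

text \<open>The product of the numbers of arms and actions. If it is 0, the horizon is not bounded
  by the number of nodes and can be exponential in the input size, but no feasible LP solution has a
  positive objective and the machine may stop.\<close>

definition guard :: expr where
 "guard = Bin Mul (Inp (Num 1)) (Inp (Num 2))"

definition degree_expr :: expr where
 "degree_expr = (let x = Bin Add (Bin Add (Inp (Num 2)) (Inp (Num 3))) (Num 10) in Bin Mul x (Bin Mul x (Bin Mul x (Bin Mul x x))))"

text \<open>Input entries 2 and 3 are the numbers of actions and nodes. The exponent 5 is justified
  in \<open>exponents\<close>.\<close>

definition degree :: nat where
 "degree = (lookup xs 2 + lookup xs 3 + 10) ^ 5"

text \<open>Bounds all loop counts. The number of subgradient rounds is of degree 7 in the base of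
  \<open>degree\<close>, and squaring provides degree 10.\<close>

definition limit :: nat where
 "limit = degree * degree"

definition factor :: "nat \<Rightarrow> nat" where
 "factor j = lookup xs (j div degree) + 2"

text \<open>Reaches the power \<open>degree\<close> of the largest entry plus 2 without a search for
  the maximum: each of the first \<open>degree\<close> positions contributes its entry plus 2 to the
  power \<open>degree\<close>, and positions past the end contribute powers of 2. In the instances
  that pass the guard the input has at most \<open>degree\<close> entries.\<close>

definition cap :: nat where
 "cap = (\<Prod>j<limit. factor j)"

text \<open>Raw machine code, because statements of the loop language presuppose both limits. Cell
  61 holds the loop index and cell 62 the number \<open>degree\<close>; they belong to arrays with
  higher numbers than those of the program.\<close>

definition cap_body :: com where
 "cap_body = Seq (Op Div 64 61 62) (Seq (Input 64 64) (Seq (Const 128 2) (Seq (Op Add 64 64 128) (Seq (Op Mul 1 1 64)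
  (Seq (Const 128 1) (Seq (Op Add 61 61 128) (Op Sub 0 0 128)))))))"

definition init :: com where
 "init = Seq (comp 0 degree_expr) (Seq (Const 64 1) (Seq (Op Mul 62 0 64) (Seq (Op Mul 2 62 62) (Seq (Const 1 1)
  (Seq (Op Mul 0 2 64) (While 0 cap_body))))))"

definition program :: "stm \<Rightarrow> com" where
 "program st = Seq (comp 0 guard) (If 0 (Seq init (comps 0 st)) Skip)"

lemma ev_degree: "ev S degree_expr = degree"
proof -
 have "x * (x * (x * (x * x))) = x ^ 5" for x :: nat by (simp add: eval_nat_numeral)
 then show ?thesis by (simp add: degree_expr_def degree_def Let_def)
qed

lemma dsound_While_True:
 assumes "R r \<noteq> 0" "dsound c R R1 w" "dsound (While r c) R1 R' w'"
 shows "dsound (While r c) R R' (w + w' + 1 + len (R r))"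
 unfolding dsound_def
proof
 fix e
 have "sound (While r c) R e (bind_pmf (return_pmf (R1, e)) (\<lambda>p. return_pmf (R', snd p))) (w + w' + 1 + len (R r))"
  by (rule sound_While_True) (use assms in \<open>auto simp: dsound_def\<close>)
 then show "sound (While r c) R e (return_pmf (R', e)) (w + w' + 1 + len (R r))" by (simp add: bind_return_pmf)
qed

definition cap_step :: "(nat \<Rightarrow> nat) \<Rightarrow> nat \<Rightarrow> nat" where
 "cap_step R = R(64 := lookup xs (R 61 div R 62) + 2, 128 := 1, 1 := R 1 * (lookup xs (R 61 div R 62) + 2),
  61 := R 61 + 1, 0 := R 0 - 1)"

lemma len_Suc: "len (x + 1) \<le> len x + 2" "len (x + 2) \<le> len x + 3"
 using len_add_le[of x 1] len_add_le[of x 2] len_le[of 1 1] len_le[of 2 2] by simp_all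

lemma dsound_cap_body:
 assumes L: "len (R 0) \<le> L" "len (R 1) \<le> L" "len (R 61) \<le> L" "len (R 62) \<le> L" "\<And>i. len (lookup xs i) \<le> L"
 shows "dsound cap_body R (cap_step R) (20 * L + 40)"
proof -
 let ?x = "lookup xs (R 61 div R 62)"
 define R1 where "R1 = R(64 := R 61 div R 62)"
 define R2 where "R2 = R1(64 := ?x)"
 define R3 where "R3 = R2(128 := 2)"
 define R4 where "R4 = R3(64 := ?x + 2)"
 define R5 where "R5 = R4(1 := R 1 * (?x + 2))"
 define R6 where "R6 = R5(128 := 1)"
 define R7 where "R7 = R6(61 := R 61 + 1)"
 define R8 where "R8 = R7(0 := R 0 - 1)"
 note d = R1_def R2_def R3_def R4_def R5_def R6_def R7_def R8_def
 have c1: "dsound (Op Div 64 61 62) R R1 (1 + len (R 61) + len (R 62))"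
  using dsound_Op[of Div 64 61 62 R] by (simp add: R1_def)
 have c2: "dsound (Input 64 64) R1 R2 (1 + len (R 61 div R 62) + len ?x)"
  using dsound_Input[of 64 64 R1] by (simp add: R1_def R2_def)
 have c3: "dsound (Const 128 2) R2 R3 (1 + len 2)" unfolding R3_def by (rule dsound_Const)
 have c4: "dsound (Op Add 64 64 128) R3 R4 (1 + len ?x + len 2)"
  using dsound_Op[of Add 64 64 128 R3] by (simp add: R4_def R3_def R2_def)
 have c5: "dsound (Op Mul 1 1 64) R4 R5 (1 + len (R 1) + len (?x + 2))"
  using dsound_Op[of Mul 1 1 64 R4] by (simp add: d)
 have c6: "dsound (Const 128 1) R5 R6 (1 + len 1)" unfolding R6_def by (rule dsound_Const)
 have c7: "dsound (Op Add 61 61 128) R6 R7 (1 + len (R 61) + len 1)"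
  using dsound_Op[of Add 61 61 128 R6] by (simp add: d)
 have c8: "dsound (Op Sub 0 0 128) R7 R8 (1 + len (R 0) + len 1)"
  using dsound_Op[of Sub 0 0 128 R7] by (simp add: d)
 have R8: "R8 = cap_step R" by (simp add: d cap_step_def fun_eq_iff)
 have "len (R 61 div R 62) \<le> len (R 61)" by (rule len_mono) simp
 moreover have "len 2 \<le> 2" "len 1 \<le> 1" by (auto intro!: len_le)
 moreover note L(1-4) L(5)[of "R 61 div R 62"] len_Suc(2)[of ?x]
 ultimately show ?thesis
  unfolding cap_body_def R8[symmetric]
  by (intro dsound_mono[OF dsound_Seq[OF c1 dsound_Seq[OF c2 dsound_Seq[OF c3 dsound_Seq[OF c4 dsound_Seq[OF c5
   dsound_Seq[OF c6 dsound_Seq[OF c7 c8]]]]]]]]) linarith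
qed

lemma factor_pos: "2 \<le> factor j" by (simp add: factor_def)

lemma prod_factor_mono: "m \<le> k \<Longrightarrow> (\<Prod>j<m. factor j) \<le> (\<Prod>j<k. factor j)"
proof (induction k rule: dec_induct)
 case (step n)
 have "(\<Prod>j<m. factor j) \<le> (\<Prod>j<n. factor j) * 1" using step by simp
 also have "\<dots> \<le> (\<Prod>j<n. factor j) * factor n" using factor_pos[of n] by (intro mult_le_mono2) simp
 also have "\<dots> = (\<Prod>j<Suc n. factor j)" by (simp add: lessThan_Suc mult.commute)
 finally show ?case .
qed simp

lemma dsound_cap_loop:
 assumes L: "\<And>i. len (lookup xs i) \<le> L" "len cap \<le> L" "len limit \<le> L" "len degree \<le> L"
 shows "R 0 = j \<Longrightarrow> j \<le> limit \<Longrightarrow> R 61 = limit - j \<Longrightarrow> R 62 = degree \<Longrightarrow> R 1 = (\<Prod>j<limit - j. factor j) \<Longrightarrow>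
  \<exists>R'. dsound (While 0 cap_body) R R' (j * (30 * L + 200) + 1) \<and> R' 1 = cap \<and>
   (\<forall>a. a \<notin> {0, 1, 61, 64, 128} \<longrightarrow> R' a = R a) \<and> R' 61 \<le> limit"
proof (induction j arbitrary: R)
 case 0
 have "dsound (While 0 cap_body) R R 1" unfolding dsound_def using sound_While_False[of R 0 cap_body] 0 by simp
 then show ?case using 0 by (intro exI[of _ R]) (simp add: cap_def)
next
 case (Suc j)
 let ?R = "cap_step R"
 have x: "lookup xs (R 61 div R 62) + 2 = factor (limit - Suc j)" using Suc.prems by (simp add: factor_def)
 have S: "limit - j = Suc (limit - Suc j)" using Suc.prems by simp
 have p: "R 1 * factor (limit - Suc j) = (\<Prod>j<limit - j. factor j)"
  using Suc.prems unfolding S by (simp add: lessThan_Suc)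
 have v: "?R 0 = j" "?R 61 = limit - j" "?R 62 = degree" "?R 1 = (\<Prod>j<limit - j. factor j)"
  "\<And>a. a \<notin> {0, 1, 61, 64, 128} \<Longrightarrow> ?R a = R a"
  using Suc.prems p x by (simp_all add: cap_step_def)
 have l: "len (R 0) \<le> L" "len (R 61) \<le> L" "len (R 62) \<le> L" "len (R 1) \<le> L"
 proof -
  have a: "len (Suc j) \<le> len limit" "len (limit - Suc j) \<le> len limit" using Suc.prems by (auto intro!: len_mono)
  have b: "len (\<Prod>j<limit - Suc j. factor j) \<le> len cap"
   unfolding cap_def by (intro len_mono prod_factor_mono) simp
  show "len (R 0) \<le> L" unfolding Suc.prems using a(1) L(3) by (rule order_trans)
  show "len (R 61) \<le> L" unfolding Suc.prems using a(2) L(3) by (rule order_trans)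
  show "len (R 62) \<le> L" unfolding Suc.prems by (rule L(4))
  show "len (R 1) \<le> L" unfolding Suc.prems using b L(2) by (rule order_trans)
 qed
 obtain R' where R': "dsound (While 0 cap_body) ?R R' (j * (30 * L + 200) + 1)" "R' 1 = cap"
  "\<forall>a. a \<notin> {0, 1, 61, 64, 128} \<longrightarrow> R' a = ?R a" "R' 61 \<le> limit"
 proof -
  have "j \<le> limit" using Suc.prems(2) by simp
  from Suc.IH[OF v(1) this v(2-4)] that show ?thesis by blast
 qed
 have "dsound (While 0 cap_body) R R' ((20 * L + 40) + (j * (30 * L + 200) + 1) + 1 + len (R 0))"
  by (rule dsound_While_True[OF _ dsound_cap_body[OF l(1) l(4) l(2,3) L(1)] R'(1)]) (use Suc.prems in simp)
 then have "dsound (While 0 cap_body) R R' (Suc j * (30 * L + 200) + 1)"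
  by (rule dsound_mono) (use l(1) in \<open>simp add: algebra_simps\<close>)
 then show ?case using R' v(5) by auto
qed

lemma lookup_le_size: "len (lookup xs i) \<le> input_size xs"
proof (cases "i < length xs")
 case True
 then have "len (xs ! i) + 1 \<in> set (map (\<lambda>x. len x + 1) xs)" by simp
 then have "len (xs ! i) + 1 \<le> input_size xs" unfolding input_size_def using member_le_sum_list by blast
 then show ?thesis using True by (simp add: lookup_def)
qed (simp add: lookup_def floorlog_def)

lemma len_prod_le: "finite A \<Longrightarrow> (\<And>x. x \<in> A \<Longrightarrow> len (f x) \<le> l) \<Longrightarrow> len (\<Prod>x\<in>A. f x) \<le> card A * l + 1"
proof (induction A rule: finite_induct)
 case empty show ?case using len_le[of 1 1] by simp
next
 case (insert x A)
 have "len (\<Prod>y\<in>insert x A. f y) \<le> len (f x) + len (\<Prod>y\<in>A. f y)" using insert len_mult_le by simp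
 also have "\<dots> \<le> l + (card A * l + 1)" using insert by (intro add_mono) auto
 finally show ?case using insert by simp
qed

lemma len_cap: "len cap \<le> limit * (input_size xs + 3) + 1"
proof -
 have "len (factor j) \<le> input_size xs + 3" for j
  using len_Suc(2)[of "lookup xs (j div degree)"] lookup_le_size[of "j div degree"] unfolding factor_def by linarith
 then show ?thesis unfolding cap_def using len_prod_le[of "{..<limit}" factor "input_size xs + 3"] by simp
qed

lemma len_less: "len x \<le> x"
 by (rule len_le) (rule less_exp)

text \<open>Bounds the bit lengths of both limits and of every input number.\<close>

definition width :: nat where
 "width = limit * (input_size xs + 5) + 20"

lemma limit_pos: "10 \<le> degree" "degree \<le> limit" "limit \<le> width"
proof -
 have "10 ^ 1 \<le> (lookup xs 2 + lookup xs 3 + 10) ^ 5"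
  by (rule order_trans[OF power_increasing[of 1 5] power_mono]) simp_all
 then show d: "10 \<le> degree" by (simp add: degree_def)
 show "degree \<le> limit" using d by (simp add: limit_def)
 show "limit \<le> width" by (simp add: width_def algebra_simps)
qed

lemma input_le_width: "input_size xs \<le> width"
proof -
 have "input_size xs \<le> 1 * (input_size xs + 5)" by simp
 also have "\<dots> \<le> limit * (input_size xs + 5)" using limit_pos by (intro mult_le_mono1) simp
 also have "\<dots> \<le> width" by (simp add: width_def)
 finally show "input_size xs \<le> width" .
qed

lemma widths: "len cap \<le> width" "len limit \<le> width" "len degree \<le> width" "len (lookup xs i) \<le> width" "20 \<le> width"
proof -
 show "len (lookup xs i) \<le> width" using lookup_le_size[of i] input_le_width by simp
 show "len cap \<le> width" using len_cap unfolding width_def by (simp add: algebra_simps)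
 show "len limit \<le> width" "len degree \<le> width"
  by (rule order_trans[OF len_less limit_pos(3)], rule order_trans[OF len_less order_trans[OF limit_pos(2,3)]])
 show "20 \<le> width" by (simp add: width_def)
qed

lemma bounded_lenI:
 assumes "0 < L" "\<And>a. a mod 64 \<noteq> 0 \<Longrightarrow> len (R a) \<le> L" "\<And>i. len (lookup xs i) \<le> L"
 shows "bounded L R"
 unfolding bounded_def
proof (intro conjI allI ballI impI)
 have up: "x < 2 ^ L" if "len x \<le> L" for x
  by (rule less_le_trans[OF less_len power_increasing[OF that]]) simp
 show "0 < L" by (rule assms)
 show "R a < 2 ^ L" if "a mod 64 \<noteq> 0" for a using assms(2)[OF that] up by simp
 fix x assume "x \<in> set xs"
 then obtain i where "i < length xs" "x = xs ! i" by (auto simp: in_set_conv_nth)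
 then show "x < 2 ^ L" using assms(3)[of i] up by (simp add: lookup_def)
qed

lemma bounded_input:
 assumes "\<And>a. a mod 64 \<noteq> 0 \<Longrightarrow> len (R a) \<le> width"
 shows "bounded width R"
 using widths by (intro bounded_lenI assms) auto

lemma dsound_init:
 assumes z: "\<And>a. a mod 64 \<noteq> 0 \<Longrightarrow> R a = 0"
 shows "\<exists>R'. dsound init R R' (ecost degree_expr * width + limit * (30 * width + 200) + 10 * width) \<and> R' 1 = cap \<and> R' 2 = limit \<and>
  bounded width R' \<and> (\<forall>k i. 2 < k \<longrightarrow> k < 61 \<longrightarrow> R' (64 * i + k) = 0)"
proof -
 have l0: "len 0 = 0" by (simp add: floorlog_def)
 have l1: "len 1 \<le> 1" by (rule len_le) simp
 have b: "bounded width R" by (rule bounded_input) (simp add: z l0)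
 have wf: "wf_expr degree_expr" by (simp add: degree_expr_def Let_def)
 obtain R1 where R1: "dsound (comp 0 degree_expr) R R1 (ecost degree_expr * width)" "R1 (64 * 0) = degree" "agree 0 R R1"
  using dsound_comp[OF wf b, of 0] ev_degree by auto
 have z1: "a mod 64 \<noteq> 0 \<Longrightarrow> R1 a = 0" for a using R1(3) z by (simp add: agree_def)
 have R10: "R1 0 = degree" using R1(2) by simp
 define R2 where "R2 = R1(64 := 1)"
 define R3 where "R3 = R2(62 := degree)"
 define R4 where "R4 = R3(2 := limit)"
 define R5 where "R5 = R4(1 := 1)"
 define R6 where "R6 = R5(0 := limit)"
 note d = R2_def R3_def R4_def R5_def R6_def
 have c2: "dsound (Const 64 1) R1 R2 (1 + len 1)" unfolding R2_def by (rule dsound_Const)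
 have c3: "dsound (Op Mul 62 0 64) R2 R3 (1 + len degree + len 1)"
  using dsound_Op[of Mul 62 0 64 R2] by (simp add: R3_def R2_def R10)
 have c4: "dsound (Op Mul 2 62 62) R3 R4 (1 + len degree + len degree)"
  using dsound_Op[of Mul 2 62 62 R3] by (simp add: d limit_def)
 have c5: "dsound (Const 1 1) R4 R5 (1 + len 1)" unfolding R5_def by (rule dsound_Const)
 have c6: "dsound (Op Mul 0 2 64) R5 R6 (1 + len limit + len 1)"
  using dsound_Op[of Mul 0 2 64 R5] by (simp add: d)
 have v6: "R6 0 = limit" "R6 61 = limit - limit" "R6 62 = degree" "R6 1 = (\<Prod>j<limit - limit. factor j)"
  using z1[of 61] by (simp_all add: d)
 obtain R' where R': "dsound (While 0 cap_body) R6 R' (limit * (30 * width + 200) + 1)" "R' 1 = cap"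
   "\<forall>a. a \<notin> {0, 1, 61, 64, 128} \<longrightarrow> R' a = R6 a" "R' 61 \<le> limit"
  using dsound_cap_loop[OF widths(4,1,2,3) v6(1) le_refl v6(2-4)] by blast
 have "dsound init R R' (ecost degree_expr * width + limit * (30 * width + 200) + 10 * width)"
  unfolding init_def
  by (rule dsound_mono[OF dsound_Seq[OF R1(1) dsound_Seq[OF c2 dsound_Seq[OF c3 dsound_Seq[OF c4 dsound_Seq[OF c5 dsound_Seq[OF c6 R'(1)]]]]]]])
   (use widths l1 in linarith)
 moreover have "R' 2 = limit" using R'(3) by (simp add: d)
 moreover have "bounded width R'"
 proof (rule bounded_input)
  fix a :: nat assume a: "a mod 64 \<noteq> 0"
  show "len (R' a) \<le> width"
  proof (cases "a \<in> {1, 2, 61, 62}")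
   case True
   have "len (R' 61) \<le> width" using len_mono[OF R'(4)] widths(2) by simp
   then show ?thesis using True R' widths \<open>R' 2 = limit\<close> by (auto simp: d)
  next
   case False
   have "a \<noteq> 0" "a \<noteq> 64" "a \<noteq> 128" using a by (auto intro!: notI)
   then have "R' a = R1 a" using R'(3) False by (auto simp: d)
   then show ?thesis using z1[OF a] l0 by simp
  qed
 qed
 moreover have "R' (64 * i + k) = 0" if k: "2 < k" "k < 61" for k i
 proof -
  have m: "(64 * i + k) mod 64 = k" using k by simp
  have "x mod 64 \<in> {0, 1, 2, 61, 62}" if "x \<in> {0, 1, 2, 61, 62, 64, 128}" for x :: nat using that by auto
  from this[of "64 * i + k"] have "64 * i + k \<notin> {0, 1, 2, 61, 62, 64, 128}" using k unfolding m by auto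
  then have "R' (64 * i + k) = R1 (64 * i + k)" using R'(3) by (auto simp: d)
  then show ?thesis using z1[of "64 * i + k"] m k by simp
 qed
 ultimately show ?thesis using R'(2) by blast
qed

lemma sound_ends:
 assumes "sound c R e D w" "w0 + w \<le> W"
 shows "ends W \<lparr>todo = [c], mem = R, env = e, cost = w0\<rparr> (map_pmf snd D)"
 unfolding map_pmf_def by (rule soundD[OF assms(1)]) (use assms(2) in \<open>auto intro: ends_halted\<close>)

lemma ends_reward:
 assumes "ends W (init_config c I) E"
 shows "algorithm_reward c xs I B = expect E earned"
proof -
 have "expect (run c xs I B k) (\<lambda>g. earned (env g)) = expect E earned" if "W \<le> k" for k
 proof -
  have "map_pmf env (run c xs I B k) = E"
   using assms that unfolding ends_def run_steps by (simp add: init_config_def)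
  then show ?thesis using integral_map_pmf[of env "run c xs I B k" earned] by simp
 qed
 then have "(\<lambda>k. expect (run c xs I B k) (\<lambda>g. earned (env g))) \<longlonglongrightarrow> expect E earned"
  by (intro tendsto_eventually eventually_sequentiallyI[of W]) simp
 then show ?thesis unfolding algorithm_reward_def by (rule limI)
qed

lemma ends_time:
 assumes "ends W (init_config c I) E" "W \<le> T" "g \<in> set_pmf (run c xs I B T)"
 shows "halted g \<and> cost g \<le> T"
 using assms unfolding ends_def run_steps by (force simp: init_config_def)

definition total :: "stm \<Rightarrow> nat" where
 "total st = ecost guard * input_size xs + 2 * input_size xs
  + (ecost degree_expr * width + limit * (30 * width + 200) + 10 * width) + scost st width limit + 10"

lemma program_starts:
 assumes "0 < input_size xs"
 obtains R where "dsound (comp 0 guard) (\<lambda>_. 0) R (ecost guard * input_size xs)" "R 0 = lookup xs 1 * lookup xs 2"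
  "\<And>a. a mod 64 \<noteq> 0 \<Longrightarrow> R a = 0" "len (R 0) \<le> 2 * input_size xs"
proof -
 have b: "bounded (input_size xs) (\<lambda>_. 0)"
  by (rule bounded_lenI) (use assms lookup_le_size in \<open>auto simp: floorlog_def\<close>)
 have wf: "wf_expr guard" by (simp add: guard_def)
 obtain R where R: "dsound (comp 0 guard) (\<lambda>_. 0) R (ecost guard * input_size xs)" "R (64 * 0) = ev (view (\<lambda>_. 0)) guard"
  "agree 0 (\<lambda>_. 0) R"
  using dsound_comp[OF wf b, of 0] by blast
 have R0: "R 0 = lookup xs 1 * lookup xs 2" using R(2) by (simp add: guard_def)
 moreover have "len (R 0) \<le> 2 * input_size xs"
  using len_mult_le[of "lookup xs 1" "lookup xs 2"] lookup_le_size[of 1] lookup_le_size[of 2] unfolding R0 by linarith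
 ultimately show ?thesis using that R(1,3) by (auto simp: agree_def)
qed

lemma program_ends_trivial:
 assumes "0 < input_size xs" "lookup xs 1 * lookup xs 2 = 0"
 shows "ends (ecost guard * input_size xs + 2 * input_size xs + 10) (init_config (program st) I) (return_pmf (init_env I))"
proof -
 obtain R where R: "dsound (comp 0 guard) (\<lambda>_. 0) R (ecost guard * input_size xs)" "R 0 = lookup xs 1 * lookup xs 2"
  "\<And>a. a mod 64 \<noteq> 0 \<Longrightarrow> R a = 0" "len (R 0) \<le> 2 * input_size xs"
  using program_starts[OF assms(1)] by blast
 have skip: "sound (If 0 (Seq init (comps 0 st)) Skip) R (init_env I) (return_pmf (R, init_env I)) (1 + 1 + len (R 0))"
 proof (rule sound_If)
  have "sound Skip R (init_env I) (return_pmf (R, init_env I)) 1" by (rule sound_prim) auto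
  then show "sound (if R 0 \<noteq> 0 then Seq init (comps 0 st) else Skip) R (init_env I) (return_pmf (R, init_env I)) 1"
   using R(2) assms(2) by simp
 qed
 have "sound (program st) (\<lambda>_. 0) (init_env I) (return_pmf (R, init_env I)) (ecost guard * input_size xs + 2 * input_size xs + 10)"
  unfolding program_def by (rule sound_mono[OF sound_dsound_Seq[OF R(1) skip]]) (use R(4) in simp)
 from sound_ends[OF this, of 0] show ?thesis by (simp add: init_config_def)
qed

theorem program_ends:
 assumes Ok: "Ok (init_env I)" "\<And>e x e'. Ok e \<Longrightarrow> e' \<in> set_pmf (env_step I B x e) \<Longrightarrow> Ok e'"
   "\<And>e i. Ok e \<Longrightarrow> i < narms I \<Longrightarrow> len (pos e i) \<le> input_size xs"
  and st: "wf_stm st" and S: "0 < input_size xs" and nz: "lookup xs 1 * lookup xs 2 \<noteq> 0"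
 obtains S where "S 1 0 = cap" "S 2 0 = limit" "\<And>k i. 2 < k \<Longrightarrow> k < 61 \<Longrightarrow> S k i = 0"
  "ends (total st) (init_config (program st) I) (map_pmf snd (sem st (S, init_env I)))"
proof -
 obtain R where R: "dsound (comp 0 guard) (\<lambda>_. 0) R (ecost guard * input_size xs)" "R 0 = lookup xs 1 * lookup xs 2"
  "\<And>a. a mod 64 \<noteq> 0 \<Longrightarrow> R a = 0" "len (R 0) \<le> 2 * input_size xs"
  using program_starts[OF S] by blast
 from dsound_init[of R] R(3) obtain R1 where
  R1: "dsound init R R1 (ecost degree_expr * width + limit * (30 * width + 200) + 10 * width)"
  "R1 1 = cap" "R1 2 = limit" "bounded width R1" "\<forall>k i. 2 < k \<longrightarrow> k < 61 \<longrightarrow> R1 (64 * i + k) = 0"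
  by blast
 have small: "pos e i < 2 ^ width" if "Ok e" "i < narms I" for e i
 proof (rule less_le_trans[OF less_len power_increasing])
  show "len (pos e i) \<le> width" using Ok(3)[OF that] input_le_width by simp
 qed simp
 obtain D where D: "sound (comps 0 st) R1 (init_env I) D (scost st width limit)"
  "map_pmf (\<lambda>p. (abs (fst p), snd p)) D = sem st (abs R1, init_env I)"
 proof -
  have "\<exists>D. sound (comps 0 st) R1 (init_env I) D (scost st width limit) \<and>
    map_pmf (\<lambda>p. (abs (fst p), snd p)) D = sem st (abs R1, init_env I) \<and>
    (\<forall>p\<in>set_pmf D. keeps 0 R1 (fst p) \<and> bounded width (fst p) \<and> Ok (snd p))"
   by (rule sound_comps) (use Ok small st R1 in auto)
  then show ?thesis using that by blast
 qed
 have "sound (if R 0 \<noteq> 0 then Seq init (comps 0 st) else Skip) R (init_env I) D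
   ((ecost degree_expr * width + limit * (30 * width + 200) + 10 * width) + scost st width limit + 1)"
  using sound_dsound_Seq[OF R1(1) D(1)] nz R(2) by simp
 then have "sound (program st) (\<lambda>_. 0) (init_env I) D (total st)"
  unfolding program_def total_def
  by (intro sound_mono[OF sound_dsound_Seq[OF R(1) sound_If]]) (use R(4) in auto)
 from sound_ends[OF this, of 0 "total st"]
 have "ends (total st) (init_config (program st) I) (map_pmf snd D)" by (simp add: init_config_def)
 moreover have "map_pmf snd D = map_pmf snd (sem st (abs R1, init_env I))"
  unfolding D(2)[symmetric] by (simp add: map_pmf_comp)
 moreover have "abs R1 k i = 0" if "2 < k" "k < 61" for k i using that R1(5) by (simp add: abs_def)
 ultimately show ?thesis using that[of "abs R1"] R1(2,3) abs_limits by metis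
qed

end

text \<open>The hypotheses bound the numbers of actions and nodes by value and not just by length;
  \<open>encoded_sizes\<close> obtains this from the tables that the input spells out.\<close>

lemma total_poly:
 "\<exists>f. poly_bounded (\<lambda>S. S) f \<and> (\<forall>xs. lookup xs 2 \<le> input_size xs \<longrightarrow> lookup xs 3 \<le> input_size xs \<longrightarrow> machine.total xs st \<le> f (input_size xs))
  \<and> (\<forall>S. machine.ecost machine.guard * S + 2 * S + 10 \<le> f S)"
proof -
 obtain C where C: "\<And>L m. machine.scost st L m \<le> (L + m + 2) ^ C"
  using machine.scost_poly[of st] unfolding poly_bounded_def by fastforce
 let ?g = "machine.ecost machine.guard" and ?d = "machine.ecost machine.degree_expr"
 define m where "m S = (2 * S + 10) ^ 5 * (2 * S + 10) ^ 5" for S :: nat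
 define l where "l S = m S * (S + 5) + 20" for S :: nat
 define f where "f S = ?g * S + 2 * S + (?d * l S + m S * (30 * l S + 200) + 10 * l S) + (l S + m S + 2) ^ C + 10" for S
 have m: "poly_bounded (\<lambda>S. S) m" unfolding m_def
  by (intro poly_bounded_mult poly_bounded_power poly_bounded_add poly_bounded_const poly_bounded_le le_refl)
 have l: "poly_bounded (\<lambda>S. S) l" unfolding l_def
  by (intro poly_bounded_mult m poly_bounded_add poly_bounded_const poly_bounded_le le_refl)
 have "poly_bounded (\<lambda>S. S) f" unfolding f_def
  by (intro poly_bounded_mult l m poly_bounded_power poly_bounded_add poly_bounded_const poly_bounded_le le_refl)
 moreover have "machine.total xs st \<le> f (input_size xs)" if "lookup xs 2 \<le> input_size xs" "lookup xs 3 \<le> input_size xs" for xs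
 proof -
  have "machine.degree xs \<le> (2 * input_size xs + 10) ^ 5"
   unfolding machine.degree_def using that by (intro power_mono) auto
  then have lim: "machine.limit xs \<le> m (input_size xs)"
   unfolding machine.limit_def m_def by (intro mult_le_mono)
  then have w: "machine.width xs \<le> l (input_size xs)"
   unfolding machine.width_def l_def by (intro add_mono mult_le_mono) auto
  have "machine.scost st (machine.width xs) (machine.limit xs) \<le> (machine.width xs + machine.limit xs + 2) ^ C" by (rule C)
  also have "\<dots> \<le> (l (input_size xs) + m (input_size xs) + 2) ^ C"
   using lim w by (intro power_mono add_mono) auto
  finally show ?thesis unfolding machine.total_def f_def using lim w by (intro add_mono mult_le_mono) auto
 qed
 moreover have "?g * S + 2 * S + 10 \<le> f S" for S by (simp add: f_def)
 ultimately show ?thesis by blast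
qed

section \<open>The program\<close>

context machine
begin

section \<open>Proof rules for deterministic statements\<close>

primrec mods :: "stm \<Rightarrow> nat set" where
 "mods Nop = {}"
| "mods (Asg k a b) = {k}"
| "mods (Rnd k a b) = {k}"
| "mods (Pul k a i x) = {k}"
| "mods (Then s s') = mods s \<union> mods s'"
| "mods (Cnd e s s') = mods s \<union> mods s'"
| "mods (For k n s) = insert k (mods s)"

lemma put_other [simp]: "j \<noteq> k \<Longrightarrow> put S k i v j = S j"
 by (simp add: put_def)

lemma put_same [simp]: "put S k i v k = (S k)(i := v)"
 by (simp add: put_def)

lemma sem_frame: "p' \<in> set_pmf (sem st p) \<Longrightarrow> k \<notin> mods st \<Longrightarrow> fst p' k = fst p k"
proof (induction st arbitrary: p p')
 case (For j n s)
 let ?f = "\<lambda>p. map_pmf (\<lambda>p. (incr j (fst p), snd p)) (sem s p)"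
 have step: "fst q' k = fst q k" if "q' \<in> set_pmf (?f q)" for q q'
  using that For.IH[of _ q] For.prems(2) by (auto simp: asg_def)
 have "q' \<in> set_pmf (iter m ?f q) \<Longrightarrow> fst q' k = fst q k" for m q q'
 proof (induction m arbitrary: q)
  case (Suc m)
  then obtain q1 where "q1 \<in> set_pmf (?f q)" "q' \<in> set_pmf (iter m ?f q1)" by auto
  then show ?case using Suc.IH[of q1] step[of q1 q] by (simp only:)
 qed simp
 from this[of p' "min (ev (fst p) n) (fst p 2 0)" "(asg j (Num 0) (Num 0) (fst p), snd p)"] For.prems
 show ?case by (simp add: asg_def)
next
 case (Then s s')
 then obtain q where q: "q \<in> set_pmf (sem s p)" "p' \<in> set_pmf (sem s' q)" by auto
 have "fst p' k = fst q k" using Then.IH(2)[OF q(2)] Then.prems(2) by simp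
 also have "\<dots> = fst p k" using Then.IH(1)[OF q(1)] Then.prems(2) by simp
 finally show ?case .
next
 case (Cnd e s s')
 then show ?case by (cases "ev (fst p) e = 0") auto
qed (auto simp: asg_def)

lemma sem_invariant:
 assumes Ok: "\<And>e x e'. Ok e \<Longrightarrow> e' \<in> set_pmf (env_step I B x e) \<Longrightarrow> Ok e'"
 shows "p' \<in> set_pmf (sem st p) \<Longrightarrow> Ok (snd p) \<Longrightarrow> Ok (snd p')"
proof (induction st arbitrary: p p')
 case (Pul k a i x)
 then show ?case using Ok by auto
next
 case (For j n s)
 let ?f = "\<lambda>p. map_pmf (\<lambda>p. (incr j (fst p), snd p)) (sem s p)"
 have step: "Ok (snd q')" if "q' \<in> set_pmf (?f q)" "Ok (snd q)" for q q'
  using that For.IH[of _ q] by auto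
 have "q' \<in> set_pmf (iter m ?f q) \<Longrightarrow> Ok (snd q) \<Longrightarrow> Ok (snd q')" for m q q'
 proof (induction m arbitrary: q)
  case (Suc m)
  then obtain q1 where "q1 \<in> set_pmf (?f q)" "q' \<in> set_pmf (iter m ?f q1)" by auto
  then show ?case using Suc.IH[of q1] step[of q1 q] Suc.prems by blast
 qed simp
 from this[of p' "min (ev (fst p) n) (fst p 2 0)" "(asg j (Num 0) (Num 0) (fst p), snd p)"] For.prems
 show ?case by simp
next
 case (Then s s')
 then obtain q where q: "q \<in> set_pmf (sem s p)" "p' \<in> set_pmf (sem s' q)" by auto
 show ?case using Then.IH(2)[OF q(2)] Then.IH(1)[OF q(1)] Then.prems(2) by blast
next
 case (Cnd e s s')
 then show ?case by (cases "ev (fst p) e = 0") auto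
qed auto

definition runs :: "stm \<Rightarrow> (nat \<Rightarrow> nat \<Rightarrow> nat) \<Rightarrow> (nat \<Rightarrow> nat \<Rightarrow> nat) \<Rightarrow> bool" where
 "runs st S T \<longleftrightarrow> (\<forall>e. sem st (S, e) = return_pmf (T, e))"

lemma runs_frame: "runs st S T \<Longrightarrow> k \<notin> mods st \<Longrightarrow> T k = S k"
 using sem_frame[of "(T, undefined)" st "(S, undefined)" k] by (simp add: runs_def)

lemma runs_Nop: "runs Nop S S"
 by (simp add: runs_def)

lemma runs_Asg: "ev S b = v \<Longrightarrow> ev S a = i \<Longrightarrow> v \<le> S 1 0 \<Longrightarrow> runs (Asg k a b) S (put S k i v)"
 by (simp add: runs_def asg_def)

lemma runs_Then: "runs s S S' \<Longrightarrow> runs s' S' S'' \<Longrightarrow> runs (Then s s') S S''"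
 by (simp add: runs_def bind_return_pmf)

lemma runs_Cnd: "runs (if ev S b \<noteq> 0 then s else s') S T \<Longrightarrow> runs (Cnd b s s') S T"
 by (simp add: runs_def split: if_splits)

lemma iter_runs:
 assumes "\<And>i T. i < m \<Longrightarrow> Inv i T \<Longrightarrow> \<exists>T'. (\<forall>e. f (T, e) = return_pmf (T', e)) \<and> Inv (Suc i) T'"
 shows "l + j = m \<Longrightarrow> Inv j S \<Longrightarrow> \<exists>T. (\<forall>e. iter l f (S, e) = return_pmf (T, e)) \<and> Inv m T"
proof (induction l arbitrary: j S)
 case 0
 then show ?case by auto
next
 case (Suc l)
 obtain T' where T': "\<forall>e. f (S, e) = return_pmf (T', e)" "Inv (Suc j) T'"
  using assms[of j S] Suc.prems by auto
 obtain T where "\<forall>e. iter l f (T', e) = return_pmf (T, e)" "Inv m T"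
  using Suc.IH[of "Suc j" T'] T' Suc.prems by auto
 then show ?case using T' by (auto simp: bind_return_pmf)
qed

text \<open>The invariant is re-established with the loop variable already at the next index,
  because a loop increments it after the body. The bounds on \<open>m\<close> keep both the count
  and the variable from being clamped.\<close>

lemma runs_For:
 assumes k: "2 < k" "k \<notin> mods c" "1 \<notin> mods c" and m: "ev S n = m" "m \<le> S 2 0" "m \<le> S 1 0"
  and base: "Inv 0 (put S k 0 0)"
  and step: "\<And>i T. i < m \<Longrightarrow> Inv i T \<Longrightarrow> T k 0 = i \<Longrightarrow> (\<And>j. j \<notin> mods (For k n c) \<Longrightarrow> T j = S j) \<Longrightarrow>
   \<exists>T'. runs c T T' \<and> Inv (Suc i) (put T' k 0 (Suc i))"
 shows "\<exists>T. runs (For k n c) S T \<and> Inv m T \<and> T k 0 = m"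
proof -
 let ?f = "\<lambda>p. map_pmf (\<lambda>p. (incr k (fst p), snd p)) (sem c p)"
 define J where "J i T \<longleftrightarrow> Inv i T \<and> T k 0 = i \<and> (\<forall>j. j \<notin> mods (For k n c) \<longrightarrow> T j = S j)" for i T
 have "\<exists>T'. (\<forall>e. ?f (T, e) = return_pmf (T', e)) \<and> J (Suc i) T'" if "i < m" "J i T" for i T
 proof -
  have "\<exists>T'. runs c T T' \<and> Inv (Suc i) (put T' k 0 (Suc i))"
   by (rule step) (use that in \<open>auto simp: J_def\<close>)
  then obtain T' where T': "runs c T T'" "Inv (Suc i) (put T' k 0 (Suc i))" by blast
  have fr: "j \<notin> mods c \<Longrightarrow> T' j = T j" for j using runs_frame[OF T'(1)] by blast
  have "T' 1 0 = S 1 0" using fr[OF k(3)] that(2) k unfolding J_def by auto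
  then have "incr k T' = put T' k 0 (Suc i)" using fr[OF k(2)] that m(3) unfolding J_def by (simp add: asg_def)
  moreover have "J (Suc i) (put T' k 0 (Suc i))" using T'(2) fr that unfolding J_def by auto
  ultimately show ?thesis using T'(1) by (intro exI[of _ "put T' k 0 (Suc i)"]) (simp add: runs_def)
 qed
 moreover have "J 0 (put S k 0 0)" using base unfolding J_def by auto
 ultimately obtain T where T: "\<forall>e. iter m ?f (put S k 0 0, e) = return_pmf (T, e)" "J m T"
  using iter_runs[of m J ?f m 0 "put S k 0 0"] by auto
 have "runs (For k n c) S T" using T(1) m by (simp add: runs_def asg_def)
 then show ?thesis using T(2) unfolding J_def by blast
qed

abbreviation Acc :: "binop \<Rightarrow> nat \<Rightarrow> nat \<Rightarrow> expr \<Rightarrow> expr \<Rightarrow> stm" where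
 "Acc f k j n e \<equiv> For j n (Asg k (Num 0) (Bin f (Arr k (Num 0)) e))"

lemma runs_sum:
 assumes k: "2 < j" "j \<noteq> k" "2 < k" and m: "ev S n = m" "m \<le> S 2 0" "m \<le> S 1 0"
  and e: "\<And>T i. i < m \<Longrightarrow> T j 0 = i \<Longrightarrow> (\<And>l. l \<noteq> j \<Longrightarrow> l \<noteq> k \<Longrightarrow> T l = S l) \<Longrightarrow> ev T e = f i"
  and b: "S k 0 + (\<Sum>i<m. f i) \<le> S 1 0"
 shows "\<exists>T. runs (Acc Add k j n e) S T \<and> T k 0 = S k 0 + (\<Sum>i<m. f i)"
proof -
 have "\<exists>T. runs (Acc Add k j n e) S T \<and> T k 0 = S k 0 + (\<Sum>i<m. f i) \<and> T j 0 = m"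
 proof (rule runs_For[OF k(1) _ _ m, where Inv = "\<lambda>l T. T k 0 = S k 0 + (\<Sum>i<l. f i)"])
  fix i T assume i: "i < m" and inv: "T k 0 = S k 0 + (\<Sum>i<i. f i)" "T j 0 = i"
   and fr: "\<And>l. l \<notin> mods (Acc Add k j n e) \<Longrightarrow> T l = S l"
  have ev: "ev T e = f i" by (rule e) (use i inv(2) fr in auto)
  have "(\<Sum>i<Suc i. f i) \<le> (\<Sum>i<m. f i)" using i by (intro sum_mono2) auto
  then have "ev T (Bin Add (Arr k (Num 0)) e) \<le> T 1 0" using b inv ev fr[of 1] k by simp
  then have "runs (Asg k (Num 0) (Bin Add (Arr k (Num 0)) e)) T (put T k 0 (T k 0 + f i))"
   by (intro runs_Asg) (use ev in auto)
  then show "\<exists>T'. runs (Asg k (Num 0) (Bin Add (Arr k (Num 0)) e)) T T' \<and> (put T' j 0 (Suc i)) k 0 = S k 0 + (\<Sum>i<Suc i. f i)"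
   using k inv by (intro exI[of _ "put T k 0 (T k 0 + f i)"]) simp
 qed (use k in auto)
 then show ?thesis by blast
qed

lemma runs_prod:
 assumes k: "2 < j" "j \<noteq> k" "2 < k" and m: "ev S n = m" "m \<le> S 2 0" "m \<le> S 1 0"
  and e: "\<And>T i. i < m \<Longrightarrow> T j 0 = i \<Longrightarrow> (\<And>l. l \<noteq> j \<Longrightarrow> l \<noteq> k \<Longrightarrow> T l = S l) \<Longrightarrow> ev T e = f i"
  and b: "\<And>l. l \<le> m \<Longrightarrow> (\<Prod>i<l. f i) \<le> S 1 0" and k0: "S k 0 = 1"
 shows "\<exists>T. runs (Acc Mul k j n e) S T \<and> T k 0 = (\<Prod>i<m. f i)"
proof -
 have "\<exists>T. runs (Acc Mul k j n e) S T \<and> T k 0 = (\<Prod>i<m. f i) \<and> T j 0 = m"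
 proof (rule runs_For[OF k(1) _ _ m, where Inv = "\<lambda>l T. T k 0 = (\<Prod>i<l. f i)"])
  fix i T assume i: "i < m" and inv: "T k 0 = (\<Prod>i<i. f i)" "T j 0 = i"
   and fr: "\<And>l. l \<notin> mods (Acc Mul k j n e) \<Longrightarrow> T l = S l"
  have ev: "ev T e = f i" by (rule e) (use i inv(2) fr in auto)
  have "ev T (Bin Mul (Arr k (Num 0)) e) \<le> T 1 0" using b[of "Suc i"] i inv ev fr[of 1] k by simp
  then have "runs (Asg k (Num 0) (Bin Mul (Arr k (Num 0)) e)) T (put T k 0 (T k 0 * f i))"
   by (intro runs_Asg) (use ev in auto)
  then show "\<exists>T'. runs (Asg k (Num 0) (Bin Mul (Arr k (Num 0)) e)) T T' \<and> (put T' j 0 (Suc i)) k 0 = (\<Prod>i<Suc i. f i)"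
   using k inv by (intro exI[of _ "put T k 0 (T k 0 * f i)"]) simp
 qed (use k k0 in auto)
 then show ?thesis by blast
qed

end

section \<open>Reading the instance from the input\<close>

lemma nth_concat_uniform:
 assumes "\<And>l. l \<in> set ls \<Longrightarrow> length l = m" "j < m"
 shows "i < length ls \<Longrightarrow> concat ls ! (i * m + j) = ls ! i ! j"
 using assms(1)
proof (induction ls arbitrary: i)
 case (Cons l ls)
 have l: "length l = m" using Cons.prems by simp
 show ?case
 proof (cases i)
  case 0
  then show ?thesis using l assms(2) by (simp add: nth_append)
 next
  case (Suc i')
  have "concat (l # ls) ! (i * m + j) = concat ls ! (i' * m + j)" using l Suc by (simp add: nth_append)
  then show ?thesis using Cons.IH[of i'] Cons.prems Suc by simp
 qed
qed simp

lemma length_concat_uniform: "(\<And>l. l \<in> set ls \<Longrightarrow> length l = m) \<Longrightarrow> length (concat ls) = length ls * m"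
 by (induction ls) auto

text \<open>An instance with an arm and an action, described by the input positions of its
  numbers.\<close>

locale encoded = bandit I B dep + machine xs I B
 for I :: "(nat, nat) mab" and B :: nat and dep :: "nat \<Rightarrow> nat" and xs :: "nat list" +
 fixes K N :: nat and rn rd :: "nat \<Rightarrow> nat \<Rightarrow> nat" and pn pd :: "nat \<Rightarrow> nat \<Rightarrow> nat \<Rightarrow> nat"
 assumes acts: "acts I = {..<K}" and states: "states I = {..<N}"
  and lk: "lookup xs 0 = B" "lookup xs 1 = narms I" "lookup xs 2 = K" "lookup xs 3 = N"
  and lk_root: "\<And>i. i < narms I \<Longrightarrow> lookup xs (4 + i) = root I i"
  and lk_rew: "\<And>a u. a < K \<Longrightarrow> u < N \<Longrightarrow> lookup xs (4 + narms I + N + 2 * (a * N + u)) = rn a u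
   \<and> lookup xs (4 + narms I + N + 2 * (a * N + u) + 1) = rd a u"
  and lk_prob: "\<And>a u v. a < K \<Longrightarrow> u < N \<Longrightarrow> v < N \<Longrightarrow>
   lookup xs (4 + narms I + N + 2 * (K * N) + 2 * ((a * N + u) * N + v)) = pn a u v
   \<and> lookup xs (4 + narms I + N + 2 * (K * N) + 2 * ((a * N + u) * N + v) + 1) = pd a u v"
  and rew_frac: "\<And>a u. a < K \<Longrightarrow> u < N \<Longrightarrow> rd a u > 0 \<and> rew I a u = rn a u / rd a u"
  and prob_frac: "\<And>a u v. a < K \<Longrightarrow> u < N \<Longrightarrow> v < N \<Longrightarrow> pd a u v > 0 \<and> prob I a u v = pn a u v / pd a u v"
  and length_xs: "length xs = 4 + narms I + N + 2 * (K * N) + 2 * (K * N * N)"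
  and arms_pos: "1 \<le> narms I" and acts_pos: "1 \<le> K"

lemma encoded_header:
 assumes "encodes xs I B"
 shows "lookup xs 0 = B" "lookup xs 1 = narms I" "acts I = {..<lookup xs 2}" "0 < length xs"
proof -
 obtain K N arm rn rd pn pd where e: "acts I = {..<K}" "\<forall>u<N. arm u < narms I"
   "xs = [B, narms I, K, N] @ map (root I) [0..<narms I] @ map arm [0..<N]
      @ concat [[rn a u, rd a u]. a \<leftarrow> [0..<K], u \<leftarrow> [0..<N]]
      @ concat [[pn a u v, pd a u v]. a \<leftarrow> [0..<K], u \<leftarrow> [0..<N], v \<leftarrow> [0..<N]]"
  using assms unfolding encodes_def by blast
 show "lookup xs 0 = B" "lookup xs 1 = narms I" "acts I = {..<lookup xs 2}" "0 < length xs"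
  unfolding e(1) by (simp_all add: e(3) lookup_def)
qed

text \<open>The nested comprehensions of the format are concatenations of blocks of equal length, so
  \<open>nth_concat_uniform\<close> locates each entry by mixed-radix arithmetic.\<close>

lemma encoded_of_encodes:
 assumes "bandit I B dep" "encodes xs I B" "lookup xs 1 * lookup xs 2 \<noteq> 0"
 obtains K N rn rd pn pd where "encoded I B dep xs K N rn rd pn pd"
proof -
 obtain K N arm rn rd pn pd where e: "acts I = {..<K}" "\<forall>u<N. arm u < narms I"
   "\<forall>i<narms I. nodes I i = {u. u < N \<and> arm u = i}"
   "\<forall>a<K. \<forall>u<N. rd a u > 0 \<and> rew I a u = real (rn a u) / real (rd a u)"
   "\<forall>a<K. \<forall>u<N. \<forall>v<N. pd a u v > 0 \<and> prob I a u v = real (pn a u v) / real (pd a u v)"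
   and xs: "xs = [B, narms I, K, N] @ map (root I) [0..<narms I] @ map arm [0..<N]
      @ concat [[rn a u, rd a u]. a \<leftarrow> [0..<K], u \<leftarrow> [0..<N]]
      @ concat [[pn a u v, pd a u v]. a \<leftarrow> [0..<K], u \<leftarrow> [0..<N], v \<leftarrow> [0..<N]]"
  using assms(2) unfolding encodes_def by blast
 let ?n = "narms I"
 let ?r2 = "map (\<lambda>a. map (\<lambda>u. [rn a u, rd a u]) [0..<N]) [0..<K]"
 let ?p2 = "map (\<lambda>a. concat (map (\<lambda>u. map (\<lambda>v. [pn a u v, pd a u v]) [0..<N]) [0..<N])) [0..<K]"
 define r1 where "r1 = concat ?r2"
 define p1 where "p1 = concat ?p2"
 have lr1: "length r1 = K * N" unfolding r1_def by (subst length_concat_uniform[of _ N]) auto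
 have lp0: "length (concat (map (\<lambda>u. map (\<lambda>v. [pn a u v, pd a u v]) [0..<N]) [0..<N])) = N * N" for a
  by (subst length_concat_uniform[of _ N]) auto
 have lp1: "length p1 = K * (N * N)" unfolding p1_def by (subst length_concat_uniform[of _ "N * N"]) (auto simp: lp0)
 have r1: "r1 ! (a * N + u) = [rn a u, rd a u]" if "a < K" "u < N" for a u
  unfolding r1_def using that by (subst nth_concat_uniform[of _ N]) auto
 have p1: "p1 ! ((a * N + u) * N + v) = [pn a u v, pd a u v]" if "a < K" "u < N" "v < N" for a u v
 proof -
  have i: "u * N + v < N * N" 
  proof -
   have "u * N + v < (u + 1) * N" using that by simp
   also have "\<dots> \<le> N * N" using that by (intro mult_le_mono1) simp
   finally show ?thesis .
  qed
  have "(a * N + u) * N + v = a * (N * N) + (u * N + v)" by (simp add: algebra_simps)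
  then have "p1 ! ((a * N + u) * N + v) = ?p2 ! a ! (u * N + v)"
   unfolding p1_def using i that by (simp only: ) (subst nth_concat_uniform[of _ "N * N"], auto simp: lp0)
  also have "\<dots> = concat (map (\<lambda>u. map (\<lambda>v. [pn a u v, pd a u v]) [0..<N]) [0..<N]) ! (u * N + v)" using that by simp
  also have "\<dots> = [pn a u v, pd a u v]" using that by (subst nth_concat_uniform[of _ N]) auto
  finally show ?thesis .
 qed
 have two: "\<forall>l\<in>set r1. length l = 2" "\<forall>l\<in>set p1. length l = 2" by (auto simp: r1_def p1_def)
 have lr: "length (concat r1) = 2 * (K * N)" using length_concat_uniform[of r1 2] two lr1 by simp
 have lp: "length (concat p1) = 2 * (K * N * N)" using length_concat_uniform[of p1 2] two lp1 by (simp add: mult.assoc)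
 have nr: "concat r1 ! (2 * i + j) = r1 ! i ! j" if "i < K * N" "j < 2" for i j
  using nth_concat_uniform[of r1 2 j i] two that lr1 by (simp add: mult.commute)
 have np: "concat p1 ! (2 * i + j) = p1 ! i ! j" if "i < K * (N * N)" "j < 2" for i j
  using nth_concat_uniform[of p1 2 j i] two that lp1 by (simp add: mult.commute)
 have xs': "xs = ([B, ?n, K, N] @ map (root I) [0..<?n] @ map arm [0..<N]) @ concat r1 @ concat p1"
  unfolding xs r1_def p1_def by simp
 have lh: "length ([B, ?n, K, N] @ map (root I) [0..<?n] @ map arm [0..<N]) = 4 + ?n + N" by simp
 have len: "length xs = 4 + ?n + N + 2 * (K * N) + 2 * (K * N * N)" unfolding xs' using lr lp by simp
 have look_r: "lookup xs (4 + ?n + N + i) = concat r1 ! i" if "i < 2 * (K * N)" for i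
 proof -
  have "4 + ?n + N + i < length xs" using len that by simp
  then have "lookup xs (4 + ?n + N + i) = xs ! (4 + ?n + N + i)" by (simp add: lookup_def)
  also have "\<dots> = (concat r1 @ concat p1) ! i" unfolding xs' nth_append lh by simp
  also have "\<dots> = concat r1 ! i" using that lr by (simp add: nth_append)
  finally show ?thesis .
 qed
 have look_p: "lookup xs (4 + ?n + N + 2 * (K * N) + i) = concat p1 ! i" if "i < 2 * (K * N * N)" for i
 proof -
  have "4 + ?n + N + 2 * (K * N) + i < length xs" using len that by simp
  then have "lookup xs (4 + ?n + N + 2 * (K * N) + i) = xs ! (4 + ?n + N + (2 * (K * N) + i))" by (simp add: lookup_def add.assoc)
  also have "\<dots> = (concat r1 @ concat p1) ! (2 * (K * N) + i)" unfolding xs' nth_append lh by simp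
  also have "\<dots> = concat p1 ! i" using lr by (simp add: nth_append)
  finally show ?thesis .
 qed
 have idx: "a * m + u < k * m" if "a < k" "u < m" for a k u m :: nat
 proof -
  have "a * m + u < (a + 1) * m" using that by simp
  also have "\<dots> \<le> k * m" using that by (intro mult_le_mono1) simp
  finally show ?thesis .
 qed
 interpret bandit I B dep by fact
 have st: "states I = {..<N}"
  using e(2,3) by (auto simp: states_def)
 have nK: "?n \<noteq> 0" "K \<noteq> 0" using assms(3) by (auto simp: xs lookup_def)
 have "encoded I B dep xs K N rn rd pn pd"
 proof (unfold_locales)
  show "lookup xs 0 = B" "lookup xs 1 = ?n" "lookup xs 2 = K" "lookup xs 3 = N"
   by (simp_all add: xs lookup_def)
  show "lookup xs (4 + i) = root I i" if "i < ?n" for i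
  proof -
   have "lookup xs (4 + i) = xs ! (4 + i)" using that len by (simp add: lookup_def)
   also have "\<dots> = ([B, ?n, K, N] @ (map (root I) [0..<?n] @ map arm [0..<N] @ concat r1 @ concat p1)) ! (4 + i)"
    unfolding xs' by simp
   also have "\<dots> = (map (root I) [0..<?n] @ map arm [0..<N] @ concat r1 @ concat p1) ! i"
    unfolding nth_append by simp
   also have "\<dots> = root I i" using that by (simp add: nth_append)
   finally show ?thesis .
  qed
  show "lookup xs (4 + ?n + N + 2 * (a * N + u)) = rn a u \<and> lookup xs (4 + ?n + N + 2 * (a * N + u) + 1) = rd a u"
   if "a < K" "u < N" for a u
  proof -
   note i = idx[OF that]
   have "lookup xs (4 + ?n + N + (2 * (a * N + u) + j)) = r1 ! (a * N + u) ! j" if "j < 2" for j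
    using look_r[of "2 * (a * N + u) + j"] nr[OF i that] i that by simp
   from this[of 0] this[of 1] show ?thesis by (simp add: r1[OF that] add.assoc)
  qed
  show "lookup xs (4 + ?n + N + 2 * (K * N) + 2 * ((a * N + u) * N + v)) = pn a u v
   \<and> lookup xs (4 + ?n + N + 2 * (K * N) + 2 * ((a * N + u) * N + v) + 1) = pd a u v"
   if "a < K" "u < N" "v < N" for a u v
  proof -
   have i: "(a * N + u) * N + v < K * N * N" using idx[OF idx[OF that(1,2)] that(3)] .
   have "lookup xs (4 + ?n + N + 2 * (K * N) + (2 * ((a * N + u) * N + v) + j)) = p1 ! ((a * N + u) * N + v) ! j" if "j < 2" for j
    using look_p[of "2 * ((a * N + u) * N + v) + j"] np[OF i[unfolded mult.assoc[of K]] that] i that by simp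
   from this[of 0] this[of 1] show ?thesis by (simp add: p1[OF that] add.assoc)
  qed
 qed (use e st len nK in auto)
 then show ?thesis by (rule that)
qed

context encoded
begin

text \<open>At a depth below \<open>B\<close> the outgoing probabilities sum to 1, so some successor
  has positive probability, and it lies exactly one layer deeper.\<close>

lemma depth_chain: "d \<le> B \<Longrightarrow> \<exists>u\<in>states I. dep u = d"
proof (induction d)
 case 0
 show ?case using root_states[of 0] dep_root[of 0] arms_pos by auto
next
 case (Suc d)
 then obtain u where u: "u \<in> states I" "dep u = d" by auto
 have a: "0 \<in> acts I" using acts acts_pos by simp
 have "(\<Sum>v\<in>states I. prob I 0 u v) = 1" using prob_sum[OF a u(1)] u Suc.prems by simp
 then obtain v where v: "v \<in> states I" "prob I 0 u v \<noteq> 0" by (metis sum.neutral zero_neq_one)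
 then have "prob I 0 u v > 0" using prob_nn[OF a u(1), of v] by simp
 then show ?case using dep_succ[OF a u(1) v(1)] u v by auto
qed

text \<open>All depths from 0 to \<open>B\<close> occur. This is what makes the horizon, although
  written in binary, polynomial in the input size.\<close>

lemma horizon_less: "B < N"
proof -
 have "{..B} \<subseteq> dep ` states I" using depth_chain by fastforce
 then have "card {..B} \<le> card (states I)"
  using fin_states by (metis card_image_le card_mono finite_imageI order_trans)
 then show ?thesis by (simp add: states)
qed

lemma arms_le: "narms I \<le> N"
proof -
 have "card (root I ` {..<narms I}) \<le> card (states I)"
  using root_states fin_states by (intro card_mono) auto
 then show ?thesis by (simp add: states card_image[OF inj_root])
qed

lemma cells:
 assumes "u < N" "v < N"
 shows "k * N + u = l * N + v \<longleftrightarrow> k = l \<and> u = v"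
proof -
 have "(k * N + u) div N = k" "(l * N + v) div N = l" "(k * N + u) mod N = u" "(l * N + v) mod N = v" using assms by auto
 then show ?thesis by metis
qed

text \<open>A common denominator of all transition probabilities, as \<open>RR\<close> below is for
  the rewards. A plain product avoids greatest common divisors and still has polynomial
  length.\<close>

definition PP :: nat where
 "PP = (\<Prod>j<K * N * N. lookup xs (4 + narms I + N + 2 * (K * N) + 2 * j + 1))"

definition RR :: nat where
 "RR = (\<Prod>j<K * N. lookup xs (4 + narms I + N + 2 * j + 1))"

definition ph :: "nat \<Rightarrow> nat \<Rightarrow> nat \<Rightarrow> nat" where
 "ph a u v = pn a u v * (PP div pd a u v)"

definition rh :: "nat \<Rightarrow> nat \<Rightarrow> nat" where
 "rh a u = rn a u * (RR div rd a u)"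

lemma index_less: "a < k \<Longrightarrow> u < m \<Longrightarrow> a * m + u < k * (m :: nat)"
proof -
 assume "a < k" "u < m"
 then have "a * m + u < (a + 1) * m" by simp
 also have "\<dots> \<le> k * m" using \<open>a < k\<close> by (intro mult_le_mono1) simp
 finally show ?thesis .
qed

lemma PP_pos: "0 < PP"
 unfolding PP_def
proof (rule prod_pos)
 fix j assume "j \<in> {..<K * N * N}"
 then have j: "j < K * N * N" by simp
 then have N: "0 < N" by (cases N) auto
 let ?v = "j mod N" and ?u = "j div N mod N" and ?a = "j div N div N"
 have "?a < K" using j N by (simp add: div_mult2_eq[symmetric] less_mult_imp_div_less mult.assoc)
 moreover have "(?a * N + ?u) * N + ?v = j" by simp
 ultimately show "0 < lookup xs (4 + narms I + N + 2 * (K * N) + 2 * j + 1)"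
  using lk_prob[of ?a ?u ?v] prob_frac[of ?a ?u ?v] N by simp
qed

lemma RR_pos: "0 < RR"
 unfolding RR_def
proof (rule prod_pos)
 fix j assume "j \<in> {..<K * N}"
 then have j: "j < K * N" by simp
 then have N: "0 < N" by (cases N) auto
 let ?u = "j mod N" and ?a = "j div N"
 have "?a < K" using j N by (simp add: less_mult_imp_div_less)
 moreover have "?a * N + ?u = j" by simp
 ultimately show "0 < lookup xs (4 + narms I + N + 2 * j + 1)"
  using lk_rew[of ?a ?u] rew_frac[of ?a ?u] N by simp
qed

lemma real_ph:
 assumes "a < K" "u < N" "v < N"
 shows "real (ph a u v) = PP * prob I a u v"
proof -
 let ?j = "(a * N + u) * N + v"
 have "?j \<in> {..<K * N * N}" using index_less[OF index_less[OF assms(1,2)] assms(3)] by simp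
 then have "lookup xs (4 + narms I + N + 2 * (K * N) + 2 * ?j + 1) dvd PP" unfolding PP_def by (intro dvd_prodI) auto
 then have "pd a u v dvd PP" using lk_prob[OF assms] by simp
 then have "real (PP div pd a u v) = PP / pd a u v" by (rule real_of_nat_div)
 then show ?thesis using prob_frac[OF assms] by (simp add: ph_def)
qed

lemma real_rh:
 assumes "a < K" "u < N"
 shows "real (rh a u) = RR * rew I a u"
proof -
 let ?j = "a * N + u"
 have "?j \<in> {..<K * N}" using index_less[OF assms] by simp
 then have "lookup xs (4 + narms I + N + 2 * ?j + 1) dvd RR" unfolding RR_def by (intro dvd_prodI) auto
 then have "rd a u dvd RR" using lk_rew[OF assms] by simp
 then have "real (RR div rd a u) = RR / rd a u" by (rule real_of_nat_div)
 then show ?thesis using rew_frac[OF assms] by (simp add: rh_def)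
qed

text \<open>The value of \<open>factor\<close> at the largest entry.\<close>

definition width_base :: nat where
 "width_base = Max (set xs) + 2"

lemma lookup_le: "lookup xs i + 2 \<le> width_base"
proof (cases "i < length xs")
 case True
 then have "xs ! i \<le> Max (set xs)" by simp
 then show ?thesis using True by (simp add: lookup_def width_base_def)
qed (simp add: lookup_def width_base_def)

lemma degree_cubic: "8 * ((K + N + 10) * (K + N + 10) * (K + N + 10)) \<le> degree"
proof -
 have p5: "m * m * (m * m * m) = m ^ 5" for m :: nat by (simp add: eval_nat_numeral)
 have "8 * (m * m * m) \<le> m * m * (m * m * m)" if "10 \<le> m" for m :: nat
 proof (rule mult_le_mono1)
  have "10 * 1 \<le> m * m" using that by (intro mult_le_mono) simp_all
  then show "8 \<le> m * m" by simp
 qed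
 from this[of "K + N + 10"] show ?thesis unfolding p5 degree_def lk by simp
qed

lemma length_le_degree: "length xs \<le> degree"
proof -
 define m where "m = K + N + 10"
 have m: "K \<le> m" "N \<le> m" "1 \<le> m" "4 \<le> m" by (simp_all add: m_def)
 have c: "K * N \<le> m * m" by (rule mult_le_mono[OF m(1,2)])
 have "K * N * N \<le> m * m * m" by (rule mult_le_mono[OF c m(2)])
 moreover have "m * 1 \<le> m * m" "m * m * 1 \<le> m * m * m" using mult_le_mono2[OF m(3)] by blast+
 moreover note c
 moreover have "length xs \<le> 4 + 2 * N + 2 * (K * N) + 2 * (K * N * N)" unfolding length_xs using arms_le by linarith
 ultimately have "length xs \<le> 8 * (m * m * m)" using m by linarith
 then show ?thesis using degree_cubic unfolding m_def by (rule order_trans)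
qed

text \<open>The position of the largest entry contributes a block of \<open>degree\<close> equal
  factors to \<open>cap\<close>; all other factors are at least 2.\<close>

lemma cap_ge: "e \<le> degree \<Longrightarrow> width_base ^ e \<le> cap"
proof -
 assume e: "e \<le> degree"
 have "xs \<noteq> []" using length_xs by auto
 then have "Max (set xs) \<in> set xs" by simp
 then obtain i where i: "i < length xs" "xs ! i = Max (set xs)" by (auto simp: in_set_conv_nth)
 let ?J = "{i * degree..<i * degree + degree}"
 have f: "factor j = width_base" if "j \<in> ?J" for j
 proof -
  have "j div degree = i" using that by (intro div_nat_eqI) (auto simp: mult.commute)
  then show ?thesis using i by (simp add: factor_def lookup_def width_base_def)
 qed
 have sub: "?J \<subseteq> {..<limit}"
 proof -
  have "i * degree + degree = (i + 1) * degree" by simp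
  also have "\<dots> \<le> degree * degree" using i(1) length_le_degree by (intro mult_le_mono1) simp
  finally show ?thesis by (auto simp: limit_def)
 qed
 have "width_base ^ e \<le> width_base ^ degree" using e by (intro power_increasing) (auto simp: width_base_def)
 also have "\<dots> = (\<Prod>j\<in>?J. factor j)" using f by simp
 also have "\<dots> \<le> (\<Prod>j\<in>?J. factor j) * (\<Prod>j\<in>{..<limit} - ?J. factor j)"
 proof -
  have "1 \<le> (\<Prod>j\<in>{..<limit} - ?J. factor j)" by (rule prod_ge_1) (simp add: factor_def)
  from mult_le_mono2[OF this, of "\<Prod>j\<in>?J. factor j"] show ?thesis by simp
 qed
 also have "\<dots> = cap" unfolding cap_def using sub by (simp add: prod.subset_diff mult.commute)
 finally show ?thesis .
qed

end

section \<open>The algorithm as a program of the loop language\<close>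

context machine
begin

abbreviation eadd :: "expr \<Rightarrow> expr \<Rightarrow> expr" (infixl ".+" 65) where "a .+ b \<equiv> Bin Add a b"
abbreviation esub :: "expr \<Rightarrow> expr \<Rightarrow> expr" (infixl ".-" 65) where "a .- b \<equiv> Bin Sub a b"
abbreviation emul :: "expr \<Rightarrow> expr \<Rightarrow> expr" (infixl ".*" 70) where "a .* b \<equiv> Bin Mul a b"
abbreviation ediv :: "expr \<Rightarrow> expr \<Rightarrow> expr" (infixl "\<oslash>" 70) where "a \<oslash> b \<equiv> Bin Div a b"
abbreviation seqs :: "stm \<Rightarrow> stm \<Rightarrow> stm" (infixr ";;" 55) where "s ;; s' \<equiv> Then s s'"
abbreviation var :: "nat \<Rightarrow> expr" where "var k \<equiv> Arr k (Num 0)"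
abbreviation assign :: "nat \<Rightarrow> expr \<Rightarrow> stm" where "assign k e \<equiv> Asg k (Num 0) e"
abbreviation "eB \<equiv> Inp (Num 0)"
abbreviation "en \<equiv> Inp (Num 1)"
abbreviation "eK \<equiv> Inp (Num 2)"
abbreviation "eN \<equiv> Inp (Num 3)"

definition root_at :: "expr \<Rightarrow> expr" where
 "root_at i = Inp (Num 4 .+ i)"

definition rew_at :: "expr \<Rightarrow> expr" where
 "rew_at j = Num 4 .+ en .+ eN .+ Num 2 .* j"

definition prob_at :: "expr \<Rightarrow> expr" where
 "prob_at j = Num 4 .+ en .+ eN .+ Num 2 .* (eK .* eN) .+ Num 2 .* j"

definition reward :: "expr \<Rightarrow> expr \<Rightarrow> expr" where
 "reward a u = Inp (rew_at (a .* eN .+ u)) .* (var 4 \<oslash> Inp (rew_at (a .* eN .+ u) .+ Num 1))"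

definition trans :: "expr \<Rightarrow> expr \<Rightarrow> expr \<Rightarrow> expr" where
 "trans a u v = Inp (prob_at ((a .* eN .+ u) .* eN .+ v)) .* (var 3 \<oslash> Inp (prob_at ((a .* eN .+ u) .* eN .+ v) .+ Num 1))"

definition scale_expr :: expr where
 "scale_expr = Num 2 .* en .* en .* en .* eB .* (eB .+ Num 1)"

definition rounds_expr :: expr where
 "rounds_expr = Num 2 .* (eB .+ Num 1) .* (scale_expr .+ en)"

definition cell :: "expr \<Rightarrow> expr \<Rightarrow> expr" where
 "cell k u = k .* eN .+ u"

text \<open>Array 10 keeps the tables of all rounds; 0 encodes no pull and \<open>a + 1\<close>
  encodes action \<open>a\<close>. Rows are numbered by the count \<open>k\<close> of slots that
  follow, so row \<open>k\<close> belongs to slot \<open>B - k\<close>.\<close>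

definition dec_at :: "expr \<Rightarrow> expr \<Rightarrow> expr \<Rightarrow> expr" where
 "dec_at r k u = Arr 10 (cell (r .* eB .+ k) u)"

definition eq :: "expr \<Rightarrow> expr \<Rightarrow> expr" where
 "eq a b = Num 1 .- ((a .- b) .+ (b .- a))"

abbreviation prob_denominators :: stm where
 "prob_denominators \<equiv> Acc Mul 3 27 (eK .* eN .* eN) (Inp (prob_at (var 27) .+ Num 1))"

abbreviation rew_denominators :: stm where
 "rew_denominators \<equiv> Acc Mul 4 27 (eK .* eN) (Inp (rew_at (var 27) .+ Num 1))"

abbreviation powers :: stm where
 "powers \<equiv> For 27 eB (Asg 5 (var 27 .+ Num 1) (Arr 5 (var 27) .* var 3))"

text \<open>Fills cell 3 with the common denominator of the probabilities, cell 4 with that of the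
  rewards, each at index 0 of its array, and array 5 with the powers of the former.\<close>

definition constants :: stm where
 "constants = assign 3 (Num 1) ;; prob_denominators
  ;; assign 4 (Num 1) ;; rew_denominators
  ;; assign 5 (Num 1) ;; powers"

abbreviation expected_value :: stm where
 "expected_value \<equiv> Acc Add 14 24 eN (trans (var 23) (var 22) (var 24) .* Arr 9 (cell (var 21) (var 24)))"

text \<open>One term of Bellman's equation in integers. Array 9 holds values with \<open>k\<close>
  slots to go, scaled by the factor in array 6, by the reward denominator and by
  \<open>PP ^ k\<close>; one more slot brings one more factor \<open>PP\<close>. The price is the
  product of the scaled free value in array 7 and the queue in array 8. Array 13 holds the best
  value so far.\<close>

definition try_action :: stm where
 "try_action = assign 14 (var 6 .* Arr 5 (var 21 .+ Num 1) .* reward (var 23) (var 22))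
  ;; expected_value
  ;; assign 14 (var 14 .- Arr 5 (var 21 .+ Num 1) .* var 7 .* Arr 8 (var 21))
  ;; Cnd (var 14 .- var 13) (assign 13 (var 14) ;; Asg 10 (cell (var 20 .* eB .+ var 21) (var 22)) (var 23 .+ Num 1)) Nop"

definition node_value :: stm where
 "node_value = assign 13 (var 3 .* Arr 9 (cell (var 21) (var 22)))
  ;; Asg 10 (cell (var 20 .* eB .+ var 21) (var 22)) (Num 0)
  ;; For 23 eK try_action
  ;; Asg 9 (cell (var 21 .+ Num 1) (var 22)) (var 13)"

definition all_values :: stm where
 "all_values = For 21 eB (For 22 eN node_value)"

abbreviation expected_load :: stm where
 "expected_load \<equiv> Acc Add 14 24 eN (trans (dec_at (var 20) (var 21) (var 22) .- Num 1) (var 22) (var 24) .* Arr 11 (cell (var 21) (var 24)))"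

abbreviation load_now :: stm where
 "load_now \<equiv> Cnd (dec_at (var 20) (var 21) (var 22))
   (assign 14 (eq (var 21) (var 25) .* Arr 5 (var 21 .+ Num 1))
    ;; expected_load)
   (assign 14 (var 3 .* Arr 11 (cell (var 21) (var 22))))"

definition node_load :: stm where
 "node_load = load_now
  ;; Asg 11 (cell (var 21 .+ Num 1) (var 22)) (var 14)"

abbreviation slot_total :: stm where
 "slot_total \<equiv> Acc Add 12 26 en (Arr 11 (cell eB (root_at (var 26))))"

text \<open>Each slot has its own backward recursion in array 11 for the probability of a pull in
  that slot. Truncated subtraction performs the projection onto nonnegative prices.\<close>

definition prices :: stm where
 "prices = For 25 eB (For 21 eB (For 22 eN node_load)
  ;; assign 12 (Num 0) ;; slot_total
  ;; Asg 8 (var 25) (Arr 8 (var 25) .+ var 12 .- Arr 5 eB))"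

abbreviation free_total :: stm where
 "free_total \<equiv> Acc Add 7 26 en (Arr 9 (cell eB (root_at (var 26))))"

text \<open>The first pass, with scale 1 and price factor 0 in array 7, yields the free value. The
  later scale contains \<open>step_scale\<close> and two factors \<open>PP ^ B\<close>, which clear
  the denominators of the step size, the free value and the queues.\<close>

definition dual :: stm where
 "dual = constants ;; assign 6 (Num 1) ;; all_values
  ;; free_total
  ;; assign 6 (scale_expr .* Arr 5 eB .* Arr 5 eB)
  ;; For 20 rounds_expr (all_values ;; prices)"

text \<open>The index counts slots from the end, so the loop moves back in time and the hit that
  survives is the earliest one.\<close>

definition first_time :: "expr \<Rightarrow> expr \<Rightarrow> expr \<Rightarrow> expr \<Rightarrow> stm" where
 "first_time i r m u = For 27 m (Cnd (dec_at r (var 27) u) (Asg 34 i (eB .- var 27)) Nop)"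

abbreviation first_play :: stm where
 "first_play \<equiv> Cnd (var 30) Nop (first_time (var 26) (Arr 31 (var 26)) eB (Arr 32 (var 26)))"

text \<open>State of the schedule for each arm: array 31 the table, array 32 the node, array 33 the
  plays made, array 34 the next virtual time. Array 30 holds the last throw of the die.\<close>

abbreviation sample_body :: stm where
 "sample_body \<equiv> Rnd 30 (Num 0) (Num 3) ;; Rnd 31 (var 26) rounds_expr ;; Asg 32 (var 26) (root_at (var 26))
  ;; Asg 34 (var 26) (eB .+ Num 1)
  ;; first_play"

definition sample :: stm where
 "sample = For 26 en sample_body"

text \<open>The truncated differences test \<open>t \<le> B\<close> and \<open>t > 2 * c\<close>, as
  in \<open>prio\<close>.\<close>

definition key :: stm where
 "key = Cnd (eB .+ Num 1 .- Arr 34 (var 26))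
  (Cnd (Arr 34 (var 26) .- Num 2 .* Arr 33 (var 26)) (assign 37 (Arr 34 (var 26))) (assign 37 (Num 0)))
  (assign 37 (eB .+ Num 1))"

definition select :: stm where
 "select = assign 35 (eB .+ Num 1)
  ;; For 26 en (key ;; Cnd (var 35 .- var 37) (assign 35 (var 37) ;; assign 36 (var 26)) Nop)"

text \<open>Array 38 saves the number of slots after the current virtual time before array 34 is
  reset to \<open>B + 1\<close>, the value that remains if no later pull is found.\<close>

definition pull :: stm where
 "pull = Pul 32 (var 36) (var 36) (dec_at (Arr 31 (var 36)) (eB .- Arr 34 (var 36)) (Arr 32 (var 36)) .- Num 1)
  ;; Asg 33 (var 36) (Arr 33 (var 36) .+ Num 1)
  ;; assign 38 (eB .- Arr 34 (var 36)) ;; Asg 34 (var 36) (eB .+ Num 1)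
  ;; first_time (var 36) (Arr 31 (var 36)) (var 38) (Arr 32 (var 36))"

definition schedule :: stm where
 "schedule = For 28 (en .* eB) (select ;; Cnd (eB .+ Num 1 .- var 35) pull Nop)"

definition bandit_program :: stm where
 "bandit_program = dual ;; sample ;; schedule"

lemmas program_defs = root_at_def rew_at_def prob_at_def reward_def trans_def scale_expr_def rounds_expr_def cell_def dec_at_def eq_def
 constants_def try_action_def node_value_def all_values_def node_load_def prices_def dual_def first_time_def sample_def key_def select_def
 pull_def schedule_def bandit_program_def

lemma wf_program: "wf_stm bandit_program"
 by (simp add: program_defs)

end

section \<open>Correctness of the dual computation\<close>

context encoded
begin

lemma ev_rew_at: "ev S (rew_at j) = 4 + narms I + N + 2 * ev S j"
 by (simp add: rew_at_def lk[unfolded One_nat_def])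

lemma ev_prob_at: "ev S (prob_at j) = 4 + narms I + N + 2 * (K * N) + 2 * ev S j"
 by (simp add: prob_at_def lk[unfolded One_nat_def])

lemma ev_sizes: "ev S eB = B" "ev S en = narms I" "ev S eK = K" "ev S eN = N"
 by (simp_all add: lk[unfolded One_nat_def])

lemma ev_scale: "ev S scale_expr = step_scale" "ev S rounds_expr = num_rounds"
 by (simp_all add: scale_expr_def rounds_expr_def step_scale_def num_rounds_def lk[unfolded One_nat_def] power3_eq_cube ac_simps)

lemma ev_cell: "ev S (cell k u) = ev S k * N + ev S u"
 by (simp add: cell_def lk)

lemma ev_dec_at: "ev S (dec_at r k u) = S 10 ((ev S r * B + ev S k) * N + ev S u)"
 by (simp add: dec_at_def ev_cell lk)

lemma ev_eq: "ev S (eq a b) = (if ev S a = ev S b then 1 else 0)"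
 by (simp add: eq_def)

lemma ev_root_at: "ev S i < narms I \<Longrightarrow> ev S (root_at i) = root I (ev S i)"
 by (simp add: root_at_def lk_root)

lemma ev_reward:
 assumes "S 4 0 = RR" "ev S a < K" "ev S u < N"
 shows "ev S (reward a u) = rh (ev S a) (ev S u)"
 using assms lk_rew[OF assms(2,3)] by (simp add: reward_def ev_rew_at rh_def lk)

lemma ev_trans:
 assumes "S 3 0 = PP" "ev S a < K" "ev S u < N" "ev S v < N"
 shows "ev S (trans a u v) = ph (ev S a) (ev S u) (ev S v)"
 using assms lk_prob[OF assms(2-4)] by (simp add: trans_def ev_prob_at ph_def lk)

text \<open>Growth of a value per slot: at most \<open>N\<close> successors, each with a probability
  of at most \<open>width_base\<close>, plus one reward of at most
  \<open>width_base\<close>.\<close>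

definition XX :: nat where
 "XX = (N + 1) * width_base"

text \<open>The left-hand side of the size condition in \<open>dp_ok\<close>, taken at the scale of
  the priced rounds.\<close>

definition max_value :: nat where
 "max_value = step_scale * PP ^ B * PP ^ B * RR * PP ^ B * XX ^ (B + 1)"

lemma base_ge: "B + 2 \<le> width_base" "narms I + 2 \<le> width_base" "K + 2 \<le> width_base" "N + 2 \<le> width_base" "2 \<le> width_base"
 using lookup_le[of 0] lookup_le[of 1] lookup_le[of 2] lookup_le[of 3] unfolding lk by linarith+

lemma power_bounds:
 "PP \<le> width_base ^ (K * N * N)" "RR \<le> width_base ^ (K * N)" "XX \<le> width_base ^ 2"
 "step_scale \<le> width_base ^ 6" "num_rounds \<le> width_base ^ 9"
 "l \<le> K * N * N \<Longrightarrow> (\<Prod>j<l. lookup xs (4 + narms I + N + 2 * (K * N) + 2 * j + 1)) \<le> width_base ^ (K * N * N)"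
 "l \<le> K * N \<Longrightarrow> (\<Prod>j<l. lookup xs (4 + narms I + N + 2 * j + 1)) \<le> width_base ^ (K * N)"
proof -
 have pr: "(\<Prod>j<l. lookup xs (f j)) \<le> width_base ^ m" if "l \<le> m" for l m f
 proof -
  have "(\<Prod>j<l. lookup xs (f j)) \<le> (\<Prod>j<l. width_base)"
  proof (rule prod_mono)
   show "0 \<le> lookup xs (f j) \<and> lookup xs (f j) \<le> width_base" for j using lookup_le[of "f j"] by simp
  qed
  also have "\<dots> \<le> width_base ^ m" using that base_ge(5) by (simp add: power_increasing)
  finally show ?thesis .
 qed
 show "PP \<le> width_base ^ (K * N * N)" "RR \<le> width_base ^ (K * N)"
  unfolding PP_def RR_def by (rule pr, simp, rule pr, simp)
 show "l \<le> K * N * N \<Longrightarrow> (\<Prod>j<l. lookup xs (4 + narms I + N + 2 * (K * N) + 2 * j + 1)) \<le> width_base ^ (K * N * N)"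
  "l \<le> K * N \<Longrightarrow> (\<Prod>j<l. lookup xs (4 + narms I + N + 2 * j + 1)) \<le> width_base ^ (K * N)"
  by (rule pr, assumption, rule pr, assumption)
 have le: "N + 1 \<le> width_base" "narms I \<le> width_base" "B \<le> width_base" "B + 1 \<le> width_base" using base_ge by linarith+
 show "XX \<le> width_base ^ 2" unfolding XX_def power2_eq_square using le by (intro mult_le_mono) auto
 have "step_scale \<le> width_base * width_base ^ 3 * width_base * width_base"
  unfolding step_scale_def using le base_ge(5) by (intro mult_le_mono power_mono) auto
 then show s: "step_scale \<le> width_base ^ 6" by (simp add: eval_nat_numeral ac_simps)
 have "width_base \<le> width_base ^ 6" using base_ge(5) power_increasing[of 1 6 width_base] by simp
 then have "step_scale + narms I \<le> 2 * width_base ^ 6" using s le by linarith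
 also have "\<dots> \<le> width_base * width_base ^ 6" using base_ge(5) by (intro mult_le_mono1)
 finally have "num_rounds \<le> width_base * width_base * (width_base * width_base ^ 6)"
  unfolding num_rounds_def using le base_ge(5) by (intro mult_le_mono) auto
 then show "num_rounds \<le> width_base ^ 9" by (simp add: eval_nat_numeral ac_simps)
qed

lemma cap_power: "a + b * (K * N * N) + c * (K * N) + 2 * d \<le> degree \<Longrightarrow>
 x \<le> width_base ^ a \<Longrightarrow> x * PP ^ b * RR ^ c * XX ^ d \<le> cap"
proof -
 assume e: "a + b * (K * N * N) + c * (K * N) + 2 * d \<le> degree" and x: "x \<le> width_base ^ a"
 have "x * PP ^ b * RR ^ c * XX ^ d \<le> width_base ^ a * (width_base ^ (K * N * N)) ^ b * (width_base ^ (K * N)) ^ c * (width_base ^ 2) ^ d"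
  using x power_bounds by (intro mult_le_mono power_mono) auto
 also have "\<dots> = width_base ^ (a + b * (K * N * N) + c * (K * N) + 2 * d)"
  by (simp add: power_add power_mult[symmetric] mult.commute)
 also have "\<dots> \<le> cap" by (rule cap_ge[OF e])
 finally show ?thesis .
qed

text \<open>The dominating term is \<open>3 * B * (K * N * N)\<close>: two factors
  \<open>PP ^ B\<close> come from the scale and one from the recursion. Since \<open>B < N\<close>,
  it is of degree 4 in \<open>m = K + N + 10\<close>, and \<open>m \<ge> 10\<close> absorbs the
  constant; hence the exponent 5 in \<open>degree\<close>.\<close>

lemma exponents:
 assumes "a \<le> 20" "b \<le> 3 * B" "c \<le> 1" "d \<le> B + 1"
 shows "a + b * (K * N * N) + c * (K * N) + 2 * d \<le> degree"
proof -
 define m where "m = K + N + 10"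
 have m: "K \<le> m" "N \<le> m" "1 \<le> m" "10 \<le> m" "B \<le> m" "B + 1 \<le> m" using horizon_less by (simp_all add: m_def)
 have c2: "K * N \<le> m * m" by (rule mult_le_mono[OF m(1,2)])
 have c4: "B * (K * N * N) \<le> m * (m * m * m)" by (rule mult_le_mono[OF m(5) mult_le_mono[OF c2 m(2)]])
 have "m * 1 \<le> m * m" "m * m * 1 \<le> m * m * m" using mult_le_mono2[OF m(3)] by blast+
 moreover have "1 * (m * m * m) \<le> m * (m * m * m)" by (rule mult_le_mono1[OF m(3)])
 ultimately have up: "m \<le> m * (m * m * m)" "m * m \<le> m * (m * m * m)" by linarith+
 have "b * (K * N * N) \<le> 3 * B * (K * N * N)" by (rule mult_le_mono1[OF assms(2)])
 moreover have "c * (K * N) \<le> 1 * (K * N)" by (rule mult_le_mono1[OF assms(3)])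
 ultimately have "a + b * (K * N * N) + c * (K * N) + 2 * d \<le> 10 * (m * (m * m * m))"
  using assms(1,4) m c2 c4 up by linarith
 also have "\<dots> \<le> m * (m * (m * m * m))" by (rule mult_le_mono1[OF m(4)])
 also have "\<dots> = m ^ 5" by (simp add: eval_nat_numeral)
 finally show ?thesis by (simp only: degree_def lk m_def add.commute)
qed

lemma caps:
 "max_value \<le> cap" "(num_rounds * narms I + 1) * PP ^ B * XX ^ (B + 1) \<le> cap" "narms I * RR * PP ^ B * XX ^ (B + 1) \<le> cap"
 "step_scale * PP ^ B * PP ^ B \<le> cap" "width_base \<le> cap" "num_rounds \<le> cap" "l \<le> B \<Longrightarrow> PP ^ l \<le> cap" "1 \<le> cap"
 "l \<le> K * N * N \<Longrightarrow> (\<Prod>j<l. lookup xs (4 + narms I + N + 2 * (K * N) + 2 * j + 1)) \<le> cap"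
 "l \<le> K * N \<Longrightarrow> (\<Prod>j<l. lookup xs (4 + narms I + N + 2 * j + 1)) \<le> cap"
proof -
 have "3 * B = B + B + B" "2 * B = B + B" by simp_all
 then have p3: "PP ^ (3 * B) = PP ^ B * PP ^ B * PP ^ B" "PP ^ (2 * B) = PP ^ B * PP ^ B"
  by (simp_all only: power_add)
 have n: "narms I \<le> width_base" "narms I \<le> width_base ^ 1" using base_ge by simp_all
 show "max_value \<le> cap"
  using cap_power[OF exponents[of 6 "3 * B" 1 "B + 1"] power_bounds(4)] unfolding p3 max_value_def
  by (simp add: ac_simps)
 have "num_rounds * narms I \<le> width_base ^ 9 * width_base" by (intro mult_le_mono power_bounds n)
 moreover have "1 \<le> width_base ^ 9 * width_base" using base_ge(5) by simp
 moreover have "2 * (width_base ^ 9 * width_base) \<le> width_base * (width_base ^ 9 * width_base)" using base_ge(5) by (rule mult_le_mono1)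
 ultimately have "num_rounds * narms I + 1 \<le> width_base * (width_base ^ 9 * width_base)" by linarith
 also have "\<dots> = width_base ^ 11" by (simp add: eval_nat_numeral)
 finally have "(num_rounds * narms I + 1) * PP ^ B * RR ^ 0 * XX ^ (B + 1) \<le> cap"
  by (intro cap_power[of 11] exponents) simp_all
 then show "(num_rounds * narms I + 1) * PP ^ B * XX ^ (B + 1) \<le> cap" by (simp only: power_0 mult_1_right)
 show "narms I * RR * PP ^ B * XX ^ (B + 1) \<le> cap"
  using cap_power[OF exponents[of 1 B 1 "B + 1"] n(2)] by (simp add: ac_simps)
 show "step_scale * PP ^ B * PP ^ B \<le> cap"
  using cap_power[OF exponents[of 6 "2 * B" 0 0] power_bounds(4)] unfolding p3 by (simp add: ac_simps)
 show w: "width_base \<le> cap" using cap_power[OF exponents[of 1 0 0 0], of width_base] by simp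
 show "num_rounds \<le> cap" using cap_power[OF exponents[of 9 0 0 0] power_bounds(5)] by simp
 show "l \<le> B \<Longrightarrow> PP ^ l \<le> cap" using cap_power[OF exponents[of 0 l 0 0], of 1] by simp
 show "1 \<le> cap" using w base_ge(5) by linarith
 have k: "K * N * N \<le> degree" "K * N \<le> degree"
  using length_le_degree length_xs by linarith+
 show "l \<le> K * N * N \<Longrightarrow> (\<Prod>j<l. lookup xs (4 + narms I + N + 2 * (K * N) + 2 * j + 1)) \<le> cap"
  by (rule order_trans[OF power_bounds(6) cap_ge[OF k(1)]])
 show "l \<le> K * N \<Longrightarrow> (\<Prod>j<l. lookup xs (4 + narms I + N + 2 * j + 1)) \<le> cap"
  by (rule order_trans[OF power_bounds(7) cap_ge[OF k(2)]])
qed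

lemma limits:
 "K * N * N \<le> limit" "K * N \<le> limit" "B \<le> limit" "N \<le> limit" "K \<le> limit" "narms I \<le> limit" "num_rounds \<le> limit"
 "narms I * B \<le> limit" "limit \<le> cap"
proof -
 define m where "m = K + N + 10"
 have m: "K \<le> m" "N \<le> m" "1 \<le> m" "10 \<le> m" "B \<le> m" "B + 1 \<le> m" "narms I \<le> m"
  using horizon_less arms_le by (simp_all add: m_def)
 have deg: "degree = m ^ 5" by (simp only: degree_def lk m_def add.commute)
 have small: "x \<le> limit" if "x \<le> degree" for x using that limit_pos by linarith
 have "K * N * N \<le> degree" "K * N \<le> degree" "N \<le> degree" "narms I \<le> degree"
  using length_le_degree length_xs by linarith+
 then show "K * N * N \<le> limit" "K * N \<le> limit" "N \<le> limit" "narms I \<le> limit" by (auto intro: small)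
 have one: "m ^ 1 \<le> degree" unfolding deg using m(3) by (rule power_increasing[rotated]) simp
 then show "B \<le> limit" "K \<le> limit" using m by (auto intro!: small)
 have "narms I * B \<le> m * m" by (rule mult_le_mono[OF m(7,5)])
 also have "\<dots> = m ^ 2" by (simp add: power2_eq_square)
 also have "\<dots> \<le> degree" unfolding deg using m(3) by (rule power_increasing[rotated]) simp
 finally show "narms I * B \<le> limit" by (rule small)
 have "step_scale \<le> 2 * m ^ 3 * m * m"
  unfolding step_scale_def using m by (intro mult_le_mono power_mono) auto
 also have "\<dots> = 2 * (m ^ 3 * m * m)" by (simp only: mult.assoc)
 also have "m ^ 3 * m * m = m ^ 5" by (simp add: eval_nat_numeral mult.assoc)
 finally have "step_scale + narms I \<le> 2 * m ^ 5 + m ^ 5" using m(7) one unfolding deg by simp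
 then have "num_rounds \<le> 2 * m * (2 * m ^ 5 + m ^ 5)"
  unfolding num_rounds_def using m(6) by (intro mult_le_mono) auto
 also have "\<dots> = 6 * (m * m ^ 5)" by simp
 also have "\<dots> \<le> m * (m * m ^ 5)" using m(4) by (intro mult_le_mono1) simp
 also have "\<dots> = m ^ 7" by (simp add: eval_nat_numeral)
 also have "\<dots> \<le> m ^ 10" using m(3) by (rule power_increasing[rotated]) simp
 also have "\<dots> = limit" unfolding limit_def deg by (simp add: power_add[symmetric])
 finally show "num_rounds \<le> limit" .
 have "limit < 2 ^ limit" by (rule less_exp)
 also have "\<dots> = (\<Prod>j<limit. 2)" by simp
 also have "\<dots> \<le> cap" unfolding cap_def using factor_pos by (intro prod_mono) auto
 finally show "limit \<le> cap" by simp
qed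

text \<open>Below depth \<open>B\<close> the transition probabilities are unconstrained, so only this crude bound holds at all nodes.\<close>

lemma prob_le: "a < K \<Longrightarrow> u < N \<Longrightarrow> v < N \<Longrightarrow> prob I a u v \<le> width_base"
proof -
 assume a: "a < K" "u < N" "v < N"
 have "prob I a u v = pn a u v / pd a u v" "0 < pd a u v" using prob_frac[OF a] by auto
 then have "prob I a u v \<le> pn a u v" by (simp add: divide_le_eq mult_le_cancel_left1)
 also have "real (pn a u v) \<le> width_base" using lookup_le lk_prob[OF a] by (metis add_leD1 of_nat_le_iff)
 finally show ?thesis .
qed

lemma rew_le: "a < K \<Longrightarrow> u < N \<Longrightarrow> rew I a u \<le> width_base"
proof -
 assume a: "a < K" "u < N"
 have "rew I a u = rn a u / rd a u" "0 < rd a u" using rew_frac[OF a] by auto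
 then have "rew I a u \<le> rn a u" by (simp add: divide_le_eq mult_le_cancel_left1)
 also have "real (rn a u) \<le> width_base" using lookup_le lk_rew[OF a] by (metis add_leD1 of_nat_le_iff)
 finally show ?thesis .
qed

lemma XX_pos: "1 \<le> XX"
 using base_ge(5) by (simp add: XX_def)

lemma XX_mono: "j \<le> k \<Longrightarrow> real (XX ^ j) \<le> real (XX ^ k)"
 unfolding of_nat_le_iff by (rule power_increasing[OF _ XX_pos])

lemma step_bound:
 assumes a: "a < K" "u < N" and f: "\<And>v. v < N \<Longrightarrow> 0 \<le> f v \<and> f v \<le> real (XX ^ k)" and g: "g \<le> real width_base" and m: "m \<le> N"
 shows "g + (\<Sum>v<m. prob I a u v * f v) \<le> XX ^ Suc k"
proof -
 have nn: "0 \<le> prob I a u v" if "v < N" for v using prob_nn[of a u v] a that acts states by simp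
 have "(\<Sum>v<m. prob I a u v * f v) \<le> (\<Sum>v<m. real width_base * real (XX ^ k))"
  using f nn prob_le[OF a] m by (intro sum_mono) (auto intro!: mult_mono)
 also have "\<dots> = real m * (real width_base * real (XX ^ k))" by simp
 also have "\<dots> \<le> real N * (real width_base * real (XX ^ k))" using m by (intro mult_right_mono) auto
 finally have s: "(\<Sum>v<m. prob I a u v * f v) \<le> real N * (real width_base * real (XX ^ k))" .
 have "width_base * 1 \<le> width_base * XX ^ k" using XX_pos by (intro mult_le_mono2) simp
 then have "real width_base \<le> real (width_base * XX ^ k)" by (simp only: of_nat_le_iff mult_1_right)
 then show ?thesis using s g by (simp add: XX_def algebra_simps)
qed

lemma val_bounds:
 assumes l: "\<And>t. 0 \<le> l t"
 shows "u < N \<Longrightarrow> 0 \<le> val l k u \<and> val l k u \<le> XX ^ k"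
proof (induction k arbitrary: u)
 case (Suc k)
 have "x \<le> XX ^ Suc k" if "x \<in> insert (val l k u) ((\<lambda>a. rew I a u - l (B - k) + (\<Sum>v\<in>states I. prob I a u v * val l k v)) ` acts I)" for x
  using that
 proof (elim insertE imageE)
  assume "x = val l k u"
  then have "x \<le> real (XX ^ k)" using Suc by simp
  also have "\<dots> \<le> XX ^ Suc k" by (rule XX_mono) simp
  finally show ?thesis .
 next
  fix a assume x: "x = rew I a u - l (B - k) + (\<Sum>v\<in>states I. prob I a u v * val l k v)" and "a \<in> acts I"
  then have a: "a < K" using acts by simp
  have "rew I a u - l (B - k) \<le> width_base" using rew_le[OF a Suc.prems] l[of "B - k"] by linarith
  from step_bound[OF a Suc.prems Suc.IH this le_refl] show ?thesis unfolding x states .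
 qed
 then have "val l (Suc k) u \<le> XX ^ Suc k" unfolding val.simps using fin_acts by simp
 then show ?case using val_nonneg by blast
qed simp

lemma pay_slot_bounds:
 assumes d: "table d"
 shows "u < N \<Longrightarrow> k \<le> B \<Longrightarrow> 0 \<le> pay d (\<lambda>t a u. if t = i then 1 else 0) k u \<and> pay d (\<lambda>t a u. if t = i then 1 else 0) k u \<le> XX ^ k"
proof (induction k arbitrary: u)
 case (Suc k)
 let ?p = "pay d (\<lambda>t a u. if t = i then 1 else 0)"
 have nn: "0 \<le> ?p (Suc k) u" using pay_nonneg[OF d _ Suc.prems(2), of "\<lambda>t a u. if t = i then 1 else 0" u] Suc.prems(1) states by simp
 have "?p (Suc k) u \<le> XX ^ Suc k"
 proof (cases "d (B - k) u")
  case None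
  then have "?p (Suc k) u \<le> real (XX ^ k)" using Suc by simp
  also have "\<dots> \<le> XX ^ Suc k" by (rule XX_mono) simp
  finally show ?thesis .
 next
  case (Some a)
  then have a: "a < K" using table_D[OF d, of k u a] Suc.prems acts states by simp
  have g: "(if B - k = i then 1 else 0) \<le> real width_base" using base_ge(5) by simp
  have "0 \<le> ?p k v \<and> ?p k v \<le> real (XX ^ k)" if "v < N" for v using Suc.IH[OF that] Suc.prems by simp
  from step_bound[OF a Suc.prems(1) this g le_refl] show ?thesis using Some by (simp add: states)
 qed
 then show ?case using nn by blast
qed simp

lemma runs_Cnd_True: "runs s S T \<Longrightarrow> ev S b \<noteq> 0 \<Longrightarrow> runs (Cnd b s s') S T"
 by (rule runs_Cnd) simp

lemma runs_Cnd_False: "runs s' S T \<Longrightarrow> ev S b = 0 \<Longrightarrow> runs (Cnd b s s') S T"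
 by (rule runs_Cnd) simp

text \<open>Real prices \<open>l\<close> are represented, up to the scale \<open>c * RR\<close>, by
  products of array 7 and array 8. The last conjunct keeps every intermediate result from being
  clamped.\<close>

definition dp_ok :: "nat \<Rightarrow> (nat \<Rightarrow> real) \<Rightarrow> (nat \<Rightarrow> nat \<Rightarrow> nat) \<Rightarrow> bool" where
 "dp_ok c l S \<longleftrightarrow> S 1 0 = cap \<and> S 2 0 = limit \<and> S 3 0 = PP \<and> S 4 0 = RR \<and> (\<forall>j\<le>B. S 5 j = PP ^ j) \<and> S 6 0 = c \<and>
  (\<forall>t. 0 \<le> l t) \<and> (\<forall>k<B. real c * real RR * l (B - k) = real (S 7 0) * real (S 8 k)) \<and> 1 \<le> c \<and> c * RR * PP ^ B * XX ^ (B + 1) \<le> cap"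

lemma dp_ok_cong: "dp_ok c l S \<Longrightarrow> (\<And>j. 1 \<le> j \<Longrightarrow> j \<le> 8 \<Longrightarrow> T j = S j) \<Longrightarrow> dp_ok c l T"
 unfolding dp_ok_def by simp

definition gain :: "(nat \<Rightarrow> real) \<Rightarrow> nat \<Rightarrow> nat \<Rightarrow> nat \<Rightarrow> real" where
 "gain l k u a = rew I a u - l (B - k) + (\<Sum>v<N. prob I a u v * val l k v)"

definition scaled :: "nat \<Rightarrow> nat \<Rightarrow> real" where
 "scaled c k = real c * real RR * real PP ^ k"

lemma scaled_Suc: "scaled c (Suc k) = scaled c k * PP"
 by (simp add: scaled_def)

lemma scaled_pos: "1 \<le> c \<Longrightarrow> 0 < scaled c k"
 using PP_pos RR_pos by (simp add: scaled_def)

lemma scaled_bound: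
 assumes "dp_ok c l S" "k \<le> B" "x \<le> real (XX ^ (B + 1))"
 shows "scaled c k * x \<le> cap"
proof -
 have P: "PP ^ k \<le> PP ^ B" using assms(2) PP_pos by (intro power_increasing) auto
 have "scaled c k * x \<le> scaled c k * real (XX ^ (B + 1))"
  using assms(3) by (intro mult_left_mono) (auto simp: scaled_def)
 also have "\<dots> = real (c * RR * PP ^ k * XX ^ (B + 1))" by (simp add: scaled_def)
 also have "\<dots> \<le> real (c * RR * PP ^ B * XX ^ (B + 1))"
  unfolding of_nat_le_iff using P by (intro mult_le_mono le_refl)
 also have "\<dots> \<le> cap" using assms(1) unfolding dp_ok_def of_nat_le_iff by simp
 finally show ?thesis .
qed

lemma K_cap: "a < K \<Longrightarrow> Suc a \<le> cap"
 using base_ge(3) caps(5) by linarith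

lemma try_action:
 assumes ok: "dp_ok c l T" and k: "T 21 0 = k" "k < B" and u: "T 22 0 = u" "u < N" and a: "T 23 0 = a" "a < K"
  and V: "\<And>v. v < N \<Longrightarrow> real (T 9 (k * N + v)) = scaled c k * val l k v"
 shows "\<exists>T'. runs try_action T T' \<and> real (T' 13 0) = max (T 13 0) (scaled c (Suc k) * gain l k u a) \<and>
  T' 10 = (if T 13 0 < scaled c (Suc k) * gain l k u a then (T 10)((T 20 0 * B + k) * N + u := Suc a) else T 10)"
proof -
 have T: "T 1 0 = cap" "T 2 0 = limit" "T 3 0 = PP" "T 4 0 = RR" "T 5 (Suc k) = PP ^ Suc k" "T 6 0 = c"
  "\<And>t. 0 \<le> l t" "real c * real RR * l (B - k) = real (T 7 0) * real (T 8 k)"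
  using ok k unfolding dp_ok_def by auto
 let ?S = "\<Sum>v<N. prob I a u v * val l k v"
 have vb: "0 \<le> val l k v \<and> val l k v \<le> real (XX ^ k)" if "v < N" for v using val_bounds[OF T(7) that] by simp
 have rewb: "0 \<le> rew I a u" "rew I a u \<le> width_base" using rew_nn acts states a u rew_le by auto
 have S0: "0 \<le> ?S" using prob_nn acts states a u vb by (intro sum_nonneg mult_nonneg_nonneg) auto
 have Kk: "rew I a u + ?S \<le> real (XX ^ (B + 1))"
  by (rule order_trans[OF step_bound[OF a(2) u(2) vb rewb(2) le_refl] XX_mono]) (use k(2) in auto)
 define A1 where "A1 = c * PP ^ Suc k * rh a u"
 define A where "A = A1 + (\<Sum>v<N. ph a u v * T 9 (k * N + v))"
 define U where "U = PP ^ Suc k * T 7 0 * T 8 k"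
 have rA1: "real A1 = scaled c (Suc k) * rew I a u"
  unfolding A1_def of_nat_mult real_rh[OF a(2) u(2)] by (simp add: scaled_def)
 have rsum: "real (\<Sum>v<N. ph a u v * T 9 (k * N + v)) = scaled c (Suc k) * ?S"
 proof -
  have "real (\<Sum>v<N. ph a u v * T 9 (k * N + v)) = (\<Sum>v<N. scaled c (Suc k) * (prob I a u v * val l k v))"
   unfolding of_nat_sum of_nat_mult using a u V by (intro sum.cong refl) (simp add: real_ph scaled_Suc)
  then show ?thesis by (simp only: sum_distrib_left)
 qed
 have rA: "real A = scaled c (Suc k) * (rew I a u + ?S)"
  unfolding A_def of_nat_add rA1 rsum by (simp add: distrib_left)
 have rU: "real U = scaled c (Suc k) * l (B - k)"
  unfolding U_def using T(8) by (simp add: scaled_def mult.assoc mult.left_commute)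
 have Acap: "A \<le> cap" using scaled_bound[OF ok _ Kk, of "Suc k"] k(2) rA by simp
 have A1cap: "A1 \<le> cap" using Acap by (simp add: A_def)
 have diff: "real A - real U = scaled c (Suc k) * gain l k u a"
  unfolding rA rU gain_def by (simp add: algebra_simps)
 define s1 where "s1 = put T 14 0 A1"
 have r1: "runs (assign 14 (var 6 .* Arr 5 (var 21 .+ Num 1) .* reward (var 23) (var 22))) T s1"
  unfolding s1_def using T k u a A1cap
  by (intro runs_Asg) (simp_all add: ev_reward A1_def)
 have "\<exists>s2. runs (expected_value) s1 s2 \<and>
   s2 14 0 = s1 14 0 + (\<Sum>v<N. ph a u v * T 9 (k * N + v))"
 proof (rule runs_sum)
  show "ev s1 eN = N" by (rule ev_sizes)
  show "N \<le> s1 2 0" "N \<le> s1 1 0" using limits T by (auto simp: s1_def)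
  show "s1 14 0 + (\<Sum>v<N. ph a u v * T 9 (k * N + v)) \<le> s1 1 0" using Acap T by (simp add: s1_def A_def)
  fix V v assume v: "v < N" "V 24 0 = v" and fr: "\<And>j. j \<noteq> 24 \<Longrightarrow> j \<noteq> 14 \<Longrightarrow> V j = s1 j"
  have "V 3 0 = PP" "V 21 0 = k" "V 22 0 = u" "V 23 0 = a" "V 9 = T 9" using fr T k u a by (auto simp: s1_def)
  then show "ev V (trans (var 23) (var 22) (var 24) .* Arr 9 (cell (var 21) (var 24))) = ph a u v * T 9 (k * N + v)"
   using v u a by (simp add: ev_trans ev_cell)
 qed auto
 then obtain s2 where r2: "runs (expected_value) s1 s2"
   and s2A: "s2 14 0 = A" by (auto simp: s1_def A_def)
 have s2: "s2 j = T j" if "j \<noteq> 24" "j \<noteq> 14" for j using runs_frame[OF r2, of j] that by (simp add: s1_def)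
 define s3 where "s3 = put s2 14 0 (A - U)"
 have r3: "runs (assign 14 (var 14 .- Arr 5 (var 21 .+ Num 1) .* var 7 .* Arr 8 (var 21))) s2 s3"
  unfolding s3_def using s2 s2A T k Acap by (intro runs_Asg) (simp_all add: U_def)
 have s3: "s3 j = T j" if "j \<noteq> 24" "j \<noteq> 14" for j using s2[OF that] that by (simp add: s3_def)
 have s3A: "s3 14 0 = A - U" by (simp add: s3_def)
 \<comment> \<open>The stored difference is truncated at 0. This is harmless, since a negative gain
   never beats the nonnegative value in array 13.\<close>
 have less: "T 13 0 < A - U \<longleftrightarrow> real (T 13 0) < scaled c (Suc k) * gain l k u a"
 proof -
  have "T 13 0 < A - U \<longleftrightarrow> real (T 13 0 + U) < real A" unfolding of_nat_less_iff by linarith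
  then show ?thesis using diff by (simp add: algebra_simps)
 qed
 show ?thesis
 proof (cases "T 13 0 < A - U")
  case True
  define s4 where "s4 = put s3 13 0 (A - U)"
  define s5 where "s5 = put s4 10 ((T 20 0 * B + k) * N + u) (Suc a)"
  have r4: "runs (assign 13 (var 14)) s3 s4" unfolding s4_def using s3A s3 T Acap by (intro runs_Asg) simp_all
  have r5: "runs (Asg 10 (cell (var 20 .* eB .+ var 21) (var 22)) (var 23 .+ Num 1)) s4 s5"
   unfolding s5_def using s3 k u a T K_cap[OF a(2)] by (intro runs_Asg) (simp_all add: s4_def ev_cell lk)
  have "runs try_action T s5" unfolding try_action_def
   by (rule runs_Then[OF r1 runs_Then[OF r2 runs_Then[OF r3 runs_Cnd_True[OF runs_Then[OF r4 r5]]]]]) (use True s3A s3 in simp)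
  moreover have "real (s5 13 0) = max (T 13 0) (scaled c (Suc k) * gain l k u a)"
   using True less diff by (simp add: s5_def s4_def of_nat_diff)
  moreover have "s5 10 = (T 10)((T 20 0 * B + k) * N + u := Suc a)" using s3 by (simp add: s5_def s4_def)
  ultimately show ?thesis using less True by auto
 next
  case False
  have "runs try_action T s3" unfolding try_action_def
   by (rule runs_Then[OF r1 runs_Then[OF r2 runs_Then[OF r3 runs_Cnd_False[OF runs_Nop]]]]) (use False s3A s3 in simp)
  then show ?thesis using False less s3 by (intro exI[of _ s3]) auto
 qed
qed

text \<open>The code \<open>x\<close> stands for an optimal decision; the choice among ties is left
  open, as in \<open>best_response\<close>.\<close>

definition decided :: "(nat \<Rightarrow> real) \<Rightarrow> nat \<Rightarrow> nat \<Rightarrow> nat \<Rightarrow> bool" where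
 "decided l k u x \<longleftrightarrow> (x = 0 \<and> val l (Suc k) u = val l k u) \<or> (\<exists>a<K. x = Suc a \<and> val l (Suc k) u = gain l k u a)"

lemma node_value:
 assumes ok: "dp_ok c l T" and k: "T 21 0 = k" "k < B" and u: "T 22 0 = u" "u < N"
  and V: "\<And>v. v < N \<Longrightarrow> real (T 9 (k * N + v)) = scaled c k * val l k v"
 shows "\<exists>T' x y. runs node_value T T' \<and> T' 9 = (T 9)(Suc k * N + u := y) \<and> real y = scaled c (Suc k) * val l (Suc k) u \<and>
  T' 10 = (T 10)((T 20 0 * B + k) * N + u := x) \<and> decided l k u x"
proof -
 let ?ix = "(T 20 0 * B + k) * N + u"
 have T: "T 1 0 = cap" "T 2 0 = limit" "T 3 0 = PP" "1 \<le> c" "\<And>t. 0 \<le> l t"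
  using ok unfolding dp_ok_def by auto
 have C: "0 < scaled c (Suc k)" using scaled_pos[OF T(4)] .
 define M where "M a = Max (insert (val l k u) (gain l k u ` {..<a}))" for a
 have M0: "M 0 = val l k u" by (simp add: M_def)
 have MS: "M (Suc a) = max (M a) (gain l k u a)" for a
  by (simp add: M_def lessThan_Suc insert_commute[of "val l k u"] max.commute)
 have MK: "M K = val l (Suc k) u"
  unfolding M_def val.simps acts states gain_def ..
 have vb: "0 \<le> val l (Suc k) u \<and> val l (Suc k) u \<le> real (XX ^ Suc k)" by (rule val_bounds) (use T(5) u in auto)
 have Mcap: "scaled c (Suc k) * val l (Suc k) u \<le> cap"
  by (rule scaled_bound[OF ok _ order_trans[OF conjunct2[OF vb] XX_mono]]) (use k(2) in auto)
 have M_le: "M a \<le> M K" if "a \<le> K" for a unfolding M_def using that by (intro Max_mono) auto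
 define b where "b = PP * T 9 (k * N + u)"
 have rb: "real b = scaled c (Suc k) * val l k u" using V[OF u(2)] by (simp add: b_def scaled_Suc)
 have bcap: "b \<le> cap"
 proof -
  have "scaled c (Suc k) * val l k u \<le> scaled c (Suc k) * val l (Suc k) u"
   using C val_ge_stay by (intro mult_left_mono) auto
  then have "real b \<le> real cap" using Mcap rb by linarith
  then show ?thesis by simp
 qed
 define s1 where "s1 = put T 13 0 b"
 define s2 where "s2 = put s1 10 ?ix 0"
 have r1: "runs (assign 13 (var 3 .* Arr 9 (cell (var 21) (var 22)))) T s1"
  unfolding s1_def using T k u bcap by (intro runs_Asg) (simp_all add: ev_cell b_def)
 have r2: "runs (Asg 10 (cell (var 20 .* eB .+ var 21) (var 22)) (Num 0)) s1 s2"
  unfolding s2_def using T k u by (intro runs_Asg) (simp_all add: ev_cell s1_def lk)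
 have s2: "s2 j = T j" if "j \<noteq> 13" "j \<noteq> 10" for j using that by (simp add: s2_def s1_def)
 define Inv :: "nat \<Rightarrow> (nat \<Rightarrow> nat \<Rightarrow> nat) \<Rightarrow> bool" where "Inv a S \<longleftrightarrow> real (S 13 0) = scaled c (Suc k) * M a \<and>
  (\<exists>x. S 10 = (T 10)(?ix := x) \<and> (x = 0 \<and> M a = val l k u \<or> (\<exists>a'<a. x = Suc a' \<and> M a = gain l k u a')))" for a S
 have "\<exists>s3. runs (For 23 eK try_action) s2 s3 \<and> Inv K s3 \<and> s3 23 0 = K"
 proof (rule runs_For)
  show "ev s2 eK = K" by (rule ev_sizes)
  show "K \<le> s2 2 0" "K \<le> s2 1 0" using limits T s2 by auto
  show "Inv 0 (put s2 23 0 0)" unfolding Inv_def M0 using rb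
   by (auto simp: s2_def s1_def intro!: exI[of _ 0])
  fix a S assume a: "a < K" "S 23 0 = a" and inv: "Inv a S" and fr: "\<And>j. j \<notin> mods (For 23 eK try_action) \<Longrightarrow> S j = s2 j"
  have eqs: "S j = T j" if "j \<notin> {10, 13, 14, 23, 24}" for j
   using fr[of j] s2[of j] that by (simp add: try_action_def)
  have ok': "dp_ok c l S" by (rule dp_ok_cong[OF ok]) (rule eqs, auto)
  have V': "real (S 9 (k * N + v)) = scaled c k * val l k v" if "v < N" for v using V[OF that] eqs[of 9] by simp
  have k': "S 21 0 = k" "S 22 0 = u" "S 20 = T 20" using eqs k u by auto
  obtain S' where S': "runs try_action S S'" "real (S' 13 0) = max (S 13 0) (scaled c (Suc k) * gain l k u a)"
   "S' 10 = (if S 13 0 < scaled c (Suc k) * gain l k u a then (S 10)(?ix := Suc a) else S 10)"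
   using try_action[OF ok' k'(1) k(2) k'(2) u(2) a(2,1) V'] unfolding k'(3) by blast
  have lt: "S 13 0 < scaled c (Suc k) * gain l k u a \<longleftrightarrow> M a < gain l k u a"
   using inv C unfolding Inv_def by simp
  have "Inv (Suc a) S'"
  proof (cases "M a < gain l k u a")
   case True
   then show ?thesis using inv S' lt C unfolding Inv_def MS by auto
  next
   case False
   then have "scaled c (Suc k) * gain l k u a \<le> scaled c (Suc k) * M a" using C by (intro mult_left_mono) auto
   then show ?thesis using inv S' lt False unfolding Inv_def MS by (auto simp: max_def less_Suc_eq)
  qed
  then have "Inv (Suc a) (put S' 23 0 (Suc a))" unfolding Inv_def by simp
  then show "\<exists>S'. runs try_action S S' \<and> Inv (Suc a) (put S' 23 0 (Suc a))" using S'(1) by blast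
 qed (auto simp: try_action_def)
 then obtain s3 where r3: "runs (For 23 eK try_action) s2 s3" and inv: "Inv K s3" by blast
 have s3: "s3 j = T j" if "j \<notin> {10, 13, 14, 23, 24}" for j
  using runs_frame[OF r3, of j] s2[of j] that by (simp add: try_action_def)
 have y: "real (s3 13 0) = scaled c (Suc k) * val l (Suc k) u" using inv unfolding Inv_def MK by blast
 define s4 where "s4 = put s3 9 (Suc k * N + u) (s3 13 0)"
 have "s3 13 0 \<le> cap" using y Mcap by simp
 then have r4: "runs (Asg 9 (cell (var 21 .+ Num 1) (var 22)) (var 13)) s3 s4"
  unfolding s4_def using s3 T k u by (intro runs_Asg) (simp_all add: ev_cell)
 have "runs node_value T s4" unfolding node_value_def by (rule runs_Then[OF r1 runs_Then[OF r2 runs_Then[OF r3 r4]]])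
 moreover have "s4 9 = (T 9)(Suc k * N + u := s3 13 0)" using s3[of 9] by (simp add: s4_def)
 moreover obtain x where "s4 10 = (T 10)(?ix := x)" "decided l k u x"
  using inv unfolding Inv_def MK decided_def by (auto simp: s4_def)
 ultimately show ?thesis using y by blast
qed

lemma all_values:
 assumes ok: "dp_ok c l S" and V0: "\<And>v. v < N \<Longrightarrow> S 9 v = 0"
 shows "\<exists>S'. runs all_values S S' \<and> (\<forall>k\<le>B. \<forall>v<N. real (S' 9 (k * N + v)) = scaled c k * val l k v) \<and>
  (\<forall>k<B. \<forall>v<N. decided l k v (S' 10 ((S 20 0 * B + k) * N + v))) \<and> (\<forall>x<S 20 0 * B * N. S' 10 x = S 10 x)"
proof -
 let ?r = "S 20 0"
 have S: "S 1 0 = cap" "S 2 0 = limit" using ok unfolding dp_ok_def by auto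
 \<comment> \<open>Rows up to \<open>k\<close> of the values are complete and row
   \<open>Suc k\<close> is complete below \<open>u\<close>. The last conjunct protects the tables of
   earlier rounds.\<close>
 define J :: "nat \<Rightarrow> nat \<Rightarrow> (nat \<Rightarrow> nat \<Rightarrow> nat) \<Rightarrow> bool" where "J k u T \<longleftrightarrow> (\<forall>k' v. v < N \<longrightarrow> k' \<le> k \<or> k' = Suc k \<and> v < u \<longrightarrow> real (T 9 (k' * N + v)) = scaled c k' * val l k' v) \<and>
  (\<forall>k' v. v < N \<longrightarrow> k' < k \<or> k' = k \<and> v < u \<longrightarrow> decided l k' v (T 10 ((?r * B + k') * N + v))) \<and> (\<forall>x<?r * B * N. T 10 x = S 10 x)" for k u T
 have J_put: "J k u (put T j i x) = J k u T" if "j \<noteq> 9" "j \<noteq> 10" for k u T j i x using that unfolding J_def by simp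
 have "\<exists>T. runs all_values S T \<and> J B 0 T \<and> T 21 0 = B"
  unfolding all_values_def
 proof (rule runs_For)
  show "ev S eB = B" by (rule ev_sizes)
  show "B \<le> S 2 0" "B \<le> S 1 0" using limits S by auto
  show "J 0 0 (put S 21 0 0)" unfolding J_def using V0 by simp
  fix k T assume k: "k < B" "T 21 0 = k" and inv: "J k 0 T"
   and fr: "\<And>j. j \<notin> mods (For 21 eB (For 22 eN node_value)) \<Longrightarrow> T j = S j"
  have eqs: "T j = S j" if "j \<notin> {9, 10, 13, 14, 21, 22, 23, 24}" for j
   using fr[of j] that by (simp add: node_value_def try_action_def)
  have "\<exists>T'. runs (For 22 eN node_value) T T' \<and> J k N T' \<and> T' 22 0 = N"
  proof (rule runs_For)
   show "ev T eN = N" by (rule ev_sizes)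
   show "N \<le> T 2 0" "N \<le> T 1 0" using limits S eqs by auto
   show "J k 0 (put T 22 0 0)" using inv by (simp add: J_put)
   fix u V assume u: "u < N" "V 22 0 = u" and inv': "J k u V"
    and fr': "\<And>j. j \<notin> mods (For 22 eN node_value) \<Longrightarrow> V j = T j"
   have eqs': "V j = T j" if "j \<notin> {9, 10, 13, 14, 22, 23, 24}" for j
    using fr'[of j] that by (simp add: node_value_def try_action_def)
   have ok': "dp_ok c l V" by (rule dp_ok_cong[OF ok]) (simp add: eqs eqs')
   have k': "V 21 0 = k" "V 20 0 = ?r" using eqs' eqs k by auto
   have V: "real (V 9 (k * N + v)) = scaled c k * val l k v" if "v < N" for v using inv' that unfolding J_def by blast
   obtain V' x y where V': "runs node_value V V'" "V' 9 = (V 9)(Suc k * N + u := y)" "real y = scaled c (Suc k) * val l (Suc k) u"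
    "V' 10 = (V 10)((?r * B + k) * N + u := x)" "decided l k u x"
    using node_value[OF ok' k'(1) k(1) u(2,1) V] unfolding k'(2) by blast
   have "J k (Suc u) V'"
    unfolding J_def
   proof (intro conjI allI impI)
    fix k' v assume v: "v < N" and c: "k' \<le> k \<or> k' = Suc k \<and> v < Suc u"
    show "real (V' 9 (k' * N + v)) = scaled c k' * val l k' v"
    proof (cases "k' = Suc k \<and> v = u")
     case True
     then show ?thesis using V' by simp
    next
     case False
     then have "V' 9 (k' * N + v) = V 9 (k' * N + v)" 
      using cells[OF v u(1), of k' "Suc k"] False unfolding V'(2) by (intro fun_upd_other) blast
     then show ?thesis using inv' v c False unfolding J_def by (auto simp: less_Suc_eq)
    qed
   next
    fix k' v assume v: "v < N" and c: "k' < k \<or> k' = k \<and> v < Suc u"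
    show "decided l k' v (V' 10 ((?r * B + k') * N + v))"
    proof (cases "k' = k \<and> v = u")
     case True
     then show ?thesis using V' by simp
    next
     case False
     then have "V' 10 ((?r * B + k') * N + v) = V 10 ((?r * B + k') * N + v)" 
      using cells[OF v u(1), of "?r * B + k'" "?r * B + k"] False unfolding V'(4) add_left_cancel by (intro fun_upd_other) blast
     then show ?thesis using inv' v c False unfolding J_def by (auto simp: less_Suc_eq)
    qed
   next
    fix x assume x: "x < ?r * B * N"
    have "?r * B * N \<le> (?r * B + k) * N + u" by (simp add: add_mult_distrib)
    then show "V' 10 x = S 10 x" using inv' x unfolding J_def V'(4) by simp
   qed
   then show "\<exists>V'. runs node_value V V' \<and> J k (Suc u) (put V' 22 0 (Suc u))" using V'(1) by (auto simp: J_put)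
  qed (auto simp: node_value_def try_action_def)
  then obtain T' where T': "runs (For 22 eN node_value) T T'" "J k N T'" by blast
  have "J (Suc k) 0 T'" using T'(2) unfolding J_def by (auto simp: le_Suc_eq less_Suc_eq)
  then show "\<exists>T'. runs (For 22 eN node_value) T T' \<and> J (Suc k) 0 (put T' 21 0 (Suc k))"
   using T'(1) by (auto simp: J_put)
 qed (auto simp: node_value_def try_action_def)
 then obtain T where "runs all_values S T" "J B 0 T" by blast
 then show ?thesis unfolding J_def by (intro exI[of _ T]) auto
qed

text \<open>Positions outside the slots and nodes read as \<open>None\<close>, so a decoded table
  depends only on the cells of its own round.\<close>

definition decode :: "(nat \<Rightarrow> nat \<Rightarrow> nat) \<Rightarrow> nat \<Rightarrow> nat \<Rightarrow> nat \<Rightarrow> nat option" where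
 "decode S r t u = (if t \<in> {1..B} \<and> u < N then case S 10 ((r * B + (B - t)) * N + u) of 0 \<Rightarrow> None | Suc a \<Rightarrow> Some a else None)"

lemma decode_cong:
 assumes "\<And>x. x < m * B * N \<Longrightarrow> T 10 x = S 10 x" "r < m"
 shows "decode T r = decode S r"
proof -
 have "(r * B + (B - t)) * N + u < m * B * N" if "t \<in> {1..B}" "u < N" for t u
  using index_less[OF index_less[OF assms(2), of "B - t" B] that(2)] that(1) by simp
 then show ?thesis using assms(1) by (auto simp: decode_def fun_eq_iff)
qed

lemma decided_best_response:
 assumes "\<And>k v. k < B \<Longrightarrow> v < N \<Longrightarrow> decided l k v (S 10 ((r * B + k) * N + v))"
 shows "best_response l (decode S r)"
 unfolding best_response_def
proof (intro conjI allI impI ballI)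
 show "table (decode S r)"
  unfolding table_def
 proof (intro allI impI)
  fix t u a assume t: "t \<in> {1..B}" "u \<in> states I" "decode S r t u = Some a"
  then show "a \<in> acts I" using assms[of "B - t" u] unfolding decided_def decode_def states acts
   by (auto split: nat.splits)
 qed
 fix k u assume k: "k < B" "u \<in> states I"
 then have "decided l k u (S 10 ((r * B + k) * N + u))" using assms states by simp
 then show "val l (Suc k) u = (case decode S r (B - k) u of None \<Rightarrow> val l k u
  | Some a \<Rightarrow> rew I a u - l (B - k) + (\<Sum>v\<in>states I. prob I a u v * val l k v))"
  using k unfolding decided_def decode_def gain_def states by (auto simp del: val.simps)
qed

abbreviation slot :: "nat \<Rightarrow> nat \<Rightarrow> nat \<Rightarrow> nat \<Rightarrow> real" where
 "slot i \<equiv> \<lambda>t a u. if t = B - i then 1 else 0"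

lemma decode_same: "T 10 = S 10 \<Longrightarrow> decode T = decode S"
 by (intro ext) (simp add: decode_def)

definition ld_ok :: "(nat \<Rightarrow> nat \<Rightarrow> nat) \<Rightarrow> bool" where
 "ld_ok S \<longleftrightarrow> S 1 0 = cap \<and> S 2 0 = limit \<and> S 3 0 = PP \<and> (\<forall>j\<le>B. S 5 j = PP ^ j)"

lemma ld_ok_cong: "ld_ok S \<Longrightarrow> (\<And>j. j \<in> {1, 2, 3, 5} \<Longrightarrow> T j = S j) \<Longrightarrow> ld_ok T"
 unfolding ld_ok_def by simp

lemma load_cap:
 assumes "k \<le> B" "x \<le> real (XX ^ (B + 1))"
 shows "real PP ^ k * x \<le> cap"
proof -
 have P: "PP ^ k \<le> PP ^ B" using assms(1) PP_pos by (intro power_increasing) auto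
 have "real PP ^ k * x \<le> real PP ^ k * real (XX ^ (B + 1))" using assms(2) by (intro mult_left_mono) auto
 also have "\<dots> = real (1 * PP ^ k * XX ^ (B + 1))" by simp
 also have "\<dots> \<le> real ((num_rounds * narms I + 1) * PP ^ B * XX ^ (B + 1))"
  unfolding of_nat_le_iff using P by (intro mult_le_mono le_refl) simp
 also have "\<dots> \<le> cap" unfolding of_nat_le_iff by (rule caps)
 finally show ?thesis .
qed

lemma node_load:
 assumes ok: "ld_ok T" and k: "T 21 0 = k" "k < B" and u: "T 22 0 = u" "u < N" and i: "T 25 0 = i" "i < B"
  and r: "T 20 0 = r" and d: "decode T r = d" "table d"
  and Y: "\<And>v. v < N \<Longrightarrow> real (T 11 (k * N + v)) = real PP ^ k * pay d (slot i) k v"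
 shows "\<exists>T' y. runs node_load T T' \<and> T' 11 = (T 11)(Suc k * N + u := y) \<and> real y = real PP ^ Suc k * pay d (slot i) (Suc k) u"
proof -
 let ?p = "pay d (slot i)"
 let ?x = "T 10 ((r * B + k) * N + u)"
 have T: "T 1 0 = cap" "T 2 0 = limit" "T 3 0 = PP" "T 5 (Suc k) = PP ^ Suc k"
  using ok k unfolding ld_ok_def by auto
 have dx: "d (B - k) u = (case ?x of 0 \<Rightarrow> None | Suc a \<Rightarrow> Some a)"
  using k u unfolding d(1)[symmetric] decode_def by auto
 have pb: "0 \<le> ?p (Suc k) u \<and> ?p (Suc k) u \<le> real (XX ^ Suc k)"
  by (rule pay_slot_bounds) (use d u k in auto)
 have tot: "real PP ^ Suc k * ?p (Suc k) u \<le> cap"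
  by (rule load_cap[OF _ order_trans[OF conjunct2[OF pb] XX_mono]]) (use k in auto)
 have x: "ev T (dec_at (var 20) (var 21) (var 22)) = ?x" using r k u by (simp add: ev_dec_at)
 have "\<exists>s. runs (load_now) T s \<and> real (s 14 0) = real PP ^ Suc k * ?p (Suc k) u"
 proof (cases ?x)
  case 0
  have y: "real (PP * T 11 (k * N + u)) = real PP ^ Suc k * ?p (Suc k) u"
   using Y[OF u(2)] dx 0 by simp
  then have c: "PP * T 11 (k * N + u) \<le> cap" using tot by (simp only: of_nat_le_iff[where 'a = real, symmetric])
  have "runs (assign 14 (var 3 .* Arr 11 (cell (var 21) (var 22)))) T (put T 14 0 (PP * T 11 (k * N + u)))"
   using T k u c by (intro runs_Asg) (simp_all add: ev_cell)
  then show ?thesis using y x 0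
   by (intro exI[of _ "put T 14 0 (PP * T 11 (k * N + u))"] conjI runs_Cnd_False) simp_all
 next
  case (Suc a)
  have da: "d (B - k) u = Some a" using dx Suc by simp
  then have a: "a < K" using table_D[OF d(2), of k u a] k u acts states by simp
  define A1 where "A1 = (if k = i then 1 else 0) * PP ^ Suc k"
  define A where "A = A1 + (\<Sum>v<N. ph a u v * T 11 (k * N + v))"
  have "real (\<Sum>v<N. ph a u v * T 11 (k * N + v)) = (\<Sum>v<N. real PP ^ Suc k * (prob I a u v * ?p k v))"
   unfolding of_nat_sum of_nat_mult using a u Y by (intro sum.cong refl) (simp add: real_ph)
  also have "\<dots> = real PP ^ Suc k * (\<Sum>v<N. prob I a u v * ?p k v)" by (simp only: sum_distrib_left)
  moreover have "B - k = B - i \<longleftrightarrow> k = i" using k i by auto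
  ultimately have rA: "real A = real PP ^ Suc k * ?p (Suc k) u"
   unfolding A_def A1_def using da by (simp add: states distrib_left)
  then have Ac: "A \<le> cap" using tot by (simp only: of_nat_le_iff[where 'a = real, symmetric])
  define s1 where "s1 = put T 14 0 A1"
  have r1: "runs (assign 14 (eq (var 21) (var 25) .* Arr 5 (var 21 .+ Num 1))) T s1"
   unfolding s1_def using T k i Ac by (intro runs_Asg) (simp_all add: ev_eq A1_def A_def)
  have "\<exists>s2. runs (expected_load) s1 s2
    \<and> s2 14 0 = s1 14 0 + (\<Sum>v<N. ph a u v * T 11 (k * N + v))"
  proof (rule runs_sum)
   show "ev s1 eN = N" by (rule ev_sizes)
   show "N \<le> s1 2 0" "N \<le> s1 1 0" using limits T by (auto simp: s1_def)
   show "s1 14 0 + (\<Sum>v<N. ph a u v * T 11 (k * N + v)) \<le> s1 1 0" using Ac T by (simp add: s1_def A_def)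
   fix V v assume v: "v < N" "V 24 0 = v" and fr: "\<And>j. j \<noteq> 24 \<Longrightarrow> j \<noteq> 14 \<Longrightarrow> V j = s1 j"
   have "V 3 0 = PP" "V 21 0 = k" "V 22 0 = u" "V 20 0 = r" "V 10 = T 10" "V 11 = T 11" using fr T k u r by (auto simp: s1_def)
   then show "ev V (trans (dec_at (var 20) (var 21) (var 22) .- Num 1) (var 22) (var 24) .* Arr 11 (cell (var 21) (var 24))) = ph a u v * T 11 (k * N + v)"
    using v u a Suc by (simp add: ev_trans ev_cell ev_dec_at)
  qed auto
  then obtain s2 where r2: "runs (expected_load) s1 s2"
    and s2: "s2 14 0 = A" by (auto simp: s1_def A_def)
  show ?thesis using runs_Cnd_True[OF runs_Then[OF r1 r2]] x Suc s2 rA by (intro exI[of _ s2]) simp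
 qed
 then obtain s where rs: "runs (load_now) T s" and s14: "real (s 14 0) = real PP ^ Suc k * ?p (Suc k) u" by blast
 have s: "s j = T j" if "j \<notin> {14, 24}" for j using runs_frame[OF rs, of j] that by simp
 have "s 14 0 \<le> cap" using s14 tot by (simp only: of_nat_le_iff[where 'a = real, symmetric])
 then have "runs (Asg 11 (cell (var 21 .+ Num 1) (var 22)) (var 14)) s (put s 11 (Suc k * N + u) (s 14 0))"
  using s T k u by (intro runs_Asg) (simp_all add: ev_cell)
 then have "runs node_load T (put s 11 (Suc k * N + u) (s 14 0))" unfolding node_load_def by (rule runs_Then[OF rs])
 then show ?thesis using s14 s[of 11] by (intro exI[of _ "put s 11 (Suc k * N + u) (s 14 0)"] exI[of _ "s 14 0"]) simp
qed

lemma all_loads: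
 assumes ok: "ld_ok S" and i: "S 25 0 = i" "i < B" and r: "S 20 0 = r" and d: "decode S r = d" "table d"
  and Y0: "\<And>v. v < N \<Longrightarrow> S 11 v = 0"
 shows "\<exists>T. runs (For 21 eB (For 22 eN node_load)) S T \<and> (\<forall>k\<le>B. \<forall>v<N. real (T 11 (k * N + v)) = real PP ^ k * pay d (slot i) k v)"
proof -
 have S: "S 1 0 = cap" "S 2 0 = limit" using ok unfolding ld_ok_def by auto
 define J :: "nat \<Rightarrow> nat \<Rightarrow> (nat \<Rightarrow> nat \<Rightarrow> nat) \<Rightarrow> bool" where "J k u T \<longleftrightarrow> (\<forall>k' v. v < N \<longrightarrow> k' \<le> k \<or> k' = Suc k \<and> v < u \<longrightarrow> 
  real (T 11 (k' * N + v)) = real PP ^ k' * pay d (slot i) k' v)" for k u T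
 have J_put: "J k u (put T j l x) = J k u T" if "j \<noteq> 11" for k u T j l x using that unfolding J_def by simp
 have "\<exists>T. runs (For 21 eB (For 22 eN node_load)) S T \<and> J B 0 T \<and> T 21 0 = B"
 proof (rule runs_For)
  show "ev S eB = B" by (rule ev_sizes)
  show "B \<le> S 2 0" "B \<le> S 1 0" using limits S by auto
  show "J 0 0 (put S 21 0 0)" unfolding J_def using Y0 by simp
  fix k T assume k: "k < B" "T 21 0 = k" and inv: "J k 0 T"
   and fr: "\<And>j. j \<notin> mods (For 21 eB (For 22 eN node_load)) \<Longrightarrow> T j = S j"
  have eqs: "T j = S j" if "j \<notin> {11, 14, 21, 22, 24}" for j
   using fr[of j] that by (simp add: node_load_def)
  have "\<exists>T'. runs (For 22 eN node_load) T T' \<and> J k N T' \<and> T' 22 0 = N"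
  proof (rule runs_For)
   show "ev T eN = N" by (rule ev_sizes)
   show "N \<le> T 2 0" "N \<le> T 1 0" using limits S eqs by auto
   show "J k 0 (put T 22 0 0)" using inv by (simp add: J_put)
   fix u V assume u: "u < N" "V 22 0 = u" and inv': "J k u V"
    and fr': "\<And>j. j \<notin> mods (For 22 eN node_load) \<Longrightarrow> V j = T j"
   have eqs': "V j = T j" if "j \<notin> {11, 14, 22, 24}" for j
    using fr'[of j] that by (simp add: node_load_def)
   have ok': "ld_ok V" by (rule ld_ok_cong[OF ok]) (auto simp: eqs eqs')
   have k': "V 21 0 = k" "V 20 0 = r" "V 25 0 = i" using eqs' eqs k r i by auto
   have d': "decode V r = d" using decode_same[of V S] eqs'[of 10] eqs[of 10] d(1) by simp
   have Y: "real (V 11 (k * N + v)) = real PP ^ k * pay d (slot i) k v" if "v < N" for v using inv' that unfolding J_def by blast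
   obtain V' y where V': "runs node_load V V'" "V' 11 = (V 11)(Suc k * N + u := y)" "real y = real PP ^ Suc k * pay d (slot i) (Suc k) u"
    using node_load[OF ok' k'(1) k(1) u(2,1) k'(3) i(2) k'(2) d' d(2) Y] by blast
   have "J k (Suc u) V'"
    unfolding J_def
   proof (intro conjI allI impI)
    fix k' v assume v: "v < N" and c: "k' \<le> k \<or> k' = Suc k \<and> v < Suc u"
    show "real (V' 11 (k' * N + v)) = real PP ^ k' * pay d (slot i) k' v"
    proof (cases "k' = Suc k \<and> v = u")
     case True
     then show ?thesis using V'(2,3) by (simp del: pay.simps)
    next
     case False
     then have "V' 11 (k' * N + v) = V 11 (k' * N + v)"
      using cells[OF v u(1), of k' "Suc k"] False unfolding V'(2) by (intro fun_upd_other) blast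
     then show ?thesis using inv' v c False unfolding J_def by (auto simp: less_Suc_eq)
    qed
   qed
   then show "\<exists>V'. runs node_load V V' \<and> J k (Suc u) (put V' 22 0 (Suc u))" using V'(1) by (auto simp: J_put)
  qed (auto simp: node_load_def)
  then obtain T' where T': "runs (For 22 eN node_load) T T'" "J k N T'" by blast
  have "J (Suc k) 0 T'" using T'(2) unfolding J_def by (auto simp: le_Suc_eq less_Suc_eq)
  then show "\<exists>T'. runs (For 22 eN node_load) T T' \<and> J (Suc k) 0 (put T' 21 0 (Suc k))"
   using T'(1) by (auto simp: J_put)
 qed (auto simp: node_load_def)
 then obtain T where "runs (For 21 eB (For 22 eN node_load)) S T" "J B 0 T" by blast
 then show ?thesis unfolding J_def by (intro exI[of _ T]) auto
qed

lemma root_less: "i < narms I \<Longrightarrow> root I i < N"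
 using root_states states by auto

text \<open>After \<open>r\<close> rounds a queue is at most \<open>r * narms I\<close>, so a
  further load still fits below the limit even before 1 is subtracted.\<close>

lemma queue_cap: "r < num_rounds \<Longrightarrow> r * narms I * PP ^ B + narms I * PP ^ B \<le> cap"
proof -
 assume "r < num_rounds"
 then have "(r + 1) * narms I \<le> num_rounds * narms I" by (intro mult_le_mono1) simp
 then have n: "(r + 1) * narms I \<le> num_rounds * narms I + 1" by (rule trans_le_add1)
 have "(r + 1) * narms I * PP ^ B * 1 \<le> (num_rounds * narms I + 1) * PP ^ B * XX ^ (B + 1)"
  using XX_pos by (intro mult_le_mono n) auto
 then show ?thesis using caps(2) by (simp add: algebra_simps)
qed

lemma prices:
 assumes ok: "ld_ok S" and r: "S 20 0 = r" "r < num_rounds" and d: "decode S r = d" "table d"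
  and Y0: "\<And>v. v < N \<Longrightarrow> S 11 v = 0" and q: "\<And>i. i < B \<Longrightarrow> S 8 i \<le> r * narms I * PP ^ B"
 shows "\<exists>T. runs prices S T \<and> (\<forall>v<N. T 11 v = 0) \<and>
  (\<forall>i<B. real (T 8 i) = max 0 (S 8 i + real PP ^ B * slot_load d (B - i) - real PP ^ B))"
proof -
 have S: "S 1 0 = cap" "S 2 0 = limit" using ok unfolding ld_ok_def by auto
 define J :: "nat \<Rightarrow> (nat \<Rightarrow> nat \<Rightarrow> nat) \<Rightarrow> bool" where "J i T \<longleftrightarrow> (\<forall>v<N. T 11 v = 0) \<and>
  (\<forall>j<i. real (T 8 j) = max 0 (S 8 j + real PP ^ B * slot_load d (B - j) - real PP ^ B)) \<and> (\<forall>j\<ge>i. T 8 j = S 8 j)" for i T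
 have J_put: "J k (put T j l x) = J k T" if "j \<noteq> 11" "j \<noteq> 8" for k T j l x using that unfolding J_def by simp
 have "\<exists>T. runs prices S T \<and> J B T \<and> T 25 0 = B"
  unfolding prices_def
 proof (rule runs_For)
  show "ev S eB = B" by (rule ev_sizes)
  show "B \<le> S 2 0" "B \<le> S 1 0" using limits S by auto
  show "J 0 (put S 25 0 0)" unfolding J_def using Y0 by simp
  let ?body = "For 21 eB (For 22 eN node_load) ;; assign 12 (Num 0) ;; slot_total
  ;; Asg 8 (var 25) (Arr 8 (var 25) .+ var 12 .- Arr 5 eB)"
  fix i T assume i: "i < B" "T 25 0 = i" and inv: "J i T" and fr: "\<And>j. j \<notin> mods (For 25 eB ?body) \<Longrightarrow> T j = S j"
  have eqs: "T j = S j" if "j \<notin> {8, 11, 12, 14, 21, 22, 24, 25, 26}" for j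
   using fr[of j] that by (simp add: node_load_def)
  have ok': "ld_ok T" by (rule ld_ok_cong[OF ok]) (auto simp: eqs)
  have d': "decode T r = d" using decode_same[of T S] eqs[of 10] d(1) by simp
  have r': "T 20 0 = r" using eqs r by simp
  have Y0': "T 11 v = 0" if "v < N" for v using inv that unfolding J_def by blast
  obtain s1 where r1: "runs (For 21 eB (For 22 eN node_load)) T s1"
   and Y: "\<forall>k\<le>B. \<forall>v<N. real (s1 11 (k * N + v)) = real PP ^ k * pay d (slot i) k v"
   using all_loads[OF ok' i(2,1) r' d' d(2) Y0'] by blast
  have s1: "s1 j = T j" if "j \<notin> {11, 14, 21, 22, 24}" for j using runs_frame[OF r1, of j] that by (simp add: node_load_def)
  define s2 where "s2 = put s1 12 0 0"
  have r2: "runs (assign 12 (Num 0)) s1 s2" unfolding s2_def by (intro runs_Asg) auto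
  define W where "W = (\<Sum>j<narms I. s1 11 (B * N + root I j))"
  have rW: "real W = real PP ^ B * slot_load d (B - i)"
   unfolding W_def slot_load_def of_nat_sum sum_distrib_left using Y root_less by (intro sum.cong refl) auto
  have W_le: "W \<le> narms I * PP ^ B"
  proof -
   have "real W \<le> real PP ^ B * narms I" unfolding rW using slot_load_le[OF d(2)] by (intro mult_left_mono) auto
   also have "\<dots> = real (narms I * PP ^ B)" by simp
   finally show ?thesis by (simp only: of_nat_le_iff)
  qed
  have q8: "T 8 i = S 8 i" using inv unfolding J_def by simp
  have sum_cap: "S 8 i + W \<le> cap" using queue_cap[OF r(2)] q[OF i(1)] W_le by linarith
  have "\<exists>s3. runs (slot_total) s2 s3 \<and> s3 12 0 = s2 12 0 + (\<Sum>j<narms I. s1 11 (B * N + root I j))"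
  proof (rule runs_sum)
   show "ev s2 en = narms I" by (rule ev_sizes)
   show "narms I \<le> s2 2 0" "narms I \<le> s2 1 0" using limits S eqs s1 by (auto simp: s2_def)
   show "s2 12 0 + (\<Sum>j<narms I. s1 11 (B * N + root I j)) \<le> s2 1 0"
    using sum_cap S eqs s1 by (simp add: s2_def W_def)
   fix V j assume "j < narms I" "V 26 0 = j" and "\<And>l. l \<noteq> 26 \<Longrightarrow> l \<noteq> 12 \<Longrightarrow> V l = s2 l"
   then show "ev V (Arr 11 (cell eB (root_at (var 26)))) = s1 11 (B * N + root I j)"
    by (simp add: ev_cell ev_root_at lk s2_def)
  qed auto
  then obtain s3 where r3: "runs (slot_total) s2 s3" and W3: "s3 12 0 = W"
   by (auto simp: s2_def W_def)
  have s3: "s3 j = s1 j" if "j \<notin> {12, 26}" for j using runs_frame[OF r3, of j] that by (simp add: s2_def)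
  define s4 where "s4 = put s3 8 i (S 8 i + W - PP ^ B)"
  have p5: "T 5 B = PP ^ B" using ok' unfolding ld_ok_def by simp
  have "ev s3 (Arr 8 (var 25) .+ var 12 .- Arr 5 eB) = S 8 i + W - PP ^ B"
   using s3 s1 i W3 p5 q8 by (simp add: lk)
  moreover have "S 8 i + W - PP ^ B \<le> s3 1 0" using sum_cap s3 s1 eqs S by simp
  ultimately have r4: "runs (Asg 8 (var 25) (Arr 8 (var 25) .+ var 12 .- Arr 5 eB)) s3 s4"
   unfolding s4_def using s3 s1 i by (intro runs_Asg) simp_all
  have "runs ?body T s4" by (rule runs_Then[OF r1 runs_Then[OF r2 runs_Then[OF r3 r4]]])
  moreover have "J (Suc i) s4"
   unfolding J_def
  proof (intro conjI allI impI)
   fix v assume "v < N"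
   then have "real (s1 11 (0 * N + v)) = real PP ^ 0 * pay d (slot i) 0 v" using Y by blast
   then show "s4 11 v = 0" using s3[of 11] by (simp add: s4_def)
  next
   fix j assume "j < Suc i"
   have "real (S 8 i + W - PP ^ B) = max 0 (S 8 i + real PP ^ B * slot_load d (B - i) - real PP ^ B)"
    unfolding rW[symmetric] by (cases "PP ^ B \<le> S 8 i + W") (simp_all add: of_nat_diff max_def not_le flip: of_nat_power of_nat_add)
   then show "real (s4 8 j) = max 0 (S 8 j + real PP ^ B * slot_load d (B - j) - real PP ^ B)"
    using inv \<open>j < Suc i\<close> s3[of 8] s1[of 8] unfolding J_def s4_def by (cases "j = i") auto
  next
   fix j assume "Suc i \<le> j"
   then show "s4 8 j = S 8 j" using inv s3[of 8] s1[of 8] unfolding J_def s4_def by simp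
  qed
  ultimately show "\<exists>T'. runs ?body T T' \<and> J (Suc i) (put T' 25 0 (Suc i))" by (auto simp: J_put)
 qed (auto simp: node_load_def)
 then show ?thesis unfolding J_def by blast
qed

lemma constants:
 assumes S: "S 1 0 = cap" "S 2 0 = limit"
 shows "\<exists>T. runs constants S T \<and> T 3 0 = PP \<and> T 4 0 = RR \<and> (\<forall>j\<le>B. T 5 j = PP ^ j)"
proof -
 define s1 where "s1 = put S 3 0 1"
 have r1: "runs (assign 3 (Num 1)) S s1" unfolding s1_def using S caps(8) by (intro runs_Asg) auto
 have "\<exists>s2. runs (prob_denominators) s1 s2 \<and>
  s2 3 0 = (\<Prod>j<K * N * N. lookup xs (4 + narms I + N + 2 * (K * N) + 2 * j + 1))"
  by (rule runs_prod) (use limits S caps(9) in \<open>auto simp: s1_def ev_prob_at lk\<close>)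
 then obtain s2 where r2: "runs (prob_denominators) s1 s2" and P: "s2 3 0 = PP"
  by (auto simp: PP_def)
 have s2: "s2 j = S j" if "j \<notin> {3, 27}" for j using runs_frame[OF r2, of j] that by (simp add: s1_def)
 define s3 where "s3 = put s2 4 0 1"
 have r3: "runs (assign 4 (Num 1)) s2 s3" unfolding s3_def using S s2 caps(8) by (intro runs_Asg) auto
 have "\<exists>s4. runs (rew_denominators) s3 s4 \<and>
  s4 4 0 = (\<Prod>j<K * N. lookup xs (4 + narms I + N + 2 * j + 1))"
  by (rule runs_prod) (use limits S s2 caps(10) in \<open>auto simp: s3_def ev_rew_at lk\<close>)
 then obtain s4 where r4: "runs (rew_denominators) s3 s4" and R: "s4 4 0 = RR"
  by (auto simp: RR_def)
 have s4: "s4 j = s2 j" if "j \<notin> {4, 27}" for j using runs_frame[OF r4, of j] that by (simp add: s3_def)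
 define s5 where "s5 = put s4 5 0 1"
 have r5: "runs (assign 5 (Num 1)) s4 s5" unfolding s5_def using S s2 s4 caps(8) by (intro runs_Asg) auto
 have s5: "s5 1 0 = cap" "s5 2 0 = limit" "s5 3 0 = PP" "s5 5 0 = 1" "s5 4 0 = RR" using S s2 s4 P R by (auto simp: s5_def)
 have "\<exists>s6. runs (powers) s5 s6 \<and> (\<forall>j\<le>B. s6 5 j = PP ^ j) \<and> s6 27 0 = B"
 proof (rule runs_For[where Inv = "\<lambda>i T. \<forall>j\<le>i. T 5 j = PP ^ j"])
  show "ev s5 eB = B" by (rule ev_sizes)
  show "B \<le> s5 2 0" "B \<le> s5 1 0" using limits s5 by auto
  show "\<forall>j\<le>0. (put s5 27 0 0) 5 j = PP ^ j" using s5 by simp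
  fix i T assume i: "i < B" "T 27 0 = i" and inv: "\<forall>j\<le>i. T 5 j = PP ^ j"
   and fr: "\<And>j. j \<notin> mods (powers) \<Longrightarrow> T j = s5 j"
  have "T 3 0 = PP" "T 1 0 = cap" using fr s5 by auto
  then have "runs (Asg 5 (var 27 .+ Num 1) (Arr 5 (var 27) .* var 3)) T (put T 5 (Suc i) (PP ^ Suc i))"
   using i inv caps(7)[of "Suc i"] by (intro runs_Asg) (auto simp: mult.commute)
  then show "\<exists>T'. runs (Asg 5 (var 27 .+ Num 1) (Arr 5 (var 27) .* var 3)) T T' \<and> (\<forall>j\<le>Suc i. (put T' 27 0 (Suc i)) 5 j = PP ^ j)"
   using inv by (intro exI[of _ "put T 5 (Suc i) (PP ^ Suc i)"]) (auto simp: le_Suc_eq)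
 qed auto
 then obtain s6 where r6: "runs (powers) s5 s6" and Pw: "\<forall>j\<le>B. s6 5 j = PP ^ j" by blast
 have s6: "s6 j = s5 j" if "j \<notin> {5, 27}" for j using runs_frame[OF r6, of j] that by simp
 have "runs constants S s6" unfolding constants_def
  by (rule runs_Then[OF r1 runs_Then[OF r2 runs_Then[OF r3 runs_Then[OF r4 runs_Then[OF r5 r6]]]]])
 then show ?thesis using Pw s6 s5 by (intro exI[of _ s6]) auto
qed

lemma mods_all_values: "mods all_values = {9, 10, 13, 14, 21, 22, 23, 24}"
 by (auto simp: all_values_def node_value_def try_action_def)

lemma mods_prices: "mods prices = {8, 11, 12, 14, 21, 22, 24, 25, 26}"
 by (auto simp: prices_def node_load_def)

text \<open>Ties the integer arrays to a real subgradient run: cell \<open>i\<close> of array 8 is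
  \<open>PP ^ B\<close> times the queue of slot \<open>B - i\<close>. The real run is extended by
  whatever table the machine has just stored.\<close>

lemma dual_round:
 assumes S: "S 1 0 = cap" "S 2 0 = limit" "S 3 0 = PP" "S 4 0 = RR" "\<forall>j\<le>B. S 5 j = PP ^ j"
   "S 6 0 = step_scale * PP ^ B * PP ^ B" "real (S 7 0) = real RR * real PP ^ B * free_value"
  and B: "1 \<le> B" and r: "S 20 0 = r" "r < num_rounds"
  and Y0: "\<And>v. v < N \<Longrightarrow> S 9 v = 0" "\<And>v. v < N \<Longrightarrow> S 11 v = 0"
  and q: "\<And>i. i < B \<Longrightarrow> S 8 i \<le> r * narms I * PP ^ B" "\<And>t. 0 \<le> q r t" "\<And>i. i < B \<Longrightarrow> real (S 8 i) = real PP ^ B * q r (B - i)"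
  and run: "dual_run (free_value / step_scale) r q (decode S)"
 shows "\<exists>T q'. runs (all_values ;; prices) S T \<and> (\<forall>v<N. T 9 v = 0 \<and> T 11 v = 0) \<and> (\<forall>i<B. T 8 i \<le> Suc r * narms I * PP ^ B) \<and>
  (\<forall>t. 0 \<le> q' (Suc r) t) \<and> (\<forall>i<B. real (T 8 i) = real PP ^ B * q' (Suc r) (B - i)) \<and> dual_run (free_value / step_scale) (Suc r) q' (decode T)"
proof -
 let ?\<eta> = "free_value / step_scale" and ?c = "step_scale * PP ^ B * PP ^ B"
 have ss: "0 < step_scale" using B arms_pos by (simp add: step_scale_def)
 have fv: "0 \<le> free_value" unfolding free_value_def by (intro sum_nonneg val_nonneg)
 have P: "0 < real PP ^ B" using PP_pos by simp
 define l where "l t = ?\<eta> * q r t" for t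
 have ok: "dp_ok ?c l S"
  unfolding dp_ok_def
 proof (intro conjI allI impI)
  show "0 \<le> l t" for t unfolding l_def using fv q(2) by (intro mult_nonneg_nonneg) auto
  show "real ?c * real RR * l (B - k) = real (S 7 0) * real (S 8 k)" if "k < B" for k
   unfolding l_def S(7) q(3)[OF that] using ss by simp
  show "1 \<le> ?c" using ss PP_pos by (simp add: Suc_le_eq)
  show "?c * RR * PP ^ B * XX ^ (B + 1) \<le> cap" using caps(1) unfolding max_value_def .
 qed (use S in auto)
 obtain s where s: "runs all_values S s" "\<forall>k\<le>B. \<forall>v<N. real (s 9 (k * N + v)) = scaled ?c k * val l k v"
  "\<forall>k<B. \<forall>v<N. decided l k v (s 10 ((r * B + k) * N + v))" "\<forall>x<r * B * N. s 10 x = S 10 x"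
  using all_values[OF ok Y0(1)] unfolding r(1) by blast
 have sfr: "s j = S j" if "j \<notin> {9, 10, 13, 14, 21, 22, 23, 24}" for j
  using runs_frame[OF s(1), of j] that unfolding mods_all_values by blast
 define d where "d = decode s r"
 have best: "best_response l d" unfolding d_def by (rule decided_best_response) (use s(3) in blast)
 then have tab: "table d" unfolding best_response_def by blast
 have ld: "ld_ok s" unfolding ld_ok_def using S by (simp add: sfr)
 obtain T where T: "runs prices s T" "\<forall>v<N. T 11 v = 0"
  "\<forall>i<B. real (T 8 i) = max 0 (s 8 i + real PP ^ B * slot_load d (B - i) - real PP ^ B)"
  using prices[OF ld _ r(2) d_def[symmetric] tab] r(1) Y0(2) q(1) by (auto simp: sfr)
 have Tfr: "T j = s j" if "j \<notin> {8, 11, 12, 14, 21, 22, 24, 25, 26}" for j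
  using runs_frame[OF T(1), of j] that unfolding mods_prices by blast
 define q' where "q' = q(Suc r := \<lambda>t. max 0 (q r t + slot_load d t - 1))"
 have dr: "decode T r = d" using decode_same[of T s] Tfr[of 10] by (simp add: d_def)
 have dec: "decode T r' = decode S r'" if "r' < r" for r'
  using decode_same[of T s] Tfr[of 10] decode_cong[of r s S r'] s(4) that by simp
 have r8: "real (T 8 i) = real PP ^ B * q' (Suc r) (B - i)" if i: "i < B" for i
 proof -
  have "real (T 8 i) = max 0 (real PP ^ B * (q r (B - i) + slot_load d (B - i) - 1))"
   using T(3) i q(3)[OF i] by (simp add: sfr algebra_simps)
  also have "\<dots> = real PP ^ B * max 0 (q r (B - i) + slot_load d (B - i) - 1)"
  proof -
   have "max 0 (p * x) = p * max 0 x" if "0 < p" for p x :: real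
    using that by (cases "0 \<le> x") (simp_all add: max_def zero_le_mult_iff)
   from this[OF P] show ?thesis .
  qed
  finally show ?thesis by (simp add: q'_def)
 qed
 have "T 8 i \<le> Suc r * narms I * PP ^ B" if i: "i < B" for i
 proof -
  have "real PP ^ B * slot_load d (B - i) \<le> real PP ^ B * narms I" using slot_load_le[OF tab] by (intro mult_left_mono) auto
  moreover have "real (S 8 i) \<le> real (r * narms I * PP ^ B)" using q(1)[OF i] by (simp only: of_nat_le_iff)
  moreover have "0 \<le> real (r * narms I * PP ^ B)" "0 \<le> real PP ^ B * narms I" by simp_all
  moreover have "real (T 8 i) = max 0 (S 8 i + real PP ^ B * slot_load d (B - i) - real PP ^ B)" using T(3) i by (simp add: sfr)
  ultimately have "real (T 8 i) \<le> real (r * narms I * PP ^ B) + real PP ^ B * narms I" using P by linarith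
  also have "\<dots> = real (Suc r * narms I * PP ^ B)" by (simp add: algebra_simps)
  finally show ?thesis by (simp only: of_nat_le_iff)
 qed
 moreover have "dual_run ?\<eta> (Suc r) q' (decode T)"
 proof -
  have "best_response (\<lambda>t. ?\<eta> * q r t) d" using best unfolding l_def .
  moreover have "q' r' = q r'" if "r' \<le> r" for r' using that by (simp add: q'_def)
  ultimately show ?thesis using run dec dr unfolding dual_run_def by (auto simp: less_Suc_eq q'_def)
 qed
 moreover have "T 9 v = 0" if "v < N" for v
 proof -
  have "real (s 9 (0 * N + v)) = scaled ?c 0 * val l 0 v" using s(2) that by blast
  then show ?thesis using Tfr[of 9] by simp
 qed
 ultimately show ?thesis using runs_Then[OF s(1) T(1)] T(2) r8
  by (intro exI[of _ T] exI[of _ q']) (simp add: q'_def)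
qed

lemma dual:
 assumes S: "S 1 0 = cap" "S 2 0 = limit" "\<And>k i. 2 < k \<Longrightarrow> k < 61 \<Longrightarrow> S k i = 0" and B: "1 \<le> B"
 shows "\<exists>T q. runs dual S T \<and> dual_run (free_value / step_scale) num_rounds q (decode T)"
proof -
 obtain s1 where r1: "runs constants S s1" and c: "s1 3 0 = PP" "s1 4 0 = RR" "\<forall>j\<le>B. s1 5 j = PP ^ j"
  using constants[of S] S(1,2) by blast
 have s1: "s1 j = S j" if "j \<notin> {3, 4, 5, 27}" for j using runs_frame[OF r1, of j] that by (simp add: constants_def)
 define s2 where "s2 = put s1 6 0 1"
 have r2: "runs (assign 6 (Num 1)) s1 s2" unfolding s2_def using S s1 caps(8) by (intro runs_Asg) auto
 have free_cap: "RR * PP ^ B * XX ^ (B + 1) \<le> cap"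
 proof -
  show ?thesis using order_trans[OF mult_le_mono1[OF arms_pos, of "RR * PP ^ B * XX ^ (B + 1)"]] caps(3)
   by (simp only: mult_1 mult.assoc)
 qed
 have ok: "dp_ok 1 (\<lambda>_. 0) s2" unfolding dp_ok_def using S s1 c free_cap by (simp add: s2_def)
 have "s2 9 v = 0" for v using S(3) s1 by (simp add: s2_def)
 then obtain s3 where r3: "runs all_values s2 s3" and V: "\<forall>k\<le>B. \<forall>v<N. real (s3 9 (k * N + v)) = scaled 1 k * val (\<lambda>_. 0) k v"
  using all_values[OF ok] by blast
 have s3: "s3 j = s2 j" if "j \<notin> {9, 10, 13, 14, 21, 22, 23, 24}" for j
  using runs_frame[OF r3, of j] that unfolding mods_all_values by blast
 define Z where "Z = (\<Sum>i<narms I. s3 9 (B * N + root I i))"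
 have rZ: "real Z = real RR * real PP ^ B * free_value"
  unfolding Z_def free_value_def of_nat_sum sum_distrib_left using V root_less
  by (intro sum.cong refl) (auto simp: scaled_def)
 have Zcap: "Z \<le> cap"
 proof -
  have "val (\<lambda>_. 0) B (root I i) \<le> real (XX ^ (B + 1))" if "i < narms I" for i
   using val_bounds[of "\<lambda>_. 0" "root I i" B] root_less[OF that] XX_mono[of B "B + 1"] by (auto intro: order_trans)
  then have "free_value \<le> (\<Sum>i<narms I. real (XX ^ (B + 1)))" unfolding free_value_def by (intro sum_mono) auto
  then have "real Z \<le> real RR * real PP ^ B * (\<Sum>i<narms I. real (XX ^ (B + 1)))" unfolding rZ by (intro mult_left_mono) auto
  also have "\<dots> = real (narms I * RR * PP ^ B * XX ^ (B + 1))" by simp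
  also have "\<dots> \<le> cap" unfolding of_nat_le_iff by (rule caps)
  finally show ?thesis by simp
 qed
 have "\<exists>s4. runs (free_total) s3 s4 \<and> s4 7 0 = s3 7 0 + (\<Sum>i<narms I. s3 9 (B * N + root I i))"
 proof (rule runs_sum)
  show "ev s3 en = narms I" by (rule ev_sizes)
  show "narms I \<le> s3 2 0" "narms I \<le> s3 1 0" using limits S s1 s3 by (auto simp: s2_def)
  show "s3 7 0 + (\<Sum>i<narms I. s3 9 (B * N + root I i)) \<le> s3 1 0"
   using Zcap S s1 s3 by (simp add: s2_def Z_def)
  fix V j assume "j < narms I" "V 26 0 = j" and "\<And>l. l \<noteq> 26 \<Longrightarrow> l \<noteq> 7 \<Longrightarrow> V l = s3 l"
  then show "ev V (Arr 9 (cell eB (root_at (var 26)))) = s3 9 (B * N + root I j)"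
   by (simp add: ev_cell ev_root_at lk)
 qed auto
 then obtain s4 where r4: "runs (free_total) s3 s4" and Z4: "s4 7 0 = Z"
  using S(3)[of 7 0] s1 s3 by (auto simp: s2_def Z_def)
 have s4: "s4 j = s3 j" if "j \<notin> {7, 26}" for j using runs_frame[OF r4, of j] that by simp
 define s5 where "s5 = put s4 6 0 (step_scale * PP ^ B * PP ^ B)"
 have r5: "runs (assign 6 (scale_expr .* Arr 5 eB .* Arr 5 eB)) s4 s5"
  unfolding s5_def using S s1 s3 s4 c caps(4) by (intro runs_Asg) (simp_all add: ev_scale s2_def lk)
 have s5: "s5 j = s1 j" if "j \<notin> {6, 7, 9, 10, 13, 14, 21, 22, 23, 24, 26}" for j using that s4 s3 by (simp add: s5_def s2_def)
 define Inv :: "nat \<Rightarrow> (nat \<Rightarrow> nat \<Rightarrow> nat) \<Rightarrow> bool" where "Inv r T \<longleftrightarrow> (\<forall>v<N. T 9 v = 0 \<and> T 11 v = 0) \<and> (\<forall>i<B. T 8 i \<le> r * narms I * PP ^ B) \<and>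
  (\<exists>q. (\<forall>t. 0 \<le> q r t) \<and> (\<forall>i<B. real (T 8 i) = real PP ^ B * q r (B - i)) \<and> dual_run (free_value / step_scale) r q (decode T))" for r T
 have Inv_put: "Inv r (put T 20 0 x) = Inv r T" for r T x unfolding Inv_def using decode_same[of "put T 20 0 x" T] by simp
 have "\<exists>T. runs (For 20 rounds_expr (all_values ;; prices)) s5 T \<and> Inv num_rounds T \<and> T 20 0 = num_rounds"
 proof (rule runs_For)
  show "ev s5 rounds_expr = num_rounds" by (rule ev_scale)
  show "num_rounds \<le> s5 2 0" "num_rounds \<le> s5 1 0" using limits(7) caps(6) S s1 s5 by auto
  have "s5 9 v = 0" if "v < N" for v
  proof -
   have "real (s3 9 (0 * N + v)) = scaled 1 0 * val (\<lambda>_. 0) 0 v" using V that by blast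
   then show ?thesis using s4 by (simp add: s5_def)
  qed
  moreover have "s5 11 v = 0" "s5 8 v = 0" for v using s5 s1 S(3) by auto
  ultimately show "Inv 0 (put s5 20 0 0)" unfolding Inv_put unfolding Inv_def
   by (auto simp: dual_run_def intro!: exI[of _ "\<lambda>_ _. 0"])
  fix r T assume r: "r < num_rounds" "T 20 0 = r" and inv: "Inv r T"
   and fr: "\<And>j. j \<notin> mods (For 20 rounds_expr (all_values ;; prices)) \<Longrightarrow> T j = s5 j"
  have eqs: "T j = s5 j" if "j \<in> {1, 2, 3, 4, 5, 6, 7}" for j
   using fr[of j] that unfolding mods.simps mods_all_values mods_prices by fastforce
  have T: "T 1 0 = cap" "T 2 0 = limit" "T 3 0 = PP" "T 4 0 = RR" "\<forall>j\<le>B. T 5 j = PP ^ j"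
   "T 6 0 = step_scale * PP ^ B * PP ^ B" "real (T 7 0) = real RR * real PP ^ B * free_value"
   using eqs s5 s1 c S Z4 rZ by (simp_all add: s5_def)
  obtain q where q: "\<And>t. 0 \<le> q r t" "\<And>i. i < B \<Longrightarrow> real (T 8 i) = real PP ^ B * q r (B - i)" "dual_run (free_value / step_scale) r q (decode T)"
   using inv unfolding Inv_def by blast
  have i: "T 9 v = 0" "T 11 v = 0" if "v < N" for v using inv that unfolding Inv_def by auto
  have q8: "T 8 i \<le> r * narms I * PP ^ B" if "i < B" for i using inv that unfolding Inv_def by auto
  obtain T' where "runs (all_values ;; prices) T T'" "Inv (Suc r) T'"
   using dual_round[OF T B r(2,1) i q8 q] unfolding Inv_def by blast
  then show "\<exists>T'. runs (all_values ;; prices) T T' \<and> Inv (Suc r) (put T' 20 0 (Suc r))" unfolding Inv_put by blast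
 qed (auto simp: mods_all_values mods_prices)
 then obtain T where r6: "runs (For 20 rounds_expr (all_values ;; prices)) s5 T" and inv: "Inv num_rounds T" by blast
 have "runs dual S T" unfolding dual_def
  by (rule runs_Then[OF r1 runs_Then[OF r2 runs_Then[OF r3 runs_Then[OF r4 runs_Then[OF r5 r6]]]]])
 then show ?thesis using inv unfolding Inv_def by blast
qed

end

section \<open>Iteration, finite supports and a recursion for the arm selection\<close>

lemma (in machine) iter_Suc': "iter (Suc m) f p = bind_pmf (iter m f p) f"
proof (induction m arbitrary: p)
 case 0
 have "iter 0 f = return_pmf" by (rule ext) simp
 then show ?case by (simp add: bind_return_pmf bind_return_pmf')
next
 case (Suc m)
 have "iter (Suc (Suc m)) f p = bind_pmf (f p) (\<lambda>q. bind_pmf (iter m f q) f)"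
  unfolding iter.simps(2)[of "Suc m"] using Suc by (intro bind_pmf_cong) auto
 then show ?case by (simp add: bind_assoc_pmf)
qed

lemma (in machine) finite_iter:
 assumes "\<And>q. Ok (snd q) \<Longrightarrow> finite (set_pmf (f q)) \<and> (\<forall>q'\<in>set_pmf (f q). Ok (snd q'))"
 shows "Ok (snd q) \<Longrightarrow> finite (set_pmf (iter m f q))"
 by (induction m arbitrary: q) (use assms in auto)

lemma (in machine) finite_sem:
 assumes Ok: "\<And>e x e'. Ok e \<Longrightarrow> e' \<in> set_pmf (env_step I B x e) \<Longrightarrow> Ok e'"
  and fin: "\<And>e x. Ok e \<Longrightarrow> finite (set_pmf (env_step I B x e))"
 shows "Ok (snd p) \<Longrightarrow> finite (set_pmf (sem st p))"
proof (induction st arbitrary: p)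
 case (Rnd k a b)
 show ?case by (auto simp: uniform_below_def set_pmf_of_set lessThan_empty_iff)
next
 case (Then s s')
 have "finite (set_pmf (sem s p))" using Then by blast
 moreover have "finite (set_pmf (sem s' q))" if "q \<in> set_pmf (sem s p)" for q
  by (rule Then.IH(2)[OF sem_invariant[of Ok, OF Ok that Then.prems]])
 ultimately show ?case by simp
next
 case (For j n s)
 let ?f = "\<lambda>p. map_pmf (\<lambda>p. (incr j (fst p), snd p)) (sem s p)"
 have "finite (set_pmf (iter m ?f q))" if "Ok (snd q)" for m q
 proof (rule finite_iter[of Ok, OF _ that])
  fix q :: "(nat \<Rightarrow> nat \<Rightarrow> nat) \<times> nat env" assume q: "Ok (snd q)"
  have "Ok (snd q')" if "q' \<in> set_pmf (sem s q)" for q'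
   by (rule sem_invariant[of Ok, OF Ok that q])
  then show "finite (set_pmf (?f q)) \<and> (\<forall>q'\<in>set_pmf (?f q). Ok (snd q'))" using For.IH[OF q] by auto
 qed
 then show ?case using For.prems by simp
qed (use fin in auto)

lemma (in machine) sem_Rnd_Then:
 "sem (Then (Rnd k a b) s) (S, e) = bind_pmf (uniform_below (min (ev S b) (S 1 0))) (\<lambda>x. sem s (put S k (ev S a) x, e))"
 by (simp add: bind_map_pmf)

lemma pick_SomeI:
 assumes "j < n" "ks j \<le> B" "\<And>l. l < n \<Longrightarrow> ks j \<le> ks l" "\<And>l. l < j \<Longrightarrow> ks j < ks l"
 shows "pick n B ks = Some j"
proof -
 have "(LEAST i. i < n \<and> (\<forall>l<n. ks i \<le> ks l)) = j"
 proof (rule Least_equality)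
  fix i assume i: "i < n \<and> (\<forall>l<n. ks i \<le> ks l)"
  show "j \<le> i"
  proof (rule ccontr)
   assume "\<not> j \<le> i"
   then have "ks j < ks i" using assms(4) by simp
   then show False using i assms(1) by (meson not_le)
  qed
 qed (use assms in auto)
 moreover have "\<not> (\<forall>i<n. B < ks i)" using assms(1,2) by (meson not_le)
 ultimately show ?thesis by (simp add: pick_def)
qed

lemma pick_first: "pick n B ks = Some j \<Longrightarrow> l < j \<Longrightarrow> ks j < ks l"
proof (rule ccontr)
 assume p: "pick n B ks = Some j" and l: "l < j" and "\<not> ks j < ks l"
 then have "\<forall>i<n. ks l \<le> ks i" using pick_Some(3)[OF p] by fastforce
 moreover have "l < n" using pick_Some(1)[OF p] l by simp
 moreover have "j = (LEAST i. i < n \<and> (\<forall>j<n. ks i \<le> ks j))" using p by (auto simp: pick_def split: if_splits)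
 ultimately show False using not_less_Least[of l "\<lambda>i. i < n \<and> (\<forall>j<n. ks i \<le> ks j)"] l by blast
qed

text \<open>This is the recursion of a left-to-right scan. Replacing the candidate only on a strict
  improvement agrees with the least index taken by \<open>pick\<close>.\<close>

lemma pick_Suc:
 "pick (Suc n) B ks = (case pick n B ks of None \<Rightarrow> if ks n \<le> B then Some n else None
  | Some j \<Rightarrow> if ks n < ks j then Some n else Some j)"
proof (cases "pick n B ks")
 case None
 then have big: "\<And>i. i < n \<Longrightarrow> B < ks i" by (simp add: pick_None)
 show ?thesis
 proof (cases "ks n \<le> B")
  case True
  have "pick (Suc n) B ks = Some n"
  proof (rule pick_SomeI)
   show "ks n \<le> ks l" if "l < Suc n" for l using that big[of l] True by (cases "l = n") auto
   show "ks n < ks l" if "l < n" for l using that big[of l] True by simp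
  qed (use True in auto)
  then show ?thesis using None True by simp
 next
  case False
  then have "pick (Suc n) B ks = None" using big by (auto simp: pick_None less_Suc_eq)
  then show ?thesis using None False by simp
 qed
next
 case (Some j)
 note p = pick_Some[OF Some] pick_first[OF Some]
 show ?thesis
 proof (cases "ks n < ks j")
  case True
  have "pick (Suc n) B ks = Some n"
  proof (rule pick_SomeI)
   show "ks n \<le> ks l" if "l < Suc n" for l using that p(3)[of l] True by (cases "l = n") auto
   show "ks n < ks l" if "l < n" for l using that p(3)[of l] True by simp
  qed (use True p in auto)
  then show ?thesis using Some True by simp
 next
  case False
  have "pick (Suc n) B ks = Some j"
  proof (rule pick_SomeI)
   show "ks j \<le> ks l" if "l < Suc n" for l using that p(3)[of l] False by (cases "l = n") auto
  qed (use p in auto)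
  then show ?thesis using Some False by simp
 qed
qed

context bandit
begin

lemma finite_env_step:
 assumes "env_ok e"
 shows "finite (set_pmf (env_step I B x e))"
proof (cases "clock e < B \<and> (\<exists>i a. x = Some (i, a) \<and> i < narms I \<and> a \<in> acts I)")
 case False
 then show ?thesis by (auto simp: env_step_def split: option.splits if_splits)
next
 case True
 then obtain i a where x: "x = Some (i, a)" "i < narms I" "a \<in> acts I" and c: "clock e < B" by blast
 have "pos e i \<in> states I" "dep (pos e i) < B"
  using assms x c nodes_states[OF x(2)] unfolding env_ok_def by auto
 then have "finite (set_pmf (next_node I a (pos e i)))"
  using finite_kernel[of "pos e i" a] x by (simp add: kernel_def)
 then show ?thesis using x c by (simp add: env_step_def)
qed

lemma lazy_cong:
 "(\<And>i. i < narms I \<Longrightarrow> S i = S' i \<and> d i = d' i) \<Longrightarrow> lazy d m c S = lazy d' m c S'"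
proof (induction m arbitrary: c S S')
 case (Suc m)
 have p: "state_pick S = state_pick S'" unfolding state_pick_def using Suc.prems by (intro pick_cong) auto
 show ?case
 proof (cases "state_pick S'")
  case (Some i)
  then have "i < narms I" unfolding state_pick_def by (rule pick_Some)
  then have i: "S i = S' i" "d i = d' i" using Suc.prems by auto
  have "lazy d m (c + 1) (move d S i v) = lazy d' m (c + 1) (move d' S' i v)" for v
   by (rule Suc.IH) (use Suc.prems i in \<open>auto simp: move_def\<close>)
  then show ?thesis using Some p i by (simp add: choice_def)
 qed (use p in simp)
qed simp

lemma state_ok_cong:
 "(\<And>i. i < narms I \<Longrightarrow> S i = S' i \<and> d i = d' i) \<Longrightarrow> state_ok d S = state_ok d' S'"
 unfolding state_ok_def by (simp cong: conj_cong)

end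

section \<open>Correctness of sampling and scheduling\<close>

context encoded
begin

lemma small_caps: "B + 1 \<le> cap" "N \<le> cap" "3 \<le> cap" "K \<le> cap"
proof -
 have "1 \<le> N" using horizon_less by simp
 then show "B + 1 \<le> cap" "N \<le> cap" "3 \<le> cap" "K \<le> cap" using base_ge caps(5) by linarith+
qed

text \<open>After \<open>j\<close> iterations the last \<open>j\<close> slots have been scanned, so
  array 34 holds the first pull from slot \<open>B + 1 - j\<close> on, with \<open>B + 1\<close> as
  the value for none.\<close>

lemma first_time:
 assumes T: "T 1 0 = cap" "T 2 0 = limit" "T 34 i = B + 1" and m: "ev T em = m" "m \<le> B" and u: "u < N"
  and e: "\<And>V. (\<And>j. j \<noteq> 27 \<Longrightarrow> j \<noteq> 34 \<Longrightarrow> V j = T j) \<Longrightarrow> ev V ei = i \<and> ev V er = r \<and> ev V eu = u"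
 shows "\<exists>T'. runs (first_time ei er em eu) T T' \<and> T' 34 = (T 34)(i := adv (decode T r) (B + 1 - m) u)"
proof -
 let ?d = "decode T r"
 have "\<exists>T'. runs (first_time ei er em eu) T T' \<and> T' 34 = (T 34)(i := adv ?d (B + 1 - m) u) \<and> T' 27 0 = m"
  unfolding first_time_def
 proof (rule runs_For[where Inv = "\<lambda>j V. V 34 = (T 34)(i := adv ?d (B + 1 - j) u)"])
  show "m \<le> T 2 0" "m \<le> T 1 0" using m(2) T limits(3) small_caps by auto
  show "(put T 27 0 0) 34 = (T 34)(i := adv ?d (B + 1 - 0) u)" using T(3) by (simp add: adv_end fun_eq_iff)
  let ?body = "Cnd (dec_at er (var 27) eu) (Asg 34 ei (eB .- var 27)) Nop"
  fix j V assume j: "j < m" "V 27 0 = j" and inv: "V 34 = (T 34)(i := adv ?d (B + 1 - j) u)"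
   and fr: "\<And>k. k \<notin> mods (For 27 em ?body) \<Longrightarrow> V k = T k"
  have ev: "ev V ei = i" "ev V er = r" "ev V eu = u" using e[of V] fr by auto
  have x: "ev V (dec_at er (var 27) eu) = T 10 ((r * B + j) * N + u)" using ev j fr[of 10] by (simp add: ev_dec_at)
  have jB: "j < B" using j m by simp
  have dx: "?d (B - j) u = (case T 10 ((r * B + j) * N + u) of 0 \<Rightarrow> None | Suc a \<Rightarrow> Some a)"
   using jB u by (auto simp: decode_def)
  have S: "B + 1 - Suc j = B - j" "B + 1 - j = Suc (B - j)" using jB by auto
  show "\<exists>V'. runs ?body V V' \<and> (put V' 27 0 (Suc j)) 34 = (T 34)(i := adv ?d (B + 1 - Suc j) u)"
  proof (cases "T 10 ((r * B + j) * N + u)")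
   case 0
   then have "adv ?d (B - j) u = adv ?d (Suc (B - j)) u" using dx by (intro adv_later) simp
   then show ?thesis using runs_Cnd_False[OF runs_Nop] x 0 inv unfolding S by (intro exI[of _ V]) (simp add: fun_eq_iff)
  next
   case (Suc a)
   then have "adv ?d (B - j) u = B - j" using dx by (intro adv_now) auto
   moreover have "runs (Asg 34 ei (eB .- var 27)) V (put V 34 i (B - j))"
    using ev j fr[of 1] T small_caps by (intro runs_Asg) (auto simp: lk)
   ultimately show ?thesis using runs_Cnd_True x Suc inv unfolding S by (intro exI[of _ "put V 34 i (B - j)"]) (simp add: fun_eq_iff)
  qed
 qed (use m in auto)
 then show ?thesis by blast
qed

definition sampled :: "(nat \<Rightarrow> nat \<Rightarrow> nat) \<Rightarrow> nat \<Rightarrow> (nat \<Rightarrow> nat \<times> nat) \<Rightarrow> (nat \<Rightarrow> nat \<Rightarrow> nat) \<Rightarrow> bool" where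
 "sampled S m w T \<longleftrightarrow> (\<forall>k. k \<notin> {26, 27, 30, 31, 32, 34} \<longrightarrow> T k = S k) \<and> T 26 0 = m \<and>
  (\<forall>i<m. T 31 i = snd (w i) \<and> T 32 i = root I i \<and>
    T 34 i = (if fst (w i) = 0 then adv (decode S (snd (w i))) 1 (root I i) else B + 1))"

lemma sample_step:
 assumes S: "S 1 0 = cap" "S 2 0 = limit" and m: "m < narms I" and s: "sampled S m w T"
 shows "\<exists>h. (\<forall>e. map_pmf (\<lambda>p. (incr 26 (fst p), snd p)) (sem sample_body (T, e))
   = map_pmf (\<lambda>x. (h x, e)) (pair_pmf (uniform_below 3) (uniform_below num_rounds))) \<and> (\<forall>x. sampled S (Suc m) (w(m := x)) (h x))"
proof -
 let ?rest = "Asg 32 (var 26) (root_at (var 26)) ;; Asg 34 (var 26) (eB .+ Num 1)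
  ;; first_play"
 have T: "T 1 0 = cap" "T 2 0 = limit" "T 26 0 = m" "T 10 = S 10" using s S unfolding sampled_def by auto
 have rest: "\<exists>V. runs ?rest (put (put T 30 0 (fst x)) 31 m (snd x)) V \<and> sampled S (Suc m) (w(m := x)) (put V 26 0 (Suc m))" for x
 proof -
  define s0 where "s0 = put (put T 30 0 (fst x)) 31 m (snd x)"
  define s1 where "s1 = put s0 32 m (root I m)"
  define s2 where "s2 = put s1 34 m (B + 1)"
  have r1: "runs (Asg 32 (var 26) (root_at (var 26))) s0 s1"
   unfolding s1_def using T m root_less[OF m] small_caps by (intro runs_Asg) (auto simp: s0_def ev_root_at)
  have r2: "runs (Asg 34 (var 26) (eB .+ Num 1)) s1 s2"
   unfolding s2_def using T small_caps by (intro runs_Asg) (auto simp: s0_def s1_def lk)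
  have s2: "s2 1 0 = cap" "s2 2 0 = limit" "s2 26 0 = m" "s2 30 0 = fst x" "s2 31 = (T 31)(m := snd x)" "s2 32 = (T 32)(m := root I m)"
   "s2 34 = (T 34)(m := B + 1)" "\<And>j. j \<notin> {30, 31, 32, 34} \<Longrightarrow> s2 j = T j"
   using T by (auto simp: s2_def s1_def s0_def)
  have dc: "decode s2 = decode S" using s2(8)[of 10] T(4) by (intro decode_same) simp
  have "\<exists>V. runs (first_play) s2 V \<and>
    V 34 = (s2 34)(m := if fst x = 0 then adv (decode S (snd x)) 1 (root I m) else B + 1)"
  proof (cases "fst x = 0")
   case True
   have "\<exists>V. runs (first_time (var 26) (Arr 31 (var 26)) eB (Arr 32 (var 26))) s2 V \<and>
     V 34 = (s2 34)(m := adv (decode s2 (snd x)) (B + 1 - B) (root I m))"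
    by (rule first_time) (use s2 root_less[OF m] in \<open>auto simp: lk\<close>)
   then obtain V where "runs (first_time (var 26) (Arr 31 (var 26)) eB (Arr 32 (var 26))) s2 V"
    "V 34 = (s2 34)(m := adv (decode S (snd x)) 1 (root I m))" unfolding dc by auto
   then show ?thesis using True s2(4) by (intro exI[of _ V] conjI runs_Cnd_False) simp_all
  next
   case False
   then show ?thesis using runs_Cnd_True[OF runs_Nop] s2(4,7) by (intro exI[of _ s2]) auto
  qed
  then obtain V where r3: "runs (first_play) s2 V"
   and V34: "V 34 = (s2 34)(m := if fst x = 0 then adv (decode S (snd x)) 1 (root I m) else B + 1)" by blast
  have fr: "V j = s2 j" if "j \<notin> {27, 34}" for j using runs_frame[OF r3, of j] that by (simp add: first_time_def)
  have "sampled S (Suc m) (w(m := x)) (put V 26 0 (Suc m))"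
   using s V34 fr s2 unfolding sampled_def by (auto simp: less_Suc_eq)
  then show ?thesis using runs_Then[OF r1 runs_Then[OF r2 r3]] unfolding s0_def by blast
 qed
 then obtain g where g: "\<And>x. runs ?rest (put (put T 30 0 (fst x)) 31 m (snd x)) (g x)"
  "\<And>x. sampled S (Suc m) (w(m := x)) (put (g x) 26 0 (Suc m))" by metis
 have inc: "incr 26 (g x) = put (g x) 26 0 (Suc m)" for x
 proof -
  have "g x 26 0 = m" "g x 1 0 = cap" using runs_frame[OF g(1)[of x], of 26] runs_frame[OF g(1)[of x], of 1] T
   by (auto simp: first_time_def)
  moreover have "Suc m \<le> cap" using m limits by linarith
  ultimately show ?thesis by (simp add: asg_def)
 qed
 have "map_pmf (\<lambda>p. (incr 26 (fst p), snd p)) (sem sample_body (T, e))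
   = map_pmf (\<lambda>x. (put (g x) 26 0 (Suc m), e)) (pair_pmf (uniform_below 3) (uniform_below num_rounds))" for e
 proof -
  have a: "min (ev T (Num 3)) (T 1 0) = 3" "ev T (Num 0) = 0" using T small_caps by simp_all
  have b: "min (ev (put T 30 0 a) rounds_expr) ((put T 30 0 a) 1 0) = num_rounds" "ev (put T 30 0 a) (var 26) = m" for a
   using T caps(6) by (simp_all add: ev_scale)
  have c: "sem ?rest (put (put T 30 0 a) 31 m b, e) = return_pmf (g (a, b), e)" for a b
   using g(1)[of "(a, b)"] unfolding runs_def fst_conv snd_conv by blast
  have "sem sample_body (T, e) = bind_pmf (uniform_below 3) (\<lambda>a. bind_pmf (uniform_below num_rounds) (\<lambda>b. return_pmf (g (a, b), e)))"
   by (simp only: sem_Rnd_Then a b c)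
  then show ?thesis by (simp only: pair_pmf_def map_bind_pmf map_return_pmf fst_conv snd_conv inc)
 qed
 then show ?thesis using g(2) by (intro exI[of _ "\<lambda>x. put (g x) 26 0 (Suc m)"] conjI allI)
qed

text \<open>The product law is generated one arm at a time. The memory afterwards is a function
  \<open>h\<close> of the seeds, so the rest of the run can be analysed for fixed seeds.\<close>

lemma sample:
 assumes S: "S 1 0 = cap" "S 2 0 = limit"
 shows "\<exists>h. (\<forall>e. sem sample (S, e) = map_pmf (\<lambda>w. (h w, e)) (seeds num_rounds)) \<and> (\<forall>w\<in>set_pmf (seeds num_rounds). sampled S (narms I) w (h w))"
proof -
 let ?p = "pair_pmf (uniform_below 3) (uniform_below num_rounds)"
 let ?P = "\<lambda>m. Pi_pmf {..<m} (0, 0) (\<lambda>_. ?p)"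
 let ?f = "\<lambda>p. map_pmf (\<lambda>p. (incr 26 (fst p), snd p)) (sem sample_body p)"
 have "m \<le> narms I \<Longrightarrow> \<exists>h. (\<forall>e. iter m ?f (put S 26 0 0, e) = map_pmf (\<lambda>w. (h w, e)) (?P m)) \<and> (\<forall>w\<in>set_pmf (?P m). sampled S m w (h w))" for m
 proof (induction m)
  case 0
  show ?case by (intro exI[of _ "\<lambda>_. put S 26 0 0"]) (simp add: sampled_def)
 next
  case (Suc m)
  then obtain h where h: "\<forall>e. iter m ?f (put S 26 0 0, e) = map_pmf (\<lambda>w. (h w, e)) (?P m)" "\<forall>w\<in>set_pmf (?P m). sampled S m w (h w)" by auto
  have step: "\<forall>w\<in>set_pmf (?P m). \<exists>g. (\<forall>e. ?f (h w, e) = map_pmf (\<lambda>x. (g x, e)) ?p) \<and> (\<forall>x. sampled S (Suc m) (w(m := x)) (g x))"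
  proof
   fix w assume "w \<in> set_pmf (?P m)"
   then show "\<exists>g. (\<forall>e. ?f (h w, e) = map_pmf (\<lambda>x. (g x, e)) ?p) \<and> (\<forall>x. sampled S (Suc m) (w(m := x)) (g x))"
    using h(2) Suc.prems S by (intro sample_step) auto
  qed
  from bchoice[OF step] obtain g where g: "\<And>w e. w \<in> set_pmf (?P m) \<Longrightarrow> ?f (h w, e) = map_pmf (\<lambda>x. (g w x, e)) ?p"
   "\<And>w x. w \<in> set_pmf (?P m) \<Longrightarrow> sampled S (Suc m) (w(m := x)) (g w x)" by blast
  have PS: "?P (Suc m) = bind_pmf (?P m) (\<lambda>w. map_pmf (\<lambda>x. w(m := x)) ?p)"
  proof -
   have "?P (Suc m) = bind_pmf ?p (\<lambda>x. bind_pmf (?P m) (\<lambda>w. return_pmf (w(m := x))))"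
    unfolding lessThan_Suc by (rule Pi_pmf_insert') auto
   then show ?thesis unfolding map_pmf_def by (simp add: bind_commute_pmf[of ?p])
  qed
  \<comment> \<open>The seeds of the first \<open>m\<close> arms are recovered by resetting
    coordinate \<open>m\<close> to the default value that the smaller product law has there.\<close>
  define h' where "h' w = g (w(m := (0, 0))) (w m)" for w
  have w0: "w m = (0, 0)" if "w \<in> set_pmf (?P m)" for w
   using that by (auto simp: set_Pi_pmf PiE_dflt_def)
  have upd: "h' (w(m := x)) = g w x" if "w \<in> set_pmf (?P m)" for w x
   using w0[OF that] by (simp add: h'_def fun_upd_idem)
  have "iter (Suc m) ?f (put S 26 0 0, e) = map_pmf (\<lambda>w. (h' w, e)) (?P (Suc m))" for e
  proof -
   have "iter (Suc m) ?f (put S 26 0 0, e) = bind_pmf (?P m) (\<lambda>w. ?f (h w, e))"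
    unfolding iter_Suc' using h(1) by (simp add: bind_map_pmf)
   also have "\<dots> = bind_pmf (?P m) (\<lambda>w. map_pmf (\<lambda>w. (h' w, e)) (map_pmf (\<lambda>x. w(m := x)) ?p))"
    using g(1) upd by (intro bind_pmf_cong) (simp_all add: map_pmf_comp)
   finally show ?thesis unfolding PS map_bind_pmf .
  qed
  moreover have "sampled S (Suc m) w (h' w)" if "w \<in> set_pmf (?P (Suc m))" for w
   using that g(2) upd unfolding PS by auto
  ultimately show ?case by blast
 qed
 from this[of "narms I"] obtain h where h: "\<And>e. iter (narms I) ?f (put S 26 0 0, e) = map_pmf (\<lambda>w. (h w, e)) (?P (narms I))"
  "\<forall>w\<in>set_pmf (?P (narms I)). sampled S (narms I) w (h w)" by blast
 have "sem sample (S, e) = iter (narms I) ?f (put S 26 0 0, e)" for e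
 proof -
  have "min (ev S en) (S 2 0) = narms I" unfolding ev_sizes S(2) using limits(6) by simp
  then show ?thesis unfolding sample_def sem.simps fst_conv snd_conv by (simp only: asg_def ev.simps min_0L)
 qed
 then show ?thesis using h unfolding seeds_def by auto
qed

lemma key:
 assumes "T 1 0 = cap" "T 26 0 = i"
 shows "runs key T (put T 37 0 (prio B (T 34 i) (T 33 i)))"
proof (cases "T 34 i \<le> B")
 case True
 have inner: "runs (Cnd (Arr 34 (var 26) .- Num 2 .* Arr 33 (var 26)) (assign 37 (Arr 34 (var 26))) (assign 37 (Num 0))) T
  (put T 37 0 (prio B (T 34 i) (T 33 i)))"
 proof (cases "T 34 i \<le> 2 * T 33 i")
  case True
  then show ?thesis using \<open>T 34 i \<le> B\<close> assms by (intro runs_Cnd_False runs_Asg) (auto simp: prio_def)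
 next
  case False
  then show ?thesis using True assms small_caps by (intro runs_Cnd_True runs_Asg) (auto simp: prio_def)
 qed
 show ?thesis unfolding key_def by (rule runs_Cnd_True[OF inner]) (use True assms in \<open>simp add: lk\<close>)
next
 case False
 then show ?thesis unfolding key_def using assms small_caps by (intro runs_Cnd_False runs_Asg) (auto simp: lk prio_def)
qed

abbreviation keys :: "(nat \<Rightarrow> nat \<Rightarrow> nat) \<Rightarrow> nat \<Rightarrow> nat" where
 "keys T i \<equiv> prio B (T 34 i) (T 33 i)"

lemma select:
 assumes T: "T 1 0 = cap" "T 2 0 = limit"
 shows "\<exists>V. runs select T V \<and> (case pick (narms I) B (keys T) of None \<Rightarrow> V 35 0 = B + 1 | Some j \<Rightarrow> V 35 0 = keys T j \<and> V 36 0 = j)"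
proof -
 define s1 where "s1 = put T 35 0 (B + 1)"
 have r1: "runs (assign 35 (eB .+ Num 1)) T s1" unfolding s1_def using T small_caps by (intro runs_Asg) (auto simp: lk)
 let ?body = "key ;; Cnd (var 35 .- var 37) (assign 35 (var 37) ;; assign 36 (var 26)) Nop"
 define Inv :: "nat \<Rightarrow> (nat \<Rightarrow> nat \<Rightarrow> nat) \<Rightarrow> bool" where
  "Inv m V \<longleftrightarrow> (case pick m B (keys T) of None \<Rightarrow> V 35 0 = B + 1 | Some j \<Rightarrow> V 35 0 = keys T j \<and> V 36 0 = j)" for m V
 have "\<exists>V. runs (For 26 en ?body) s1 V \<and> Inv (narms I) V \<and> V 26 0 = narms I"
 proof (rule runs_For)
  show "ev s1 en = narms I" by (rule ev_sizes)
  show "narms I \<le> s1 2 0" "narms I \<le> s1 1 0" using limits T by (auto simp: s1_def)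
  have "pick 0 B (keys T) = None" by (simp add: pick_None)
  then show "Inv 0 (put s1 26 0 0)" unfolding Inv_def by (simp add: s1_def)
  fix i V assume i: "i < narms I" "V 26 0 = i" and inv: "Inv i V" and fr: "\<And>j. j \<notin> mods (For 26 en ?body) \<Longrightarrow> V j = s1 j"
  have eqs: "V j = T j" if "j \<notin> {26, 35, 36, 37}" for j using fr[of j] that by (simp add: key_def s1_def)
  define s2 where "s2 = put V 37 0 (keys T i)"
  have r2: "runs key V s2" using key[of V i] eqs T i by (simp add: s2_def)
  have prio_le: "keys T i \<le> B + 1" by (simp add: prio_def)
  show "\<exists>V'. runs ?body V V' \<and> Inv (Suc i) (put V' 26 0 (Suc i))"
  proof (cases "keys T i < V 35 0")
   case True
   define s3 where "s3 = put (put s2 35 0 (keys T i)) 36 0 i"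
   have a: "runs (assign 35 (var 37)) s2 (put s2 35 0 (keys T i))"
    using prio_le small_caps(1) eqs[of 1] T by (intro runs_Asg) (auto simp: s2_def)
   have b: "runs (assign 36 (var 26)) (put s2 35 0 (keys T i)) s3" unfolding s3_def
    using eqs[of 1] T i limits(6,9) by (intro runs_Asg) (auto simp: s2_def)
   have "runs ?body V s3"
    by (rule runs_Then[OF r2 runs_Cnd_True[OF runs_Then[OF a b]]]) (use True in \<open>simp add: s2_def\<close>)
   moreover have "Inv (Suc i) (put s3 26 0 (Suc i))"
    using inv True unfolding Inv_def pick_Suc by (auto simp: s3_def split: option.splits)
   ultimately show ?thesis by blast
  next
   case False
   then have "runs ?body V s2" by (intro runs_Then[OF r2 runs_Cnd_False[OF runs_Nop]]) (simp add: s2_def)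
   moreover have "Inv (Suc i) (put s2 26 0 (Suc i))"
    using inv False unfolding Inv_def pick_Suc by (auto simp: s2_def split: option.splits)
   ultimately show ?thesis by blast
  qed
 qed (auto simp: key_def)
 then obtain V where "runs (For 26 en ?body) s1 V" "Inv (narms I) V" by blast
 then show ?thesis using runs_Then[OF r1] unfolding select_def Inv_def by blast
qed

lemma sem_Pul_Then:
 "sem (Then (Pul k a i x) s) (S, e) = bind_pmf (env_step I B (Some (ev S i, ev S x)) e)
  (\<lambda>e'. sem s (put S k (ev S a) (min (if ev S i < narms I then pos e' (ev S i) else 0) (S 1 0)), e'))"
 by (simp add: bind_map_pmf cong: if_cong)

lemma pull:
 assumes T: "T 1 0 = cap" "T 2 0 = limit" and i: "T 36 0 = i" "i < narms I"
  and t: "T 34 i = t" "1 \<le> t" "t \<le> B" and u: "T 32 i = u" "u < N" "dep u < B" and a: "decode T (T 31 i) t u = Some a" "a < K"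
  and e: "clock e < B" "pos e i = u" and c: "T 33 i < B"
 shows "\<exists>h. sem pull (T, e) = map_pmf (\<lambda>v. (h v, \<lparr>pos = (pos e)(i := v), clock = clock e + 1, earned = earned e + rew I a u\<rparr>)) (kernel a u) \<and>
  (\<forall>v\<in>set_pmf (kernel a u). h v 32 = (T 32)(i := v) \<and> h v 33 = (T 33)(i := Suc (T 33 i)) \<and>
   h v 34 = (T 34)(i := adv (decode T (T 31 i)) (Suc t) v) \<and> (\<forall>j. j \<notin> {27, 32, 33, 34, 38} \<longrightarrow> h v j = T j))"
proof -
 let ?rest = "Asg 33 (var 36) (Arr 33 (var 36) .+ Num 1) ;; assign 38 (eB .- Arr 34 (var 36)) ;; Asg 34 (var 36) (eB .+ Num 1)
  ;; first_time (var 36) (Arr 31 (var 36)) (var 38) (Arr 32 (var 36))"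
 have st: "u \<in> states I" "a \<in> acts I" using u a states acts by auto
 have rest: "\<exists>V. runs ?rest (put T 32 i v) V \<and> (V 32 = (T 32)(i := v) \<and> V 33 = (T 33)(i := Suc (T 33 i)) \<and>
   V 34 = (T 34)(i := adv (decode T (T 31 i)) (Suc t) v) \<and> (\<forall>j. j \<notin> {27, 32, 33, 34, 38} \<longrightarrow> V j = T j))" if v: "v < N" for v
 proof -
  define s0 where "s0 = put T 32 i v"
  define s1 where "s1 = put s0 33 i (Suc (T 33 i))"
  define s2 where "s2 = put s1 38 0 (B - t)"
  define s3 where "s3 = put s2 34 i (B + 1)"
  have r1: "runs (Asg 33 (var 36) (Arr 33 (var 36) .+ Num 1)) s0 s1"
   unfolding s1_def using T i c small_caps by (intro runs_Asg) (auto simp: s0_def)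
  have r2: "runs (assign 38 (eB .- Arr 34 (var 36))) s1 s2"
   unfolding s2_def using T i t small_caps by (intro runs_Asg) (auto simp: s0_def s1_def lk)
  have r3: "runs (Asg 34 (var 36) (eB .+ Num 1)) s2 s3"
   unfolding s3_def using T i small_caps by (intro runs_Asg) (auto simp: s0_def s1_def s2_def lk)
  have s3: "s3 1 0 = cap" "s3 2 0 = limit" "s3 36 0 = i" "s3 38 0 = B - t" "s3 31 = T 31" "s3 32 = (T 32)(i := v)"
   "s3 33 = (T 33)(i := Suc (T 33 i))" "s3 34 = (T 34)(i := B + 1)" "\<And>j. j \<notin> {32, 33, 34, 38} \<Longrightarrow> s3 j = T j"
   using T i by (auto simp: s3_def s2_def s1_def s0_def)
  have dc: "decode s3 = decode T" using s3(9)[of 10] by (intro decode_same) simp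
  have "\<exists>V. runs (first_time (var 36) (Arr 31 (var 36)) (var 38) (Arr 32 (var 36))) s3 V \<and>
    V 34 = (s3 34)(i := adv (decode s3 (T 31 i)) (B + 1 - (B - t)) v)"
   by (rule first_time) (use s3 v in auto)
  then obtain V where r4: "runs (first_time (var 36) (Arr 31 (var 36)) (var 38) (Arr 32 (var 36))) s3 V"
   and V: "V 34 = (T 34)(i := adv (decode T (T 31 i)) (Suc t) v)"
   using t unfolding dc s3(8) by (auto simp: Suc_diff_le)
  have fr: "V j = s3 j" if "j \<notin> {27, 34}" for j using runs_frame[OF r4, of j] that by (simp add: first_time_def)
  have "runs ?rest s0 V" by (rule runs_Then[OF r1 runs_Then[OF r2 runs_Then[OF r3 r4]]])
  then show ?thesis using V fr s3 unfolding s0_def by (intro exI[of _ V]) auto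
 qed
 have vN: "v < N" if "v \<in> set_pmf (kernel a u)" for v using set_kernel[OF st(1) that] states by simp
 have "\<forall>v\<in>set_pmf (kernel a u). \<exists>V. runs ?rest (put T 32 i v) V \<and> (V 32 = (T 32)(i := v) \<and> V 33 = (T 33)(i := Suc (T 33 i)) \<and>
   V 34 = (T 34)(i := adv (decode T (T 31 i)) (Suc t) v) \<and> (\<forall>j. j \<notin> {27, 32, 33, 34, 38} \<longrightarrow> V j = T j))"
  using rest vN by blast
 from bchoice[OF this] obtain h where h: "\<And>v. v \<in> set_pmf (kernel a u) \<Longrightarrow> runs ?rest (put T 32 i v) (h v)"
  "\<And>v. v \<in> set_pmf (kernel a u) \<Longrightarrow> h v 32 = (T 32)(i := v) \<and> h v 33 = (T 33)(i := Suc (T 33 i)) \<and>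
   h v 34 = (T 34)(i := adv (decode T (T 31 i)) (Suc t) v) \<and> (\<forall>j. j \<notin> {27, 32, 33, 34, 38} \<longrightarrow> h v j = T j)" by blast
 have x: "ev T (dec_at (Arr 31 (var 36)) (eB .- Arr 34 (var 36)) (Arr 32 (var 36)) .- Num 1) = a"
 proof -
  have "T 10 ((T 31 i * B + (B - t)) * N + u) = Suc a"
   using a(1) t u by (auto simp: decode_def split: nat.splits)
  then show ?thesis using i t u by (simp add: ev_dec_at lk)
 qed
 let ?e = "\<lambda>v. \<lparr>pos = (pos e)(i := v), clock = clock e + 1, earned = earned e + rew I a u\<rparr>"
 have step: "env_step I B (Some (i, a)) e = map_pmf ?e (kernel a u)"
  using e i st u by (simp add: env_step_def kernel_def)
 have vi: "ev T (var 36) = i" using i by simp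
 have "sem pull (T, e) = bind_pmf (map_pmf ?e (kernel a u)) (\<lambda>e'. sem ?rest (put T 32 i (min (if i < narms I then pos e' i else 0) (T 1 0)), e'))"
  unfolding pull_def sem_Pul_Then vi x step ..
 also have "\<dots> = bind_pmf (kernel a u) (\<lambda>v. return_pmf (h v, ?e v))"
  unfolding bind_map_pmf
 proof (rule bind_pmf_cong[OF refl])
  fix v assume v: "v \<in> set_pmf (kernel a u)"
  have "min (if i < narms I then pos (?e v) i else 0) (T 1 0) = v" using i vN[OF v] T small_caps by simp
  then show "sem ?rest (put T 32 i (min (if i < narms I then pos (?e v) i else 0) (T 1 0)), ?e v) = return_pmf (h v, ?e v)"
   using h(1)[OF v] unfolding runs_def by (simp only:)
 qed
 finally show ?thesis using h(2) unfolding map_pmf_def by blast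
qed

definition arm_state :: "(nat \<Rightarrow> nat \<Rightarrow> nat) \<Rightarrow> nat \<Rightarrow> nat \<times> nat \<times> nat" where
 "arm_state T i = (T 32 i, T 34 i, T 33 i)"

abbreviation plan :: "(nat \<Rightarrow> nat \<Rightarrow> nat) \<Rightarrow> nat \<Rightarrow> nat \<Rightarrow> nat \<Rightarrow> nat option" where
 "plan T i \<equiv> decode T (T 31 i)"

text \<open>The simulation relation between memory and environment. Bounding the play counts by the
  clock keeps the counters in array 33 from being clamped.\<close>

definition tracks :: "(nat \<Rightarrow> nat \<Rightarrow> nat) \<Rightarrow> nat env \<Rightarrow> bool" where
 "tracks T e \<longleftrightarrow> T 1 0 = cap \<and> T 2 0 = limit \<and> state_ok (plan T) (arm_state T) \<and> (\<forall>i<narms I. table (plan T i)) \<and>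
  (\<forall>i<narms I. pos e i = T 32 i \<and> T 33 i \<le> clock e)"

lemma same_state:
 assumes "\<And>j. j \<in> {1, 2, 10, 31, 32, 33, 34} \<Longrightarrow> T' j = T j"
 shows "arm_state T' = arm_state T" "plan T' = plan T" "tracks T' e = tracks T e"
proof -
 show a: "arm_state T' = arm_state T" using assms by (simp add: arm_state_def fun_eq_iff)
 show p: "plan T' = plan T" using assms decode_same[of T' T] by (simp add: fun_eq_iff)
 then have "plan T' i = plan T i" for i by (rule fun_cong)
 then show "tracks T' e = tracks T e" unfolding tracks_def a p using assms by simp
qed

abbreviation round_body :: stm where
 "round_body \<equiv> select ;; Cnd (eB .+ Num 1 .- var 35) pull Nop"

abbreviation schedule_round :: "(nat \<Rightarrow> nat \<Rightarrow> nat) \<times> nat env \<Rightarrow> ((nat \<Rightarrow> nat \<Rightarrow> nat) \<times> nat env) pmf" where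
 "schedule_round \<equiv> \<lambda>p. map_pmf (\<lambda>p. (incr 28 (fst p), snd p)) (sem round_body p)"

lemma incr_28: "j \<noteq> 28 \<Longrightarrow> incr 28 T j = T j"
 by (simp add: asg_def)

lemma finite_rounds: "env_ok (snd p) \<Longrightarrow> finite (set_pmf (iter m schedule_round p))"
proof (rule finite_iter[of env_ok])
 have Ok: "\<And>e x e'. env_ok e \<Longrightarrow> e' \<in> set_pmf (env_step I B x e) \<Longrightarrow> env_ok e'" using env_ok_step by blast
 fix q :: "(nat \<Rightarrow> nat \<Rightarrow> nat) \<times> nat env" assume q: "env_ok (snd q)"
 have "env_ok (snd q')" if "q' \<in> set_pmf (sem round_body q)" for q'
  by (rule sem_invariant[of env_ok, OF Ok that q])
 then show "finite (set_pmf (schedule_round q)) \<and> (\<forall>q'\<in>set_pmf (schedule_round q). env_ok (snd q'))"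
  using finite_sem[of env_ok q round_body, OF Ok finite_env_step q] by auto
qed

lemma rounds_late:
 assumes "B \<le> clock e"
 shows "p' \<in> set_pmf (iter m schedule_round (T, e)) \<Longrightarrow> snd p' = e"
proof (induction m arbitrary: T)
 case (Suc m)
 then obtain q where q: "q \<in> set_pmf (sem round_body (T, e))" "p' \<in> set_pmf (iter m schedule_round (incr 28 (fst q), snd q))"
  by auto
 have "snd q = e"
  by (rule sem_invariant[of "\<lambda>e'. e' = e", OF _ q(1)]) (use assms in \<open>auto simp: env_step_def\<close>)
 then show ?case using Suc.IH q(2) by simp
qed simp

text \<open>At the horizon the environment freezes while the program goes on, so memory and
  environment drift apart. From then on the environment earns nothing and the lazy value is 0, so
  \<open>tracks\<close> is required only before.\<close>

lemma rounds_reward: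
 assumes "env_ok e" "tracks T e \<or> B \<le> clock e"
 shows "expect (iter m schedule_round (T, e)) (\<lambda>p. earned (snd p)) = earned e + lazy (plan T) m (clock e) (arm_state T)"
 using assms
proof (induction m arbitrary: T e)
 case (Suc m)
 let ?E = expect
 show ?case
 proof (cases "B \<le> clock e")
  case True
  have "?E (iter (Suc m) schedule_round (T, e)) (\<lambda>p. earned (snd p)) = ?E (iter (Suc m) schedule_round (T, e)) (\<lambda>_. earned e)"
  proof (rule expectation_cong_pmf)
   fix p' assume "p' \<in> set_pmf (iter (Suc m) schedule_round (T, e))"
   then have "snd p' = e" by (rule rounds_late[OF True])
   then show "earned (snd p') = earned e" by simp
  qed
  then show ?thesis using lazy_late[OF True] by simp
 next
  case False
  then have tr: "tracks T e" and clk: "clock e < B" using Suc.prems by auto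
  have T: "T 1 0 = cap" "T 2 0 = limit" and ok: "state_ok (plan T) (arm_state T)"
   and tab: "\<And>i. i < narms I \<Longrightarrow> table (plan T i)" and p: "\<And>i. i < narms I \<Longrightarrow> pos e i = T 32 i \<and> T 33 i \<le> clock e"
   using tr unfolding tracks_def by auto
  obtain V where r1: "runs select T V"
   and sel: "case pick (narms I) B (keys T) of None \<Rightarrow> V 35 0 = B + 1 | Some j \<Rightarrow> V 35 0 = keys T j \<and> V 36 0 = j"
   using select[of T] T by blast
  have pk: "state_pick (arm_state T) = pick (narms I) B (keys T)" by (simp add: state_pick_def arm_state_def)
  have Vfr: "V j = T j" if "j \<notin> {26, 35, 36, 37}" for j
   using runs_frame[OF r1, of j] that by (simp add: select_def key_def)
  have body: "sem round_body (T, e) = sem (Cnd (eB .+ Num 1 .- var 35) pull Nop) (V, e)"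
   using r1 by (simp add: runs_def bind_return_pmf del: sem.simps(6))
  show ?thesis
  proof (cases "state_pick (arm_state T)")
   case None
   then have "V 35 0 = B + 1" using sel pk by simp
   then have "sem round_body (T, e) = return_pmf (V, e)" unfolding body by (simp add: lk)
   then have F: "schedule_round (T, e) = return_pmf (incr 28 V, e)" by simp
   have same: "incr 28 V j = T j" if "j \<in> {1, 2, 10, 31, 32, 33, 34}" for j
    using that Vfr[of j] incr_28[of j V] by auto
   have "lazy (plan T) m c (arm_state T) = 0" for c using None by (cases m) simp_all
   moreover have "?E (iter m schedule_round (incr 28 V, e)) (\<lambda>p. earned (snd p)) = earned e + lazy (plan T) m (clock e) (arm_state T)"
   proof -
    have "tracks (incr 28 V) e \<or> B \<le> clock e" using tr same_state(3)[of "incr 28 V" T e] same by blast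
    from Suc.IH[OF Suc.prems(1) this] show ?thesis
     using same_state(1,2)[of "incr 28 V" T] same by (simp only:)
   qed
   ultimately show ?thesis using None unfolding iter.simps(2) F by (simp add: bind_return_pmf)
  next
   case (Some i)
   let ?u = "T 32 i" and ?t = "T 34 i" and ?a = "choice (plan T) (arm_state T) i"
   note D = state_pick_D[OF ok Some tab]
   have i: "i < narms I" "V 35 0 = keys T i" "V 36 0 = i" using D(1) sel Some pk by auto
   have t: "?t \<le> B" "1 \<le> ?t" using D(2) ok D(1) unfolding state_ok_def by (auto simp: arm_state_def)
   have u: "?u < N" "dep ?u < B" "?u \<in> states I"
    using D(3,5) nodes_states[OF D(1)] states by (auto simp: arm_state_def)
   have "plan T i ?t ?u \<noteq> None" using ok D(1) t unfolding state_ok_def by (auto simp: arm_state_def)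
   then have a: "plan T i ?t ?u = Some ?a" "?a < K" using D(4) acts by (auto simp: choice_def arm_state_def)
   let ?k = "kernel ?a ?u" and ?e = "\<lambda>v. \<lparr>pos = (pos e)(i := v), clock = clock e + 1, earned = earned e + rew I ?a ?u\<rparr>"
   have "keys T i \<le> B" using pick_Some(2) Some pk by metis
   then have "sem round_body (T, e) = sem pull (V, e)" unfolding body using i(2) by (simp add: lk)
   moreover obtain h where h: "sem pull (V, e) = map_pmf (\<lambda>v. (h v, ?e v)) ?k"
    "\<forall>v\<in>set_pmf ?k. h v 32 = (T 32)(i := v) \<and> h v 33 = (T 33)(i := Suc (T 33 i)) \<and>
    h v 34 = (T 34)(i := adv (plan T i) (Suc ?t) v) \<and> (\<forall>j. j \<notin> {27, 32, 33, 34, 38} \<longrightarrow> h v j = V j)"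
   proof -
    have dc: "decode V = decode T" using Vfr[of 10] by (intro decode_same) simp
    have "\<exists>h. sem pull (V, e) = map_pmf (\<lambda>v. (h v, ?e v)) ?k \<and>
     (\<forall>v\<in>set_pmf ?k. h v 32 = (V 32)(i := v) \<and> h v 33 = (V 33)(i := Suc (V 33 i)) \<and>
     h v 34 = (V 34)(i := adv (decode V (V 31 i)) (Suc ?t) v) \<and> (\<forall>j. j \<notin> {27, 32, 33, 34, 38} \<longrightarrow> h v j = V j))"
     by (rule pull) (use T i t u a clk p[OF i(1)] Vfr dc in auto)
    then show ?thesis using that Vfr[of 32] Vfr[of 33] Vfr[of 34] Vfr[of 31] unfolding dc by auto
   qed
   ultimately have F: "schedule_round (T, e) = map_pmf (\<lambda>v. (incr 28 (h v), ?e v)) ?k" by (simp add: map_pmf_comp)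
   have hv: "incr 28 (h v) 32 = (T 32)(i := v)" "incr 28 (h v) 33 = (T 33)(i := Suc (T 33 i))"
    "incr 28 (h v) 34 = (T 34)(i := adv (plan T i) (Suc ?t) v)" "\<And>j. j \<in> {1, 2, 10, 31} \<Longrightarrow> incr 28 (h v) j = T j"
    if "v \<in> set_pmf ?k" for v
    using h(2) that Vfr incr_28[of _ "h v"] by auto
   have mv: "arm_state (incr 28 (h v)) = move (plan T) (arm_state T) i v" if "v \<in> set_pmf ?k" for v
    using hv[OF that] by (simp add: arm_state_def move_def fun_eq_iff)
   have pl: "plan (incr 28 (h v)) = plan T" if "v \<in> set_pmf ?k" for v
    using hv(4)[OF that, of 10] hv(4)[OF that, of 31] decode_same[of "incr 28 (h v)" T] by (simp add: fun_eq_iff)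
   have fk: "finite (set_pmf ?k)" using finite_kernel u by blast
   have eok: "env_ok (?e v)" if "v \<in> set_pmf ?k" for v
   proof -
    have "?e v \<in> set_pmf (env_step I B (Some (i, ?a)) e)"
     using that clk i(1) a acts u p[OF i(1)] by (auto simp: env_step_def kernel_def)
    then show ?thesis using env_ok_step[OF Suc.prems(1)] by blast
   qed
   have trk: "tracks (incr 28 (h v)) (?e v)" if v: "v \<in> set_pmf ?k" for v
    unfolding tracks_def
   proof (intro conjI allI impI)
    show "incr 28 (h v) 1 0 = cap" "incr 28 (h v) 2 0 = limit" using hv(4)[OF v] T by auto
    have "fst (arm_state T i) = ?u" by (simp add: arm_state_def)
    then have "state_ok (plan T) (move (plan T) (arm_state T) i v)"
     using v by (intro state_ok_move[OF ok D(1,2) tab[OF D(1)]]) simp_all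
    then show "state_ok (plan (incr 28 (h v))) (arm_state (incr 28 (h v)))" unfolding pl[OF v] mv[OF v] .
    fix j assume j: "j < narms I"
    show "table (plan (incr 28 (h v)) j)" using tab[OF j] fun_cong[OF pl[OF v], of j] by simp
    show "pos (?e v) j = incr 28 (h v) 32 j" "incr 28 (h v) 33 j \<le> clock (?e v)"
     using hv[OF v] p[OF j] by (auto simp: le_SucI)
   qed
   have "?E (iter (Suc m) schedule_round (T, e)) (\<lambda>p. earned (snd p))
     = ?E ?k (\<lambda>v. ?E (iter m schedule_round (incr 28 (h v), ?e v)) (\<lambda>p. earned (snd p)))"
    unfolding iter.simps(2) F bind_map_pmf
    using fk finite_rounds eok by (intro expectation_bind_finite) auto
   also have "\<dots> = ?E ?k (\<lambda>v. (earned e + rew I ?a ?u) + lazy (plan T) m (clock e + 1) (move (plan T) (arm_state T) i v))"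
   proof (rule expectation_cong_pmf)
    fix v assume v: "v \<in> set_pmf ?k"
    have "?E (iter m schedule_round (incr 28 (h v), ?e v)) (\<lambda>p. earned (snd p))
     = earned (?e v) + lazy (plan (incr 28 (h v))) m (clock (?e v)) (arm_state (incr 28 (h v)))"
     by (rule Suc.IH) (use eok[OF v] trk[OF v] in auto)
    then show "?E (iter m schedule_round (incr 28 (h v), ?e v)) (\<lambda>p. earned (snd p))
     = (earned e + rew I ?a ?u) + lazy (plan T) m (clock e + 1) (move (plan T) (arm_state T) i v)"
     unfolding pl[OF v] mv[OF v] by simp
   qed
   also have "\<dots> = (earned e + rew I ?a ?u) + ?E ?k (\<lambda>v. lazy (plan T) m (clock e + 1) (move (plan T) (arm_state T) i v))"
    using fk by simp
   also have "\<dots> = earned e + lazy (plan T) (Suc m) (clock e) (arm_state T)"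
    using Some clk by (simp add: arm_state_def)
   finally show ?thesis .
  qed
 qed
qed simp

theorem program_reward:
 assumes S: "S 1 0 = cap" "S 2 0 = limit" "\<And>k i. 2 < k \<Longrightarrow> k < 61 \<Longrightarrow> S k i = 0"
  and pos: "free_value > 0" and B: "B \<ge> 1" and feas: "PolyLP_feasible I B x s"
 shows "expect (sem bandit_program (S, init_env I)) (\<lambda>p. earned (snd p)) \<ge> 4/27 * PolyLP_objective I B x"
proof -
 let ?E = expect and ?e = "init_env I"
 obtain T q where r: "runs dual S T" and q: "dual_run (free_value / step_scale) num_rounds q (decode T)"
  using dual[OF _ _ _ B, of S] S by blast
 have T: "T 1 0 = cap" "T 2 0 = limit" "T 33 = S 33"
  using runs_frame[OF r, of 1] runs_frame[OF r, of 2] runs_frame[OF r, of 33] S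
  by (auto simp: dual_def constants_def mods_all_values mods_prices)
 obtain h where h: "\<And>e. sem sample (T, e) = map_pmf (\<lambda>w. (h w, e)) (seeds num_rounds)"
  "\<And>w. w \<in> set_pmf (seeds num_rounds) \<Longrightarrow> sampled T (narms I) w (h w)" using sample[of T] T(1,2) by blast
 have rounds_pos: "0 < num_rounds" using arms_pos by (simp add: num_rounds_def)
 have fin: "finite (set_pmf (seeds num_rounds))"
  unfolding seeds_def by (rule finite_set_Pi_pmf) (auto simp: uniform_below_set rounds_pos)
 have sch: "sem schedule (h w, ?e) = iter (narms I * B) schedule_round (put (h w) 28 0 0, ?e)" if w: "w \<in> set_pmf (seeds num_rounds)" for w
 proof -
  have "h w 1 0 = cap" "h w 2 0 = limit" using h(2)[OF w] T unfolding sampled_def by auto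
  then have "min (ev (h w) (en .* eB)) (h w 2 0) = narms I * B" using limits(8) by (simp add: lk[unfolded One_nat_def])
  then show ?thesis unfolding schedule_def sem.simps(7) fst_conv snd_conv by (simp only: asg_def ev.simps min_0L)
 qed
 have rew: "?E (sem schedule (h w, ?e)) (\<lambda>p. earned (snd p)) = lazy (seeded (decode T) w) (narms I * B) 0 (start (decode T) w)"
  if w: "w \<in> set_pmf (seeds num_rounds)" for w
 proof -
  let ?s = "put (h w) 28 0 0"
  have s: "?s 1 0 = cap" "?s 2 0 = limit" "?s 33 = T 33" "?s 10 = T 10"
   "\<And>i. i < narms I \<Longrightarrow> ?s 31 i = snd (w i) \<and> ?s 32 i = root I i \<and>
    ?s 34 i = (if fst (w i) = 0 then adv (decode T (snd (w i))) 1 (root I i) else B + 1)"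
   using h(2)[OF w] T unfolding sampled_def by auto
  have same: "arm_state ?s i = start (decode T) w i \<and> plan ?s i = seeded (decode T) w i" if "i < narms I" for i
   using s(5)[OF that] s(3) T(3) S(3)[of 33 i] decode_same[of ?s T] s(4) by (auto simp: arm_state_def start_def)
  have rT: "snd (w i) < num_rounds" if "i < narms I" for i
   using set_Pi_pmf_D[OF _ w[unfolded seeds_def]] that rounds_pos by (fastforce simp: uniform_below_set mem_Times_iff)
  have "tracks ?s ?e"
   unfolding tracks_def
  proof (intro conjI allI impI)
   show "state_ok (plan ?s) (arm_state ?s)"
    using state_ok_start[of "decode T" w] state_ok_cong[of "arm_state ?s" "start (decode T) w" "plan ?s" "seeded (decode T) w", OF same]
    by blast
   fix i assume i: "i < narms I"
   show "table (plan ?s i)" using same[OF i] q rT[OF i] unfolding dual_run_def best_response_def by simp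
   show "pos ?e i = ?s 32 i" "?s 33 i \<le> clock ?e" using s(5)[OF i] s(3) T(3) S(3)[of 33 i] by (auto simp: init_env_def)
  qed (use s in auto)
  then have "?E (iter (narms I * B) schedule_round (?s, ?e)) (\<lambda>p. earned (snd p)) = earned ?e + lazy (plan ?s) (narms I * B) (clock ?e) (arm_state ?s)"
   using env_ok_init by (intro rounds_reward) auto
  also have "lazy (plan ?s) (narms I * B) (clock ?e) (arm_state ?s) = lazy (seeded (decode T) w) (narms I * B) (clock ?e) (start (decode T) w)"
   by (rule lazy_cong[OF same])
  finally show ?thesis unfolding sch[OF w] by (simp add: init_env_def)
 qed
 have finS: "finite (set_pmf (sem schedule (h w, ?e)))" if "w \<in> set_pmf (seeds num_rounds)" for w
  unfolding sch[OF that] using env_ok_init by (intro finite_rounds) simp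
 have "sem bandit_program (S, ?e) = bind_pmf (seeds num_rounds) (\<lambda>w. sem schedule (h w, ?e))"
  using r h(1) unfolding bandit_program_def runs_def sem.simps(5) by (simp add: bind_return_pmf bind_map_pmf)
 then have "?E (sem bandit_program (S, ?e)) (\<lambda>p. earned (snd p))
   = ?E (seeds num_rounds) (\<lambda>w. ?E (sem schedule (h w, ?e)) (\<lambda>p. earned (snd p)))"
  using fin finS by (simp add: expectation_bind_finite)
 also have "\<dots> = ?E (seeds num_rounds) (\<lambda>w. lazy (seeded (decode T) w) (narms I * B) 0 (start (decode T) w))"
  by (rule expectation_cong_pmf) (rule rew)
 finally show ?thesis using rounded_dual_run[OF q pos arms_pos B feas] by simp
qed

theorem program_reward_nonneg: "0 \<le> expect (sem st (S, init_env I)) (\<lambda>p. earned (snd p))"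
proof (rule expectation_nonneg_pmf)
 fix p assume p: "p \<in> set_pmf (sem st (S, init_env I))"
 have "env_ok (snd p) \<and> 0 \<le> earned (snd p)"
 proof (rule sem_invariant[of "\<lambda>e. env_ok e \<and> 0 \<le> earned e", OF _ p])
  show "env_ok (snd (S, init_env I)) \<and> 0 \<le> earned (snd (S, init_env I))" using env_ok_init by (simp add: init_env_def)
  fix e x e' assume "env_ok e \<and> 0 \<le> earned e" "e' \<in> set_pmf (env_step I B x e)"
  then show "env_ok e' \<and> 0 \<le> earned e'" using env_ok_step[of e e' x] by linarith
 qed
 then show "0 \<le> earned (snd p)" by blast
qed

text \<open>The tables contain entries for each action and node, so both numbers are at most the
  number of input entries.\<close>

lemma encoded_sizes: "lookup xs 2 \<le> input_size xs" "lookup xs 3 \<le> input_size xs" "0 < input_size xs"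
 "env_ok e \<Longrightarrow> i < narms I \<Longrightarrow> len (pos e i) \<le> input_size xs"
proof -
 have "length ys \<le> (\<Sum>y\<leftarrow>ys. len y + 1)" for ys by (induction ys) auto
 then have l: "length xs \<le> input_size xs" unfolding input_size_def .
 have "K * 1 \<le> K * N" using horizon_less by (intro mult_le_mono2) simp
 then show "lookup xs 2 \<le> input_size xs" "lookup xs 3 \<le> input_size xs" "0 < input_size xs"
  using l length_xs unfolding lk by linarith+
 assume "env_ok e" "i < narms I"
 then have "pos e i < N" using nodes_states[of i "pos e i"] states unfolding env_ok_def by auto
 then have "len (pos e i) \<le> len (lookup xs 3)" unfolding lk by (intro len_mono) simp
 then show "len (pos e i) \<le> input_size xs" using lookup_le_size[of 3] by simp
qed

end

section \<open>Cost and reward of the machine program on every instance\<close>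

text \<open>The two cost bounds belong to the branches of the guard: only instances with arms and
  actions have sizes controlled by the input, and for the others the program ends right after the
  guard.\<close>

theorem algorithm_guarantee:
 assumes valid: "valid_mab I B" and enc: "encodes xs I B"
 obtains W E where "machine.ends xs I B W (init_config (machine.program machine.bandit_program) I) E"
  "W \<le> machine.total xs machine.bandit_program \<and> lookup xs 2 \<le> input_size xs \<and> lookup xs 3 \<le> input_size xs
   \<or> W \<le> machine.ecost machine.guard * input_size xs + 2 * input_size xs + 10"
  "expect E earned \<ge> 4/27 * OPT_PolyLP I B"
proof -
 obtain dep where b: "bandit I B dep" using bandit_of_valid[OF valid] .
 interpret bandit I B dep by fact
 interpret machine xs I B .
 let ?p = "bandit_program"
 show thesis
 proof (cases "lookup xs 1 * lookup xs 2 = 0")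
  case True
  have S: "0 < input_size xs" using encoded_header(4)[OF enc] unfolding input_size_def by (cases xs) auto
  have "PolyLP_objective I B x \<le> 0" if feas: "PolyLP_feasible I B x s" for x s
  proof (cases "narms I = 0")
   case True
   then show ?thesis using objective_trivial[OF feas] by simp
  next
   case False
   then have "acts I = {}" using \<open>lookup xs 1 * lookup xs 2 = 0\<close> encoded_header[OF enc] by auto
   then show ?thesis by (simp add: PolyLP_objective_def)
  qed
  then have "OPT_PolyLP I B \<le> 0" by (rule OPT_PolyLP_le)
  then have "expect (return_pmf (init_env I)) earned \<ge> 4/27 * OPT_PolyLP I B" by (simp add: init_env_def)
  then show thesis using that[OF program_ends_trivial[OF S True]] by simp
 next
  case False
  obtain K N rn rd pn pd where "encoded I B dep xs K N rn rd pn pd"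
   using encoded_of_encodes[OF b enc False] .
  then interpret encoded I B dep xs K N rn rd pn pd .
  obtain S where S: "S 1 0 = cap" "S 2 0 = limit" "\<And>k i. 2 < k \<Longrightarrow> k < 61 \<Longrightarrow> S k i = 0"
   "ends (total ?p) (init_config (program ?p) I) (map_pmf snd (sem ?p (S, init_env I)))"
   using program_ends[of env_ok ?p, OF env_ok_init _ encoded_sizes(4) wf_program encoded_sizes(3) False] env_ok_step by blast
  have "4/27 * PolyLP_objective I B x \<le> expect (sem ?p (S, init_env I)) (\<lambda>p. earned (snd p))"
   if feas: "PolyLP_feasible I B x s" for x s
  proof (cases "free_value > 0 \<and> B \<ge> 1")
   case True
   show ?thesis by (rule program_reward) (use S(1-3) True feas in auto)
  next
   case False
   then have "PolyLP_objective I B x \<le> 0" by (intro objective_trivial[OF feas]) auto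
   then show ?thesis using program_reward_nonneg[of ?p S] by linarith
  qed
  then have "OPT_PolyLP I B \<le> 27/4 * expect (sem ?p (S, init_env I)) (\<lambda>p. earned (snd p))"
   by (intro OPT_PolyLP_le) (simp add: field_simps)
  then have "expect (map_pmf snd (sem ?p (S, init_env I))) earned \<ge> 4/27 * OPT_PolyLP I B"
   by (simp add: field_simps)
  then show thesis using that[OF S(4)] encoded_sizes(1,2) by simp
 qed
qed

theorem theorem10:
  shows "(\<exists>c. polynomial_time c \<and>
            (\<forall>I B xs. valid_mab I B \<longrightarrow> encodes xs I B \<longrightarrow>
               algorithm_reward c xs I B \<ge> 4 / 27 * OPT_PolyLP I B)) \<and>
         (\<forall>(I :: ('s, 'a) mab) B. valid_mab I B \<longrightarrow>
               OPT_PolyLP I B \<le> 27 / 4 * OPT_adaptive I B)"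
proof (intro conjI allI impI)
  let ?c = "machine.program machine.bandit_program"
  show "\<exists>c. polynomial_time c \<and> (\<forall>I B xs. valid_mab I B \<longrightarrow> encodes xs I B \<longrightarrow>
      algorithm_reward c xs I B \<ge> 4 / 27 * OPT_PolyLP I B)"
  proof (intro exI[of _ ?c] conjI allI impI)
    obtain f where f: "poly_bounded (\<lambda>S. S) f"
      "\<And>xs. lookup xs 2 \<le> input_size xs \<Longrightarrow> lookup xs 3 \<le> input_size xs \<Longrightarrow> machine.total xs machine.bandit_program \<le> f (input_size xs)"
      "\<And>S. machine.ecost machine.guard * S + 2 * S + 10 \<le> f S"
      using total_poly[of "machine.bandit_program"] by blast
    obtain k where k: "\<And>S. f S \<le> k * S ^ k + k" using poly_bounded_normal[OF f(1)] by blast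
    show "polynomial_time ?c"
      unfolding polynomial_time_def Let_def
    proof (intro exI[of _ k] allI impI ballI)
      fix I B xs g
      assume a: "valid_mab I B" "encodes xs I B" and g: "g \<in> set_pmf (run ?c xs I B (k * input_size xs ^ k + k))"
      obtain W E where W: "machine.ends xs I B W (init_config ?c I) E"
        "W \<le> machine.total xs machine.bandit_program \<and> lookup xs 2 \<le> input_size xs \<and> lookup xs 3 \<le> input_size xs
          \<or> W \<le> machine.ecost machine.guard * input_size xs + 2 * input_size xs + 10"
        using algorithm_guarantee[OF a] by blast
      have "W \<le> f (input_size xs)" using W(2) f(2)[of xs] f(3)[of "input_size xs"] by linarith
      then have "W \<le> k * input_size xs ^ k + k" using k order_trans by blast
      then show "halted g \<and> cost g \<le> k * input_size xs ^ k + k" using machine.ends_time[OF W(1) _ g] by blast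
    qed
    fix I B xs
    assume a: "valid_mab I B" "encodes xs I B"
    obtain W E where "machine.ends xs I B W (init_config ?c I) E" "expect E earned \<ge> 4/27 * OPT_PolyLP I B"
      using algorithm_guarantee[OF a] by blast
    then show "algorithm_reward ?c xs I B \<ge> 4 / 27 * OPT_PolyLP I B" using machine.ends_reward by metis
  qed
  fix I :: "('s, 'a) mab" and B
  assume v: "valid_mab I B"
  obtain dep where "bandit I B dep" using bandit_of_valid[OF v] .
  then interpret bandit I B dep .
  show "OPT_PolyLP I B \<le> 27 / 4 * OPT_adaptive I B"
    using objective_le_adaptive by (rule OPT_PolyLP_le)
qed

end
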